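(* Let $N\ge 2$, let $\omega\subset\mathbb{R}^{N-1}$ be a bounded convex open set, let $L>0$ and $\Omega=\omega\times(0,L)\subset\mathbb{R}^N$. Let $d,D,\mu_0,\nu_0>0$, let $\alpha=\beta>1$, and set $\mu=\alpha\mu_0$, $\nu=\alpha\nu_0$. Let $v_0\in L^\infty(\Omega)$ and $u_0\in L^\infty(\omega)$ be both nonnegative and not simultaneously trivial (i.e. not both zero almost everywhere). Let $(v,u)=(v(t,x,y),u(t,x))$ be the (weak) solution, starting from $(v_0,u_0)$, of the field-road system $$ \begin{cases} \partial_t v=d\,\Delta v, & t>0,\ x\in\omega,\ y\in(0,L),\\ -d\,\partial_y v|_{y=0}=\mu u^\alpha-\nu (v|_{y=0})^\alpha, & t>0,\ x\in\omega,\\ \partial_t u=D\,\Delta u+\nu (v|_{y=0})^\alpha-\mu u^\alpha, & t>0,\ x\in\omega,\\ \dfrac{\partial u}{\partial n'}=0, & t>0,\ x\in\partial\omega,\\ \dfrac{\partial v}{\partial n}=0, & t>0,\ x\in\partial\omega,\ y\in(0,L),\ \text{ and }\ x\in\omega,\ y=L. \end{cases} $$ Let $M_0=\int_\Omega v_0\,dx\,dy+\int_\omega u_0\,dx>0$ and let $(v_\infty,u_\infty)$ be the unique pair of positive constants such that $$\nu v_\infty^\alpha=\mu u_\infty^\alpha,\qquad |\Omega|\,v_\infty+|\omega|\,u_\infty=M_0 .$$ Define, for $s\ge 0$, $\Phi(s)=\dfrac{s^{\alpha+1}-(\alpha+1)s}{\alpha}+1$, and, for $t\ge 0$, $$\mathcal{H}(t)=\int_\Omega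 v_\infty\,\Phi\!\left(\frac{v(t,x,y)}{v_\infty}\right)dx\,dy+\int_\omega u_\infty\,\Phi\!\left(\frac{u(t,x)}{u_\infty}\right)dx .$$ Then there exists $\lambda>0$, depending only on $N,\Omega,\mu,\nu,d,D,v_0,u_0,\alpha$, such that $$0\le \mathcal{H}(t)\le \mathcal{H}(0)\,e^{-\lambda t}\qquad\text{for all } t>0 .$$ As a by-product, there exists $M>0$, depending only on $N,\Omega,\mu,\nu,d,D,v_0,u_0,\alpha$, such that, with the same $\lambda$, $$\|v(t)-v_\infty\|_{L^{\alpha+1}(\Omega)}^{\alpha+1}+\|u(t)-u_\infty\|_{L^{\alpha+1}(\omega)}^{\alpha+1}\le M e^{-\lambda t}\qquad\text{for all } t>0 .$$
   Context: Points of $\Omega=\omega\times(0,L)$ are written $(x,y)$ with $x\in\omega$, $y\in(0,L)$. In the equation for $v$, $\Delta v=\Delta_x v+\partial_{yy}v$; in the equation for $u$, $\Delta u=\Delta_x u$. The vector $n$ is the unit outward normal to $\partial\Omega$, and $n'$ is the unit outward normal to $\partial\omega$. $|\Omega|$ and $|\omega|$ denote Lebesgue measures in dimensions $N$ and $N-1$ respectively. $v|_{y=0}$ is the trace of $v$ on $\omega\times\{0\}$, identified with $\omega$. The general field-road system has exchange terms with exponents $\alpha,\beta$: $-d\,\partial_y v|_{y=0}=\alpha(\mu_0u^\beta-\nu_0(v|_{y=0})^\alpha)$ and $\partial_t u=D\Delta u+\beta(\nu_0(v|_{y=0})^\alpha-\mu_0u^\beta)$. With $\alpha=\beta$, $\mu=\alpha\mu_0$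 and $\nu=\alpha\nu_0$ this is the system in the claim. Solution concept: $(v,u)$ is the unique weak solution of the Cauchy problem. It is nonnegative and uniformly bounded on $(0,\infty)\times\Omega$, resp. $(0,\infty)\times\omega$. In standard form, this means that for every $T>0$, $v\in L^2(0,T;H^1(\Omega))\cap C([0,T];L^2(\Omega))$, $u\in L^2(0,T;H^1(\omega))\cap C([0,T];L^2(\omega))$, $\partial_t v\in L^2(0,T;H^1(\Omega)')$, $\partial_t u\in L^2(0,T;H^1(\omega)')$, $v(0)=v_0$, $u(0)=u_0$, and for almost every $t>0$, for all $\varphi\in H^1(\Omega)$ and $\psi\in H^1(\omega)$, $$\langle\partial_t v,\varphi\rangle=-d\int_\Omega\nabla v\cdot\nabla\varphi\,dx\,dy+\int_\omega\big(\mu u^\alpha-\nu(v|_{y=0})^\alpha\big)\varphi|_{y=0}\,dx,$$ $$\langle\partial_t u,\psi\rangle=-D\int_\omega\nabla u\cdot\nabla\psi\,dx+\int_\omega\big(\nu(v|_{y=0})^\alpha-\mu u^\alpha\big)\psi\,dx .$$ Existence and uniqueness of this solution, its nonnegativity and its uniform boundedness (by a constant depending on $\|v_0\|_{L^\infty},\|u_0\|_{L^\infty},\mu,\nu,\alpha$) are taken as known, as is conservation of mass: $\int_\Omega v(t,x,y)\,dx\,dy+\int_\omega u(t,x)\,dx=M_0$ for all $t>0$. *)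

theory Defs
  imports "HOL-Analysis.Analysis"
begin

section \<open>Lebesgue spaces\<close>

text \<open>
  Elements of function spaces are represented by functions on the whole type; only their
  values almost everywhere on the set \<open>S\<close> matter, so the norms below are seminorms.
\<close>

definition Lp_space ::
  "'n::euclidean_space set \<Rightarrow> real \<Rightarrow> ('n \<Rightarrow> 'b::{real_normed_vector, second_countable_topology}) set"
where
  "Lp_space S p = {f \<in> borel_measurable (lebesgue_on S).
     integrable (lebesgue_on S) (\<lambda>x. norm (f x) powr p)}"

definition Lp_norm ::
  "'n::euclidean_space set \<Rightarrow> real \<Rightarrow> ('n \<Rightarrow> 'b::{real_normed_vector, second_countable_topology}) \<Rightarrow> real"
where
  "Lp_norm S p f = (LINT x|lebesgue_on S. norm (f x) powr p) powr (1 / p)"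

definition Linf_space :: "'n::euclidean_space set \<Rightarrow> ('n \<Rightarrow> real) set" where
  "Linf_space S = {f \<in> borel_measurable (lebesgue_on S).
     \<exists>C. AE x in lebesgue_on S. \<bar>f x\<bar> \<le> C}"


section \<open>Smooth functions and test functions\<close>

primrec C_k :: "nat \<Rightarrow> ('n::euclidean_space \<Rightarrow> real) \<Rightarrow> bool" where
  "C_k 0 f \<longleftrightarrow> continuous_on UNIV f"
| "C_k (Suc k) f \<longleftrightarrow>
     f differentiable_on UNIV \<and> (\<forall>b\<in>Basis. C_k k (\<lambda>x. frechet_derivative f (at x) b))"

definition smooth :: "('n::euclidean_space \<Rightarrow> real) \<Rightarrow> bool" where
  "smooth f \<longleftrightarrow> (\<forall>k. C_k k f)"

definition test_functions :: "'n::euclidean_space set \<Rightarrow> ('n \<Rightarrow> real) set" where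
  "test_functions S = {f. smooth f \<and> (\<exists>K. compact K \<and> K \<subseteq> S \<and> (\<forall>x. x \<notin> K \<longrightarrow> f x = 0))}"


section \<open>The Sobolev space \<open>H\<^sup>1\<close>, its dual, and the trace\<close>

definition has_weak_gradient ::
  "'n::euclidean_space set \<Rightarrow> ('n \<Rightarrow> real) \<Rightarrow> ('n \<Rightarrow> 'n) \<Rightarrow> bool"
where
  "has_weak_gradient S f g \<longleftrightarrow> g \<in> Lp_space S 2 \<and>
     (\<forall>\<phi>\<in>test_functions S. \<forall>b\<in>Basis.
        (LINT x|lebesgue_on S. f x * frechet_derivative \<phi> (at x) b)
          = - (LINT x|lebesgue_on S. (g x \<bullet> b) * \<phi> x))"

definition H1_space :: "'n::euclidean_space set \<Rightarrow> ('n \<Rightarrow> real) set" where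
  "H1_space S = {f \<in> Lp_space S 2. \<exists>g. has_weak_gradient S f g}"

definition weak_grad :: "'n::euclidean_space set \<Rightarrow> ('n \<Rightarrow> real) \<Rightarrow> 'n \<Rightarrow> 'n" where
  "weak_grad S f = (SOME g. has_weak_gradient S f g)"

definition H1_norm :: "'n::euclidean_space set \<Rightarrow> ('n \<Rightarrow> real) \<Rightarrow> real" where
  "H1_norm S f = sqrt ((Lp_norm S 2 f)\<^sup>2 + (Lp_norm S 2 (weak_grad S f))\<^sup>2)"

definition H1_dual :: "'n::euclidean_space set \<Rightarrow> (('n \<Rightarrow> real) \<Rightarrow> real) set" where
  "H1_dual S = {F.
     (\<forall>f\<in>H1_space S. \<forall>g\<in>H1_space S. \<forall>a b.
        F (\<lambda>x. a * f x + b * g x) = a * F f + b * F g) \<and>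
     (\<exists>C. \<forall>f\<in>H1_space S. \<bar>F f\<bar> \<le> C * H1_norm S f)}"

definition H1_dual_norm :: "'n::euclidean_space set \<Rightarrow> (('n \<Rightarrow> real) \<Rightarrow> real) \<Rightarrow> real" where
  "H1_dual_norm S F = Sup {\<bar>F f\<bar> | f. f \<in> H1_space S \<and> H1_norm S f \<le> 1}"

text \<open>
  The trace on \<open>\<omega> \<times> {0}\<close>, identified with \<open>\<omega>\<close>, of a function in \<open>H\<^sup>1(\<omega> \<times> (0,L))\<close>: the
  extension by continuity of the restriction operator, defined on functions that are smooth
  up to the boundary and bounded from the \<open>H\<^sup>1\<close> norm to the \<open>L\<^sup>2(\<omega>)\<close> norm.
\<close>

definition has_trace ::
  "'a::euclidean_space set \<Rightarrow> real \<Rightarrow> ('a \<times> real \<Rightarrow> real) \<Rightarrow> ('a \<Rightarrow> real) \<Rightarrow> bool"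
where
  "has_trace \<omega> L f g \<longleftrightarrow> f \<in> H1_space (\<omega> \<times> {0<..<L}) \<and> g \<in> Lp_space \<omega> 2 \<and>
     (\<exists>\<phi>::nat \<Rightarrow> 'a \<times> real \<Rightarrow> real. (\<forall>n. smooth (\<phi> n)) \<and>
        (\<lambda>n. H1_norm (\<omega> \<times> {0<..<L}) (\<phi> n - f)) \<longlonglongrightarrow> 0 \<and>
        (\<lambda>n. Lp_norm \<omega> 2 (\<lambda>x. \<phi> n (x, 0) - g x)) \<longlonglongrightarrow> 0)"

definition trace0 ::
  "'a::euclidean_space set \<Rightarrow> real \<Rightarrow> ('a \<times> real \<Rightarrow> real) \<Rightarrow> 'a \<Rightarrow> real"
where
  "trace0 \<omega> L f = (SOME g. has_trace \<omega> L f g)"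


section \<open>Functions of time with values in a function space\<close>

text \<open>
  Bochner measurability and square integrability on a time set \<open>J\<close> for functions with values in
  a space \<open>V\<close> with (semi)norm \<open>nrm\<close>: strong measurability means being almost everywhere the
  limit of simple functions. Subtraction is pointwise subtraction of functions.
\<close>

definition strongly_measurable ::
  "real set \<Rightarrow> 'f::minus set \<Rightarrow> ('f \<Rightarrow> real) \<Rightarrow> (real \<Rightarrow> 'f) \<Rightarrow> bool"
where
  "strongly_measurable J V nrm w \<longleftrightarrow>
     (\<exists>s::nat \<Rightarrow> real \<Rightarrow> 'f.
        (\<forall>n. finite (s n ` J) \<and> s n ` J \<subseteq> V \<and> (\<forall>f. {t \<in> J. s n t = f} \<in> sets lebesgue)) \<and>
        (AE t in lebesgue_on J. w t \<in> V \<and> (\<lambda>n. nrm (s n t - w t)) \<longlonglongrightarrow> 0))"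

definition L2_Bochner ::
  "real set \<Rightarrow> 'f::minus set \<Rightarrow> ('f \<Rightarrow> real) \<Rightarrow> (real \<Rightarrow> 'f) set"
where
  "L2_Bochner J V nrm = {w. strongly_measurable J V nrm w \<and>
     integrable (lebesgue_on J) (\<lambda>t. (nrm (w t))\<^sup>2)}"

definition C_L2 :: "real \<Rightarrow> 'n::euclidean_space set \<Rightarrow> (real \<Rightarrow> 'n \<Rightarrow> real) set" where
  "C_L2 T S = {w. (\<forall>t\<in>{0..T}. w t \<in> Lp_space S 2) \<and>
     (\<forall>t\<in>{0..T}. ((\<lambda>s. Lp_norm S 2 (w s - w t)) \<longlongrightarrow> 0) (at t within {0..T}))}"

text \<open>
  The derivative in time is taken in the sense of distributions on \<open>(0,T)\<close> with values in the
  dual of \<open>H\<^sup>1(S)\<close>, where \<open>L\<^sup>2(S)\<close> is embedded in that dual through the \<open>L\<^sup>2\<close> inner product.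
\<close>

definition has_weak_time_deriv ::
  "real \<Rightarrow> 'n::euclidean_space set \<Rightarrow> (real \<Rightarrow> 'n \<Rightarrow> real) \<Rightarrow> (real \<Rightarrow> ('n \<Rightarrow> real) \<Rightarrow> real) \<Rightarrow> bool"
where
  "has_weak_time_deriv T S w w' \<longleftrightarrow>
     (\<forall>\<theta>\<in>test_functions {0<..<T}. \<forall>\<phi>\<in>H1_space S.
        (LINT t|lebesgue_on {0<..<T}. deriv \<theta> t * (LINT x|lebesgue_on S. w t x * \<phi> x))
          = - (LINT t|lebesgue_on {0<..<T}. \<theta> t * w' t \<phi>))"

definition parabolic_class ::
  "'n::euclidean_space set \<Rightarrow> (real \<Rightarrow> 'n \<Rightarrow> real) \<Rightarrow> (real \<Rightarrow> ('n \<Rightarrow> real) \<Rightarrow> real) \<Rightarrow> bool"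
where
  "parabolic_class S w w' \<longleftrightarrow>
     (\<forall>T>0. w \<in> L2_Bochner {0<..<T} (H1_space S) (H1_norm S) \<and> w \<in> C_L2 T S \<and>
        w' \<in> L2_Bochner {0<..<T} (H1_dual S) (H1_dual_norm S) \<and> has_weak_time_deriv T S w w')"


section \<open>The field-road system\<close>

text \<open>
  Nonnegative, uniformly bounded weak solutions. Both bounds are required for every \<open>t > 0\<close>,
  which is meaningful because solutions are continuous in time with values in \<open>L\<^sup>2\<close>.
  The boundary conditions are encoded in the variational identities.
\<close>

definition field_road_solution ::
  "'a::euclidean_space set \<Rightarrow> real \<Rightarrow> real \<Rightarrow> real \<Rightarrow> real \<Rightarrow> real \<Rightarrow> real \<Rightarrow>
   ('a \<times> real \<Rightarrow> real) \<Rightarrow> ('a \<Rightarrow> real) \<Rightarrow>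
   (real \<Rightarrow> 'a \<times> real \<Rightarrow> real) \<Rightarrow> (real \<Rightarrow> 'a \<Rightarrow> real) \<Rightarrow> bool"
where
  "field_road_solution \<omega> L d D \<mu> \<nu> \<alpha> v0 u0 v u \<longleftrightarrow>
     (let \<Omega> = \<omega> \<times> {0<..<L} in
      (\<exists>C. \<forall>t>0. (AE z in lebesgue_on \<Omega>. 0 \<le> v t z \<and> v t z \<le> C) \<and>
                (AE x in lebesgue_on \<omega>. 0 \<le> u t x \<and> u t x \<le> C)) \<and>
      (AE z in lebesgue_on \<Omega>. v 0 z = v0 z) \<and>
      (AE x in lebesgue_on \<omega>. u 0 x = u0 x) \<and>
      (\<exists>v' u'. parabolic_class \<Omega> v v' \<and> parabolic_class \<omega> u u' \<and>
        (AE t in lebesgue_on {0<..}. \<forall>\<phi>\<in>H1_space \<Omega>. \<forall>\<psi>\<in>H1_space \<omega>.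
          v' t \<phi> = - d * (LINT z|lebesgue_on \<Omega>. weak_grad \<Omega> (v t) z \<bullet> weak_grad \<Omega> \<phi> z)
            + (LINT x|lebesgue_on \<omega>.
                 (\<mu> * u t x powr \<alpha> - \<nu> * trace0 \<omega> L (v t) x powr \<alpha>) * trace0 \<omega> L \<phi> x) \<and>
          u' t \<psi> = - D * (LINT x|lebesgue_on \<omega>. weak_grad \<omega> (u t) x \<bullet> weak_grad \<omega> \<psi> x)
            + (LINT x|lebesgue_on \<omega>.
                 (\<nu> * trace0 \<omega> L (v t) x powr \<alpha> - \<mu> * u t x powr \<alpha>) * \<psi> x))))"

definition Phi :: "real \<Rightarrow> real \<Rightarrow> real" where
  "Phi \<alpha> s = (s powr (\<alpha> + 1) - (\<alpha> + 1) * s) / \<alpha> + 1"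

definition entropy ::
  "'a::euclidean_space set \<Rightarrow> real \<Rightarrow> real \<Rightarrow> real \<Rightarrow> real \<Rightarrow>
   (real \<Rightarrow> 'a \<times> real \<Rightarrow> real) \<Rightarrow> (real \<Rightarrow> 'a \<Rightarrow> real) \<Rightarrow> real \<Rightarrow> real"
where
  "entropy \<omega> L \<alpha> vinf uinf v u t =
     (LINT z|lebesgue_on (\<omega> \<times> {0<..<L}). vinf * Phi \<alpha> (v t z / vinf))
     + (LINT x|lebesgue_on \<omega>. uinf * Phi \<alpha> (u t x / uinf))"

end

theory Submission
  imports Defs
begin

text \<open>
  The entropy dissipation controls \<open>\<integral>|\<nabla>v\<^sup>p|\<^sup>2 + \<integral>|\<nabla>u\<^sup>p|\<^sup>2 + \<integral>(v\<^sup>\<alpha> - u\<^sup>\<alpha>)\<^sup>2\<close> with \<open>p = (\<alpha>+1)/2\<close>, after rescaling by the equilibrium.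
  By the Poincare inequality the powers \<open>v\<^sup>p\<close>, \<open>u\<^sup>p\<close> are close to the \<open>p\<close>-th powers of the means of \<open>v\<close> and \<open>u\<close>, and the trace
  inequality together with the exchange term brings these two means close to each other. Conservation of mass then makes both
  means close to \<open>1\<close>, and \<open>\<Phi>(s) \<le> C (s\<^sup>p - 1)\<^sup>2\<close> bounds the entropy by its dissipation, uniformly in the solution.
  In time, convexity of \<open>\<Phi>\<close> bounds the increments of the entropy by the dual pairing of the time derivative with \<open>\<Phi>'\<close> at the
  later time, up to errors that are small in mean because the time derivative is Bochner square integrable. Averaging the resulting
  inequality gives the integrated differential inequality for the entropy and hence exponential decay. The \<open>L\<^sup>\<alpha>\<^sup>+\<^sup>1\<close> bound follows from
  \<open>|s - 1|\<^sup>\<alpha>\<^sup>+\<^sup>1 \<le> \<alpha> \<Phi>(s)\<close>.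
\<close>

section \<open>Square integrable functions\<close>

text \<open>\<open>Phi\<close> is tuned to the exchange law. Its derivative is a multiple of
  \<open>s powr \<alpha> - 1\<close>, so testing both equations with it merges the two boundary
  terms into one exact square; its second derivative is a multiple of the square of the derivative
  of \<open>s powr p\<close>, which is where \<open>p\<close> comes from. Two obstacles shape the
  estimates. The rate is fixed before the solution, so the sup bound of the solution may serve
  integrability only and must not enter a constant. And the exchange square compares \<alpha>-th
  powers, while the gradients control p-th powers; near 0 the former comparison is the weaker one,
  and only the mass constraint, which keeps one of the two rescaled means at or above 1, closes the
  gap. Weak gradients and traces are picked by \<open>SOME\<close> and determined almost everywhere
  only. Nonlinear functions of the solution are therefore reached through approximations that are C1
  up to the boundary, respect the bounds of the solution, and converge in L2 together with their
  gradients. Conservation of mass is not part of \<open>field_road_solution\<close>; it is derived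
  from the weak equations.\<close>

definition sq_integrable ::
  "'a measure \<Rightarrow> ('a \<Rightarrow> 'b::{real_normed_vector, second_countable_topology}) \<Rightarrow> bool" where
  "sq_integrable M f \<longleftrightarrow> f \<in> borel_measurable M \<and> integrable M (\<lambda>x. (norm (f x))\<^sup>2)"

lemma sq_integrableD:
  assumes "sq_integrable M f"
  shows "f \<in> borel_measurable M" "integrable M (\<lambda>x. (norm (f x))\<^sup>2)"
  using assms by (auto simp: sq_integrable_def)

declare sq_integrableD [dest]

lemma sq_integrable_realD:
  "sq_integrable M (f::_\<Rightarrow>real) \<Longrightarrow> integrable M (\<lambda>x. (f x)\<^sup>2)"
  using sq_integrableD(2)[of M f] by simp

lemma Lp_space_2_iff: "f \<in> Lp_space S 2 \<longleftrightarrow> sq_integrable (lebesgue_on S) f"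
  by (simp add: Lp_space_def sq_integrable_def)

lemma Lp_norm_2: "Lp_norm S 2 f = sqrt (LINT x|lebesgue_on S. (norm (f x))\<^sup>2)"
  by (simp add: Lp_norm_def powr_half_sqrt)

lemma norm_add_sq_le: "(norm (a + b))\<^sup>2 \<le> 2 * (norm a)\<^sup>2 + 2 * (norm (b::'b::real_normed_vector))\<^sup>2"
proof -
  have "(norm (a + b))\<^sup>2 \<le> (norm a + norm b)\<^sup>2"
    by (intro power_mono norm_triangle_ineq norm_ge_zero)
  also have "\<dots> \<le> 2 * (norm a)\<^sup>2 + 2 * (norm b)\<^sup>2"
    using sum_squares_bound[of "norm a" "norm b"] by (simp add: power2_sum)
  finally show ?thesis .
qed

lemma sq_integrable_dominated:
  assumes "sq_integrable M g" "f \<in> borel_measurable M" "AE x in M. norm (f x) \<le> C * norm (g x)"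
  shows "sq_integrable M f"
proof -
  have "integrable M (\<lambda>x. C\<^sup>2 * (norm (g x))\<^sup>2)"
    using assms(1) by auto
  then have "integrable M (\<lambda>x. (norm (f x))\<^sup>2)"
  proof (rule Bochner_Integration.integrable_bound)
    show "AE x in M. norm ((norm (f x))\<^sup>2) \<le> norm (C\<^sup>2 * (norm (g x))\<^sup>2)"
      using assms(3)
    proof eventually_elim
      case (elim x)
      then have "(norm (f x))\<^sup>2 \<le> (C * norm (g x))\<^sup>2"
        by (intro power_mono) auto
      then show ?case by (simp add: power_mult_distrib)
    qed
  qed (use assms(2) in measurable)
  then show ?thesis using assms(2) by (simp add: sq_integrable_def)
qed

lemma sq_integrable_add:
  assumes "sq_integrable M f" "sq_integrable M g"
  shows "sq_integrable M (\<lambda>x. f x + g x)"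
proof -
  note [measurable] = assms[THEN sq_integrableD(1)]
  have "integrable M (\<lambda>x. 2 * (norm (f x))\<^sup>2 + 2 * (norm (g x))\<^sup>2)"
    using assms[THEN sq_integrableD(2)] by auto
  then have "integrable M (\<lambda>x. (norm (f x + g x))\<^sup>2)"
    by (rule Bochner_Integration.integrable_bound)
       (auto intro!: norm_add_sq_le)
  then show ?thesis by (simp add: sq_integrable_def)
qed

lemma sq_integrable_scaleR:
  assumes "sq_integrable M f"
  shows "sq_integrable M (\<lambda>x. c *\<^sub>R f x)"
  by (rule sq_integrable_dominated[OF assms, where C = "\<bar>c\<bar>"]) (use assms in \<open>auto\<close>)

lemma sq_integrable_diff:
  assumes "sq_integrable M f" "sq_integrable M g"
  shows "sq_integrable M (\<lambda>x. f x - g x)"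
  using sq_integrable_add[OF assms(1) sq_integrable_scaleR[OF assms(2), of "-1"]] by simp

lemma sq_integrable_mult:
  assumes "sq_integrable M (f::_\<Rightarrow>real)"
  shows "sq_integrable M (\<lambda>x. c * f x)"
  using sq_integrable_scaleR[OF assms, of c] by simp

lemma sq_integrable_norm:
  "sq_integrable M f \<Longrightarrow> sq_integrable M (\<lambda>x. norm (f x))"
  by (auto simp: sq_integrable_def)

lemma sq_integrable_bounded:
  assumes "finite_measure M" "f \<in> borel_measurable M" "AE x in M. norm (f x) \<le> C"
  shows "sq_integrable M f"
proof -
  interpret finite_measure M by fact
  have "sq_integrable M (\<lambda>x. 1::real)" by (simp add: sq_integrable_def)
  then show ?thesis
    by (rule sq_integrable_dominated[where C = C]) (use assms in auto)
qed

lemma integrable_norm_mult: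
  assumes "sq_integrable M f" "sq_integrable M g"
  shows "integrable M (\<lambda>x. norm (f x) * norm (g x))"
proof -
  note [measurable] = assms[THEN sq_integrableD(1)]
  have "integrable M (\<lambda>x. (norm (f x))\<^sup>2 + (norm (g x))\<^sup>2)"
    using assms[THEN sq_integrableD(2)] by auto
  then show ?thesis
  proof (rule Bochner_Integration.integrable_bound)
    show "AE x in M. norm (norm (f x) * norm (g x)) \<le> norm ((norm (f x))\<^sup>2 + (norm (g x))\<^sup>2)"
    proof (intro always_eventually allI)
      fix x
      show "norm (norm (f x) * norm (g x)) \<le> norm ((norm (f x))\<^sup>2 + (norm (g x))\<^sup>2)"
      proof -
        have a: "0 \<le> norm (f x) * norm (g x)" by simp
        have b: "norm ((norm (f x))\<^sup>2 + (norm (g x))\<^sup>2) = (norm (f x))\<^sup>2 + (norm (g x))\<^sup>2" by simp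
        show ?thesis
          using sum_squares_bound[of "norm (f x)" "norm (g x)"] a
          unfolding b real_norm_def abs_of_nonneg[OF a] mult.assoc by linarith
      qed
    qed
  qed measurable
qed

lemma integrable_mult_sq:
  assumes "sq_integrable M (f::_\<Rightarrow>real)" "sq_integrable M g"
  shows "integrable M (\<lambda>x. f x * g x)"
  by (rule Bochner_Integration.integrable_bound[OF integrable_norm_mult[OF assms]])
     (simp_all add: abs_mult borel_measurable_times sq_integrableD(1)[OF assms(1)] sq_integrableD(1)[OF assms(2)])

lemma integrable_inner_sq:
  assumes "sq_integrable M (f::_\<Rightarrow>'b::{real_inner, second_countable_topology})" "sq_integrable M g"
  shows "integrable M (\<lambda>x. f x \<bullet> g x)"
  by (rule Bochner_Integration.integrable_bound[OF integrable_norm_mult[OF assms]])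
     (simp_all add: Cauchy_Schwarz_ineq2 borel_measurable_inner sq_integrableD(1)[OF assms(1)] sq_integrableD(1)[OF assms(2)])

lemma integrable_sq:
  assumes "finite_measure M" "sq_integrable M (f::_\<Rightarrow>real)"
  shows "integrable M f"
proof -
  interpret finite_measure M by fact
  have "sq_integrable M (\<lambda>x. 1::real)" by (simp add: sq_integrable_def)
  from integrable_mult_sq[OF assms(2) this] show ?thesis by simp
qed

lemma Cauchy_Schwarz_integral:
  assumes "sq_integrable M (f::_\<Rightarrow>real)" "sq_integrable M g"
  shows "(LINT x|M. f x * g x)\<^sup>2 \<le> (LINT x|M. (f x)\<^sup>2) * (LINT x|M. (g x)\<^sup>2)"
proof -
  have i: "integrable M (\<lambda>x. (f x)\<^sup>2)" "integrable M (\<lambda>x. (g x)\<^sup>2)" "integrable M (\<lambda>x. f x * g x)"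
    using assms[THEN sq_integrableD(2)] integrable_mult_sq[OF assms] by auto
  show ?thesis
  proof (cases "(LINT x|M. (f x)\<^sup>2) = 0")
    case True
    then have "AE x in M. (f x)\<^sup>2 = 0"
      using integral_nonneg_eq_0_iff_AE[OF i(1)] by simp
    then have "(LINT x|M. f x * g x) = (LINT x|M. 0)"
      by (intro integral_cong_AE borel_measurable_times sq_integrableD(1)[OF assms(1)] sq_integrableD(1)[OF assms(2)]) auto
    then show ?thesis using True by simp
  next
    case False
    define F where "F = (LINT x|M. (f x)\<^sup>2)"
    \<comment> \<open>Minimiser in \<open>t\<close> of the integral of
      \<open>(g x - t * f x)\<^sup>2\<close>.\<close>
    define t where "t = (LINT x|M. f x * g x) / F"
    have "0 \<le> F" unfolding F_def by simp
    moreover have "F \<noteq> 0" using False unfolding F_def .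
    ultimately have F: "F > 0" by linarith
    have "0 \<le> (LINT x|M. (g x - t * f x)\<^sup>2)" by simp
    also have "\<dots> = (LINT x|M. (g x)\<^sup>2 - 2 * t * (f x * g x) + t\<^sup>2 * (f x)\<^sup>2)"
      by (simp add: power2_diff power_mult_distrib algebra_simps)
    also have "\<dots> = (LINT x|M. (g x)\<^sup>2) - 2 * t * (LINT x|M. f x * g x) + t\<^sup>2 * F"
      using i by (simp add: F_def)
    also have "\<dots> = (LINT x|M. (g x)\<^sup>2) - (LINT x|M. f x * g x)\<^sup>2 / F"
      using F by (simp add: t_def power2_eq_square field_simps)
    finally show ?thesis using F unfolding F_def[symmetric] by (simp add: field_simps)
  qed
qed

lemma integral_norm_mult_le:
  assumes "sq_integrable M f" "sq_integrable M g"
  shows "(LINT x|M. norm (f x) * norm (g x)) \<le> sqrt (LINT x|M. (norm (f x))\<^sup>2) * sqrt (LINT x|M. (norm (g x))\<^sup>2)"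
  using real_le_rsqrt[OF Cauchy_Schwarz_integral[OF assms[THEN sq_integrable_norm]]]
  by (simp add: real_sqrt_mult)

lemma integral_norm_sq_add_le:
  assumes "sq_integrable M f" "sq_integrable M g"
  shows "(LINT x|M. (norm (f x + g x))\<^sup>2) \<le> 2 * (LINT x|M. (norm (f x))\<^sup>2) + 2 * (LINT x|M. (norm (g x))\<^sup>2)"
proof -
  have "(LINT x|M. (norm (f x + g x))\<^sup>2) \<le> (LINT x|M. 2 * (norm (f x))\<^sup>2 + 2 * (norm (g x))\<^sup>2)"
    by (intro integral_mono norm_add_sq_le Bochner_Integration.integrable_add integrable_mult_right
        sq_integrableD(2) sq_integrable_add assms)
  also have "\<dots> = 2 * (LINT x|M. (norm (f x))\<^sup>2) + 2 * (LINT x|M. (norm (g x))\<^sup>2)"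
    using assms[THEN sq_integrableD(2)] by simp
  finally show ?thesis .
qed

lemma integral_norm_sq_triangle:
  assumes "sq_integrable M f" "sq_integrable M g" "sq_integrable M h"
  shows "(LINT x|M. (norm (f x - h x))\<^sup>2) \<le> 2 * (LINT x|M. (norm (f x - g x))\<^sup>2) + 2 * (LINT x|M. (norm (g x - h x))\<^sup>2)"
  using integral_norm_sq_add_le[OF sq_integrable_diff[OF assms(1,2)] sq_integrable_diff[OF assms(2,3)]]
  by simp

text \<open>Square integrability is part of the predicate because the Bochner integral of a
  non-integrable function is 0, so the numerical limit alone would say nothing.\<close>

definition l2_tendsto ::
  "'a measure \<Rightarrow> (nat \<Rightarrow> 'a \<Rightarrow> 'b::{real_normed_vector, second_countable_topology}) \<Rightarrow> ('a \<Rightarrow> 'b) \<Rightarrow> bool" where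
  "l2_tendsto M F f \<longleftrightarrow> (\<forall>n. sq_integrable M (F n)) \<and> sq_integrable M f \<and>
     (\<lambda>n. LINT x|M. (norm (F n x - f x))\<^sup>2) \<longlonglongrightarrow> 0"

lemma l2_tendstoD:
  assumes "l2_tendsto M F f"
  shows "sq_integrable M (F n)" "sq_integrable M f" "(\<lambda>n. LINT x|M. (norm (F n x - f x))\<^sup>2) \<longlonglongrightarrow> 0"
  using assms by (auto simp: l2_tendsto_def)

lemma l2_tendsto_subseq:
  assumes "l2_tendsto M F f" "strict_mono r"
  shows "l2_tendsto M (\<lambda>n. F (r n)) f"
  using assms LIMSEQ_subseq_LIMSEQ[OF l2_tendstoD(3)[OF assms(1)] assms(2)]
  by (auto simp: l2_tendsto_def o_def)

text \<open>The squared distances tend to 0 in L1, and an L1 null sequence has a subsequence that is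
  null almost everywhere.\<close>

lemma l2_tendsto_AE_subseq:
  assumes "l2_tendsto M F f"
  obtains r where "strict_mono r" "AE x in M. (\<lambda>n. F (r n) x) \<longlonglongrightarrow> f x"
proof -
  have "\<exists>r. strict_mono r \<and> (AE x in M. (\<lambda>n. (norm (F (r n) x - f x))\<^sup>2) \<longlonglongrightarrow> 0)"
    by (rule tendsto_L1_AE_subseq)
       (use assms sq_integrable_diff in \<open>auto simp: l2_tendsto_def intro!: sq_integrableD(2)\<close>)
  then obtain r where r: "strict_mono r" "AE x in M. (\<lambda>n. (norm (F (r n) x - f x))\<^sup>2) \<longlonglongrightarrow> 0" by blast
  from r(2) have "AE x in M. (\<lambda>n. F (r n) x) \<longlonglongrightarrow> f x"
  proof eventually_elim
    case (elim x)
    from tendsto_real_sqrt[OF elim] have "(\<lambda>n. norm (F (r n) x - f x)) \<longlonglongrightarrow> 0" by simp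
    then show ?case by (simp add: tendsto_norm_zero_iff LIM_zero_iff)
  qed
  with r(1) that show ?thesis by blast
qed

text \<open>The limit inherits the bound by \<open>g\<close>, so the squared differences are
  dominated by \<open>4 * (norm (g x))\<^sup>2\<close>.\<close>

lemma l2_tendsto_dominated:
  assumes "\<And>n. F n \<in> borel_measurable M" "f \<in> borel_measurable M" "sq_integrable M g"
    and "\<And>n. AE x in M. norm (F n x) \<le> norm (g x)"
    and "AE x in M. (\<lambda>n. F n x) \<longlonglongrightarrow> f x"
  shows "l2_tendsto M F f"
proof -
  have sF: "sq_integrable M (F n)" for n
    by (rule sq_integrable_dominated[OF assms(3,1), where C = 1]) (use assms(4) in auto)
  have "AE x in M. \<forall>n. norm (F n x) \<le> norm (g x)" using assms(4) by (simp add: AE_all_countable)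
  with assms(5) have fg: "AE x in M. norm (f x) \<le> norm (g x)"
  proof eventually_elim
    case (elim x)
    show ?case
      by (rule LIMSEQ_le_const2[OF tendsto_norm[OF elim(1)]]) (use elim(2) in auto)
  qed
  then have sf: "sq_integrable M f"
    by (intro sq_integrable_dominated[OF assms(3,2), where C = 1]) auto
  note [measurable] = assms(1,2)
  have "(\<lambda>n. LINT x|M. (norm (F n x - f x))\<^sup>2) \<longlonglongrightarrow> (LINT x|M. 0)"
  proof (rule integral_dominated_convergence[where w = "\<lambda>x. 4 * (norm (g x))\<^sup>2"])
    show "AE x in M. (\<lambda>n. (norm (F n x - f x))\<^sup>2) \<longlonglongrightarrow> 0"
      using assms(5)
    proof eventually_elim
      case (elim x)
      have "(\<lambda>n. (norm (F n x - f x))\<^sup>2) \<longlonglongrightarrow> (norm (f x - f x))\<^sup>2"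
        by (intro tendsto_intros elim)
      then show ?case by simp
    qed
    show "AE x in M. norm ((norm (F n x - f x))\<^sup>2) \<le> 4 * (norm (g x))\<^sup>2" for n
      using assms(4)[of n] fg
    proof eventually_elim
      case (elim x)
      have "(norm (F n x))\<^sup>2 \<le> (norm (g x))\<^sup>2" "(norm (f x))\<^sup>2 \<le> (norm (g x))\<^sup>2"
        using elim by (auto intro!: power_mono)
      then show ?case using norm_add_sq_le[of "F n x" "- f x"]
        unfolding real_norm_def norm_minus_cancel by (simp del: power2_le_iff_abs_le power_mono_iff)
    qed
  qed (use assms(3) in auto)
  then show ?thesis using sF sf by (simp add: l2_tendsto_def)
qed

lemma l2_tendsto_add:
  assumes "l2_tendsto M F f" "l2_tendsto M G g"
  shows "l2_tendsto M (\<lambda>n x. F n x + G n x) (\<lambda>x. f x + g x)"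
proof -
  note D = l2_tendstoD[OF assms(1)] l2_tendstoD[OF assms(2)]
  have "(\<lambda>n. 2 * (LINT x|M. (norm (F n x - f x))\<^sup>2) + 2 * (LINT x|M. (norm (G n x - g x))\<^sup>2)) \<longlonglongrightarrow> 2 * 0 + 2 * 0"
    by (intro tendsto_intros D)
  then have S0: "(\<lambda>n. 2 * (LINT x|M. (norm (F n x - f x))\<^sup>2) + 2 * (LINT x|M. (norm (G n x - g x))\<^sup>2)) \<longlonglongrightarrow> 0"
    by simp
  have "(\<lambda>n. LINT x|M. (norm ((F n x + G n x) - (f x + g x)))\<^sup>2) \<longlonglongrightarrow> 0"
  proof (rule metric_tendsto_imp_tendsto[OF S0 always_eventually], rule allI)
    fix n
    have "(LINT x|M. (norm ((F n x + G n x) - (f x + g x)))\<^sup>2) = (LINT x|M. (norm ((F n x - f x) + (G n x - g x)))\<^sup>2)"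
      by (simp add: algebra_simps)
    also have "\<dots> \<le> 2 * (LINT x|M. (norm (F n x - f x))\<^sup>2) + 2 * (LINT x|M. (norm (G n x - g x))\<^sup>2)"
      by (intro integral_norm_sq_add_le sq_integrable_diff D)
    finally show "dist (LINT x|M. (norm ((F n x + G n x) - (f x + g x)))\<^sup>2) 0
      \<le> dist (2 * (LINT x|M. (norm (F n x - f x))\<^sup>2) + 2 * (LINT x|M. (norm (G n x - g x))\<^sup>2)) 0"
      by (simp add: dist_real_def)
  qed
  then show ?thesis using D by (simp add: l2_tendsto_def sq_integrable_add)
qed

lemma l2_tendsto_const: "sq_integrable M f \<Longrightarrow> l2_tendsto M (\<lambda>n. f) f"
  by (simp add: l2_tendsto_def)

lemma l2_tendsto_close:
  assumes "l2_tendsto M F f" "\<And>n. sq_integrable M (G n)"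
    and "(\<lambda>n. LINT x|M. (norm (G n x - F n x))\<^sup>2) \<longlonglongrightarrow> 0"
  shows "l2_tendsto M G f"
proof -
  have "l2_tendsto M (\<lambda>n x. G n x - F n x) (\<lambda>x. 0)"
    using assms l2_tendstoD(1)[OF assms(1)] by (auto simp: l2_tendsto_def sq_integrable_diff) (simp add: sq_integrable_def)
  from l2_tendsto_add[OF assms(1) this] show ?thesis by simp
qed

lemma l2_tendsto_unique:
  assumes "l2_tendsto M F f" "l2_tendsto M F g"
  shows "AE x in M. f x = g x"
proof -
  from l2_tendsto_AE_subseq[OF assms(1)] obtain r where r: "strict_mono r"
    "AE x in M. (\<lambda>n. F (r n) x) \<longlonglongrightarrow> f x" .
  from l2_tendsto_AE_subseq[OF l2_tendsto_subseq[OF assms(2) r(1)]] obtain s where s: "strict_mono s"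
    "AE x in M. (\<lambda>n. F (r (s n)) x) \<longlonglongrightarrow> g x" .
  from r(2) s(2) show ?thesis
  proof eventually_elim
    case (elim x)
    from LIMSEQ_subseq_LIMSEQ[OF elim(1) s(1)] elim(2) show ?case
      by (auto simp: o_def intro: LIMSEQ_unique)
  qed
qed

lemma l2_tendsto_inner:
  assumes "l2_tendsto M F (f::_\<Rightarrow>'b::{real_inner, second_countable_topology})" "l2_tendsto M G g"
  shows "(\<lambda>n. LINT x|M. F n x \<bullet> G n x) \<longlonglongrightarrow> (LINT x|M. f x \<bullet> g x)"
proof -
  note D = l2_tendstoD[OF assms(1)] l2_tendstoD[OF assms(2)]
  define a where "a n = (LINT x|M. (norm (F n x - f x))\<^sup>2)" for n
  define b where "b n = (LINT x|M. (norm (G n x - g x))\<^sup>2)" for n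
  define B where "B n = sqrt (a n) * sqrt (b n) + sqrt (a n) * sqrt (LINT x|M. (norm (g x))\<^sup>2)
    + sqrt (LINT x|M. (norm (f x))\<^sup>2) * sqrt (b n)" for n
  have ab: "a \<longlonglongrightarrow> 0" "b \<longlonglongrightarrow> 0" using D unfolding a_def b_def by auto
  have le: "\<bar>LINT x|M. f' x \<bullet> g' x\<bar> \<le> sqrt (LINT x|M. (norm (f' x))\<^sup>2) * sqrt (LINT x|M. (norm (g' x))\<^sup>2)"
    if "sq_integrable M f'" "sq_integrable M g'" for f' g' :: "_\<Rightarrow>'b"
  proof -
    have "\<bar>LINT x|M. f' x \<bullet> g' x\<bar> \<le> (LINT x|M. \<bar>f' x \<bullet> g' x\<bar>)" by (rule integral_abs_bound)
    also have "\<dots> \<le> (LINT x|M. norm (f' x) * norm (g' x))"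
      by (intro integral_mono integrable_norm_mult that integrable_abs integrable_inner_sq Cauchy_Schwarz_ineq2)
    also note integral_norm_mult_le[OF that]
    finally show ?thesis .
  qed
  have "B \<longlonglongrightarrow> sqrt 0 * sqrt 0 + sqrt 0 * sqrt (LINT x|M. (norm (g x))\<^sup>2) + sqrt (LINT x|M. (norm (f x))\<^sup>2) * sqrt 0"
    unfolding B_def by (intro tendsto_intros ab)
  then have B: "B \<longlonglongrightarrow> 0" by simp
  have "(\<lambda>n. (LINT x|M. F n x \<bullet> G n x) - (LINT x|M. f x \<bullet> g x)) \<longlonglongrightarrow> 0"
  proof (rule Lim_null_comparison[OF always_eventually B, rule_format])
    fix n
    note ii = integrable_inner_sq
    have d: "sq_integrable M (\<lambda>x. F n x - f x)" "sq_integrable M (\<lambda>x. G n x - g x)"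
      using D sq_integrable_diff by blast+
    have "(LINT x|M. F n x \<bullet> G n x) - (LINT x|M. f x \<bullet> g x) = (LINT x|M. F n x \<bullet> G n x - f x \<bullet> g x)"
      by (simp add: D ii)
    also have "\<dots> = (LINT x|M. (F n x - f x) \<bullet> (G n x - g x) + ((F n x - f x) \<bullet> g x + f x \<bullet> (G n x - g x)))"
      by (simp add: inner_diff algebra_simps)
    also have "\<dots> = (LINT x|M. (F n x - f x) \<bullet> (G n x - g x)) + ((LINT x|M. (F n x - f x) \<bullet> g x)
        + (LINT x|M. f x \<bullet> (G n x - g x)))"
      using d D(2,5) by (subst Bochner_Integration.integral_add, auto intro!: ii)
        (subst Bochner_Integration.integral_add, auto intro!: ii)
    finally show "norm ((LINT x|M. F n x \<bullet> G n x) - (LINT x|M. f x \<bullet> g x)) \<le> B n"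
      using le[OF d] le[OF d(1) D(5)] le[OF D(2) d(2)] unfolding B_def a_def b_def real_norm_def by linarith
  qed
  then show ?thesis by (simp add: LIM_zero_iff)
qed

lemma l2_tendsto_norm_sq:
  assumes "l2_tendsto M F (f::_\<Rightarrow>'b::{real_inner, second_countable_topology})"
  shows "(\<lambda>n. LINT x|M. (norm (F n x))\<^sup>2) \<longlonglongrightarrow> (LINT x|M. (norm (f x))\<^sup>2)"
  using l2_tendsto_inner[OF assms assms] by (simp add: power2_norm_eq_inner)

text \<open>The error splits into \<open>c n x *\<^sub>R (F n x - f x)\<close>, controlled by
  \<open>K\<close>, and \<open>(c n x - d x) *\<^sub>R f x\<close>, handled by dominated
  convergence. In this way the bounded coefficients of the chain rule pass to the limit.\<close>

lemma l2_tendsto_scaleR_bounded: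
  fixes F :: "nat \<Rightarrow> 'a \<Rightarrow> 'b::{real_normed_vector, second_countable_topology}"
  assumes "l2_tendsto M F f" "\<And>n. c n \<in> borel_measurable M" "d \<in> borel_measurable M"
    and "\<And>n. AE x in M. \<bar>c n x\<bar> \<le> K" and c: "AE x in M. (\<lambda>n. c n x) \<longlonglongrightarrow> d x"
  shows "l2_tendsto M (\<lambda>n x. c n x *\<^sub>R F n x) (\<lambda>x. d x *\<^sub>R f x)"
proof -
  note D = l2_tendstoD[OF assms(1)]
  note [measurable] = assms(2,3) D(1)[THEN sq_integrableD(1)] D(2)[THEN sq_integrableD(1)]
  have 1: "l2_tendsto M (\<lambda>n x. c n x *\<^sub>R f x) (\<lambda>x. d x *\<^sub>R f x)"
  proof (rule l2_tendsto_dominated[OF _ _ sq_integrable_scaleR[OF D(2), of "\<bar>K\<bar>"]])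
    show "AE x in M. norm (c n x *\<^sub>R f x) \<le> norm (\<bar>K\<bar> *\<^sub>R f x)" for n
      using assms(4)[of n] by eventually_elim (auto intro!: mult_right_mono)
    show "AE x in M. (\<lambda>n. c n x *\<^sub>R f x) \<longlonglongrightarrow> d x *\<^sub>R f x"
      using c by eventually_elim (auto intro!: tendsto_intros)
  qed measurable
  have sq: "sq_integrable M (\<lambda>x. c n x *\<^sub>R g x)" if "sq_integrable M g" for n and g :: "'a \<Rightarrow> 'b"
    by (rule sq_integrable_dominated[OF that, where C = K])
       (use that assms(4)[of n] in \<open>auto intro!: mult_right_mono borel_measurable_scaleR\<close>)
  show ?thesis
  proof (rule l2_tendsto_close[OF 1])
    show "sq_integrable M (\<lambda>x. c n x *\<^sub>R F n x)" for n by (intro sq D)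
    have "(\<lambda>n. K\<^sup>2 * (LINT x|M. (norm (F n x - f x))\<^sup>2)) \<longlonglongrightarrow> K\<^sup>2 * 0" by (intro tendsto_intros D)
    then have K0: "(\<lambda>n. K\<^sup>2 * (LINT x|M. (norm (F n x - f x))\<^sup>2)) \<longlonglongrightarrow> 0" by simp
    show "(\<lambda>n. LINT x|M. (norm (c n x *\<^sub>R F n x - c n x *\<^sub>R f x))\<^sup>2) \<longlonglongrightarrow> 0"
    proof (rule Lim_null_comparison[OF always_eventually K0, rule_format])
      fix n
      have "(LINT x|M. (norm (c n x *\<^sub>R F n x - c n x *\<^sub>R f x))\<^sup>2) \<le> (LINT x|M. K\<^sup>2 * (norm (F n x - f x))\<^sup>2)"
      proof (rule integral_mono_AE)
        show "integrable M (\<lambda>x. (norm (c n x *\<^sub>R F n x - c n x *\<^sub>R f x))\<^sup>2)"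
          by (intro sq_integrableD(2) sq_integrable_diff sq D)
        show "integrable M (\<lambda>x. K\<^sup>2 * (norm (F n x - f x))\<^sup>2)"
          by (intro integrable_mult_right sq_integrableD(2) sq_integrable_diff D)
        show "AE x in M. (norm (c n x *\<^sub>R F n x - c n x *\<^sub>R f x))\<^sup>2 \<le> K\<^sup>2 * (norm (F n x - f x))\<^sup>2"
          using assms(4)[of n]
        proof eventually_elim
          case (elim x)
          have "(c n x)\<^sup>2 \<le> K\<^sup>2" using elim by (metis abs_le_square_iff abs_of_nonneg abs_ge_zero order_trans)
          then show ?case by (auto simp flip: scaleR_diff_right simp: power_mult_distrib intro!: mult_right_mono)
        qed
      qed
      then show "norm (LINT x|M. (norm (c n x *\<^sub>R F n x - c n x *\<^sub>R f x))\<^sup>2) \<le> K\<^sup>2 * (LINT x|M. (norm (F n x - f x))\<^sup>2)"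
        by simp
    qed
  qed
qed

text \<open>Truncation at height \<open>K\<close> comes first, so that the continuous functions
  which approximate \<open>f\<close> almost everywhere can be truncated at the same height. They are
  then dominated by a constant, and almost everywhere convergence becomes L2 convergence.\<close>

lemma sq_dense_continuous:
  fixes f :: "'a::euclidean_space \<Rightarrow> real"
  assumes S: "S \<in> lmeasurable" and f: "sq_integrable (lebesgue_on S) f" and "e > 0"
  obtains g K where "continuous_on UNIV g" "\<And>x. \<bar>g x\<bar> \<le> K" "sq_integrable (lebesgue_on S) g"
    "(LINT x|lebesgue_on S. (f x - g x)\<^sup>2) < e"
proof -
  let ?M = "lebesgue_on S"
  have SL: "S \<in> sets lebesgue" using S by auto
  interpret finite_measure ?M by (rule finite_measure_lebesgue_on[OF S])
  define cl where "cl (K::real) y = max (-K) (min K y)" for K y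
  have cl: "\<bar>cl K y\<bar> \<le> K" "continuous_on A (cl K)" if "K \<ge> 0" for K y A
    using that unfolding cl_def by (auto intro!: continuous_intros)
  have clb: "\<bar>cl K y\<bar> \<le> \<bar>y\<bar>" if "K \<ge> 0" for K y using that unfolding cl_def by auto
  have [measurable]: "f \<in> borel_measurable ?M" using f by auto
  have clm[measurable]: "cl K \<in> borel_measurable borel" for K unfolding cl_def by measurable
  have "l2_tendsto ?M (\<lambda>n x. cl (real n) (f x)) f"
  proof (rule l2_tendsto_dominated[OF _ _ f])
    show "AE x in ?M. (\<lambda>n. cl (real n) (f x)) \<longlonglongrightarrow> f x"
    proof (intro always_eventually allI)
      fix x
      obtain N where N: "\<bar>f x\<bar> \<le> real N" using real_arch_simple by blast
      show "(\<lambda>n. cl (real n) (f x)) \<longlonglongrightarrow> f x"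
        by (rule tendsto_eventually, rule eventually_sequentiallyI[of N])
           (use N in \<open>auto simp: cl_def min_def max_def\<close>)
    qed
  qed (auto simp: clb)
  then have "(\<lambda>n. LINT x|?M. (norm (cl (real n) (f x) - f x))\<^sup>2) \<longlonglongrightarrow> 0" by (rule l2_tendstoD)
  from order_tendstoD(2)[OF this, of "e/4"] obtain K where
    K: "(LINT x|?M. (norm (cl (real K) (f x) - f x))\<^sup>2) < e/4"
    using \<open>e > 0\<close> by (auto simp: eventually_sequentially)
  have "f measurable_on S" using SL by (simp add: measurable_on_iff_borel_measurable)
  then obtain Z g where Zg: "negligible Z" "\<And>n. continuous_on UNIV (g n)"
     "\<And>x. x \<notin> Z \<Longrightarrow> (\<lambda>n. g n x) \<longlonglongrightarrow> (if x \<in> S then f x else 0)"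
    unfolding measurable_on_def by blast
  have Z: "AE x in ?M. x \<notin> Z"
    using Zg(1) SL by (auto simp: negligible_iff_null_sets AE_restrict_space_iff AE_not_in intro: AE_mp[OF AE_not_in])
  have gm: "(\<lambda>x. cl (real K) (g n x)) \<in> borel_measurable ?M" for n
    using continuous_imp_measurable_on_sets_lebesgue[OF continuous_on_subset[OF Zg(2)] SL] by (auto intro: measurable_compose)
  have sK: "sq_integrable ?M (\<lambda>x. real K)" by (simp add: sq_integrable_def)
  have L: "l2_tendsto ?M (\<lambda>n x. cl (real K) (g n x)) (\<lambda>x. cl (real K) (f x))"
  proof (rule l2_tendsto_dominated[OF gm _ sK])
    show "AE x in ?M. (\<lambda>n. cl (real K) (g n x)) \<longlonglongrightarrow> cl (real K) (f x)"
      using Z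
    proof (rule AE_mp, intro AE_I2 impI)
      fix x assume x: "x \<in> space ?M" "x \<notin> Z"
      with Zg(3)[OF x(2)] have "(\<lambda>n. g n x) \<longlonglongrightarrow> f x" by simp
      then show "(\<lambda>n. cl (real K) (g n x)) \<longlonglongrightarrow> cl (real K) (f x)"
        unfolding cl_def by (intro tendsto_intros)
    qed
  qed (auto simp: cl)
  from order_tendstoD(2)[OF l2_tendstoD(3)[OF this], of "e/4"] obtain n where
    n: "(LINT x|?M. (norm (cl (real K) (g n x) - cl (real K) (f x)))\<^sup>2) < e/4"
    using \<open>e > 0\<close> by (auto simp: eventually_sequentially)
  show thesis
  proof (rule that[of "\<lambda>x. cl (real K) (g n x)" "real K"])
    show "continuous_on UNIV (\<lambda>x. cl (real K) (g n x))"
      using Zg(2) unfolding cl_def by (intro continuous_intros)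
    show s: "sq_integrable ?M (\<lambda>x. cl (real K) (g n x))" using L by (rule l2_tendstoD)
    have "(LINT x|?M. (norm (cl (real K) (g n x) - f x))\<^sup>2) \<le> 2 * (LINT x|?M. (norm (cl (real K) (g n x) - cl (real K) (f x)))\<^sup>2)
      + 2 * (LINT x|?M. (norm (cl (real K) (f x) - f x))\<^sup>2)"
      by (intro integral_norm_sq_triangle s f l2_tendstoD(2)[OF L])
    also have "\<dots> < e" using K n by linarith
    finally show "(LINT x|?M. (f x - cl (real K) (g n x))\<^sup>2) < e" by (simp add: power2_commute)
  qed (simp add: cl)
qed

section \<open>Smooth functions, mollifiers and convolution\<close>

text \<open>Coinduction for smoothness: each differentiation leads back into \<open>A\<close>, so
  all orders exist. The smoothness proofs below only have to exhibit a set closed under partial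
  derivatives.\<close>

lemma smooth_coinduct:
  fixes f :: "'n::euclidean_space \<Rightarrow> real"
  assumes "f \<in> A"
    and step: "\<And>g. g \<in> A \<Longrightarrow> \<exists>g'. (\<forall>x. (g has_derivative g' x) (at x)) \<and> (\<forall>b\<in>Basis. (\<lambda>x. g' x b) \<in> A)"
  shows "smooth f"
proof -
  have "C_k k g" if "g \<in> A" for k g
    using that
  proof (induction k arbitrary: g)
    case 0
    then obtain g' where "\<forall>x. (g has_derivative g' x) (at x)" using step by blast
    then have "g differentiable (at x)" for x unfolding differentiable_def by blast
    then show ?case
      by (simp add: differentiable_imp_continuous_on differentiable_on_def)
  next
    case (Suc k)
    then obtain g' where g': "\<forall>x. (g has_derivative g' x) (at x)" "\<forall>b\<in>Basis. (\<lambda>x. g' x b) \<in> A"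
      using step by blast
    have "frechet_derivative g (at x) = g' x" for x
      using g'(1) by (metis frechet_derivative_at)
    moreover have "g differentiable (at x)" for x using g'(1) unfolding differentiable_def by blast
    ultimately show ?case using Suc.IH g'(2) by (simp add: differentiable_on_def)
  qed
  then show ?thesis using assms(1) by (auto simp: smooth_def)
qed

definition grad :: "('n::euclidean_space \<Rightarrow> real) \<Rightarrow> 'n \<Rightarrow> 'n" where
  "grad f x = (\<Sum>b\<in>Basis. frechet_derivative f (at x) b *\<^sub>R b)"

lemma grad_inner_Basis: "b \<in> Basis \<Longrightarrow> grad f x \<bullet> b = frechet_derivative f (at x) b"
  by (simp add: grad_def inner_sum_left inner_Basis if_distrib sum.delta cong: if_cong)

lemma has_derivative_grad:
  assumes "f differentiable (at x)"
  shows "(f has_derivative (\<lambda>h. grad f x \<bullet> h)) (at x)"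
proof -
  have d: "(f has_derivative frechet_derivative f (at x)) (at x)"
    using assms frechet_derivative_works by blast
  then have "linear (frechet_derivative f (at x))"
    using has_derivative_linear by blast
  then have "frechet_derivative f (at x) h = grad f x \<bullet> h" for h
  proof -
    assume l: "linear (frechet_derivative f (at x))"
    have "frechet_derivative f (at x) h = frechet_derivative f (at x) (\<Sum>b\<in>Basis. (h \<bullet> b) *\<^sub>R b)"
      by (simp add: euclidean_representation)
    also have "\<dots> = (\<Sum>b\<in>Basis. (h \<bullet> b) * frechet_derivative f (at x) b)"
      by (simp add: linear_sum[OF l] linear_scale[OF l])
    also have "\<dots> = grad f x \<bullet> h"
      by (simp add: grad_def inner_sum_left inner_sum_right inner_commute mult.commute)
    finally show ?thesis .
  qed
  then have "frechet_derivative f (at x) = (\<lambda>h. grad f x \<bullet> h)" by blast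
  with d show ?thesis by simp
qed

lemma smooth_differentiable: "smooth f \<Longrightarrow> f differentiable (at x)"
  unfolding smooth_def using C_k.simps(2)[of 0 f] by (auto simp: differentiable_on_def)

lemma smooth_has_derivative: "smooth f \<Longrightarrow> (f has_derivative (\<lambda>h. grad f x \<bullet> h)) (at x)"
  by (intro has_derivative_grad smooth_differentiable)

lemma smooth_continuous: "smooth f \<Longrightarrow> continuous_on A f"
  unfolding smooth_def using C_k.simps(1)[of f] continuous_on_subset by blast

lemma smooth_partial: "smooth f \<Longrightarrow> b \<in> Basis \<Longrightarrow> smooth (\<lambda>x. grad f x \<bullet> b)"
  unfolding smooth_def grad_inner_Basis by (metis C_k.simps(2) grad_inner_Basis)

lemma smooth_continuous_grad:
  assumes "smooth f" shows "continuous_on A (grad f)"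
  by (subst continuous_on_componentwise) (auto intro: smooth_continuous smooth_partial assms)

text \<open>Compositions of a smooth function with a merely C1 nonlinearity, such as a real power,
  land in this class and not among the smooth functions. The gradient is an explicit argument so
  that formulas for it can be carried along.\<close>

definition C1_fun :: "('n::euclidean_space \<Rightarrow> real) \<Rightarrow> ('n \<Rightarrow> 'n) \<Rightarrow> bool" where
  "C1_fun f G \<longleftrightarrow> (\<forall>x. (f has_derivative (\<lambda>h. G x \<bullet> h)) (at x)) \<and> continuous_on UNIV G"

lemma C1_fun_smooth: "smooth f \<Longrightarrow> C1_fun f (grad f)"
  by (simp add: C1_fun_def smooth_has_derivative smooth_continuous_grad)

lemma C1_fun_continuous: "C1_fun f G \<Longrightarrow> continuous_on A f"
  unfolding C1_fun_def by (meson continuous_at_imp_continuous_on has_derivative_continuous)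

lemma C1_fun_grad_continuous: "C1_fun f G \<Longrightarrow> continuous_on A G"
  unfolding C1_fun_def using continuous_on_subset by blast

lemma C1_fun_derivative: "C1_fun f G \<Longrightarrow> (f has_derivative (\<lambda>h. G x \<bullet> h)) (at x within A)"
  unfolding C1_fun_def by (meson has_derivative_at_withinI)

lemma C1_fun_mult:
  assumes "C1_fun f F" "C1_fun g G"
  shows "C1_fun (\<lambda>x. f x * g x) (\<lambda>x. f x *\<^sub>R G x + g x *\<^sub>R F x)"
  unfolding C1_fun_def
proof (intro conjI allI)
  fix x
  have "((\<lambda>x. f x * g x) has_derivative (\<lambda>h. f x * (G x \<bullet> h) + (F x \<bullet> h) * g x)) (at x)"
    using assms by (intro has_derivative_mult) (auto simp: C1_fun_def)
  then show "((\<lambda>x. f x * g x) has_derivative (\<lambda>h. (f x *\<^sub>R G x + g x *\<^sub>R F x) \<bullet> h)) (at x)"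
    by (simp add: inner_add_left mult.commute)
next
  show "continuous_on UNIV (\<lambda>x. f x *\<^sub>R G x + g x *\<^sub>R F x)"
    by (intro continuous_intros C1_fun_continuous[OF assms(1)] C1_fun_continuous[OF assms(2)]
        C1_fun_grad_continuous[OF assms(1)] C1_fun_grad_continuous[OF assms(2)])
qed

lemma C1_fun_compose:
  assumes "C1_fun f F" "\<And>x. (\<phi> has_real_derivative \<phi>' x) (at x)" "continuous_on UNIV \<phi>'"
  shows "C1_fun (\<lambda>x. \<phi> (f x)) (\<lambda>x. \<phi>' (f x) *\<^sub>R F x)"
  unfolding C1_fun_def
proof (intro conjI allI)
  fix x
  have "((\<lambda>x. \<phi> (f x)) has_derivative (\<lambda>h. (F x \<bullet> h) * \<phi>' (f x))) (at x)"
  proof (rule has_derivative_compose[where g = \<phi> and g' = "\<lambda>h. h * \<phi>' (f x)"])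
    show "(\<phi> has_derivative (\<lambda>h. h * \<phi>' (f x))) (at (f x))"
      proof -
      have "(\<lambda>h. h * \<phi>' (f x)) = (*) (\<phi>' (f x))" by (simp add: fun_eq_iff)
      then show ?thesis using assms(2)[of "f x"] unfolding has_field_derivative_def by metis
    qed
  qed (use assms(1) in \<open>simp add: C1_fun_def\<close>)
  then show "((\<lambda>x. \<phi> (f x)) has_derivative (\<lambda>h. (\<phi>' (f x) *\<^sub>R F x) \<bullet> h)) (at x)"
    by (simp add: mult.commute)
next
  show "continuous_on UNIV (\<lambda>x. \<phi>' (f x) *\<^sub>R F x)"
    by (intro continuous_intros C1_fun_grad_continuous[OF assms(1)]
        continuous_on_compose2[OF assms(3) C1_fun_continuous[OF assms(1)]]) auto
qed

text \<open>The product rule turns a product into a sum of products, so products of two smooth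
  functions are not by themselves a set fit for \<open>smooth_coinduct\<close>; the generated
  algebra is.\<close>

inductive_set smooth_algebra :: "('n::euclidean_space \<Rightarrow> real) set" where
  base: "smooth f \<Longrightarrow> f \<in> smooth_algebra"
| add: "f \<in> smooth_algebra \<Longrightarrow> g \<in> smooth_algebra \<Longrightarrow> (\<lambda>x. f x + g x) \<in> smooth_algebra"
| mult: "f \<in> smooth_algebra \<Longrightarrow> g \<in> smooth_algebra \<Longrightarrow> (\<lambda>x. f x * g x) \<in> smooth_algebra"

lemma smooth_algebra_smooth:
  assumes "f \<in> smooth_algebra" shows "smooth f"
proof (rule smooth_coinduct[OF assms])
  show "\<exists>g'. (\<forall>x. (g has_derivative g' x) (at x)) \<and> (\<forall>b\<in>Basis. (\<lambda>x. g' x b) \<in> smooth_algebra)"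
    if "g \<in> smooth_algebra" for g :: "'a \<Rightarrow> real"
    using that
  proof induction
    case (base f)
    then show ?case
      by (intro exI[of _ "\<lambda>x h. grad f x \<bullet> h"]) (auto intro: smooth_algebra.base smooth_has_derivative smooth_partial)
  next
    case (add f g)
    then obtain f' g' where "\<forall>x. (f has_derivative f' x) (at x)" "\<forall>b\<in>Basis. (\<lambda>x. f' x b) \<in> smooth_algebra"
      "\<forall>x. (g has_derivative g' x) (at x)" "\<forall>b\<in>Basis. (\<lambda>x. g' x b) \<in> smooth_algebra" by blast
    then show ?case
      by (intro exI[of _ "\<lambda>x h. f' x h + g' x h"]) (auto intro!: has_derivative_add smooth_algebra.add)
  next
    case (mult f g)
    then obtain f' g' where "\<forall>x. (f has_derivative f' x) (at x)" "\<forall>b\<in>Basis. (\<lambda>x. f' x b) \<in> smooth_algebra"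
      "\<forall>x. (g has_derivative g' x) (at x)" "\<forall>b\<in>Basis. (\<lambda>x. g' x b) \<in> smooth_algebra" by blast
    with mult.hyps show ?case
      by (intro exI[of _ "\<lambda>x h. f x * g' x h + f' x h * g x"])
         (auto intro!: has_derivative_mult smooth_algebra.add smooth_algebra.mult)
  qed
qed

lemma smooth_add: "smooth f \<Longrightarrow> smooth g \<Longrightarrow> smooth (\<lambda>x. f x + g x)"
  by (rule smooth_algebra_smooth[OF smooth_algebra.add[OF smooth_algebra.base smooth_algebra.base]])

lemma smooth_mult: "smooth f \<Longrightarrow> smooth g \<Longrightarrow> smooth (\<lambda>x. f x * g x)"
  by (rule smooth_algebra_smooth[OF smooth_algebra.mult[OF smooth_algebra.base smooth_algebra.base]])

lemma smooth_const: "smooth (\<lambda>x. c)"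
proof (rule smooth_coinduct[of _ "range (\<lambda>c x. c)"])
  fix g :: "'a \<Rightarrow> real" assume "g \<in> range (\<lambda>c x. c)"
  then show "\<exists>g'. (\<forall>x. (g has_derivative g' x) (at x)) \<and> (\<forall>b\<in>Basis. (\<lambda>x. g' x b) \<in> range (\<lambda>c x. c))"
    by (intro exI[of _ "\<lambda>x h. 0"]) auto
qed auto

lemma smooth_cmult: "smooth f \<Longrightarrow> smooth (\<lambda>x. c * f x)"
  by (intro smooth_mult smooth_const)

lemma smooth_inner: "smooth (\<lambda>x. x \<bullet> v)"
proof (rule smooth_coinduct[of _ "insert (\<lambda>x. x \<bullet> v) (Collect smooth)"])
  fix g :: "'a \<Rightarrow> real" assume "g \<in> insert (\<lambda>x. x \<bullet> v) (Collect smooth)"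
  then consider "g = (\<lambda>x. x \<bullet> v)" | "smooth g" by blast
  then show "\<exists>g'. (\<forall>x. (g has_derivative g' x) (at x)) \<and> (\<forall>b\<in>Basis. (\<lambda>x. g' x b) \<in> insert (\<lambda>x. x \<bullet> v) (Collect smooth))"
  proof cases
    case 1 then show ?thesis
      by (intro exI[of _ "\<lambda>x h. h \<bullet> v"]) (auto intro!: smooth_const derivative_eq_intros)
  next
    case 2 then show ?thesis
      by (intro exI[of _ "\<lambda>x h. grad g x \<bullet> h"]) (auto intro: smooth_has_derivative smooth_partial)
  qed
qed auto

text \<open>Each differentiation produces a factor \<open>a\<close>, hence the scalar multiples in
  the invariant set.\<close>

lemma smooth_affine:
  assumes "smooth f" shows "smooth (\<lambda>x. f (a *\<^sub>R x + v))"
proof (rule smooth_coinduct[of _ "{\<lambda>x. c * g (a *\<^sub>R x + v) |c g. smooth g}"])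
  fix h assume "h \<in> {\<lambda>x. c * g (a *\<^sub>R x + v) |c g. smooth g}"
  then obtain c g where h: "h = (\<lambda>x. c * g (a *\<^sub>R x + v))" "smooth g" by blast
  have "(h has_derivative (\<lambda>k. c * (grad g (a *\<^sub>R x + v) \<bullet> (a *\<^sub>R k)))) (at x)" for x
  proof -
    have "((\<lambda>x. a *\<^sub>R x + v) has_derivative (\<lambda>k. a *\<^sub>R k)) (at x)"
      by (auto intro!: derivative_eq_intros)
    from has_derivative_compose[OF this smooth_has_derivative[OF h(2)]]
    show ?thesis unfolding h(1) by (rule has_derivative_mult_right)
  qed
  moreover have "(\<lambda>x. c * (grad g (a *\<^sub>R x + v) \<bullet> (a *\<^sub>R b))) \<in> {\<lambda>x. c * g (a *\<^sub>R x + v) |c g. smooth g}"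
    if "b \<in> Basis" for b
  proof -
    have "(\<lambda>x. c * (grad g (a *\<^sub>R x + v) \<bullet> (a *\<^sub>R b))) = (\<lambda>x. (c * a) * (\<lambda>y. grad g y \<bullet> b) (a *\<^sub>R x + v))"
      by (simp add: mult.assoc)
    then show ?thesis using smooth_partial[OF h(2) that]
      by (intro CollectI exI[of _ "c * a"] exI[of _ "\<lambda>x. grad g x \<bullet> b"]) auto
  qed
  ultimately show "\<exists>g'. (\<forall>x. (h has_derivative g' x) (at x)) \<and> (\<forall>b\<in>Basis. (\<lambda>x. g' x b) \<in> {\<lambda>x. c * g (a *\<^sub>R x + v) |c g. smooth g})"
    by (intro exI[of _ "\<lambda>x k. c * (grad g (a *\<^sub>R x + v) \<bullet> (a *\<^sub>R k))"]) blast
next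
  show "(\<lambda>x. f (a *\<^sub>R x + v)) \<in> {\<lambda>x. c * g (a *\<^sub>R x + v) |c g. smooth g}"
    using assms by (intro CollectI exI[of _ 1] exI[of _ f]) auto
qed

section \<open>A smooth bump function\<close>

definition flat_exp :: "nat \<Rightarrow> real \<Rightarrow> real" where
  "flat_exp k s = (if s > 0 then exp (- 1 / s) / s ^ k else 0)"

lemma power_div_fact_le_exp:
  assumes "0 \<le> (x::real)" shows "x ^ n / fact n \<le> exp x"
proof -
  have "x ^ n / fact n \<le> (\<Sum>i<Suc n. x ^ i / fact i)"
    using assms by (intro member_le_sum[of n "{..<Suc n}" "\<lambda>i. x ^ i / fact i"]) auto
  also have "\<dots> \<le> (\<Sum>i. x ^ i / fact i)"
    using assms summable_exp[of x] by (intro sum_le_suminf) (auto simp: divide_inverse mult.commute)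
  also have "\<dots> = exp x" by (simp add: exp_def divide_inverse mult.commute)
  finally show ?thesis .
qed

text \<open>The term of order \<open>k + 2\<close> of the exponential series at \<open>1 / s\<close>
  beats the denominator \<open>s ^ k\<close> with two powers of \<open>s\<close> to spare. This
  makes the difference quotient at 0 vanish.\<close>

lemma flat_exp_bound: "\<bar>flat_exp k s\<bar> \<le> fact (k + 2) * s\<^sup>2"
proof (cases "s > 0")
  case True
  define F :: real where "F = fact (k + 2)"
  have F: "F > 0" unfolding F_def by (rule fact_gt_zero)
  have "(1/s) ^ (k+2) / F \<le> exp (1/s)" using True unfolding F_def by (intro power_div_fact_le_exp) auto
  then have "exp (- (1 / s)) \<le> F * s ^ (k+2)"
    using True F by (simp add: exp_minus field_simps)
  then have "exp (- 1 / s) / s ^ k \<le> F * s\<^sup>2"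
    using True by (simp add: field_simps power_add power2_eq_square)
  then show ?thesis using True unfolding F_def[symmetric] by (simp add: flat_exp_def)
qed (simp add: flat_exp_def)

text \<open>Differentiation raises the power in the denominator by one or two and stays in the span
  of the family; this is the reason for the index \<open>k\<close>.\<close>

lemma flat_exp_derivative:
  "(flat_exp k has_real_derivative (flat_exp (k+2) s - real k * flat_exp (k+1) s)) (at s)"
proof -
  consider "s > 0" | "s < 0" | "s = 0" by linarith
  then show ?thesis
  proof cases
    case 1
    have "((\<lambda>s. exp (- 1 / s) / s ^ k) has_real_derivative (flat_exp (k+2) s - real k * flat_exp (k+1) s)) (at s)"
      using 1 by (auto intro!: derivative_eq_intros simp: flat_exp_def power2_eq_square)
        (cases k; simp add: field_simps power2_eq_square power_add)
    from has_field_derivative_transform_within_open[OF this open_greaterThan] show ?thesis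
      using 1 by (auto simp: flat_exp_def)
  next
    case 2
    have "((\<lambda>s. 0) has_real_derivative (flat_exp (k+2) s - real k * flat_exp (k+1) s)) (at s)"
      using 2 by (auto simp: flat_exp_def)
    from has_field_derivative_transform_within_open[OF this open_lessThan] show ?thesis
      using 2 by (auto simp: flat_exp_def)
  next
    case 3
    have "(\<lambda>h. fact (k + 2) * \<bar>h\<bar>) \<midarrow>0\<rightarrow> fact (k+2) * \<bar>0::real\<bar>" by (intro tendsto_intros)
    then have l: "(\<lambda>h. fact (k + 2) * \<bar>h::real\<bar>) \<midarrow>0\<rightarrow> 0" by simp
    have "(\<lambda>h. flat_exp k h / h) \<midarrow>0\<rightarrow> 0"
    proof (rule Lim_null_comparison[OF _ l], rule always_eventually, rule allI)
      fix h :: real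
      show "norm (flat_exp k h / h) \<le> fact (k + 2) * \<bar>h\<bar>"
        using flat_exp_bound[of k h] by (cases "h = 0") (auto simp: field_simps power2_eq_square abs_mult simp del: fact_Suc)
    qed
    then show ?thesis using 3 by (simp add: DERIV_def flat_exp_def)
  qed
qed

inductive_set bump_algebra :: "('n::euclidean_space \<Rightarrow> real) set" where
  base: "smooth f \<Longrightarrow> f \<in> bump_algebra"
| bump: "(\<lambda>x. flat_exp k (1 - x \<bullet> x)) \<in> bump_algebra"
| add: "f \<in> bump_algebra \<Longrightarrow> g \<in> bump_algebra \<Longrightarrow> (\<lambda>x. f x + g x) \<in> bump_algebra"
| mult: "f \<in> bump_algebra \<Longrightarrow> g \<in> bump_algebra \<Longrightarrow> (\<lambda>x. f x * g x) \<in> bump_algebra"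

lemma bump_algebra_smooth:
  assumes "f \<in> bump_algebra" shows "smooth f"
proof (rule smooth_coinduct[OF assms])
  show "\<exists>g'. (\<forall>x. (g has_derivative g' x) (at x)) \<and> (\<forall>b\<in>Basis. (\<lambda>x. g' x b) \<in> bump_algebra)"
    if "g \<in> bump_algebra" for g :: "'a \<Rightarrow> real"
    using that
  proof induction
    case (base f)
    then show ?case
      by (intro exI[of _ "\<lambda>x h. grad f x \<bullet> h"]) (auto intro: bump_algebra.base smooth_has_derivative smooth_partial)
  next
    case (bump k)
    define g' where "g' x h = (flat_exp (k+2) (1 - x \<bullet> x) + (- real k) * flat_exp (k+1) (1 - x \<bullet> x)) * ((-2) * (x \<bullet> h))"
      for x h :: 'a
    have "((\<lambda>x. flat_exp k (1 - x \<bullet> x)) has_derivative g' x) (at x)" for x :: 'a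
    proof -
      have 1: "((\<lambda>x. 1 - x \<bullet> x) has_derivative (\<lambda>h. (-2) * (x \<bullet> h))) (at x)"
        by (auto intro!: derivative_eq_intros simp: inner_commute)
      have 2: "(flat_exp k has_derivative (\<lambda>h. (flat_exp (k+2) (1 - x \<bullet> x) - real k * flat_exp (k+1) (1 - x \<bullet> x)) * h)) (at (1 - x \<bullet> x))"
        using flat_exp_derivative[of k "1 - x \<bullet> x"] by (simp add: has_field_derivative_def)
      show ?thesis using has_derivative_compose[OF 1 2] unfolding g'_def by simp
    qed
    moreover have "(\<lambda>x. g' x b) \<in> bump_algebra" for b
      unfolding g'_def
      by (intro bump_algebra.mult bump_algebra.add bump_algebra.bump bump_algebra.base[OF smooth_const] bump_algebra.base[OF smooth_inner])
    ultimately show ?case by blast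
  next
    case (add f g)
    then obtain f' g' where "\<forall>x. (f has_derivative f' x) (at x)" "\<forall>b\<in>Basis. (\<lambda>x. f' x b) \<in> bump_algebra"
      "\<forall>x. (g has_derivative g' x) (at x)" "\<forall>b\<in>Basis. (\<lambda>x. g' x b) \<in> bump_algebra" by blast
    then show ?case
      by (intro exI[of _ "\<lambda>x h. f' x h + g' x h"]) (auto intro!: has_derivative_add bump_algebra.add)
  next
    case (mult f g)
    then obtain f' g' where "\<forall>x. (f has_derivative f' x) (at x)" "\<forall>b\<in>Basis. (\<lambda>x. f' x b) \<in> bump_algebra"
      "\<forall>x. (g has_derivative g' x) (at x)" "\<forall>b\<in>Basis. (\<lambda>x. g' x b) \<in> bump_algebra" by blast
    with mult.hyps show ?case
      by (intro exI[of _ "\<lambda>x h. f x * g' x h + f' x h * g x"])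
         (auto intro!: has_derivative_mult bump_algebra.add bump_algebra.mult)
  qed
qed

text \<open>Normalisation of \<open>flat_exp 0 (1 - x \<bullet> x)\<close>. Its integral is not 0
  because the function is positive on the open unit ball, which has positive measure.\<close>

lemma mollifier_exists:
  obtains \<rho> :: "'n::euclidean_space \<Rightarrow> real" where
    "smooth \<rho>" "\<And>x. 0 \<le> \<rho> x" "\<And>x. norm x \<ge> 1 \<Longrightarrow> \<rho> x = 0"
    "integrable lborel \<rho>" "(LINT x|lborel. \<rho> x) = 1"
proof -
  define \<beta> :: "'n \<Rightarrow> real" where "\<beta> x = flat_exp 0 (1 - x \<bullet> x)" for x
  have sm: "smooth \<beta>" unfolding \<beta>_def by (intro bump_algebra_smooth bump_algebra.bump)
  have pos: "0 \<le> \<beta> x" for x by (simp add: \<beta>_def flat_exp_def)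
  have supp: "\<beta> x = 0" if "norm x \<ge> 1" for x
  proof -
    have "x \<bullet> x \<ge> 1" using power_mono[OF that, of 2] by (simp add: power2_norm_eq_inner)
    then show ?thesis by (simp add: \<beta>_def flat_exp_def)
  qed
  have eq: "\<beta> = (\<lambda>x. indicator (cball 0 1) x *\<^sub>R \<beta> x)"
    using supp by (auto simp: indicator_def fun_eq_iff split: split_of_bool)
  have "set_integrable lborel (cball 0 1) \<beta>"
    unfolding set_integrable_def by (intro borel_integrable_compact smooth_continuous sm) auto
  then have int: "integrable lborel \<beta>"
    unfolding set_integrable_def by (subst eq)
  define I where "I = (LINT x|lborel. \<beta> x)"
  have "I \<noteq> 0"
  proof
    assume "I = 0"
    then have "AE x in lborel. \<beta> x = 0"
      unfolding I_def using integral_nonneg_eq_0_iff_AE[OF int] pos by auto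
    then have "AE x in lborel. x \<notin> ball (0::'n) 1"
    proof (rule eventually_mono)
      fix x assume elim: "\<beta> x = 0"
      show "x \<notin> ball (0::'n) 1"
      proof
        assume "x \<in> ball 0 1"
        then have "x \<bullet> x < 1" using power_strict_mono[of "norm x" 1 2] by (simp add: power2_norm_eq_inner)
        then show False using elim by (simp add: \<beta>_def flat_exp_def)
      qed
    qed
    then have "emeasure lborel (ball (0::'n) 1) = 0"
      by (subst AE_iff_measurable[symmetric, of _ _ "\<lambda>x. x \<notin> ball 0 1"]) auto
    moreover have "emeasure lborel (ball (0::'n) 1) \<noteq> 0"
      using content_ball_pos[of 1 "0::'n"] by (metis enn2real_0 measure_def less_irrefl zero_less_one)
    ultimately show False by simp
  qed
  moreover have "0 \<le> I" unfolding I_def using pos by (intro Bochner_Integration.integral_nonneg) auto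
  ultimately have I: "I > 0" by simp
  show thesis
  proof (rule that[of "\<lambda>x. (1 / I) * \<beta> x"])
    show "smooth (\<lambda>x. (1 / I) * \<beta> x)" by (intro smooth_cmult sm)
    show "(LINT x|lborel. 1 / I * \<beta> x) = 1" using I by (simp add: I_def)
  qed (use I pos supp int in auto)
qed

section \<open>Smoothness of convolutions\<close>

lemma C1_linearization:
  assumes "C1_fun f G" "\<And>y. y \<in> closed_segment z (z + k) \<Longrightarrow> norm (G y - G z) \<le> e"
  shows "\<bar>f (z + k) - f z - G z \<bullet> k\<bar> \<le> e * norm k"
proof -
  have e0: "0 \<le> e" using assms(2)[of z] by simp
  have "norm (f (z + k) - f z - G z \<bullet> ((z + k) - z)) \<le> norm ((z + k) - z) * e"
  proof (rule differentiable_bound_linearization[where S = "closed_segment z (z + k)" and f' = "\<lambda>x h. G x \<bullet> h"])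
    show "z + t *\<^sub>R (z + k - z) \<in> closed_segment z (z + k)" if "t \<in> {0..1}" for t
      using that by (auto simp: in_segment algebra_simps intro!: exI[of _ t])
    show "onorm ((\<lambda>h. G x \<bullet> h) - (\<lambda>h. G z \<bullet> h)) \<le> e" if "x \<in> closed_segment z (z + k)" for x
    proof (rule onorm_bound[OF e0])
      fix h
      have "\<bar>(G x - G z) \<bullet> h\<bar> \<le> norm (G x - G z) * norm h" by (rule Cauchy_Schwarz_ineq2)
      also have "\<dots> \<le> e * norm h" using assms(2)[OF that] by (intro mult_right_mono) auto
      finally show "norm (((\<lambda>h. G x \<bullet> h) - (\<lambda>h. G z \<bullet> h)) h) \<le> e * norm h" by (simp add: inner_diff_left)
    qed
  qed (use C1_fun_derivative[OF assms(1)] in auto)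
  then show ?thesis by (simp add: mult.commute)
qed

lemma uniformly_continuous_compact_support:
  fixes f :: "'n::euclidean_space \<Rightarrow> 'b::real_normed_vector"
  assumes "continuous_on UNIV f" "\<And>x. norm x \<ge> R \<Longrightarrow> f x = 0" "e > 0"
  obtains d where "d > 0" "\<And>x y. dist x y < d \<Longrightarrow> dist (f x) (f y) < e"
proof -
  have "uniformly_continuous_on (cball 0 (R + 1)) f"
    by (intro compact_uniformly_continuous continuous_on_subset[OF assms(1)]) auto
  then obtain d where d: "d > 0" "\<And>x y. x \<in> cball 0 (R+1) \<Longrightarrow> y \<in> cball 0 (R+1) \<Longrightarrow> dist y x < d \<Longrightarrow> dist (f y) (f x) < e"
    using assms(3) unfolding uniformly_continuous_on_def by blast
  show thesis
  proof (rule that[of "min d 1"])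
    fix x y :: 'n assume xy: "dist x y < min d 1"
    show "dist (f x) (f y) < e"
    proof (cases "x \<in> cball 0 (R+1) \<and> y \<in> cball 0 (R+1)")
      case True then show ?thesis using d xy by auto
    next
      case False
      then have "norm x \<ge> R \<and> norm y \<ge> R" using xy norm_triangle_ineq3[of x y] by (auto simp: dist_norm)
      then show ?thesis using assms by simp
    qed
  qed (use d in auto)
qed

definition smooth_cs :: "('n::euclidean_space \<Rightarrow> real) \<Rightarrow> bool" where
  "smooth_cs \<rho> \<longleftrightarrow> smooth \<rho> \<and> (\<exists>R. \<forall>x. norm x \<ge> R \<longrightarrow> \<rho> x = 0)"

lemma smooth_cs_grad:
  assumes "smooth_cs \<rho>"
  obtains R where "\<And>x. norm x \<ge> R \<Longrightarrow> grad \<rho> x = 0" "\<And>x. norm x \<ge> R \<Longrightarrow> \<rho> x = 0"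
proof -
  obtain R where R: "\<And>x. norm x \<ge> R \<Longrightarrow> \<rho> x = 0" using assms by (auto simp: smooth_cs_def)
  have "grad \<rho> x = 0" if x: "norm x \<ge> R + 1" for x
  proof -
    have "x \<in> - cball 0 R" using x by auto
    then have "(\<rho> has_derivative (\<lambda>h. 0)) (at x)"
      by (rule has_derivative_transform_within_open[OF has_derivative_const[of "0::real" "at x"] open_Compl[OF closed_cball]])
         (use R in auto)
    then have "frechet_derivative \<rho> (at x) = (\<lambda>h. 0)" by (metis frechet_derivative_at)
    then show ?thesis by (simp add: grad_def)
  qed
  then show thesis using that[of "R + 1"] R by auto
qed

lemma smooth_cs_partial:
  assumes "smooth_cs \<rho>" "b \<in> Basis" shows "smooth_cs (\<lambda>x. grad \<rho> x \<bullet> b)"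
proof -
  obtain R where "\<And>x. norm x \<ge> R \<Longrightarrow> grad \<rho> x = 0" "\<And>x. norm x \<ge> R \<Longrightarrow> \<rho> x = 0"
    using smooth_cs_grad[OF assms(1)] by blast
  then have "\<forall>x. norm x \<ge> R \<longrightarrow> grad \<rho> x \<bullet> b = 0" by simp
  moreover have "smooth (\<lambda>x. grad \<rho> x \<bullet> b)"
    using assms by (intro smooth_partial) (simp_all add: smooth_cs_def)
  ultimately show ?thesis unfolding smooth_cs_def by blast
qed

lemma bounded_compact_support:
  fixes f :: "'n::euclidean_space \<Rightarrow> 'b::real_normed_vector"
  assumes "continuous_on UNIV f" "\<And>x. norm x \<ge> R \<Longrightarrow> f x = 0"
  obtains K where "\<And>x. norm (f x) \<le> K" "K \<ge> 0"
proof -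
  have "bounded (f ` cball 0 R)"
    by (intro compact_imp_bounded compact_continuous_image continuous_on_subset[OF assms(1)]) auto
  then obtain K where K: "\<forall>x\<in>cball 0 R. norm (f x) \<le> K" by (auto simp: bounded_iff)
  have "norm (f x) \<le> max K 0" for x
    using K[rule_format, of x] assms(2)[of x] by (cases "norm x \<le> R") auto
  then show thesis using that[of "max K 0"] by auto
qed

lemma integrable_mult_bounded_continuous:
  fixes f :: "'n::euclidean_space \<Rightarrow> real" and g :: "'n \<Rightarrow> 'b::euclidean_space"
  assumes "S \<in> sets lebesgue" "integrable (lebesgue_on S) f" "continuous_on S g" "\<And>x. norm (g x) \<le> K"
  shows "integrable (lebesgue_on S) (\<lambda>y. f y *\<^sub>R g y)"
proof (rule Bochner_Integration.integrable_bound[where f = "\<lambda>y. K * f y"])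
  show "(\<lambda>y. f y *\<^sub>R g y) \<in> borel_measurable (lebesgue_on S)"
    using assms continuous_imp_measurable_on_sets_lebesgue[OF assms(3,1)] by (intro borel_measurable_scaleR) auto
  have "norm (g y) \<le> \<bar>K\<bar>" for y using assms(4)[of y] by linarith
  then show "AE x in lebesgue_on S. norm (f x *\<^sub>R g x) \<le> norm (K * f x)"
    by (auto simp: abs_mult mult.commute[of "\<bar>K\<bar>"] intro!: mult_left_mono)
qed (use assms(2) in auto)

text \<open>The argument \<open>a *\<^sub>R x + v - b *\<^sub>R y\<close> contains scaling, shift
  and contraction at once, as the mollifiers below require. Uniform continuity of the compactly
  supported \<open>grad \<rho>\<close> gives a linearisation error uniform in \<open>y\<close>, and
  integrating it against \<open>f\<close> costs only the L1 norm of \<open>f\<close>.\<close>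

lemma convolution_has_derivative:
  fixes \<rho> :: "'n::euclidean_space \<Rightarrow> real"
  assumes S: "S \<in> sets lebesgue" and f: "integrable (lebesgue_on S) f" and \<rho>: "smooth_cs \<rho>"
  shows "((\<lambda>x. LINT y|lebesgue_on S. f y * \<rho> (a *\<^sub>R x + v - b *\<^sub>R y)) has_derivative
    (\<lambda>h. a * (LINT y|lebesgue_on S. f y * (grad \<rho> (a *\<^sub>R x + v - b *\<^sub>R y) \<bullet> h)))) (at x)"
proof -
  let ?M = "lebesgue_on S"
  have sm: "smooth \<rho>" using \<rho> by (simp add: smooth_cs_def)
  obtain R where R: "\<And>x. norm x \<ge> R \<Longrightarrow> grad \<rho> x = 0" "\<And>x. norm x \<ge> R \<Longrightarrow> \<rho> x = 0"
    using smooth_cs_grad[OF \<rho>] by blast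
  obtain K where K: "\<And>x. norm (grad \<rho> x) \<le> K"
    using bounded_compact_support[OF smooth_continuous_grad[OF sm] R(1)] by blast
  obtain K' where K': "\<And>x. norm (\<rho> x) \<le> K'"
    using bounded_compact_support[OF smooth_continuous[OF sm] R(2)] by blast
  define z where "z x y = a *\<^sub>R x + v - b *\<^sub>R y" for x y
  have iG: "integrable ?M (\<lambda>y. f y *\<^sub>R grad \<rho> (z x y))" for x
  proof (rule integrable_mult_bounded_continuous[OF S f])
    show "continuous_on S (\<lambda>y. grad \<rho> (z x y))" unfolding z_def
      by (intro continuous_on_compose2[OF smooth_continuous_grad[OF sm, of UNIV]] continuous_intros) auto
  qed (rule K)
  have i\<rho>: "integrable ?M (\<lambda>y. f y * \<rho> (z x y))" for x
  proof -
    have "continuous_on S (\<lambda>y. \<rho> (z x y))" unfolding z_def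
      by (intro continuous_on_compose2[OF smooth_continuous[OF sm, of UNIV]] continuous_intros) auto
    from integrable_mult_bounded_continuous[OF S f this K'] show ?thesis by simp
  qed
  define J where "J = (LINT y|?M. f y *\<^sub>R grad \<rho> (z x y))"
  define I where "I = (LINT y|?M. \<bar>f y\<bar>)"
  have I0: "0 \<le> I" unfolding I_def by simp
  have Jk: "(LINT y|?M. f y * (grad \<rho> (z x y) \<bullet> h)) = J \<bullet> h" for h
    using integral_inner_left[of h ?M "\<lambda>y. f y *\<^sub>R grad \<rho> (z x y)"] iG[of x] by (simp add: J_def)
  have der: "(\<lambda>h. a * (LINT y|?M. f y * (grad \<rho> (z x y) \<bullet> h))) = (\<lambda>h. (a *\<^sub>R J) \<bullet> h)"
    using Jk by simp
  have "((\<lambda>x. LINT y|?M. f y * \<rho> (z x y)) has_derivative (\<lambda>h. (a *\<^sub>R J) \<bullet> h)) (at x)"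
    unfolding has_derivative_at_alt
  proof (intro conjI allI impI bounded_linear_inner_right)
    fix e :: real assume "e > 0"
    \<comment> \<open>Chosen so that the total error \<open>e' * (\<bar>a\<bar> * I)\<close> is at
      most \<open>e\<close>; the added ones avoid division by 0.\<close>
    define e' where "e' = e / ((\<bar>a\<bar> + 1) * (I + 1))"
    have e': "e' > 0" using \<open>e > 0\<close> I0 unfolding e'_def by (intro divide_pos_pos mult_pos_pos) auto
    obtain d where d: "d > 0" "\<And>x y. dist x y < d \<Longrightarrow> dist (grad \<rho> x) (grad \<rho> y) < e'"
      using uniformly_continuous_compact_support[OF smooth_continuous_grad[OF sm] R(1) e'] by blast
    show "\<exists>d>0. \<forall>y. norm (y - x) < d \<longrightarrow> norm ((LINT w|?M. f w * \<rho> (z y w)) - (LINT w|?M. f w * \<rho> (z x w)) - (a *\<^sub>R J) \<bullet> (y - x)) \<le> e * norm (y - x)"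
    proof (intro exI[of _ "d / (\<bar>a\<bar> + 1)"] conjI allI impI)
      show "d / (\<bar>a\<bar> + 1) > 0" using d by auto
      fix y assume y: "norm (y - x) < d / (\<bar>a\<bar> + 1)"
      let ?k = "a *\<^sub>R (y - x)"
      have k: "norm ?k < d"
      proof -
        have "norm ?k \<le> (\<bar>a\<bar> + 1) * norm (y - x)" by (auto intro!: mult_right_mono)
        also have "\<dots> < d" using y by (simp add: field_simps)
        finally show ?thesis .
      qed
      have pt: "\<bar>\<rho> (z y w) - \<rho> (z x w) - grad \<rho> (z x w) \<bullet> ?k\<bar> \<le> e' * norm ?k" for w
      proof -
        have zz: "z y w = z x w + ?k" by (simp add: z_def algebra_simps)
        show ?thesis unfolding zz
        proof (rule C1_linearization[OF C1_fun_smooth[OF sm]])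
          fix q assume "q \<in> closed_segment (z x w) (z x w + ?k)"
          then have "dist q (z x w) < d"
            using segment_bound1[of q "z x w" "z x w + ?k"] k by (simp add: dist_norm norm_minus_commute)
          then show "norm (grad \<rho> q - grad \<rho> (z x w)) \<le> e'" using d(2) by (force simp: dist_norm)
        qed
      qed
      have iGk: "integrable ?M (\<lambda>w. f w * (grad \<rho> (z x w) \<bullet> ?k))"
        using integrable_inner_left[of ?k ?M "\<lambda>y. f y *\<^sub>R grad \<rho> (z x y)"] iG[of x]
        by (simp del: inner_scaleR_right)
      have "(a *\<^sub>R J) \<bullet> (y - x) = (LINT w|?M. f w * (grad \<rho> (z x w) \<bullet> ?k))"
        unfolding Jk by simp
      then have eq: "(LINT w|?M. f w * \<rho> (z y w)) - (LINT w|?M. f w * \<rho> (z x w)) - (a *\<^sub>R J) \<bullet> (y - x)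
        = (LINT w|?M. f w * \<rho> (z y w) - f w * \<rho> (z x w) - f w * (grad \<rho> (z x w) \<bullet> ?k))"
        using i\<rho> iGk by simp
      have "norm ((LINT w|?M. f w * \<rho> (z y w)) - (LINT w|?M. f w * \<rho> (z x w)) - (a *\<^sub>R J) \<bullet> (y - x))
        \<le> (LINT w|?M. norm (f w * \<rho> (z y w) - f w * \<rho> (z x w) - f w * (grad \<rho> (z x w) \<bullet> ?k)))"
        unfolding eq by (rule integral_norm_bound)
      also have "\<dots> \<le> (LINT w|?M. \<bar>f w\<bar> * (e' * norm ?k))"
      proof (rule integral_mono)
        fix w
        have "f w * \<rho> (z y w) - f w * \<rho> (z x w) - f w * (grad \<rho> (z x w) \<bullet> ?k)
          = f w * (\<rho> (z y w) - \<rho> (z x w) - grad \<rho> (z x w) \<bullet> ?k)" by (simp only: right_diff_distrib)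
        then show "norm (f w * \<rho> (z y w) - f w * \<rho> (z x w) - f w * (grad \<rho> (z x w) \<bullet> ?k)) \<le> \<bar>f w\<bar> * (e' * norm ?k)"
          using pt[of w] by (simp add: abs_mult mult_left_mono)
      next
        show "integrable ?M (\<lambda>w. norm (f w * \<rho> (z y w) - f w * \<rho> (z x w) - f w * (grad \<rho> (z x w) \<bullet> ?k)))"
          by (intro integrable_norm Bochner_Integration.integrable_diff i\<rho> iGk)
        show "integrable ?M (\<lambda>w. \<bar>f w\<bar> * (e' * norm ?k))"
          by (intro integrable_mult_left integrable_abs f)
      qed
      also have "\<dots> = (e' * (\<bar>a\<bar> * I)) * norm (y - x)" by (simp add: I_def)
      also have "\<dots> \<le> e * norm (y - x)"
      proof (rule mult_right_mono)
        have "e' * (\<bar>a\<bar> * I) \<le> e' * ((\<bar>a\<bar> + 1) * (I + 1))"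
          using e' I0 by (intro mult_left_mono mult_mono) auto
        also have "\<dots> = e" unfolding e'_def using I0 by simp
        finally show "e' * (\<bar>a\<bar> * I) \<le> e" .
      qed auto
      finally show "norm ((LINT w|?M. f w * \<rho> (z y w)) - (LINT w|?M. f w * \<rho> (z x w)) - (a *\<^sub>R J) \<bullet> (y - x)) \<le> e * norm (y - x)" .
    qed
  qed
  then show ?thesis unfolding der[symmetric] unfolding z_def .
qed

text \<open>The derivative falls on the kernel, so the multiples of convolutions with smooth,
  compactly supported kernels are closed under partial derivatives.\<close>

lemma convolution_smooth:
  fixes \<rho> :: "'n::euclidean_space \<Rightarrow> real"
  assumes S: "S \<in> sets lebesgue" and f: "integrable (lebesgue_on S) f" and \<rho>: "smooth_cs \<rho>"
  shows "smooth (\<lambda>x. LINT y|lebesgue_on S. f y * \<rho> (a *\<^sub>R x + v - b *\<^sub>R y))"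
proof -
  define F where "F c \<rho> = (\<lambda>x. c * (LINT y|lebesgue_on S. f y * \<rho> (a *\<^sub>R x + v - b *\<^sub>R y)))" for c :: real and \<rho> :: "'n \<Rightarrow> real"
  have "smooth (F 1 \<rho>)"
  proof (rule smooth_coinduct[of _ "{F c \<rho> |c \<rho>. smooth_cs \<rho>}"])
    fix g assume "g \<in> {F c \<rho> |c \<rho>. smooth_cs \<rho>}"
    then obtain c \<rho> where g: "g = F c \<rho>" "smooth_cs \<rho>" by blast
    have "(g has_derivative (\<lambda>h. c * (a * (LINT y|lebesgue_on S. f y * (grad \<rho> (a *\<^sub>R x + v - b *\<^sub>R y) \<bullet> h))))) (at x)" for x
      unfolding g(1) F_def by (intro has_derivative_mult_right convolution_has_derivative S f g(2))
    moreover have "(\<lambda>x. c * (a * (LINT y|lebesgue_on S. f y * (grad \<rho> (a *\<^sub>R x + v - b *\<^sub>R y) \<bullet> b')))) = F (c * a) (\<lambda>x. grad \<rho> x \<bullet> b')" for b'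
      by (simp add: F_def mult.assoc)
    ultimately show "\<exists>g'. (\<forall>x. (g has_derivative g' x) (at x)) \<and> (\<forall>b\<in>Basis. (\<lambda>x. g' x b) \<in> {F c \<rho> |c \<rho>. smooth_cs \<rho>})"
      using smooth_cs_partial[OF g(2)]
      by (intro exI[of _ "\<lambda>x h. c * (a * (LINT y|lebesgue_on S. f y * (grad \<rho> (a *\<^sub>R x + v - b *\<^sub>R y) \<bullet> h)))"]) (simp only: mem_Collect_eq, blast)
  qed (use \<rho> in blast)
  then show ?thesis by (simp add: F_def)
qed

section \<open>Mollification on convex sets\<close>

lemma lborel_nn_integral_affine:
  fixes f :: "'n::euclidean_space \<Rightarrow> ennreal"
  assumes "c \<noteq> 0" "f \<in> borel_measurable borel"
  shows "(\<integral>\<^sup>+x. f x \<partial>lborel) = ennreal (\<bar>c\<bar> ^ DIM('n)) * (\<integral>\<^sup>+x. f (t + c *\<^sub>R x) \<partial>lborel)"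
  using assms by (subst lborel_affine[OF assms(1), of t])
    (simp add: nn_integral_density nn_integral_distr nn_integral_cmult)

lemma lborel_integral_affine:
  fixes f :: "'n::euclidean_space \<Rightarrow> real"
  assumes "c \<noteq> 0" "f \<in> borel_measurable borel"
  shows "(LINT x|lborel. f x) = \<bar>c\<bar> ^ DIM('n) * (LINT x|lborel. f (t + c *\<^sub>R x))"
  using assms by (subst lborel_affine[OF assms(1), of t])
    (simp add: integral_density integral_distr)

lemma lebesgue_on_integral_borel:
  fixes f :: "'n::euclidean_space \<Rightarrow> real"
  assumes "S \<in> sets borel" "f \<in> borel_measurable borel"
  shows "(LINT x|lebesgue_on S. f x) = (LINT x|lborel. indicator S x * f x)"
proof -
  have "(LINT x|lebesgue_on S. f x) = (LINT x|lebesgue. indicator S x *\<^sub>R f x)"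
    using assms(1) by (intro integral_restrict_space) auto
  also have "\<dots> = (LINT x|lborel. indicator S x *\<^sub>R f x)"
    using assms by (intro integral_completion) auto
  finally show ?thesis by simp
qed

lemma lebesgue_on_nn_integral_borel:
  fixes f :: "'n::euclidean_space \<Rightarrow> ennreal"
  assumes "S \<in> sets borel" "f \<in> borel_measurable borel"
  shows "(\<integral>\<^sup>+x. f x \<partial>lebesgue_on S) = (\<integral>\<^sup>+x. f x * indicator S x \<partial>lborel)"
proof -
  have "(\<integral>\<^sup>+x. f x \<partial>lebesgue_on S) = (\<integral>\<^sup>+x. f x * indicator S x \<partial>lebesgue)"
    using assms(1) by (simp add: nn_integral_restrict_space)
  also have "\<dots> = (\<integral>\<^sup>+x. f x * indicator S x \<partial>lborel)"
    using assms by (simp add: nn_integral_completion)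
  finally show ?thesis .
qed

text \<open>Substitution and Fubini are carried out with \<open>lborel\<close>, while the data are
  only Lebesgue measurable on \<open>S\<close>; this is the passage between the two.\<close>

lemma borel_representative:
  fixes f :: "'n::euclidean_space \<Rightarrow> real"
  assumes "S \<in> sets borel" "f \<in> borel_measurable (lebesgue_on S)"
  obtains f0 where "f0 \<in> borel_measurable borel" "\<And>x. x \<notin> S \<Longrightarrow> f0 x = 0"
    "AE x in lebesgue_on S. f x = f0 x"
proof -
  have "(\<lambda>x. indicator S x *\<^sub>R f x) \<in> borel_measurable lebesgue"
    using assms borel_measurable_restrict_space_iff[of S lebesgue f] by auto
  then obtain g where g: "g \<in> borel_measurable lborel" "AE x in lborel. indicator S x *\<^sub>R f x = g x"
    using completion_ex_borel_measurable_real by blast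
  have "AE x in lebesgue. indicator S x *\<^sub>R f x = g x" using AE_completion[OF g(2)] .
  then have "AE x in lebesgue_on S. f x = indicator S x * g x"
    using assms(1) by (subst AE_restrict_space_iff) (auto elim!: eventually_mono simp: indicator_def)
  then show thesis using g(1) assms(1) by (intro that[of "\<lambda>x. indicator S x * g x"]) auto
qed

lemma continuous_bounded_open_sq_integrable:
  fixes g :: "'n::euclidean_space \<Rightarrow> 'b::euclidean_space"
  assumes "bounded S" "open S" "continuous_on UNIV g"
  shows "sq_integrable (lebesgue_on S) g"
proof -
  have S: "S \<in> lmeasurable" using assms by (simp add: lmeasurable_open)
  have "bounded (g ` closure S)"
    using assms by (intro compact_imp_bounded compact_continuous_image continuous_on_subset[OF assms(3)]) (auto simp: compact_closure)
  then obtain K where "\<forall>x\<in>closure S. norm (g x) \<le> K" by (auto simp: bounded_iff)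
  then have "\<forall>x\<in>S. norm (g x) \<le> K" using closure_subset by blast
  then have "AE x in lebesgue_on S. norm (g x) \<le> K" by (intro AE_I2) auto
  moreover have "g \<in> borel_measurable (lebesgue_on S)"
    using S by (intro continuous_imp_measurable_on_sets_lebesgue continuous_on_subset[OF assms(3)]) auto
  ultimately show ?thesis using finite_measure_lebesgue_on[OF S] by (intro sq_integrable_bounded)
qed

lemma l2_tendsto_componentwise:
  fixes f :: "'a \<Rightarrow> 'b::euclidean_space"
  assumes "\<And>b. b \<in> Basis \<Longrightarrow> l2_tendsto M (\<lambda>n x. F n x \<bullet> b) (\<lambda>x. f x \<bullet> b)"
  shows "l2_tendsto M F f"
proof -
  have sq: "sq_integrable M g" if "\<And>b. b \<in> Basis \<Longrightarrow> sq_integrable M (\<lambda>x. g x \<bullet> b)" for g :: "'a \<Rightarrow> 'b"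
  proof -
    have "(\<lambda>x. \<Sum>b\<in>Basis. (g x \<bullet> b) *\<^sub>R b) \<in> borel_measurable M"
      by (intro borel_measurable_sum borel_measurable_scaleR sq_integrableD(1)[OF that] borel_measurable_const)
    then have 1: "g \<in> borel_measurable M" by (simp add: euclidean_representation)
    have "integrable M (\<lambda>x. \<Sum>b\<in>Basis. (g x \<bullet> b)\<^sup>2)"
      using that by (intro Bochner_Integration.integrable_sum sq_integrable_realD) auto
    also have "(\<lambda>x. \<Sum>b\<in>Basis. (g x \<bullet> b)\<^sup>2) = (\<lambda>x. (norm (g x))\<^sup>2)"
      unfolding power2_norm_eq_inner by (subst euclidean_inner) (simp add: power2_eq_square)
    finally show ?thesis using 1 by (simp add: sq_integrable_def)
  qed
  have D: "sq_integrable M (F n)" "sq_integrable M f" for n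
    by (auto intro!: sq l2_tendstoD(1)[OF assms] l2_tendstoD(2)[OF assms])
  have i: "integrable M (\<lambda>x. (norm (F n x \<bullet> b - f x \<bullet> b))\<^sup>2)" if "b \<in> Basis" for n b
    using that by (intro sq_integrableD(2) sq_integrable_diff l2_tendstoD(1)[OF assms] l2_tendstoD(2)[OF assms])
  have "(\<lambda>n. \<Sum>b\<in>Basis. LINT x|M. (norm (F n x \<bullet> b - f x \<bullet> b))\<^sup>2) \<longlonglongrightarrow> (\<Sum>b\<in>(Basis::'b set). 0)"
    by (intro tendsto_sum l2_tendstoD(3) assms)
  moreover have "(\<Sum>b\<in>Basis. LINT x|M. (norm (F n x \<bullet> b - f x \<bullet> b))\<^sup>2) = (LINT x|M. (norm (F n x - f x))\<^sup>2)" for n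
  proof -
    have "(LINT x|M. (norm (F n x - f x))\<^sup>2) = (LINT x|M. (\<Sum>b\<in>Basis. (norm (F n x \<bullet> b - f x \<bullet> b))\<^sup>2))"
      unfolding power2_norm_eq_inner by (subst euclidean_inner) (simp add: inner_diff_left)
    also have "\<dots> = (\<Sum>b\<in>Basis. LINT x|M. (norm (F n x \<bullet> b - f x \<bullet> b))\<^sup>2)"
      using i by (intro Bochner_Integration.integral_sum)
    finally show ?thesis by simp
  qed
  ultimately show ?thesis using D by (simp add: l2_tendsto_def)
qed

lemma sq_integrable_component:
  "sq_integrable M f \<Longrightarrow> b \<in> Basis \<Longrightarrow> sq_integrable M (\<lambda>x. f x \<bullet> (b::'b::euclidean_space))"
  by (rule sq_integrable_dominated[of M f _ 1])
     (simp_all add: Basis_le_norm borel_measurable_inner sq_integrableD(1))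

text \<open>Points are first contracted towards the interior point \<open>x0\<close>. As \<open>S\<close> is convex, the ball over which \<open>mol n f x\<close>
  averages then stays inside \<open>S\<close> for every \<open>x \<in> S\<close>, so the approximation holds up to the boundary.\<close>

locale mollification =
  fixes S :: "'n::euclidean_space set" and x0 :: 'n and r :: real and \<rho> :: "'n \<Rightarrow> real"
  assumes op: "open S" and cv: "convex S" and bd: "bounded S" and r: "r > 0" and ball: "ball x0 r \<subseteq> S"
    and sm: "smooth \<rho>" and pos: "0 \<le> \<rho> x" and supp: "norm x \<ge> 1 \<Longrightarrow> \<rho> x = 0"
    and int: "integrable lborel \<rho>" and int1: "(LINT x|lborel. \<rho> x) = 1"
begin

abbreviation "M \<equiv> lebesgue_on S"

text \<open>The offset 2 keeps \<open>a n\<close> at least \<open>1/2\<close>, so undoing the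
  contraction enlarges volumes by at most \<open>2 ^ DIM('n)\<close>, uniformly in
  \<open>n\<close>.\<close>

definition a :: "nat \<Rightarrow> real" where "a n = 1 - 1 / (real n + 2)"
text \<open>The radius \<open>r / 2\<close> scaled by \<open>1 - a n\<close>. Half of
  \<open>r\<close> is taken so that the closed ball of that radius around \<open>x0\<close> fits
  into the open ball of radius \<open>r\<close>.\<close>

definition eps :: "nat \<Rightarrow> real" where "eps n = (1 - a n) * r / 2"
definition pt :: "nat \<Rightarrow> 'n \<Rightarrow> 'n" where "pt n x = a n *\<^sub>R x + (1 - a n) *\<^sub>R x0"
text \<open>A weighted average of \<open>f\<close> over the ball of radius \<open>eps n\<close>
  around \<open>pt n x\<close>. The kernel is written in the affine form of
  \<open>convolution_smooth\<close>; \<open>mol_eq_borel\<close> recovers the averaging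
  form.\<close>

definition mol :: "nat \<Rightarrow> ('n \<Rightarrow> real) \<Rightarrow> 'n \<Rightarrow> real" where
  "mol n f x = (1 / eps n ^ DIM('n)) * (LINT y|M. f y * \<rho> ((a n / eps n) *\<^sub>R x + ((1 - a n) / eps n) *\<^sub>R x0 - (1 / eps n) *\<^sub>R y))"

lemma a_bounds: "1/2 \<le> a n" "a n < 1" "0 < a n"
  by (auto simp: a_def field_simps)

lemma eps_pos: "eps n > 0"
  using a_bounds[of n] r by (simp add: eps_def)

lemma a_lim: "a \<longlonglongrightarrow> 1"
proof -
  have "(\<lambda>n. 1 - 1 / real (n + 2)) \<longlonglongrightarrow> 1 - 0"
    by (intro tendsto_diff tendsto_const LIMSEQ_ignore_initial_segment[OF lim_1_over_n])
  then show ?thesis unfolding a_def[abs_def] by (simp add: add.commute)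
qed

lemma eps_lim: "eps \<longlonglongrightarrow> 0"
proof -
  have "(\<lambda>n. (1 - a n) * r / 2) \<longlonglongrightarrow> (1 - 1) * r / 2" by (intro tendsto_intros a_lim) auto
  then show ?thesis by (simp add: eps_def[abs_def])
qed

lemma Sb: "S \<in> sets borel" and Sm: "S \<in> lmeasurable" and SL: "S \<in> sets lebesgue"
  using op bd by (auto simp: lmeasurable_open)

lemma fin: "finite_measure M" by (rule finite_measure_lebesgue_on[OF Sm])

text \<open>The point is the convex combination of \<open>x\<close> and
  \<open>x0 - (r/2) *\<^sub>R z\<close> with weights \<open>a n\<close> and
  \<open>1 - a n\<close>.\<close>

lemma pt_in: "x \<in> S \<Longrightarrow> norm z \<le> 1 \<Longrightarrow> pt n x - eps n *\<^sub>R z \<in> S"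
proof -
  assume x: "x \<in> S" and z: "norm z \<le> 1"
  have "norm ((r/2) *\<^sub>R z) \<le> r / 2" using z r by simp
  then have "x0 - (r/2) *\<^sub>R z \<in> S" using ball r by (auto simp: subset_iff dist_norm)
  then have "a n *\<^sub>R x + (1 - a n) *\<^sub>R (x0 - (r/2) *\<^sub>R z) \<in> S"
    using cv x a_bounds[of n] by (intro convexD) auto
  then show ?thesis by (simp add: pt_def eps_def algebra_simps)
qed

text \<open>Substitution of \<open>pt n x - eps n *\<^sub>R z\<close> for \<open>y\<close>. The
  representative vanishes outside \<open>S\<close>, so the integral over \<open>S\<close> becomes
  one over the whole space.\<close>

lemma mol_eq_borel:
  assumes f0: "f0 \<in> borel_measurable borel" "\<And>x. x \<notin> S \<Longrightarrow> f0 x = 0" "AE x in M. f x = f0 x"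
    and f: "f \<in> borel_measurable M"
  shows "mol n f x = (LINT z|lborel. f0 (pt n x - eps n *\<^sub>R z) * \<rho> z)"
proof -
  let ?e = "eps n"
  define k where "k y = \<rho> ((a n / ?e) *\<^sub>R x + ((1 - a n) / ?e) *\<^sub>R x0 - (1 / ?e) *\<^sub>R y)" for y
  have kc: "continuous_on A k" for A unfolding k_def
    by (intro continuous_on_compose2[OF smooth_continuous[OF sm, of UNIV]] continuous_intros) auto
  have kb: "k \<in> borel_measurable borel" using kc by (rule borel_measurable_continuous_onI)
  have f0M: "f0 \<in> borel_measurable M"
    using f0(1) SL by (intro measurable_restrict_space1 measurable_completion) auto
  have kM: "k \<in> borel_measurable M" using kc SL by (intro continuous_imp_measurable_on_sets_lebesgue)
  have "(LINT y|M. f y * k y) = (LINT y|M. f0 y * k y)"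
    using f0(3) f f0M kM by (intro integral_cong_AE borel_measurable_times) (auto elim!: eventually_mono)
  also have "\<dots> = (LINT y|lborel. indicator S y * (f0 y * k y))"
    using f0(1) kb by (intro lebesgue_on_integral_borel Sb) auto
  also have "\<dots> = (LINT y|lborel. f0 y * k y)"
    using f0(2) by (intro Bochner_Integration.integral_cong) (auto simp: indicator_def)
  also have "\<dots> = \<bar>-?e\<bar> ^ DIM('n) * (LINT z|lborel. f0 (pt n x + (-?e) *\<^sub>R z) * k (pt n x + (-?e) *\<^sub>R z))"
    using eps_pos[of n] f0(1) kb by (intro lborel_integral_affine) auto
  also have "(\<lambda>z. f0 (pt n x + (-?e) *\<^sub>R z) * k (pt n x + (-?e) *\<^sub>R z)) = (\<lambda>z. f0 (pt n x - ?e *\<^sub>R z) * \<rho> z)"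
  proof
    fix z
    have "(a n / ?e) *\<^sub>R x + ((1 - a n) / ?e) *\<^sub>R x0 - (1 / ?e) *\<^sub>R (pt n x + (-?e) *\<^sub>R z) = z"
      using eps_pos[of n] by (simp add: pt_def algebra_simps divide_inverse)
    then show "f0 (pt n x + (-?e) *\<^sub>R z) * k (pt n x + (-?e) *\<^sub>R z) = f0 (pt n x - ?e *\<^sub>R z) * \<rho> z"
      unfolding k_def by simp
  qed
  finally show ?thesis using eps_pos[of n] by (simp add: mol_def k_def[symmetric])
qed

lemma smooth_cs_rho: "smooth_cs \<rho>"
  using sm supp by (auto simp: smooth_cs_def)

lemma mol_smooth:
  assumes "integrable M f" shows "smooth (mol n f)"
proof -
  have "smooth (\<lambda>x. LINT y|M. f y * \<rho> ((a n / eps n) *\<^sub>R x + ((1 - a n) / eps n) *\<^sub>R x0 - (1 / eps n) *\<^sub>R y))"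
    by (rule convolution_smooth[OF SL assms smooth_cs_rho])
  from smooth_cmult[OF this] show ?thesis unfolding mol_def[abs_def] .
qed

lemma mol_sq: "integrable M f \<Longrightarrow> sq_integrable M (mol n f)"
  by (intro continuous_bounded_open_sq_integrable bd op smooth_continuous mol_smooth)

lemma rho_borel[measurable]: "\<rho> \<in> borel_measurable borel"
  by (intro borel_measurable_continuous_onI smooth_continuous sm)

text \<open>Jensen's inequality for the probability density \<open>\<rho>\<close>, proved as
  Cauchy-Schwarz for \<open>h z * sqrt (\<rho> z)\<close> and \<open>sqrt (\<rho> z)\<close>. The
  nonnegative integral on the right also covers an infinite second moment.\<close>

lemma rho_prob_bound:
  assumes h: "h \<in> borel_measurable borel"
  shows "ennreal ((LINT z|lborel. h z * \<rho> z)\<^sup>2) \<le> (\<integral>\<^sup>+z. ennreal (\<rho> z * (h z)\<^sup>2) \<partial>lborel)"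
proof (cases "integrable lborel (\<lambda>z. \<rho> z * (h z)\<^sup>2)")
  case True
  have [measurable]: "(\<lambda>z. sqrt (\<rho> z)) \<in> borel_measurable borel" by measurable
  note [measurable] = h
  have 1: "sq_integrable lborel (\<lambda>z. sqrt (\<rho> z))"
    using int pos by (simp add: sq_integrable_def)
  have 2: "sq_integrable lborel (\<lambda>z. h z * sqrt (\<rho> z))"
    using True pos by (simp add: sq_integrable_def power_mult_distrib mult.commute)
  have "(LINT z|lborel. (h z * sqrt (\<rho> z)) * sqrt (\<rho> z))\<^sup>2 \<le> (LINT z|lborel. (h z * sqrt (\<rho> z))\<^sup>2) * (LINT z|lborel. (sqrt (\<rho> z))\<^sup>2)"
    by (rule Cauchy_Schwarz_integral[OF 2 1])
  moreover have "(h z * sqrt (\<rho> z)) * sqrt (\<rho> z) = h z * \<rho> z" "(h z * sqrt (\<rho> z))\<^sup>2 = \<rho> z * (h z)\<^sup>2" for z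
    using pos[of z] by (simp_all add: power_mult_distrib)
  ultimately have "(LINT z|lborel. h z * \<rho> z)\<^sup>2 \<le> (LINT z|lborel. \<rho> z * (h z)\<^sup>2)"
    using pos int1 by simp
  then show ?thesis
    using pos by (subst nn_integral_eq_integral[OF True]) (auto intro: ennreal_leI)
next
  case False
  have "(\<lambda>z. \<rho> z * (h z)\<^sup>2) \<in> borel_measurable lborel" using h by measurable
  then have "(\<integral>\<^sup>+z. ennreal (norm (\<rho> z * (h z)\<^sup>2)) \<partial>lborel) = \<infinity>"
    using False by (auto simp: integrable_iff_bounded less_top[symmetric])
  then show ?thesis using pos by (simp add: abs_mult)
qed

text \<open>Jensen's inequality inside, then exchange of the two integrals. For fixed
  \<open>z\<close> the affine substitution in \<open>x\<close> has Jacobian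
  \<open>a n ^ DIM('n)\<close>, at least \<open>(1/2) ^ DIM('n)\<close>.\<close>

lemma mol_l2_bound:
  assumes f: "sq_integrable M f"
  shows "(LINT x|M. (mol n f x)\<^sup>2) \<le> 2 ^ DIM('n) * (LINT x|M. (f x)\<^sup>2)"
proof -
  have fM: "f \<in> borel_measurable M" using f by (rule sq_integrableD)
  have fi: "integrable M f" by (rule integrable_sq[OF fin f])
  obtain f0 where f0: "f0 \<in> borel_measurable borel" "\<And>x. x \<notin> S \<Longrightarrow> f0 x = 0" "AE x in M. f x = f0 x"
    using borel_representative[OF Sb fM] by metis
  note [measurable] = f0(1)
  let ?I = "\<integral>\<^sup>+y. ennreal ((f0 y)\<^sup>2) \<partial>lborel"
  have ptm[measurable]: "(\<lambda>(x, z). pt n x - eps n *\<^sub>R z) \<in> borel_measurable (borel \<Otimes>\<^sub>M borel)"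
    unfolding pt_def by measurable
  have ptm2[measurable]: "(\<lambda>x. pt n x - eps n *\<^sub>R z) \<in> borel_measurable borel"
     "(\<lambda>z. pt n x - eps n *\<^sub>R z) \<in> borel_measurable borel" for x z
    unfolding pt_def by measurable
  have [measurable]: "mol n f \<in> borel_measurable borel"
    by (intro borel_measurable_continuous_onI smooth_continuous mol_smooth fi)
  have II: "?I = ennreal (LINT x|M. (f x)\<^sup>2)"
  proof -
    have "ennreal (LINT x|M. (f x)\<^sup>2) = (\<integral>\<^sup>+x. ennreal ((f x)\<^sup>2) \<partial>M)"
      using f by (intro nn_integral_eq_integral[symmetric]) (auto intro: sq_integrable_realD)
    also have "\<dots> = (\<integral>\<^sup>+x. ennreal ((f0 x)\<^sup>2) \<partial>M)"
      using f0(3) by (intro nn_integral_cong_AE) (auto elim!: eventually_mono)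
    also have "\<dots> = (\<integral>\<^sup>+x. ennreal ((f0 x)\<^sup>2) * indicator S x \<partial>lborel)"
      by (intro lebesgue_on_nn_integral_borel Sb) measurable
    also have "\<dots> = ?I" using f0(2) by (intro nn_integral_cong) (auto simp: indicator_def)
    finally show ?thesis ..
  qed
  have "ennreal (LINT x|M. (mol n f x)\<^sup>2) = (\<integral>\<^sup>+x. ennreal ((mol n f x)\<^sup>2) \<partial>M)"
    using mol_sq[OF fi] by (intro nn_integral_eq_integral[symmetric]) (auto intro: sq_integrable_realD)
  also have "\<dots> = (\<integral>\<^sup>+x. ennreal ((mol n f x)\<^sup>2) * indicator S x \<partial>lborel)"
    by (intro lebesgue_on_nn_integral_borel Sb) measurable
  also have "\<dots> \<le> (\<integral>\<^sup>+x. ennreal ((mol n f x)\<^sup>2) \<partial>lborel)"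
    by (intro nn_integral_mono) (auto simp: indicator_def)
  also have "\<dots> \<le> (\<integral>\<^sup>+x. (\<integral>\<^sup>+z. ennreal (\<rho> z * (f0 (pt n x - eps n *\<^sub>R z))\<^sup>2) \<partial>lborel) \<partial>lborel)"
  proof (intro nn_integral_mono)
    fix x
    have "mol n f x = (LINT z|lborel. f0 (pt n x - eps n *\<^sub>R z) * \<rho> z)" by (rule mol_eq_borel[OF f0 fM])
    moreover have "(\<lambda>z. f0 (pt n x - eps n *\<^sub>R z)) \<in> borel_measurable borel" by measurable
    ultimately show "ennreal ((mol n f x)\<^sup>2) \<le> (\<integral>\<^sup>+z. ennreal (\<rho> z * (f0 (pt n x - eps n *\<^sub>R z))\<^sup>2) \<partial>lborel)"
      using rho_prob_bound by simp
  qed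
  also have "\<dots> = (\<integral>\<^sup>+z. (\<integral>\<^sup>+x. ennreal (\<rho> z * (f0 (pt n x - eps n *\<^sub>R z))\<^sup>2) \<partial>lborel) \<partial>lborel)"
    by (rule lborel_pair.Fubini'[symmetric]) (simp add: lborel_prod[symmetric], measurable)
  also have "\<dots> = (\<integral>\<^sup>+z. ennreal (\<rho> z) * (\<integral>\<^sup>+x. ennreal ((f0 (pt n x - eps n *\<^sub>R z))\<^sup>2) \<partial>lborel) \<partial>lborel)"
    using pos by (intro nn_integral_cong, subst nn_integral_cmult[symmetric]) (auto simp: ennreal_mult')
  also have "\<dots> \<le> (\<integral>\<^sup>+z. ennreal (\<rho> z) * (ennreal (2 ^ DIM('n)) * ?I) \<partial>lborel)"
  proof (intro nn_integral_mono mult_left_mono)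
    fix z
    let ?J = "\<integral>\<^sup>+x. ennreal ((f0 (pt n x - eps n *\<^sub>R z))\<^sup>2) \<partial>lborel"
    have an: "\<bar>a n\<bar> = a n" "a n \<noteq> 0" using a_bounds(3)[of n] by auto
    have "?I = ennreal (\<bar>a n\<bar> ^ DIM('n)) * (\<integral>\<^sup>+x. ennreal ((f0 (((1 - a n) *\<^sub>R x0 - eps n *\<^sub>R z) + a n *\<^sub>R x))\<^sup>2) \<partial>lborel)"
      by (rule lborel_nn_integral_affine) (use an in auto)
    also have "(\<integral>\<^sup>+x. ennreal ((f0 (((1 - a n) *\<^sub>R x0 - eps n *\<^sub>R z) + a n *\<^sub>R x))\<^sup>2) \<partial>lborel) = ?J"
      by (intro nn_integral_cong) (simp add: pt_def algebra_simps)
    finally have I: "?I = ennreal (a n ^ DIM('n)) * ?J" unfolding an .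
    have "ennreal 1 \<le> ennreal (2 ^ DIM('n) * a n ^ DIM('n))"
      unfolding power_mult_distrib[symmetric] using a_bounds(1)[of n] by (intro ennreal_leI one_le_power) auto
    then have "?J * 1 \<le> ?J * ennreal (2 ^ DIM('n) * a n ^ DIM('n))" by (intro mult_left_mono) auto
    also have "\<dots> = ennreal (2 ^ DIM('n)) * ?I"
      unfolding I using a_bounds(3)[of n] by (simp add: ennreal_mult ac_simps)
    finally show "?J \<le> ennreal (2 ^ DIM('n)) * ?I" by simp
  qed auto
  also have "\<dots> = (\<integral>\<^sup>+z. ennreal (\<rho> z) \<partial>lborel) * (ennreal (2 ^ DIM('n)) * ?I)"
    by (intro nn_integral_multc) measurable
  also have "(\<integral>\<^sup>+z. ennreal (\<rho> z) \<partial>lborel) = 1"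
    using int int1 pos by (subst nn_integral_eq_integral) auto
  also have "1 * (ennreal (2 ^ DIM('n)) * ?I) = ennreal (2 ^ DIM('n) * (LINT x|M. (f x)\<^sup>2))"
    unfolding II by (simp add: ennreal_mult)
  finally show ?thesis by (subst (asm) ennreal_le_iff) auto
qed

lemma mol_diff:
  assumes "integrable M f" "integrable M g"
  shows "mol n (\<lambda>x. f x - g x) x = mol n f x - mol n g x"
proof -
  let ?k = "\<lambda>y. \<rho> ((a n / eps n) *\<^sub>R x + ((1 - a n) / eps n) *\<^sub>R x0 - (1 / eps n) *\<^sub>R y)"
  obtain K where K: "\<And>x. norm (\<rho> x) \<le> K"
    using bounded_compact_support[OF smooth_continuous[OF sm] supp] by blast
  have kc: "continuous_on S ?k"
    by (intro continuous_on_compose2[OF smooth_continuous[OF sm, of UNIV]] continuous_intros) auto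
  have "integrable M (\<lambda>y. f y * ?k y)" "integrable M (\<lambda>y. g y * ?k y)"
    using integrable_mult_bounded_continuous[OF SL assms(1) kc, of K]
      integrable_mult_bounded_continuous[OF SL assms(2) kc, of K] K by auto
  then show ?thesis unfolding mol_def by (simp add: left_diff_distrib right_diff_distrib)
qed

text \<open>A weighted average stays between bounds of the averaged function. These hold almost
  everywhere while the conclusion is wanted at every point of \<open>S\<close>, so the
  representative is first clamped to the interval from \<open>l\<close> to \<open>u\<close>.\<close>

lemma mol_bounds:
  assumes f: "integrable M f" and b: "AE x in M. l \<le> f x \<and> f x \<le> u" and x: "x \<in> S"
  shows "l \<le> mol n f x" "mol n f x \<le> u"
proof -
  have fM: "f \<in> borel_measurable M" using f by auto
  obtain f0 where f0: "f0 \<in> borel_measurable borel" "\<And>x. x \<notin> S \<Longrightarrow> f0 x = 0" "AE x in M. f x = f0 x"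
    using borel_representative[OF Sb fM] by metis
  define f1 where "f1 x = indicator S x * max l (min u (f0 x))" for x
  have f1: "f1 \<in> borel_measurable borel" "\<And>x. x \<notin> S \<Longrightarrow> f1 x = 0" "AE x in M. f x = f1 x"
  proof -
    show "f1 \<in> borel_measurable borel" unfolding f1_def using f0(1) Sb by measurable
    show "f1 x = 0" if "x \<notin> S" for x using that by (simp add: f1_def)
    have "AE x in M. x \<in> S" by (intro AE_I2) auto
    with f0(3) b show "AE x in M. f x = f1 x"
      by eventually_elim (auto simp: f1_def)
  qed
  \<comment> \<open>\<open>S\<close> contains a ball, so it is not null, and bounds valid almost
    everywhere on it cannot be contradictory.\<close>
  have lu: "l \<le> u"
  proof (rule ccontr)
    assume "\<not> l \<le> u"
    with b have "AE x in M. False"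
      by (elim eventually_mono) linarith
    then have "emeasure M (space M) = 0" by (subst (asm) AE_iff_measurable[of "space M"]) auto
    then have "emeasure lebesgue S = 0" using SL by (simp add: emeasure_restrict_space)
    moreover have "emeasure lebesgue (ball x0 r) \<le> emeasure lebesgue S" using ball SL by (intro emeasure_mono) auto
    ultimately have "emeasure lborel (ball x0 r) = 0" by simp
    then show False using content_ball_pos[OF r, of x0] by (simp add: measure_def)
  qed
  have in_bounds: "l \<le> f1 (pt n x - eps n *\<^sub>R z) \<and> f1 (pt n x - eps n *\<^sub>R z) \<le> u" if "\<rho> z \<noteq> 0" for z
  proof -
    have "norm z \<le> 1" using that supp[of z] by linarith
    then have "pt n x - eps n *\<^sub>R z \<in> S" by (intro pt_in x)
    then show ?thesis using lu by (auto simp: f1_def)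
  qed
  have eq: "mol n f x = (LINT z|lborel. f1 (pt n x - eps n *\<^sub>R z) * \<rho> z)" by (rule mol_eq_borel[OF f1 fM])
  have [measurable]: "(\<lambda>z. f1 (pt n x - eps n *\<^sub>R z)) \<in> borel_measurable borel"
    using f1(1) by measurable
  have bnds: "l * \<rho> z \<le> f1 (pt n x - eps n *\<^sub>R z) * \<rho> z \<and> f1 (pt n x - eps n *\<^sub>R z) * \<rho> z \<le> u * \<rho> z" for z
    using in_bounds[of z] pos[of z] by (cases "\<rho> z = 0") (auto intro!: mult_right_mono)
  have i: "integrable lborel (\<lambda>z. f1 (pt n x - eps n *\<^sub>R z) * \<rho> z)"
  proof (rule Bochner_Integration.integrable_bound[where f = "\<lambda>z. (\<bar>l\<bar> + \<bar>u\<bar>) * \<rho> z"])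
    show "AE z in lborel. norm (f1 (pt n x - eps n *\<^sub>R z) * \<rho> z) \<le> norm ((\<bar>l\<bar> + \<bar>u\<bar>) * \<rho> z)"
    proof (intro always_eventually allI)
      fix z
      show "norm (f1 (pt n x - eps n *\<^sub>R z) * \<rho> z) \<le> norm ((\<bar>l\<bar> + \<bar>u\<bar>) * \<rho> z)"
        using in_bounds[of z] by (cases "\<rho> z = 0") (auto simp: abs_mult intro!: mult_right_mono)
    qed
  qed (use int in auto)
  have "l = (LINT z|lborel. l * \<rho> z)" using int1 by simp
  also have "\<dots> \<le> mol n f x" unfolding eq using bnds int i by (intro integral_mono) auto
  finally show "l \<le> mol n f x" .
  have "mol n f x \<le> (LINT z|lborel. u * \<rho> z)" unfolding eq using bnds int i by (intro integral_mono) auto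
  also have "\<dots> = u" using int1 by simp
  finally show "mol n f x \<le> u" .
qed

text \<open>All points over which \<open>mol n g x\<close> averages lie within
  \<open>(1 - a n) * (norm x0 + B) + eps n\<close> of \<open>x\<close>, a distance that does not
  depend on \<open>x\<close>; uniform continuity on the compact closure does the rest.\<close>

lemma mol_continuous_uniform:
  assumes g: "continuous_on UNIV g" and e: "e > 0"
  shows "\<forall>\<^sub>F n in sequentially. \<forall>x\<in>S. \<bar>mol n g x - g x\<bar> \<le> e"
proof -
  have fi: "integrable M g" by (intro integrable_sq[OF fin] continuous_bounded_open_sq_integrable bd op g)
  have "uniformly_continuous_on (closure S) g"
    using bd by (intro compact_uniformly_continuous continuous_on_subset[OF g]) (auto simp: compact_closure)
  then obtain d where d: "d > 0" "\<And>x y. x \<in> S \<Longrightarrow> y \<in> S \<Longrightarrow> dist y x < d \<Longrightarrow> dist (g y) (g x) < e"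
    using e closure_subset[of S] unfolding uniformly_continuous_on_def by (metis subsetD)
  obtain B where B: "\<And>x. x \<in> S \<Longrightarrow> norm x \<le> B" using bd by (auto simp: bounded_iff)
  have "(\<lambda>n. (1 - a n) * (norm x0 + B) + eps n) \<longlonglongrightarrow> (1 - 1) * (norm x0 + B) + 0"
    by (intro tendsto_intros a_lim eps_lim)
  then have "\<forall>\<^sub>F n in sequentially. (1 - a n) * (norm x0 + B) + eps n < d"
    using d(1) by (intro order_tendstoD(2)) auto
  then show ?thesis
  proof eventually_elim
    case (elim n)
    show ?case
    proof
      fix x assume x: "x \<in> S"
      define h where "h y = indicator S y * g y" for y
      have gM: "g \<in> borel_measurable M" using fi by auto
      have gb: "g \<in> borel_measurable borel" by (rule borel_measurable_continuous_onI[OF g])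
      have h: "h \<in> borel_measurable borel" "\<And>x. x \<notin> S \<Longrightarrow> h x = 0" "AE x in M. g x = h x"
        using gb Sb unfolding h_def[abs_def]
        by (intro borel_measurable_times borel_measurable_indicator) (auto intro!: AE_I2)
      have eq: "mol n g x = (LINT z|lborel. h (pt n x - eps n *\<^sub>R z) * \<rho> z)" by (rule mol_eq_borel[OF h gM])
      have near: "\<bar>h (pt n x - eps n *\<^sub>R z) - g x\<bar> \<le> e" if "\<rho> z \<noteq> 0" for z
      proof -
        have z: "norm z \<le> 1" using that supp[of z] by linarith
        then have in_S: "pt n x - eps n *\<^sub>R z \<in> S" by (intro pt_in x)
        have "(pt n x - eps n *\<^sub>R z) - x = (1 - a n) *\<^sub>R (x0 - x) - eps n *\<^sub>R z" by (simp add: pt_def algebra_simps)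
        then have "dist (pt n x - eps n *\<^sub>R z) x \<le> norm ((1 - a n) *\<^sub>R (x0 - x)) + norm (eps n *\<^sub>R z)"
          unfolding dist_norm by (metis norm_triangle_ineq4)
        also have "norm ((1 - a n) *\<^sub>R (x0 - x)) \<le> (1 - a n) * (norm x0 + B)"
          using a_bounds[of n] norm_triangle_ineq4[of x0 x] B[OF x] by (auto intro!: mult_left_mono)
        also have "norm (eps n *\<^sub>R z) \<le> eps n * 1"
          using eps_pos[of n] z by (auto intro!: mult_left_mono)
        finally have "dist (pt n x - eps n *\<^sub>R z) x < d" using elim by simp
        from d(2)[OF x in_S this] in_S show ?thesis by (simp add: h_def dist_real_def)
      qed
      have "mol n (\<lambda>y. g x) x = g x"
        using mol_bounds[of "\<lambda>y. g x" "g x" "g x" x n] x fin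
        by (intro antisym) (auto simp: finite_measure.integrable_const)
      have hm: "(\<lambda>z. h (pt n x - eps n *\<^sub>R z)) \<in> borel_measurable borel" using h(1) by measurable
      have le: "\<bar>(h (pt n x - eps n *\<^sub>R z) - g x) * \<rho> z\<bar> \<le> e * \<rho> z" for z
        using near[of z] pos[of z] by (cases "\<rho> z = 0") (auto simp: abs_mult intro!: mult_right_mono)
      have i: "integrable lborel (\<lambda>z. (h (pt n x - eps n *\<^sub>R z) - g x) * \<rho> z)"
        by (rule Bochner_Integration.integrable_bound[where f = "\<lambda>z. e * \<rho> z"])
           (use hm int le e pos in \<open>auto simp: abs_mult\<close>)
      have "mol n g x = (LINT z|lborel. (h (pt n x - eps n *\<^sub>R z) - g x) * \<rho> z + g x * \<rho> z)"
        unfolding eq by (simp add: algebra_simps)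
      also have "\<dots> = (LINT z|lborel. (h (pt n x - eps n *\<^sub>R z) - g x) * \<rho> z) + g x"
        using i int int1 by simp
      finally have "mol n g x - g x = (LINT z|lborel. (h (pt n x - eps n *\<^sub>R z) - g x) * \<rho> z)" by simp
      then have "\<bar>mol n g x - g x\<bar> \<le> (LINT z|lborel. \<bar>(h (pt n x - eps n *\<^sub>R z) - g x) * \<rho> z\<bar>)"
        using integral_abs_bound by metis
      also have "\<dots> \<le> (LINT z|lborel. e * \<rho> z)"
        using i int le by (intro integral_mono) auto
      also have "\<dots> = e" using int1 by simp
      finally show "\<bar>mol n g x - g x\<bar> \<le> e" .
    qed
  qed
qed

text \<open>Comparison with a continuous \<open>g\<close> close to \<open>f\<close>: the bound of
  \<open>mol_l2_bound\<close> handles \<open>f - g\<close> uniformly in \<open>n\<close>, and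
  \<open>g\<close> itself is approximated uniformly.\<close>

lemma mol_l2_tendsto:
  assumes f: "sq_integrable M f" shows "l2_tendsto M (\<lambda>n. mol n f) f"
proof -
  interpret M: finite_measure M by (rule fin)
  have fi: "integrable M f" by (rule integrable_sq[OF fin f])
  have "(\<lambda>n. LINT x|M. (norm (mol n f x - f x))\<^sup>2) \<longlonglongrightarrow> 0"
  proof (rule LIMSEQ_I)
    fix e :: real assume e: "e > 0"
    \<comment> \<open>The total error is at most \<open>2 * 2 ^ DIM('n) + 4\<close> times the
      squared distance of \<open>f\<close> and \<open>g\<close>, plus
      \<open>4 * \<eta>\<^sup>2\<close> times the measure of \<open>S\<close>. \<open>c\<close>
      dominates the first factor, and \<open>\<eta>\<close> makes the second part at most
      \<open>e / 2\<close>.\<close>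
    define c where "c = 2 * 2 ^ DIM('n) + (6::real)"
    have c: "c > 0" by (simp add: c_def add_pos_pos)
    define \<eta> where "\<eta> = sqrt (e / (2 * (4 * (measure M (space M) + 1))))"
    have \<eta>: "\<eta> > 0" "\<eta>\<^sup>2 = e / (2 * (4 * (measure M (space M) + 1)))" using e by (auto simp: \<eta>_def add_nonneg_pos)
    obtain g K where g: "continuous_on UNIV g" "\<And>x. \<bar>g x\<bar> \<le> K" "sq_integrable M g" "(LINT x|M. (f x - g x)\<^sup>2) < e / (2 * c)"
      using sq_dense_continuous[OF Sm f, of "e / (2 * c)"] e c by auto
    have gi: "integrable M g" by (rule integrable_sq[OF fin g(3)])
    have "\<forall>\<^sub>F n in sequentially. \<forall>x\<in>S. \<bar>mol n g x - g x\<bar> \<le> \<eta>" by (rule mol_continuous_uniform[OF g(1) \<eta>(1)])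
    then obtain N where N: "\<And>n x. n \<ge> N \<Longrightarrow> x \<in> S \<Longrightarrow> \<bar>mol n g x - g x\<bar> \<le> \<eta>"
      by (auto simp: eventually_sequentially)
    show "\<exists>N. \<forall>n\<ge>N. norm ((LINT x|M. (norm (mol n f x - f x))\<^sup>2) - 0) < e"
    proof (intro exI[of _ N] allI impI)
      fix n assume n: "n \<ge> N"
      have s: "sq_integrable M (mol n f)" "sq_integrable M (mol n g)" using mol_sq fi gi by auto
      have "(LINT x|M. (norm (mol n f x - f x))\<^sup>2) \<le> 2 * (LINT x|M. (norm (mol n f x - mol n g x))\<^sup>2) + 2 * (LINT x|M. (norm (mol n g x - f x))\<^sup>2)"
        by (intro integral_norm_sq_triangle s f)
      also have "(LINT x|M. (norm (mol n g x - f x))\<^sup>2) \<le> 2 * (LINT x|M. (norm (mol n g x - g x))\<^sup>2) + 2 * (LINT x|M. (norm (g x - f x))\<^sup>2)"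
        by (intro integral_norm_sq_triangle s f g)
      also have "(LINT x|M. (norm (mol n f x - mol n g x))\<^sup>2) \<le> 2 ^ DIM('n) * (LINT x|M. (f x - g x)\<^sup>2)"
        using mol_l2_bound[OF sq_integrable_diff[OF f g(3)], of n] mol_diff[OF fi gi, of n] by simp
      also have "(LINT x|M. (norm (mol n g x - g x))\<^sup>2) \<le> (LINT x|M. \<eta>\<^sup>2)"
      proof (intro integral_mono)
        show "integrable M (\<lambda>x. (norm (mol n g x - g x))\<^sup>2)"
          by (intro sq_integrableD sq_integrable_diff s g)
        show "(norm (mol n g x - g x))\<^sup>2 \<le> \<eta>\<^sup>2" if "x \<in> space M" for x
          using N[OF n, of x] that \<eta>(1) by (intro power_mono) auto
      qed auto
      also have "(LINT x|M. \<eta>\<^sup>2) = measure M (space M) * \<eta>\<^sup>2" by simp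
      also have "(LINT x|M. (norm (g x - f x))\<^sup>2) = (LINT x|M. (f x - g x)\<^sup>2)" by (simp add: power2_commute)
      finally have "(LINT x|M. (norm (mol n f x - f x))\<^sup>2) \<le> (2 * 2 ^ DIM('n) + 4) * (LINT x|M. (f x - g x)\<^sup>2) + 4 * (measure M (space M) * \<eta>\<^sup>2)"
        by (simp add: algebra_simps)
      also have "(2 * 2 ^ DIM('n) + 4) * (LINT x|M. (f x - g x)\<^sup>2) \<le> c * (LINT x|M. (f x - g x)\<^sup>2)"
        by (intro mult_right_mono) (auto simp: c_def)
      also have "c * (LINT x|M. (f x - g x)\<^sup>2) < e / 2" using g(4) c by (simp add: field_simps)
      also have "4 * (measure M (space M) * \<eta>\<^sup>2) \<le> e / 2"
      proof -
        have e_half: "4 * (m * (e / (2 * (4 * m)))) = e / 2" if "m > 0" for m :: real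
          using that by (simp add: field_simps)
        have m: "measure M (space M) \<ge> 0" by simp
        have "4 * (measure M (space M) * \<eta>\<^sup>2) \<le> 4 * ((measure M (space M) + 1) * \<eta>\<^sup>2)"
          by (intro mult_left_mono mult_right_mono) auto
        also have "\<dots> = e / 2" unfolding \<eta>(2) by (rule e_half) (use m in linarith)
        finally show ?thesis .
      qed
      finally show "norm ((LINT x|M. (norm (mol n f x - f x))\<^sup>2) - 0) < e" by simp
    qed
  qed
  then show ?thesis using f mol_sq[OF fi] by (simp add: l2_tendsto_def)
qed

text \<open>As a function of \<open>y\<close> the kernel is supported in
  \<open>cball (pt n x) (eps n)\<close>, a compact subset of \<open>S\<close> for every
  \<open>x\<close> in \<open>S\<close>, however close to the boundary. Hence weak gradients may be
  tested with it.\<close>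

lemma kernel_test_function:
  assumes x: "x \<in> S"
  shows "(\<lambda>y. \<rho> ((a n / eps n) *\<^sub>R x + ((1 - a n) / eps n) *\<^sub>R x0 - (1 / eps n) *\<^sub>R y)) \<in> test_functions S" (is "?k \<in> _")
    and "frechet_derivative (\<lambda>y. \<rho> ((a n / eps n) *\<^sub>R x + ((1 - a n) / eps n) *\<^sub>R x0 - (1 / eps n) *\<^sub>R y)) (at y) b
      = - (1 / eps n) * (grad \<rho> ((a n / eps n) *\<^sub>R x + ((1 - a n) / eps n) *\<^sub>R x0 - (1 / eps n) *\<^sub>R y) \<bullet> b)"
proof -
  let ?v = "(a n / eps n) *\<^sub>R x + ((1 - a n) / eps n) *\<^sub>R x0"
  have keq: "?k = (\<lambda>y. \<rho> ((- (1 / eps n)) *\<^sub>R y + ?v))" by (simp add: algebra_simps)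
  have "smooth ?k" unfolding keq by (rule smooth_affine[OF sm])
  moreover have "?k y = 0" if "y \<notin> cball (pt n x) (eps n)" for y
  proof (rule supp)
    have "?v - (1 / eps n) *\<^sub>R y = (1 / eps n) *\<^sub>R (pt n x - y)"
      by (simp add: pt_def scaleR_diff_right scaleR_add_right)
    then have ne: "norm (?v - (1 / eps n) *\<^sub>R y) = dist (pt n x) y / eps n"
      using eps_pos[of n] by (simp add: dist_norm)
    show "1 \<le> norm (?v - (1 / eps n) *\<^sub>R y)" unfolding ne using that eps_pos[of n] by (simp add: le_divide_eq)
  qed
  moreover have "cball (pt n x) (eps n) \<subseteq> S"
  proof
    fix y assume y: "y \<in> cball (pt n x) (eps n)"
    have "y = pt n x - eps n *\<^sub>R ((1 / eps n) *\<^sub>R (pt n x - y))" using eps_pos[of n] by simp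
    moreover have "norm ((1 / eps n) *\<^sub>R (pt n x - y)) \<le> 1"
      unfolding norm_scaleR using y eps_pos[of n] by (simp add: dist_norm divide_le_eq)
    ultimately show "y \<in> S" using pt_in[OF x] by metis
  qed
  ultimately show "?k \<in> test_functions S"
    unfolding test_functions_def by (intro CollectI conjI exI[of _ "cball (pt n x) (eps n)"]) auto
  have "((\<lambda>y. (- (1 / eps n)) *\<^sub>R y + ?v) has_derivative (\<lambda>h. (- (1 / eps n)) *\<^sub>R h)) (at y)"
    by (auto intro!: derivative_eq_intros)
  from has_derivative_compose[OF this smooth_has_derivative[OF sm]]
  have "(?k has_derivative (\<lambda>h. grad \<rho> ((- (1 / eps n)) *\<^sub>R y + ?v) \<bullet> ((- (1 / eps n)) *\<^sub>R h))) (at y)"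
    unfolding keq .
  from frechet_derivative_at[OF this]
  show "frechet_derivative ?k (at y) b = - (1 / eps n) * (grad \<rho> (?v - (1 / eps n) *\<^sub>R y) \<bullet> b)"
    by (simp add: algebra_simps fun_eq_iff)
qed

text \<open>The derivative of the kernel in \<open>x\<close> is \<open>- a n\<close> times its
  derivative in \<open>y\<close>, so the definition of the weak gradient moves it onto
  \<open>f\<close>. The contraction leaves the factor \<open>a n\<close>, which tends to 1.\<close>

lemma mol_grad:
  assumes f: "sq_integrable M f" and g: "has_weak_gradient S f g" and x: "x \<in> S" and b: "b \<in> Basis"
  shows "grad (mol n f) x \<bullet> b = a n * mol n (\<lambda>y. g y \<bullet> b) x"
proof -
  let ?z = "\<lambda>y. (a n / eps n) *\<^sub>R x + ((1 - a n) / eps n) *\<^sub>R x0 - (1 / eps n) *\<^sub>R y"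
  let ?c = "1 / eps n ^ DIM('n)"
  have fi: "integrable M f" by (rule integrable_sq[OF fin f])
  have "(mol n f has_derivative (\<lambda>h. ?c * ((a n / eps n) * (LINT y|M. f y * (grad \<rho> (?z y) \<bullet> h))))) (at x)"
    unfolding mol_def[abs_def]
    by (intro has_derivative_mult_right convolution_has_derivative[OF SL fi smooth_cs_rho])
  from frechet_derivative_at[OF this, symmetric]
  have 1: "grad (mol n f) x \<bullet> b = ?c * ((a n / eps n) * (LINT y|M. f y * (grad \<rho> (?z y) \<bullet> b)))"
    by (subst grad_inner_Basis[OF b]) simp
  have "(LINT y|M. f y * frechet_derivative (\<lambda>y. \<rho> (?z y)) (at y) b) = - (LINT y|M. (g y \<bullet> b) * \<rho> (?z y))"
    using g kernel_test_function(1)[OF x] b unfolding has_weak_gradient_def by blast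
  then have "(LINT y|M. f y * (- (1 / eps n) * (grad \<rho> (?z y) \<bullet> b))) = - (LINT y|M. (g y \<bullet> b) * \<rho> (?z y))"
    unfolding kernel_test_function(2)[OF x] .
  moreover have "(LINT y|M. f y * (- (1 / eps n) * (grad \<rho> (?z y) \<bullet> b))) = - (1 / eps n) * (LINT y|M. f y * (grad \<rho> (?z y) \<bullet> b))"
    by (subst integral_mult_right_zero[symmetric]) (simp add: algebra_simps)
  ultimately have eq: "(1 / eps n) * (LINT y|M. f y * (grad \<rho> (?z y) \<bullet> b)) = (LINT y|M. (g y \<bullet> b) * \<rho> (?z y))" by simp
  show ?thesis unfolding 1 mol_def eq[symmetric] by simp
qed

end

section \<open>Weak gradients\<close>

lemma mollification_exists:
  fixes S :: "'n::euclidean_space set"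
  assumes "open S" "convex S" "bounded S" "S \<noteq> {}"
  obtains x0 r \<rho> where "mollification S x0 r \<rho>"
proof -
  obtain x0 r where "r > 0" "ball x0 r \<subseteq> S" using assms open_contains_ball[of S] by blast
  moreover obtain \<rho> :: "'n \<Rightarrow> real" where "smooth \<rho>" "\<And>x. 0 \<le> \<rho> x" "\<And>x. norm x \<ge> 1 \<Longrightarrow> \<rho> x = 0"
    "integrable lborel \<rho>" "(LINT x|lborel. \<rho> x) = 1" using mollifier_exists by metis
  ultimately show thesis using assms by (intro that[of x0 r \<rho>]) (unfold_locales, auto)
qed

lemma test_function_smooth: "\<phi> \<in> test_functions S \<Longrightarrow> smooth \<phi>"
  by (simp add: test_functions_def)

text \<open>On \<open>S\<close> each value \<open>mol n h x\<close> is a multiple of a pairing of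
  \<open>h\<close> with a test function, hence 0, while \<open>mol n h\<close> tends to
  \<open>h\<close>.\<close>

lemma vanishing_if_orthogonal_to_test_functions:
  fixes S :: "'n::euclidean_space set"
  assumes S: "open S" "convex S" "bounded S" and h: "sq_integrable (lebesgue_on S) h"
    and 0: "\<And>\<phi>. \<phi> \<in> test_functions S \<Longrightarrow> (LINT x|lebesgue_on S. h x * \<phi> x) = 0"
  shows "AE x in lebesgue_on S. h x = 0"
proof (cases "S = {}")
  case True then show ?thesis by (auto intro: AE_I2)
next
  case False
  obtain x0 r \<rho> where "mollification S x0 r \<rho>" using mollification_exists[OF S False] by metis
  then interpret mollification S x0 r \<rho> .
  have mz: "mol n h x = 0" if "x \<in> S" for n x
    unfolding mol_def using 0[OF kernel_test_function(1)[OF that]] by simp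
  have "(LINT x|M. (norm (mol n h x - h x))\<^sup>2) = (LINT x|M. (h x)\<^sup>2)" for n
    using mz by (intro Bochner_Integration.integral_cong) auto
  then have "(\<lambda>n. LINT x|M. (h x)\<^sup>2) \<longlonglongrightarrow> 0" using l2_tendstoD(3)[OF mol_l2_tendsto[OF h]] by simp
  then have z: "(LINT x|M. (h x)\<^sup>2) = 0" by (simp add: LIMSEQ_const_iff)
  have "integrable M (\<lambda>x. (h x)\<^sup>2)" by (rule sq_integrable_realD[OF h])
  from integral_nonneg_eq_0_iff_AE[OF this] z show ?thesis by simp
qed

lemma has_weak_gradientD:
  assumes "has_weak_gradient S f g"
  shows "sq_integrable (lebesgue_on S) g"
    "\<phi> \<in> test_functions S \<Longrightarrow> b \<in> Basis \<Longrightarrow>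
      (LINT x|lebesgue_on S. f x * frechet_derivative \<phi> (at x) b) = - (LINT x|lebesgue_on S. (g x \<bullet> b) * \<phi> x)"
  using assms by (auto simp: has_weak_gradient_def Lp_space_2_iff)

lemma test_function_sq_integrable:
  fixes S :: "'n::euclidean_space set"
  assumes "open S" "bounded S" "\<phi> \<in> test_functions S"
  shows "sq_integrable (lebesgue_on S) \<phi>"
    and "b \<in> Basis \<Longrightarrow> sq_integrable (lebesgue_on S) (\<lambda>x. frechet_derivative \<phi> (at x) b)"
proof -
  have sm: "smooth \<phi>" using assms by (simp add: test_functions_def)
  show "sq_integrable (lebesgue_on S) \<phi>"
    using assms sm by (intro continuous_bounded_open_sq_integrable smooth_continuous)
  show "sq_integrable (lebesgue_on S) (\<lambda>x. frechet_derivative \<phi> (at x) b)" if "b \<in> Basis"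
    using assms smooth_continuous[OF smooth_partial[OF sm that], of UNIV]
    by (intro continuous_bounded_open_sq_integrable) (simp_all add: grad_inner_Basis[OF that])
qed

lemma has_weak_gradient_unique:
  fixes S :: "'n::euclidean_space set"
  assumes S: "open S" "convex S" "bounded S" and g: "has_weak_gradient S f g" "has_weak_gradient S f g'"
  shows "AE x in lebesgue_on S. g x = g' x"
proof -
  note sq = has_weak_gradientD(1)[OF g(1)] has_weak_gradientD(1)[OF g(2)]
  have "AE x in lebesgue_on S. (g x - g' x) \<bullet> b = 0" if b: "b \<in> Basis" for b
  proof (rule vanishing_if_orthogonal_to_test_functions[OF S])
    show "sq_integrable (lebesgue_on S) (\<lambda>x. (g x - g' x) \<bullet> b)"
      by (rule sq_integrable_component[OF sq_integrable_diff[OF sq] b])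
    fix \<phi> assume \<phi>: "\<phi> \<in> test_functions S"
    note s\<phi> = test_function_sq_integrable(1)[OF S(1,3) \<phi>]
    have "(LINT x|lebesgue_on S. ((g x - g' x) \<bullet> b) * \<phi> x)
      = (LINT x|lebesgue_on S. (g x \<bullet> b) * \<phi> x - (g' x \<bullet> b) * \<phi> x)"
      by (simp add: inner_diff_left left_diff_distrib)
    also have "\<dots> = (LINT x|lebesgue_on S. (g x \<bullet> b) * \<phi> x) - (LINT x|lebesgue_on S. (g' x \<bullet> b) * \<phi> x)"
      by (intro Bochner_Integration.integral_diff integrable_mult_sq sq_integrable_component sq b s\<phi>)
    also have "\<dots> = 0"
      using has_weak_gradientD(2)[OF g(1) \<phi> b] has_weak_gradientD(2)[OF g(2) \<phi> b] by simp
    finally show "(LINT x|lebesgue_on S. ((g x - g' x) \<bullet> b) * \<phi> x) = 0" .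
  qed
  then have "AE x in lebesgue_on S. \<forall>b\<in>Basis. (g x - g' x) \<bullet> b = 0"
    by (subst AE_finite_all) auto
  then show ?thesis
  proof (rule eventually_mono)
    fix x assume "\<forall>b\<in>Basis. (g x - g' x) \<bullet> b = 0"
    then have "\<And>b. b \<in> Basis \<Longrightarrow> g x \<bullet> b = g' x \<bullet> b" by (simp add: inner_diff_left)
    then show "g x = g' x" by (rule euclidean_eqI)
  qed
qed

lemma has_weak_gradient_lincomb:
  fixes S :: "'n::euclidean_space set"
  assumes S: "open S" "bounded S" and f: "sq_integrable (lebesgue_on S) f" "sq_integrable (lebesgue_on S) f'"
    and g: "has_weak_gradient S f g" "has_weak_gradient S f' g'"
  shows "has_weak_gradient S (\<lambda>x. c * f x + c' * f' x) (\<lambda>x. c *\<^sub>R g x + c' *\<^sub>R g' x)"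
  unfolding has_weak_gradient_def Lp_space_2_iff
proof (intro conjI ballI)
  note sq = has_weak_gradientD(1)[OF g(1)] has_weak_gradientD(1)[OF g(2)]
  show "sq_integrable (lebesgue_on S) (\<lambda>x. c *\<^sub>R g x + c' *\<^sub>R g' x)"
    by (intro sq_integrable_add sq_integrable_scaleR sq)
  fix \<phi> :: "'n \<Rightarrow> real" and b :: 'n assume \<phi>: "\<phi> \<in> test_functions S" and b: "b \<in> Basis"
  note s = test_function_sq_integrable(1)[OF S \<phi>] test_function_sq_integrable(2)[OF S \<phi> b]
  have "(LINT x|lebesgue_on S. (c * f x + c' * f' x) * frechet_derivative \<phi> (at x) b)
    = (LINT x|lebesgue_on S. c * (f x * frechet_derivative \<phi> (at x) b) + c' * (f' x * frechet_derivative \<phi> (at x) b))"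
    by (simp add: algebra_simps)
  also have "\<dots> = (LINT x|lebesgue_on S. c * (f x * frechet_derivative \<phi> (at x) b)) + (LINT x|lebesgue_on S. c' * (f' x * frechet_derivative \<phi> (at x) b))"
    by (intro Bochner_Integration.integral_add integrable_mult_right integrable_mult_sq f s)
  also have "\<dots> = - (c * (LINT x|lebesgue_on S. (g x \<bullet> b) * \<phi> x) + c' * (LINT x|lebesgue_on S. (g' x \<bullet> b) * \<phi> x))"
    using has_weak_gradientD(2)[OF g(1) \<phi> b] has_weak_gradientD(2)[OF g(2) \<phi> b] by simp
  also have "\<dots> = - ((LINT x|lebesgue_on S. c * ((g x \<bullet> b) * \<phi> x)) + (LINT x|lebesgue_on S. c' * ((g' x \<bullet> b) * \<phi> x)))"
    by simp
  also have "\<dots> = - (LINT x|lebesgue_on S. c * ((g x \<bullet> b) * \<phi> x) + c' * ((g' x \<bullet> b) * \<phi> x))"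
    by (subst Bochner_Integration.integral_add) (intro integrable_mult_right integrable_mult_sq sq_integrable_component sq b s refl)+
  also have "\<dots> = - (LINT x|lebesgue_on S. ((c *\<^sub>R g x + c' *\<^sub>R g' x) \<bullet> b) * \<phi> x)"
    by (simp add: algebra_simps)
  finally show "(LINT x|lebesgue_on S. (c * f x + c' * f' x) * frechet_derivative \<phi> (at x) b)
     = - (LINT x|lebesgue_on S. ((c *\<^sub>R g x + c' *\<^sub>R g' x) \<bullet> b) * \<phi> x)" .
qed

lemma has_weak_gradient_limit:
  fixes S :: "'n::euclidean_space set"
  assumes S: "open S" "bounded S" and F: "l2_tendsto (lebesgue_on S) F f" and G: "l2_tendsto (lebesgue_on S) G g"
    and w: "\<And>n. has_weak_gradient S (F n) (G n)"
  shows "has_weak_gradient S f g"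
  unfolding has_weak_gradient_def Lp_space_2_iff
proof (intro conjI ballI)
  show "sq_integrable (lebesgue_on S) g" by (rule l2_tendstoD(2)[OF G])
  fix \<phi> :: "'n \<Rightarrow> real" and b :: 'n assume \<phi>: "\<phi> \<in> test_functions S" and b: "b \<in> Basis"
  note s = test_function_sq_integrable(1)[OF S \<phi>] test_function_sq_integrable(2)[OF S \<phi> b]
  have sb: "sq_integrable (lebesgue_on S) (\<lambda>x. \<phi> x *\<^sub>R b)"
    by (rule sq_integrable_dominated[OF s(1), of _ "norm b"]) (use sq_integrableD(1)[OF s(1)] in \<open>auto intro!: borel_measurable_scaleR\<close>)
  have 1: "(\<lambda>n. LINT x|lebesgue_on S. F n x * frechet_derivative \<phi> (at x) b) \<longlonglongrightarrow> (LINT x|lebesgue_on S. f x * frechet_derivative \<phi> (at x) b)"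
    using l2_tendsto_inner[OF F l2_tendsto_const[OF s(2)]] by simp
  have 2: "(\<lambda>n. - (LINT x|lebesgue_on S. (G n x \<bullet> b) * \<phi> x)) \<longlonglongrightarrow> - (LINT x|lebesgue_on S. (g x \<bullet> b) * \<phi> x)"
    using tendsto_minus[OF l2_tendsto_inner[OF G l2_tendsto_const[OF sb]]] by (simp add: mult.commute)
  show "(LINT x|lebesgue_on S. f x * frechet_derivative \<phi> (at x) b) = - (LINT x|lebesgue_on S. (g x \<bullet> b) * \<phi> x)"
    using LIMSEQ_unique[OF 1] 2 has_weak_gradientD(2)[OF w \<phi> b] by simp
qed

text \<open>By translation invariance \<open>H (x + t *\<^sub>R b) - H x\<close> has integral 0. The
  integral of \<open>G x \<bullet> b\<close> is therefore, up to sign, the integrated linearisation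
  error divided by \<open>t\<close>, which can be made arbitrarily small.\<close>

lemma integral_partial_compact_support:
  fixes H :: "'n::euclidean_space \<Rightarrow> real"
  assumes H: "C1_fun H G" and R: "\<And>x. norm x \<ge> R \<Longrightarrow> H x = 0" "\<And>x. norm x \<ge> R \<Longrightarrow> G x = 0"
  shows "(LINT x|lborel. G x \<bullet> b) = 0"
proof -
  note Hc = C1_fun_continuous[OF H, of UNIV] and Gc = C1_fun_grad_continuous[OF H, of UNIV]
  have iG: "integrable lborel (\<lambda>x. G x \<bullet> b)"
  proof -
    have "set_integrable lborel (cball 0 R) (\<lambda>x. G x \<bullet> b)"
      unfolding set_integrable_def
      by (intro borel_integrable_compact continuous_intros continuous_on_subset[OF Gc]) auto
    moreover have "(\<lambda>x. indicator (cball 0 R) x *\<^sub>R (G x \<bullet> b)) = (\<lambda>x. G x \<bullet> b)"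
      using R(2) by (auto simp: indicator_def fun_eq_iff split: split_of_bool)
    ultimately show ?thesis by (simp add: set_integrable_def)
  qed
  have iH: "integrable lborel H"
  proof -
    have "set_integrable lborel (cball 0 R) H"
      unfolding set_integrable_def
      by (intro borel_integrable_compact continuous_on_subset[OF Hc]) auto
    moreover have "(\<lambda>x. indicator (cball 0 R) x *\<^sub>R H x) = H"
      using R(1) by (auto simp: indicator_def fun_eq_iff split: split_of_bool)
    ultimately show ?thesis by (simp add: set_integrable_def)
  qed
  have Hb: "H \<in> borel_measurable borel" by (rule borel_measurable_continuous_onI[OF Hc])
  have trans: "(LINT x|lborel. H x) = (LINT x|lborel. H (v + x))" for v
    using lborel_integral_affine[of 1 H v] Hb by simp
  have itrans: "integrable lborel (\<lambda>x. H (x + v))" for v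
  proof -
    have "set_integrable lborel (cball 0 (R + norm v)) (\<lambda>x. H (x + v))"
      unfolding set_integrable_def
      by (intro borel_integrable_compact continuous_on_compose2[OF Hc] continuous_intros) auto
    moreover have "(\<lambda>x. indicator (cball 0 (R + norm v)) x *\<^sub>R H (x + v)) = (\<lambda>x. H (x + v))"
    proof
      fix x
      show "indicator (cball 0 (R + norm v)) x *\<^sub>R H (x + v) = H (x + v)"
      proof (cases "x \<in> cball 0 (R + norm v)")
        case False
        then have "norm (x + v) \<ge> R" using norm_triangle_ineq4[of "x + v" v] by simp
        then show ?thesis using R(1) by simp
      qed simp
    qed
    ultimately show ?thesis by (simp add: set_integrable_def)
  qed
  have "\<bar>LINT x|lborel. G x \<bullet> b\<bar> \<le> e * (norm b * measure lborel (cball (0::'n) (R + norm b)))" if e: "e > 0" for e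
  proof -
    obtain d where d: "d > 0" "\<And>x y. dist x y < d \<Longrightarrow> dist (G x) (G y) < e"
      using uniformly_continuous_compact_support[OF Gc R(2) e] by metis
    \<comment> \<open>\<open>t \<le> 1\<close> keeps the support of the translate in a ball
      independent of \<open>t\<close>; the other bound makes \<open>G\<close> vary by less than
      \<open>e\<close> along the step.\<close>
    define t where "t = min 1 (d / (2 * (norm b + 1)))"
    have t: "0 < t" "t \<le> 1" using d(1) by (auto simp: t_def add_nonneg_pos)
    have tb: "norm (t *\<^sub>R b) < d"
    proof -
      have "norm (t *\<^sub>R b) \<le> (d / (2 * (norm b + 1))) * (norm b + 1)"
        using t d(1) unfolding norm_scaleR by (intro mult_mono) (auto simp: t_def)
      also have "\<dots> = d / 2" by (simp add: field_simps add_nonneg_eq_0_iff)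
      finally show ?thesis using d(1) by simp
    qed
    let ?D = "\<lambda>x. H (x + t *\<^sub>R b) - H x - G x \<bullet> (t *\<^sub>R b)"
    have pt: "\<bar>?D x\<bar> \<le> (e * norm (t *\<^sub>R b)) * indicator (cball 0 (R + norm b)) x" for x
    proof (cases "x \<in> cball 0 (R + norm b)")
      case True
      have "\<bar>?D x\<bar> \<le> e * norm (t *\<^sub>R b)"
      proof (rule C1_linearization[OF H])
        fix y assume "y \<in> closed_segment x (x + t *\<^sub>R b)"
        then have "dist y x < d" using segment_bound1[of y x "x + t *\<^sub>R b"] tb by (simp add: dist_norm norm_minus_commute)
        then show "norm (G y - G x) \<le> e" using d(2)[of y x] by (simp add: dist_norm)
      qed
      then show ?thesis using True by simp
    next
      case False
      then have "norm x > R + norm b" by simp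
      moreover have "norm (t *\<^sub>R b) \<le> norm b" using t by (auto intro!: mult_left_le_one_le)
      ultimately have "norm x \<ge> R" "norm (x + t *\<^sub>R b) \<ge> R" using norm_triangle_ineq4[of "x + t *\<^sub>R b" "t *\<^sub>R b"] norm_ge_zero[of b]
        by (simp_all del: norm_scaleR norm_ge_zero)
      then have "H (x + t *\<^sub>R b) = 0" "H x = 0" "G x = 0" using R by auto
      then show ?thesis using False by simp
    qed
    have iD: "integrable lborel ?D"
      using itrans[of "t *\<^sub>R b"] iH iG by auto
    have "(LINT x|lborel. ?D x) = (LINT x|lborel. H (x + t *\<^sub>R b)) - (LINT x|lborel. H x) - t * (LINT x|lborel. G x \<bullet> b)"
      using itrans[of "t *\<^sub>R b"] iH iG by simp
    also have "(LINT x|lborel. H (x + t *\<^sub>R b)) = (LINT x|lborel. H x)" using trans[of "t *\<^sub>R b"] by (simp add: add.commute)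
    finally have "t * \<bar>LINT x|lborel. G x \<bullet> b\<bar> = \<bar>LINT x|lborel. ?D x\<bar>" using t by (simp add: abs_mult)
    also have "\<dots> \<le> (LINT x|lborel. \<bar>?D x\<bar>)" by (rule integral_abs_bound)
    also have "\<dots> \<le> (LINT x|lborel. (e * norm (t *\<^sub>R b)) * indicator (cball (0::'n) (R + norm b)) x)"
      using iD emeasure_bounded_finite[OF bounded_cball, of "0::'n" "R + norm b"] by (intro integral_mono pt) (auto intro!: integrable_mult_right)
    also have "\<dots> = e * norm (t *\<^sub>R b) * measure lborel (cball (0::'n) (R + norm b))" by simp
    finally have "t * \<bar>LINT x|lborel. G x \<bullet> b\<bar> \<le> t * (e * (norm b * measure lborel (cball (0::'n) (R + norm b))))"
      using t by (simp add: ac_simps)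
    then show ?thesis using t by simp
  qed
  then have "\<bar>LINT x|lborel. G x \<bullet> b\<bar> \<le> 0"
  proof -
    assume *: "\<And>e. e > 0 \<Longrightarrow> \<bar>LINT x|lborel. G x \<bullet> b\<bar> \<le> e * (norm b * measure lborel (cball (0::'n) (R + norm b)))"
    define m where "m = norm b * measure lborel (cball (0::'n) (R + norm b))"
    have m: "m \<ge> 0" by (simp add: m_def)
    show ?thesis
    proof (rule field_le_epsilon)
      fix e :: real assume e: "e > 0"
      have "\<bar>LINT x|lborel. G x \<bullet> b\<bar> \<le> e / (m + 1) * m" unfolding m_def
        by (rule *) (use e m in \<open>auto simp: m_def add_nonneg_pos\<close>)
      also have "\<dots> \<le> e" using m e by (simp add: field_simps)
      finally show "\<bar>LINT x|lborel. G x \<bullet> b\<bar> \<le> 0 + e" by simp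
    qed
  qed
  then show ?thesis by simp
qed

text \<open>The product of \<open>f\<close> with a test function is C1 with compact support, so its
  partial derivative integrates to 0.\<close>

lemma C1_has_weak_gradient:
  fixes S :: "'n::euclidean_space set"
  assumes S: "open S" "bounded S" and f: "C1_fun f G"
  shows "has_weak_gradient S f G"
  unfolding has_weak_gradient_def Lp_space_2_iff
proof (intro conjI ballI)
  show "sq_integrable (lebesgue_on S) G"
    by (intro continuous_bounded_open_sq_integrable S C1_fun_grad_continuous[OF f])
  fix \<phi> :: "'n \<Rightarrow> real" and b :: 'n assume \<phi>: "\<phi> \<in> test_functions S" and b: "b \<in> Basis"
  note s = test_function_sq_integrable(1)[OF S \<phi>] test_function_sq_integrable(2)[OF S \<phi> b]
  note sf = continuous_bounded_open_sq_integrable[OF S(2,1) C1_fun_continuous[OF f]]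
    continuous_bounded_open_sq_integrable[OF S(2,1) C1_fun_grad_continuous[OF f]]
  obtain K where K: "compact K" "K \<subseteq> S" "\<And>x. x \<notin> K \<Longrightarrow> \<phi> x = 0" using \<phi> by (auto simp: test_functions_def)
  have sm: "smooth \<phi>" using \<phi> by (rule test_function_smooth)
  have gK: "grad \<phi> x = 0" if "x \<notin> K" for x
  proof -
    have "(\<phi> has_derivative (\<lambda>h. 0)) (at x)"
      by (rule has_derivative_transform_within_open[OF has_derivative_const[of "0::real" "at x"] open_Compl[OF compact_imp_closed[OF K(1)]]])
         (use that K in auto)
    from frechet_derivative_at[OF this, symmetric] show ?thesis by (simp add: grad_def)
  qed
  define G' where "G' x = f x *\<^sub>R grad \<phi> x + \<phi> x *\<^sub>R G x" for x
  have C: "C1_fun (\<lambda>x. f x * \<phi> x) G'"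
    unfolding G'_def by (rule C1_fun_mult[OF f C1_fun_smooth[OF sm]])
  obtain R where R: "\<And>x. x \<in> K \<Longrightarrow> norm x < R"
    using compact_imp_bounded[OF K(1)] bounded_pos_less[of K] by metis
  have zero: "f x * \<phi> x = 0" "G' x = 0" if "norm x \<ge> R" for x
    using R[of x] that K(3)[of x] gK[of x] by (force simp: G'_def)+
  have 0: "(LINT x|lborel. G' x \<bullet> b) = 0"
    by (rule integral_partial_compact_support[OF C zero])
  have "(\<lambda>x. G' x \<bullet> b) \<in> borel_measurable borel"
    by (intro borel_measurable_continuous_onI continuous_intros C1_fun_grad_continuous[OF C])
  then have "(LINT x|lebesgue_on S. G' x \<bullet> b) = (LINT x|lborel. indicator S x * (G' x \<bullet> b))"
    using S by (intro lebesgue_on_integral_borel) auto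
  also have "\<dots> = (LINT x|lborel. G' x \<bullet> b)"
  proof (intro Bochner_Integration.integral_cong refl)
    fix x
    show "indicator S x * (G' x \<bullet> b) = G' x \<bullet> b"
    proof (cases "x \<in> S")
      case False
      then have "x \<notin> K" using K(2) by blast
      then show ?thesis by (simp add: G'_def K(3) gK)
    qed simp
  qed
  finally have "0 = (LINT x|lebesgue_on S. G' x \<bullet> b)" using 0 by simp
  also have "\<dots> = (LINT x|lebesgue_on S. f x * frechet_derivative \<phi> (at x) b + (G x \<bullet> b) * \<phi> x)"
    by (simp add: G'_def inner_add_left grad_inner_Basis[OF b] mult.commute)
  also have "\<dots> = (LINT x|lebesgue_on S. f x * frechet_derivative \<phi> (at x) b) + (LINT x|lebesgue_on S. (G x \<bullet> b) * \<phi> x)"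
    by (intro Bochner_Integration.integral_add integrable_mult_sq sq_integrable_component sf b s)
  finally show "(LINT x|lebesgue_on S. f x * frechet_derivative \<phi> (at x) b) = - (LINT x|lebesgue_on S. (G x \<bullet> b) * \<phi> x)" by simp
qed

text \<open>The approximations are smooth on the whole space and obey the bounds at every point of
  \<open>S\<close>. This is what later permits boundary values and nonlinear compositions.\<close>

lemma H1_smooth_approximation:
  fixes S :: "'n::euclidean_space set"
  assumes S: "open S" "convex S" "bounded S" "S \<noteq> {}"
    and f: "sq_integrable (lebesgue_on S) f" and g: "has_weak_gradient S f g"
    and b: "AE x in lebesgue_on S. l \<le> f x \<and> f x \<le> u"
  obtains F where "\<forall>n. smooth (F n)" "l2_tendsto (lebesgue_on S) F f" "l2_tendsto (lebesgue_on S) (\<lambda>n. grad (F n)) g"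
    "\<forall>n. \<forall>x\<in>S. l \<le> F n x \<and> F n x \<le> u"
proof -
  obtain x0 r \<rho> where "mollification S x0 r \<rho>" using mollification_exists[OF S] by metis
  then interpret mollification S x0 r \<rho> .
  have fi: "integrable M f" by (rule integrable_sq[OF fin f])
  note gs = has_weak_gradientD(1)[OF g]
  have "l2_tendsto M (\<lambda>n. grad (mol n f)) g"
  proof (rule l2_tendsto_componentwise)
    fix b :: 'n assume b: "b \<in> Basis"
    have L: "l2_tendsto M (\<lambda>n. mol n (\<lambda>y. g y \<bullet> b)) (\<lambda>x. g x \<bullet> b)"
      by (intro mol_l2_tendsto sq_integrable_component gs b)
    have "l2_tendsto M (\<lambda>n x. a n *\<^sub>R mol n (\<lambda>y. g y \<bullet> b) x) (\<lambda>x. 1 *\<^sub>R (g x \<bullet> b))"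
    proof (rule l2_tendsto_scaleR_bounded[OF L])
      show "AE x in M. \<bar>a n\<bar> \<le> 1" for n using a_bounds[of n] by simp
      show "AE x in M. (\<lambda>n. a n) \<longlonglongrightarrow> 1" using a_lim by simp
    qed auto
    then have L2: "l2_tendsto M (\<lambda>n x. a n * mol n (\<lambda>y. g y \<bullet> b) x) (\<lambda>x. g x \<bullet> b)" by simp
    show "l2_tendsto M (\<lambda>n x. grad (mol n f) x \<bullet> b) (\<lambda>x. g x \<bullet> b)"
    proof (rule l2_tendsto_close[OF L2])
      show "sq_integrable M (\<lambda>x. grad (mol n f) x \<bullet> b)" for n
        by (intro continuous_bounded_open_sq_integrable S continuous_intros smooth_continuous_grad mol_smooth fi)
      have "(LINT x|M. (norm (grad (mol n f) x \<bullet> b - a n * mol n (\<lambda>y. g y \<bullet> b) x))\<^sup>2) = (LINT x|M. 0)" for n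
        using mol_grad[OF f g _ b] by (intro Bochner_Integration.integral_cong) auto
      then show "(\<lambda>n. LINT x|M. (norm (grad (mol n f) x \<bullet> b - a n * mol n (\<lambda>y. g y \<bullet> b) x))\<^sup>2) \<longlonglongrightarrow> 0" by simp
    qed
  qed
  then show thesis
    using mol_smooth[OF fi] mol_l2_tendsto[OF f] mol_bounds[OF fi b] by (intro that[of "\<lambda>n. mol n f"]) auto
qed

section \<open>The space H1 and its norm\<close>

lemma has_weak_gradient_weak_grad:
  "f \<in> H1_space S \<Longrightarrow> has_weak_gradient S f (weak_grad S f)"
  unfolding H1_space_def weak_grad_def using someI_ex[of "has_weak_gradient S f"] by auto

lemma H1_spaceI: "sq_integrable (lebesgue_on S) f \<Longrightarrow> has_weak_gradient S f g \<Longrightarrow> f \<in> H1_space S"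
  unfolding H1_space_def Lp_space_2_iff by blast

lemma H1_spaceD: "f \<in> H1_space S \<Longrightarrow> sq_integrable (lebesgue_on S) f"
  unfolding H1_space_def Lp_space_2_iff by blast

text \<open>\<open>H1_norm\<close> refers to a weak gradient picked by \<open>SOME\<close>; by
  uniqueness almost everywhere, any weak gradient computes it.\<close>

lemma H1_norm_sq:
  fixes S :: "'n::euclidean_space set"
  assumes S: "open S" "convex S" "bounded S"
    and f: "sq_integrable (lebesgue_on S) f" and g: "has_weak_gradient S f g"
  shows "(H1_norm S f)\<^sup>2 = (LINT x|lebesgue_on S. (f x)\<^sup>2) + (LINT x|lebesgue_on S. (norm (g x))\<^sup>2)"
proof -
  have w: "has_weak_gradient S f (weak_grad S f)" by (intro has_weak_gradient_weak_grad H1_spaceI[OF f g])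
  have "AE x in lebesgue_on S. weak_grad S f x = g x" by (rule has_weak_gradient_unique[OF S w g])
  then have eq: "(LINT x|lebesgue_on S. (norm (weak_grad S f x))\<^sup>2) = (LINT x|lebesgue_on S. (norm (g x))\<^sup>2)"
    using has_weak_gradientD(1)[OF w] has_weak_gradientD(1)[OF g]
    by (intro integral_cong_AE) (auto intro!: sq_integrableD(2) borel_measurable_integrable)
  show ?thesis unfolding H1_norm_def Lp_norm_2 eq by simp
qed

lemma H1_norm_nonneg: "0 \<le> H1_norm S f"
  by (simp add: H1_norm_def)

lemma nn_integral_lborel_eq_lebesgue_on:
  fixes g :: "'n::euclidean_space \<Rightarrow> real"
  assumes "S \<in> sets borel" "g \<in> borel_measurable borel" "\<And>x. 0 \<le> g x" "integrable (lebesgue_on S) g"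
  shows "(\<integral>\<^sup>+x. ennreal (g x) * indicator S x \<partial>lborel) = ennreal (LINT x|lebesgue_on S. g x)"
  using lebesgue_on_nn_integral_borel[of S "\<lambda>x. ennreal (g x)"] nn_integral_eq_integral[OF assms(4)] assms by simp

text \<open>The fundamental theorem of calculus followed by Cauchy-Schwarz, in extended nonnegative
  form so that Fubini can be applied to the bound afterwards.\<close>

lemma increment_sq_le:
  fixes F g :: "real \<Rightarrow> real"
  assumes "a \<le> b" "\<And>t. (F has_real_derivative g t) (at t)" "continuous_on UNIV g"
  shows "ennreal ((F b - F a)\<^sup>2) \<le> ennreal (b - a) * (\<integral>\<^sup>+t. ennreal ((g t)\<^sup>2) * indicator {a..b} t \<partial>lborel)"
proof -
  have F: "has_bochner_integral lborel (\<lambda>t. g t * indicator {a..b} t) (F b - F a)"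
    using assms by (intro has_bochner_integral_FTC_Icc_real) (auto simp: continuous_on_eq_continuous_at)
  have [measurable]: "g \<in> borel_measurable borel" by (rule borel_measurable_continuous_onI[OF assms(3)])
  have i2: "integrable lborel (\<lambda>t. (g t)\<^sup>2 * indicator {a..b} t)"
  proof -
    have "set_integrable lborel {a..b} (\<lambda>t. (g t)\<^sup>2)" unfolding set_integrable_def
      by (intro borel_integrable_compact continuous_intros continuous_on_subset[OF assms(3)]) auto
    then show ?thesis by (simp add: set_integrable_def mult.commute)
  qed
  have 1: "sq_integrable lborel (\<lambda>t. g t * indicator {a..b} t)"
  proof -
    have "(\<lambda>t. (g t * indicator {a..b} t)\<^sup>2) = (\<lambda>t. (g t)\<^sup>2 * indicator {a..b} t)" by (auto simp: indicator_def)
    then show ?thesis using i2 by (simp add: sq_integrable_def)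
  qed
  have 2: "sq_integrable lborel (indicator {a..b} :: real \<Rightarrow> real)"
  proof -
    have "integrable lborel (indicator {a..b} :: real \<Rightarrow> real)"
      using assms(1) by (intro integrable_real_indicator) auto
    moreover have "(\<lambda>t. (norm (indicator {a..b} t :: real))\<^sup>2) = (indicator {a..b} :: real \<Rightarrow> real)"
      by (auto simp: indicator_def)
    ultimately show ?thesis by (simp only: sq_integrable_def) simp
  qed
  have "(F b - F a)\<^sup>2 = (LINT t|lborel. (g t * indicator {a..b} t) * indicator {a..b} t)\<^sup>2"
    using has_bochner_integral_integral_eq[OF F] by (simp add: mult.assoc flip: indicator_inter_arith)
  also have "\<dots> \<le> (LINT t|lborel. (g t * indicator {a..b} t)\<^sup>2) * (LINT t|lborel. (indicator {a..b} t)\<^sup>2)"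
    by (rule Cauchy_Schwarz_integral[OF 1 2])
  also have "(\<lambda>t. (indicator {a..b} t)\<^sup>2) = (indicator {a..b} :: real \<Rightarrow> real)" by (auto simp: indicator_def)
  also have "(\<lambda>t. (g t * indicator {a..b} t)\<^sup>2) = (\<lambda>t. (g t)\<^sup>2 * indicator {a..b} t)" by (auto simp: indicator_def)
  finally have "(F b - F a)\<^sup>2 \<le> (b - a) * (LINT t|lborel. (g t)\<^sup>2 * indicator {a..b} t)" using assms(1) by (simp add: mult.commute)
  then have "ennreal ((F b - F a)\<^sup>2) \<le> ennreal (b - a) * ennreal (LINT t|lborel. (g t)\<^sup>2 * indicator {a..b} t)"
    using assms(1) by (subst ennreal_mult[symmetric]) (auto intro: ennreal_leI)
  also have "ennreal (LINT t|lborel. (g t)\<^sup>2 * indicator {a..b} t) = (\<integral>\<^sup>+t. ennreal ((g t)\<^sup>2) * indicator {a..b} t \<partial>lborel)"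
    by (subst nn_integral_eq_integral[OF i2, symmetric]) (auto intro!: nn_integral_cong simp: indicator_def)
  finally show ?thesis .
qed

lemma C1_fun_line_derivative:
  assumes "C1_fun f G"
  shows "((\<lambda>t. f (p + t *\<^sub>R w)) has_real_derivative (G (p + t *\<^sub>R w) \<bullet> w)) (at t)"
    and "continuous_on UNIV (\<lambda>t. G (p + t *\<^sub>R w) \<bullet> w)"
proof -
  have 1: "((\<lambda>t. p + t *\<^sub>R w) has_derivative (\<lambda>h. h *\<^sub>R w)) (at t)" by (auto intro!: derivative_eq_intros)
  have "(f has_derivative (\<lambda>h. G (p + t *\<^sub>R w) \<bullet> h)) (at (p + t *\<^sub>R w))" using assms by (simp add: C1_fun_def)
  from has_derivative_compose[OF 1 this]
  show "((\<lambda>t. f (p + t *\<^sub>R w)) has_real_derivative (G (p + t *\<^sub>R w) \<bullet> w)) (at t)"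
    by (simp add: has_field_derivative_def mult_commute_abs)
  show "continuous_on UNIV (\<lambda>t. G (p + t *\<^sub>R w) \<bullet> w)"
    by (intro continuous_intros continuous_on_compose2[OF C1_fun_grad_continuous[OF assms, of UNIV]]) auto
qed

section \<open>Poincare and trace inequalities for continuously differentiable functions\<close>

text \<open>The left side is half the double integral of \<open>(f x - f y)\<^sup>2\<close> over
  \<open>S\<close>. Differences are integrated along segments, which convexity keeps inside
  \<open>S\<close>, and the line integral is then exchanged with the integral over an endpoint.
  \<open>K\<close> involves only diameter, measure and dimension.\<close>

lemma poincare_C1:
  fixes S :: "'n::euclidean_space set"
  assumes S: "open S" "convex S" "bounded S"
  obtains K where "K \<ge> 0" "\<And>f G. C1_fun f G \<Longrightarrow>
    measure lebesgue S * (LINT x|lebesgue_on S. (f x)\<^sup>2) - (LINT x|lebesgue_on S. f x)\<^sup>2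
      \<le> K * (LINT x|lebesgue_on S. (norm (G x))\<^sup>2)"
proof -
  let ?M = "lebesgue_on S"
  let ?N = "2 ^ DIM('n) :: real"
  have Sm: "S \<in> lmeasurable" and Sb[measurable]: "S \<in> sets borel" using S by (auto simp: lmeasurable_open)
  have fin: "finite_measure ?M" by (rule finite_measure_lebesgue_on[OF Sm])
  define m where "m = measure lebesgue S"
  have m0: "m \<ge> 0" by (simp add: m_def)
  have msp: "measure ?M S = m" using Sm by (simp add: m_def measure_restrict_space)
  have em: "emeasure lborel S = ennreal m"
  proof -
    have "emeasure lborel S = emeasure lebesgue S" using Sb by simp
    also have "\<dots> = ennreal m" unfolding m_def by (rule emeasure_eq_ennreal_measure) (use fmeasurableD2[OF Sm] in auto)
    finally show ?thesis .
  qed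
  define R where "R = diameter S"
  have R: "norm (x - y) \<le> R" if "x \<in> S" "y \<in> S" for x y
    unfolding R_def dist_norm[symmetric] by (rule diameter_bounded_bound[OF S(3) that])
  show thesis
  proof (rule that[of "R\<^sup>2 * (m * ?N)"])
    show "0 \<le> R\<^sup>2 * (m * ?N)" using m0 by simp
    fix f :: "'n \<Rightarrow> real" and G assume fG: "C1_fun f G"
    have fc: "continuous_on UNIV f" and Gc: "continuous_on UNIV G"
      using fG by (auto intro: C1_fun_continuous C1_fun_grad_continuous)
    have [measurable]: "f \<in> borel_measurable borel" "G \<in> borel_measurable borel"
      using fc Gc by (auto intro: borel_measurable_continuous_onI)
    have sf: "sq_integrable ?M f" "sq_integrable ?M G"
      using S by (auto intro: continuous_bounded_open_sq_integrable fc Gc)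
    have fi: "integrable ?M f" "integrable ?M (\<lambda>x. (f x)\<^sup>2)"
      using integrable_sq[OF fin sf(1)] sq_integrable_realD[OF sf(1)] by auto
    define A where "A = (LINT x|?M. f x)"
    define B where "B = (LINT x|?M. (f x)\<^sup>2)"
    define C where "C = (LINT x|?M. (norm (G x))\<^sup>2)"
    define q where "q z = ennreal ((norm (G z))\<^sup>2) * indicator S z" for z
    have [measurable]: "q \<in> borel_measurable borel" unfolding q_def by measurable
    have Q: "(\<integral>\<^sup>+z. q z \<partial>lborel) = ennreal C"
      unfolding q_def C_def using sf by (intro nn_integral_lborel_eq_lebesgue_on) (auto intro: sq_integrableD)
    have C0: "C \<ge> 0" by (simp add: C_def)
    define I where "I = (\<integral>\<^sup>+x. (\<integral>\<^sup>+y. ennreal ((f x - f y)\<^sup>2) * indicator S y \<partial>lborel) * indicator S x \<partial>lborel)"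
    have inner: "(LINT y|?M. (f x - f y)\<^sup>2) = (f x)\<^sup>2 * m - 2 * f x * A + B" for x
    proof -
      have "(LINT y|?M. (f x - f y)\<^sup>2) = (LINT y|?M. (f x)\<^sup>2 - (2 * f x) * f y + (f y)\<^sup>2)"
        by (simp add: power2_diff algebra_simps)
      also have "\<dots> = (f x)\<^sup>2 * m - 2 * f x * A + B"
        using fi fin by (simp add: A_def B_def msp finite_measure.integrable_const mult.commute)
      finally show ?thesis .
    qed
    have inner_pos: "0 \<le> (f x)\<^sup>2 * m - 2 * f x * A + B" for x
      unfolding inner[symmetric] by simp
    have "I = (\<integral>\<^sup>+x. ennreal ((f x)\<^sup>2 * m - 2 * f x * A + B) * indicator S x \<partial>lborel)"
      unfolding I_def
    proof (intro nn_integral_cong arg_cong2[where f = "(*)"] refl)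
      fix x
      have "sq_integrable ?M (\<lambda>y. f x - f y)"
        using S by (intro continuous_bounded_open_sq_integrable continuous_intros fc)
      then show "(\<integral>\<^sup>+y. ennreal ((f x - f y)\<^sup>2) * indicator S y \<partial>lborel) = ennreal ((f x)\<^sup>2 * m - 2 * f x * A + B)"
        unfolding inner[symmetric]
        by (intro nn_integral_lborel_eq_lebesgue_on) (auto intro: sq_integrable_realD)
    qed
    also have "\<dots> = ennreal (LINT x|?M. (f x)\<^sup>2 * m - 2 * f x * A + B)"
      using fi fin inner_pos by (intro nn_integral_lborel_eq_lebesgue_on) (auto simp: finite_measure.integrable_const)
    also have "(LINT x|?M. (f x)\<^sup>2 * m - 2 * f x * A + B) = 2 * (m * B - A\<^sup>2)"
      using fi fin by (simp add: A_def[symmetric] B_def[symmetric] msp finite_measure.integrable_const power2_eq_square[of A] algebra_simps)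
    finally have I1: "I = ennreal (2 * (m * B - A\<^sup>2))" .

    \<comment> \<open>Segments are cut at the midpoint. On the half next to \<open>x\<close> the
      parameter \<open>t\<close> of \<open>y + t *\<^sub>R (x - y)\<close> is at least
      \<open>1/2\<close>, so the substitution in \<open>x\<close> costs at most
      \<open>2 ^ DIM('n)\<close>; the other half gives the same integral with \<open>x\<close> and
      \<open>y\<close> exchanged.\<close>
    define J where "J = (\<integral>\<^sup>+x. (\<integral>\<^sup>+y. ennreal ((f x - f ((1/2) *\<^sub>R (x + y)))\<^sup>2) * indicator S x * indicator S y \<partial>lborel) \<partial>lborel)"
    have J': "J = (\<integral>\<^sup>+x. (\<integral>\<^sup>+y. ennreal ((f y - f ((1/2) *\<^sub>R (x + y)))\<^sup>2) * indicator S x * indicator S y \<partial>lborel) \<partial>lborel)"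
      unfolding J_def
      by (subst lborel_pair.Fubini') (simp_all add: add.commute mult.assoc mult.commute[of "indicator S _" "indicator S _"])
    have "I \<le> (\<integral>\<^sup>+x. (\<integral>\<^sup>+y. 2 * (ennreal ((f x - f ((1/2) *\<^sub>R (x + y)))\<^sup>2) * indicator S x * indicator S y)
        + 2 * (ennreal ((f y - f ((1/2) *\<^sub>R (x + y)))\<^sup>2) * indicator S x * indicator S y) \<partial>lborel) \<partial>lborel)"
      unfolding I_def
    proof (intro nn_integral_mono)
      fix x
      have "(\<integral>\<^sup>+y. ennreal ((f x - f y)\<^sup>2) * indicator S y \<partial>lborel) * indicator S x
        = (\<integral>\<^sup>+y. ennreal ((f x - f y)\<^sup>2) * indicator S y * indicator S x \<partial>lborel)"
        by (intro nn_integral_multc[symmetric]) measurable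
      also have "\<dots> \<le> (\<integral>\<^sup>+y. 2 * (ennreal ((f x - f ((1/2) *\<^sub>R (x + y)))\<^sup>2) * indicator S x * indicator S y)
        + 2 * (ennreal ((f y - f ((1/2) *\<^sub>R (x + y)))\<^sup>2) * indicator S x * indicator S y) \<partial>lborel)"
      proof (intro nn_integral_mono)
        fix y
        let ?p = "f ((1/2) *\<^sub>R (x + y))"
        have "(f x - f y)\<^sup>2 \<le> 2 * (f x - ?p)\<^sup>2 + 2 * (f y - ?p)\<^sup>2"
          using norm_add_sq_le[of "f x - ?p" "?p - f y"] by (simp add: power2_commute)
        then have "ennreal ((f x - f y)\<^sup>2) \<le> ennreal (2 * (f x - ?p)\<^sup>2 + 2 * (f y - ?p)\<^sup>2)" by (rule ennreal_leI)
        also have "\<dots> = 2 * ennreal ((f x - ?p)\<^sup>2) + 2 * ennreal ((f y - ?p)\<^sup>2)" by (simp add: ennreal_plus ennreal_mult)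
        finally show "ennreal ((f x - f y)\<^sup>2) * indicator S y * indicator S x
          \<le> 2 * (ennreal ((f x - ?p)\<^sup>2) * indicator S x * indicator S y) + 2 * (ennreal ((f y - ?p)\<^sup>2) * indicator S x * indicator S y)"
          by (auto simp: indicator_def)
      qed
      finally show "(\<integral>\<^sup>+y. ennreal ((f x - f y)\<^sup>2) * indicator S y \<partial>lborel) * indicator S x
        \<le> (\<integral>\<^sup>+y. 2 * (ennreal ((f x - f ((1/2) *\<^sub>R (x + y)))\<^sup>2) * indicator S x * indicator S y)
        + 2 * (ennreal ((f y - f ((1/2) *\<^sub>R (x + y)))\<^sup>2) * indicator S x * indicator S y) \<partial>lborel)" .
    qed
    also have "\<dots> = 2 * J + 2 * J"
      by (subst (2) J', unfold J_def) (simp add: nn_integral_add nn_integral_cmult)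
    finally have IJ: "I \<le> 2 * J + 2 * J" .

    define h where "h x y t = q (y + t *\<^sub>R (x - y)) * indicator S y * indicator {1/2..1::real} t" for x y t
    have [measurable]: "(\<lambda>(x, y, t). h x y t) \<in> borel_measurable (borel \<Otimes>\<^sub>M (borel \<Otimes>\<^sub>M borel))"
      "(\<lambda>(x, t). h x y t) \<in> borel_measurable (borel \<Otimes>\<^sub>M borel)" "(\<lambda>(x, y). \<integral>\<^sup>+t. h x y t \<partial>lborel) \<in> borel_measurable (borel \<Otimes>\<^sub>M borel)"
      "(\<lambda>(t, x). h x y t) \<in> borel_measurable (borel \<Otimes>\<^sub>M borel)" "(\<lambda>t. h x y t) \<in> borel_measurable borel" "(\<lambda>x. h x y t) \<in> borel_measurable borel"
      "(\<lambda>y. \<integral>\<^sup>+t. h x y t \<partial>lborel) \<in> borel_measurable borel" for x y t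
      unfolding h_def by measurable
    have Jpt: "ennreal ((f x - f ((1/2) *\<^sub>R (x + y)))\<^sup>2) * indicator S x * indicator S y \<le> ennreal (R\<^sup>2 / 2) * (\<integral>\<^sup>+t. h x y t \<partial>lborel)" for x y
    proof (cases "x \<in> S \<and> y \<in> S")
      case True
      define F where "F t = f (y + t *\<^sub>R (x - y))" for t
      note ld = C1_fun_line_derivative[OF fG, of y "x - y"]
      have "F 1 = f x" "F (1/2) = f ((1/2) *\<^sub>R (x + y))"
      proof -
        have "y + (1/2) *\<^sub>R (x - y) = (1/2) *\<^sub>R (x + y)"
          by (subst euclidean_eq_iff) (simp add: inner_simps field_simps)
        then show "F (1/2) = f ((1/2) *\<^sub>R (x + y))" by (simp only: F_def)
      qed (simp add: F_def)
      then have "ennreal ((f x - f ((1/2) *\<^sub>R (x + y)))\<^sup>2) = ennreal ((F 1 - F (1/2))\<^sup>2)" by simp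
      also have "\<dots> \<le> ennreal (1 - 1/2) * (\<integral>\<^sup>+t. ennreal ((G (y + t *\<^sub>R (x - y)) \<bullet> (x - y))\<^sup>2) * indicator {1/2..1} t \<partial>lborel)"
        unfolding F_def by (rule increment_sq_le[OF _ ld]) auto
      also have "\<dots> \<le> ennreal (1 - 1/2) * (\<integral>\<^sup>+t. ennreal (R\<^sup>2) * h x y t \<partial>lborel)"
      proof (intro mult_left_mono nn_integral_mono)
        fix t :: real
        show "ennreal ((G (y + t *\<^sub>R (x - y)) \<bullet> (x - y))\<^sup>2) * indicator {1/2..1} t \<le> ennreal (R\<^sup>2) * h x y t"
        proof (cases "t \<in> {1/2..1}")
          case t: True
          have z: "y + t *\<^sub>R (x - y) \<in> S"
            using convexD[OF S(2), of y x "1 - t" t] True t by (simp add: algebra_simps)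
          let ?g = "G (y + t *\<^sub>R (x - y))"
          have "\<bar>?g \<bullet> (x - y)\<bar> \<le> norm ?g * R"
            using Cauchy_Schwarz_ineq2[of ?g "x - y"] R[of x y] True by (meson mult_left_mono norm_ge_zero order_trans)
          then have "\<bar>?g \<bullet> (x - y)\<bar>\<^sup>2 \<le> (norm ?g * R)\<^sup>2" by (intro power_mono) auto
          then have "(?g \<bullet> (x - y))\<^sup>2 \<le> R\<^sup>2 * (norm ?g)\<^sup>2" by (simp add: power_mult_distrib mult.commute)
          then have "ennreal ((?g \<bullet> (x - y))\<^sup>2) \<le> ennreal (R\<^sup>2) * ennreal ((norm ?g)\<^sup>2)"
            by (subst ennreal_mult[symmetric]) (auto intro: ennreal_leI)
          then show ?thesis using z True t by (simp add: h_def q_def)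
        qed simp
      qed auto
      also have "\<dots> = ennreal (1 - 1/2) * (ennreal (R\<^sup>2) * (\<integral>\<^sup>+t. h x y t \<partial>lborel))"
        by (subst nn_integral_cmult) measurable
      also have "\<dots> = ennreal (R\<^sup>2 / 2) * (\<integral>\<^sup>+t. h x y t \<partial>lborel)"
        by (subst mult.assoc[symmetric], subst ennreal_mult[symmetric]) auto
      finally show ?thesis using True by simp
    qed auto
    have "J \<le> (\<integral>\<^sup>+x. (\<integral>\<^sup>+y. ennreal (R\<^sup>2 / 2) * (\<integral>\<^sup>+t. h x y t \<partial>lborel) \<partial>lborel) \<partial>lborel)"
      unfolding J_def by (intro nn_integral_mono Jpt)
    also have "\<dots> = ennreal (R\<^sup>2 / 2) * (\<integral>\<^sup>+x. (\<integral>\<^sup>+y. (\<integral>\<^sup>+t. h x y t \<partial>lborel) \<partial>lborel) \<partial>lborel)"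
      by (simp add: nn_integral_cmult)
    finally have J1: "J \<le> ennreal (R\<^sup>2 / 2) * (\<integral>\<^sup>+x. (\<integral>\<^sup>+y. (\<integral>\<^sup>+t. h x y t \<partial>lborel) \<partial>lborel) \<partial>lborel)" .
    have "(\<integral>\<^sup>+x. (\<integral>\<^sup>+y. (\<integral>\<^sup>+t. h x y t \<partial>lborel) \<partial>lborel) \<partial>lborel) = (\<integral>\<^sup>+y. (\<integral>\<^sup>+x. (\<integral>\<^sup>+t. h x y t \<partial>lborel) \<partial>lborel) \<partial>lborel)"
      by (rule lborel_pair.Fubini'[symmetric]) measurable
    also have "\<dots> = (\<integral>\<^sup>+y. (\<integral>\<^sup>+t. (\<integral>\<^sup>+x. h x y t \<partial>lborel) \<partial>lborel) \<partial>lborel)"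
      by (intro nn_integral_cong lborel_pair.Fubini'[symmetric]) measurable
    also have "\<dots> \<le> (\<integral>\<^sup>+y. (\<integral>\<^sup>+t. (ennreal (?N * C) * indicator S y) * indicator {1/2..1::real} t \<partial>lborel) \<partial>lborel)"
    proof (intro nn_integral_mono)
      fix y :: 'n and t :: real
      show "(\<integral>\<^sup>+x. h x y t \<partial>lborel) \<le> (ennreal (?N * C) * indicator S y) * indicator {1/2..1::real} t"
      proof (cases "y \<in> S \<and> t \<in> {1/2..1}")
        case True
        then have t: "1/2 \<le> t" "t \<noteq> 0" "\<bar>t\<bar> = t" by auto
        let ?X = "\<integral>\<^sup>+x. q (y + t *\<^sub>R (x - y)) \<partial>lborel"
        have "ennreal C = ennreal (\<bar>t\<bar> ^ DIM('n)) * (\<integral>\<^sup>+x. q ((1 - t) *\<^sub>R y + t *\<^sub>R x) \<partial>lborel)"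
          unfolding Q[symmetric] by (rule lborel_nn_integral_affine) (use t in auto)
        also have "(\<integral>\<^sup>+x. q ((1 - t) *\<^sub>R y + t *\<^sub>R x) \<partial>lborel) = ?X"
          by (intro nn_integral_cong) (simp add: algebra_simps)
        finally have X: "ennreal C = ennreal (t ^ DIM('n)) * ?X" unfolding t .
        have "ennreal 1 \<le> ennreal (?N * t ^ DIM('n))"
          unfolding power_mult_distrib[symmetric] using t by (intro ennreal_leI one_le_power) auto
        then have "?X * 1 \<le> ?X * ennreal (?N * t ^ DIM('n))" by (intro mult_left_mono) auto
        also have "\<dots> = ennreal ?N * ennreal C" unfolding X using t by (simp add: ennreal_mult ac_simps)
        also have "\<dots> = ennreal (?N * C)" using C0 by (simp add: ennreal_mult)
        finally show ?thesis using True by (simp add: h_def)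
      qed (auto simp: h_def)
    qed
    also have "\<dots> = (\<integral>\<^sup>+y. (ennreal (?N * C) * indicator S y) * ennreal (1/2) \<partial>lborel)"
      by (intro nn_integral_cong, subst nn_integral_cmult) auto
    also have "\<dots> = ennreal (?N * C) * ennreal m * ennreal (1/2)"
      by (subst nn_integral_multc, simp, subst nn_integral_cmult) (auto simp: em)
    also have "\<dots> = ennreal (?N * C * m * (1/2))"
    proof -
      have p: "0 \<le> ?N * C" "0 \<le> ?N * C * m" using C0 m0 by auto
      show ?thesis
        using ennreal_mult[OF p(2), of "1/2"] ennreal_mult[OF p(1) m0] by simp
    qed
    finally have "(\<integral>\<^sup>+x. (\<integral>\<^sup>+y. (\<integral>\<^sup>+t. h x y t \<partial>lborel) \<partial>lborel) \<partial>lborel) \<le> ennreal (?N * C * m * (1/2))" .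
    then have "ennreal (R\<^sup>2 / 2) * (\<integral>\<^sup>+x. (\<integral>\<^sup>+y. (\<integral>\<^sup>+t. h x y t \<partial>lborel) \<partial>lborel) \<partial>lborel) \<le> ennreal (R\<^sup>2 / 2) * ennreal (?N * C * m * (1/2))"
      by (rule mult_left_mono) simp
    note order_trans[OF J1 this]
    also have "\<dots> = ennreal (R\<^sup>2 / 2 * (?N * C * m * (1/2)))"
      using C0 m0 by (intro ennreal_mult[symmetric]) auto
    finally have J2: "J \<le> ennreal (R\<^sup>2 / 2 * (?N * C * m * (1/2)))" .
    define z where "z = R\<^sup>2 / 2 * (?N * C * m * (1/2))"
    have z0: "z \<ge> 0" using C0 m0 by (simp add: z_def)
    have "ennreal (2 * (m * B - A\<^sup>2)) \<le> 2 * J + 2 * J" using IJ unfolding I1 .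
    also have "\<dots> \<le> 2 * ennreal z + 2 * ennreal z"
      using J2 unfolding z_def by (intro add_mono mult_left_mono) auto
    also have "\<dots> = ennreal (2 * z + 2 * z)"
    proof -
      have "2 * ennreal z = ennreal (2 * z)" using z0 by (simp add: ennreal_mult)
      then show ?thesis using z0 ennreal_plus[of "2 * z" "2 * z"] by simp
    qed
    finally have "2 * (m * B - A\<^sup>2) \<le> 2 * z + 2 * z"
      using z0 by (subst (asm) ennreal_le_iff) auto
    also have "\<dots> \<le> 2 * (R\<^sup>2 * (m * ?N) * C)" using C0 m0 by (simp add: z_def algebra_simps)
    finally have "m * B - A\<^sup>2 \<le> R\<^sup>2 * (m * ?N) * C" by simp
    then show "measure lebesgue S * (LINT x|?M. (f x)\<^sup>2) - (LINT x|?M. f x)\<^sup>2 \<le> R\<^sup>2 * (m * ?N) * (LINT x|?M. (norm (G x))\<^sup>2)"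
      by (simp add: A_def B_def C_def m_def)
  qed
qed

text \<open>\<open>f (x, 0)\<close> differs from \<open>f (x, y)\<close> by an integral of the
  gradient over \<open>{0..y}\<close>. Squaring and averaging over \<open>y\<close> gives the
  weights \<open>2 / L\<close> for the function and \<open>2 * L\<close> for the gradient, which are
  added to obtain one constant.\<close>

lemma trace_inequality_C1:
  fixes \<omega> :: "'a::euclidean_space set"
  assumes \<omega>: "open \<omega>" "bounded \<omega>" and L: "L > 0" and fG: "C1_fun f G"
  defines "\<Omega> \<equiv> \<omega> \<times> {0<..<L}"
  shows "(LINT x|lebesgue_on \<omega>. (f (x, 0))\<^sup>2)
    \<le> (2 / L + 2 * L) * ((LINT z|lebesgue_on \<Omega>. (f z)\<^sup>2) + (LINT z|lebesgue_on \<Omega>. (norm (G z))\<^sup>2))"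
proof -
  have \<Omega>: "open \<Omega>" "bounded \<Omega>" using \<omega> by (auto simp: \<Omega>_def open_Times bounded_Times)
  have [measurable]: "\<omega> \<in> sets borel" "\<Omega> \<in> sets borel" using \<omega> \<Omega> by auto
  have fc: "continuous_on A f" and Gc: "continuous_on A G" for A
    using fG by (auto intro: C1_fun_continuous C1_fun_grad_continuous)
  have [measurable]: "f \<in> borel_measurable borel" "G \<in> borel_measurable borel"
    using fc Gc by (auto intro: borel_measurable_continuous_onI)
  have [measurable]: "(\<lambda>(x,y). f (x,y)) \<in> borel_measurable (borel \<Otimes>\<^sub>M borel)" "(\<lambda>(x,y). G (x,y)) \<in> borel_measurable (borel \<Otimes>\<^sub>M borel)"
    by (simp_all add: borel_prod)
  have sf: "sq_integrable (lebesgue_on \<Omega>) f" "sq_integrable (lebesgue_on \<Omega>) G"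
    using \<Omega> fc Gc by (auto intro: continuous_bounded_open_sq_integrable)
  have s0: "sq_integrable (lebesgue_on \<omega>) (\<lambda>x. f (x, 0))"
    using \<omega> by (intro continuous_bounded_open_sq_integrable continuous_on_compose2[OF fc[of UNIV]] continuous_intros) auto
  define B where "B = (LINT z|lebesgue_on \<Omega>. (f z)\<^sup>2)"
  define C where "C = (LINT z|lebesgue_on \<Omega>. (norm (G z))\<^sup>2)"
  have BC0: "0 \<le> B" "0 \<le> C" by (auto simp: B_def C_def)
  have fm[measurable]: "(\<lambda>x. f (x, y)) \<in> borel_measurable borel" "(\<lambda>y. f (x, y)) \<in> borel_measurable borel"
     "(\<lambda>y. G (x, y)) \<in> borel_measurable borel" for x y
    by (auto intro!: borel_measurable_continuous_onI continuous_on_compose2[OF fc[of UNIV]] continuous_on_compose2[OF Gc[of UNIV]] continuous_intros)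
  have nn: "(\<integral>\<^sup>+x. (\<integral>\<^sup>+y. ennreal (g (x,y)) * indicator {0<..<L} y \<partial>lborel) * indicator \<omega> x \<partial>lborel) = ennreal (LINT z|lebesgue_on \<Omega>. g z)"
    if g: "g \<in> borel_measurable borel" "\<And>z. 0 \<le> g z" "integrable (lebesgue_on \<Omega>) g" for g :: "'a \<times> real \<Rightarrow> real"
  proof -
    have gm[measurable]: "g \<in> borel_measurable (borel \<Otimes>\<^sub>M borel)" using g(1) by (simp add: borel_prod)
    have "ennreal (LINT z|lebesgue_on \<Omega>. g z) = (\<integral>\<^sup>+z. ennreal (g z) * indicator \<Omega> z \<partial>(lborel \<Otimes>\<^sub>M lborel))"
      using nn_integral_lborel_eq_lebesgue_on[OF _ g(1,2,3)] by (simp add: lborel_prod)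
    also have "\<dots> = (\<integral>\<^sup>+x. (\<integral>\<^sup>+y. ennreal (g (x,y)) * indicator \<Omega> (x,y) \<partial>lborel) \<partial>lborel)"
      unfolding \<Omega>_def by (rule lborel.nn_integral_fst[symmetric]) measurable
    also have "\<dots> = (\<integral>\<^sup>+x. (\<integral>\<^sup>+y. ennreal (g (x,y)) * indicator {0<..<L} y \<partial>lborel) * indicator \<omega> x \<partial>lborel)"
    proof (intro nn_integral_cong)
      fix x
      have "(\<integral>\<^sup>+y. ennreal (g (x,y)) * indicator {0<..<L} y \<partial>lborel) * indicator \<omega> x
        = (\<integral>\<^sup>+y. ennreal (g (x,y)) * indicator {0<..<L} y * indicator \<omega> x \<partial>lborel)"
        by (intro nn_integral_multc[symmetric]) measurable
      then show "(\<integral>\<^sup>+y. ennreal (g (x,y)) * indicator \<Omega> (x,y) \<partial>lborel) = (\<integral>\<^sup>+y. ennreal (g (x,y)) * indicator {0<..<L} y \<partial>lborel) * indicator \<omega> x"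
        by (simp add: \<Omega>_def indicator_times mult_ac)
    qed
    finally show ?thesis ..
  qed
  define P where "P x = (\<integral>\<^sup>+y. ennreal ((f (x,y))\<^sup>2) * indicator {0<..<L} y \<partial>lborel)" for x
  define Q where "Q x = (\<integral>\<^sup>+y. ennreal ((norm (G (x,y)))\<^sup>2) * indicator {0<..<L} y \<partial>lborel)" for x
  have [measurable]: "P \<in> borel_measurable borel" "Q \<in> borel_measurable borel"
    unfolding P_def Q_def by measurable
  have PQ: "(\<integral>\<^sup>+x. P x * indicator \<omega> x \<partial>lborel) = ennreal B" "(\<integral>\<^sup>+x. Q x * indicator \<omega> x \<partial>lborel) = ennreal C"
    unfolding P_def Q_def B_def C_def using sf by (auto intro!: nn sq_integrable_realD sq_integrableD(2))
  have pt: "ennreal ((f (x,0))\<^sup>2) \<le> 2 * ennreal ((f (x,y))\<^sup>2) + ennreal (2 * L) * Q x" if y: "y \<in> {0<..<L}" for x y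
  proof -
    define F where "F s = f ((x, 0) + s *\<^sub>R (0, 1))" for s
    note ld = C1_fun_line_derivative[OF fG, of "(x,0)" "(0,1)"]
    have "ennreal ((F y - F 0)\<^sup>2) \<le> ennreal (y - 0) * (\<integral>\<^sup>+t. ennreal ((G ((x,0) + t *\<^sub>R (0, 1)) \<bullet> (0, 1))\<^sup>2) * indicator {0..y} t \<partial>lborel)"
      unfolding F_def by (rule increment_sq_le[OF _ ld]) (use y in auto)
    also have "\<dots> \<le> ennreal L * Q x"
      unfolding Q_def
    proof (intro mult_mono nn_integral_mono_AE)
      show "AE t in lborel. ennreal ((G ((x,0) + t *\<^sub>R (0, 1)) \<bullet> (0, 1))\<^sup>2) * indicator {0..y} t
        \<le> ennreal ((norm (G (x,t)))\<^sup>2) * indicator {0<..<L} t"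
        using AE_lborel_singleton[of "0::real"]
      proof (rule eventually_mono)
        fix t :: real assume t: "t \<noteq> 0"
        have "\<bar>G (x,t) \<bullet> (0, 1)\<bar> \<le> norm (G (x,t))"
          using Cauchy_Schwarz_ineq2[of "G (x,t)" "(0,1)"] by (simp add: norm_Pair)
        then have "\<bar>G (x,t) \<bullet> (0, 1)\<bar>\<^sup>2 \<le> (norm (G (x,t)))\<^sup>2" by (intro power_mono) auto
        then have "ennreal ((G (x,t) \<bullet> (0, 1))\<^sup>2) \<le> ennreal ((norm (G (x,t)))\<^sup>2)" by (intro ennreal_leI) simp
        then show "ennreal ((G ((x,0) + t *\<^sub>R (0, 1)) \<bullet> (0, 1))\<^sup>2) * indicator {0..y} t
          \<le> ennreal ((norm (G (x,t)))\<^sup>2) * indicator {0<..<L} t"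
          using y t by (auto simp: indicator_def)
      qed
    qed (use y in \<open>auto intro: ennreal_leI\<close>)
    finally have 1: "ennreal ((f (x,y) - f (x,0))\<^sup>2) \<le> ennreal L * Q x" by (simp add: F_def)
    have "(f (x,0))\<^sup>2 \<le> 2 * (f (x,y))\<^sup>2 + 2 * (f (x,y) - f (x,0))\<^sup>2"
      using norm_add_sq_le[of "f (x,y)" "f (x,0) - f (x,y)"] by (simp add: power2_commute)
    then have "ennreal ((f (x,0))\<^sup>2) \<le> ennreal (2 * (f (x,y))\<^sup>2 + 2 * (f (x,y) - f (x,0))\<^sup>2)" by (rule ennreal_leI)
    also have "\<dots> = 2 * ennreal ((f (x,y))\<^sup>2) + 2 * ennreal ((f (x,y) - f (x,0))\<^sup>2)" by (simp add: ennreal_plus ennreal_mult)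
    also have "\<dots> \<le> 2 * ennreal ((f (x,y))\<^sup>2) + 2 * (ennreal L * Q x)" using 1 by (intro add_left_mono mult_left_mono) auto
    also have "\<dots> = 2 * ennreal ((f (x,y))\<^sup>2) + ennreal (2 * L) * Q x" using L by (simp add: ennreal_mult mult.assoc)
    finally show ?thesis .
  qed
  have pt2: "ennreal L * ennreal ((f (x,0))\<^sup>2) \<le> 2 * P x + ennreal (2 * L * L) * Q x" for x
  proof -
    have "ennreal ((f (x,0))\<^sup>2) * ennreal L = (\<integral>\<^sup>+y. ennreal ((f (x,0))\<^sup>2) * indicator {0<..<L} y \<partial>lborel)"
      using L by (simp add: nn_integral_cmult_indicator)
    also have "\<dots> \<le> (\<integral>\<^sup>+y. 2 * (ennreal ((f (x,y))\<^sup>2) * indicator {0<..<L} y) + (ennreal (2 * L) * Q x) * indicator {0<..<L} y \<partial>lborel)"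
      using pt by (intro nn_integral_mono) (auto simp: indicator_def)
    also have "\<dots> = 2 * P x + (ennreal (2 * L) * Q x) * ennreal L"
      using L by (simp add: nn_integral_add nn_integral_cmult nn_integral_cmult_indicator P_def)
    also have "(ennreal (2 * L) * Q x) * ennreal L = ennreal (2 * L * L) * Q x"
      using L by (simp add: ennreal_mult mult_ac)
    finally show ?thesis by (simp add: mult.commute)
  qed
  define A where "A = (LINT x|lebesgue_on \<omega>. (f (x, 0))\<^sup>2)"
  have A: "(\<integral>\<^sup>+x. ennreal ((f (x,0))\<^sup>2) * indicator \<omega> x \<partial>lborel) = ennreal A"
    unfolding A_def using s0 by (intro nn_integral_lborel_eq_lebesgue_on) (auto intro: sq_integrable_realD)
  have "ennreal (L * A) = ennreal L * (\<integral>\<^sup>+x. ennreal ((f (x,0))\<^sup>2) * indicator \<omega> x \<partial>lborel)"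
    unfolding A using L by (simp add: ennreal_mult A_def)
  also have "\<dots> = (\<integral>\<^sup>+x. ennreal L * (ennreal ((f (x,0))\<^sup>2) * indicator \<omega> x) \<partial>lborel)"
    by (rule nn_integral_cmult[symmetric]) measurable
  also have "\<dots> \<le> (\<integral>\<^sup>+x. 2 * (P x * indicator \<omega> x) + ennreal (2 * L * L) * (Q x * indicator \<omega> x) \<partial>lborel)"
    using pt2 by (intro nn_integral_mono) (auto simp: indicator_def)
  also have "\<dots> = 2 * ennreal B + ennreal (2 * L * L) * ennreal C"
    by (simp add: nn_integral_add nn_integral_cmult PQ)
  also have "\<dots> = ennreal (2 * B + 2 * L * L * C)"
    using BC0 L by (simp add: ennreal_plus ennreal_mult)
  finally have "L * A \<le> 2 * B + 2 * L * L * C"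
    using BC0 L by (subst (asm) ennreal_le_iff) auto
  then have "A \<le> (2 / L) * B + (2 * L) * C" using L by (simp add: field_simps)
  also have "\<dots> \<le> (2 / L + 2 * L) * B + (2 / L + 2 * L) * C"
    using BC0 L by (intro add_mono mult_right_mono) auto
  finally show ?thesis by (simp add: A_def B_def C_def distrib_left)
qed

section \<open>Chain rule and traces in the Sobolev space\<close>

locale bounded_convex =
  fixes S :: "'n::euclidean_space set"
  assumes op: "open S" and cv: "convex S" and bd: "bounded S" and ne: "S \<noteq> {}"
begin

abbreviation "M \<equiv> lebesgue_on S"

lemma Sm: "S \<in> lmeasurable" and Sb: "S \<in> sets borel"
  using op bd by (auto simp: lmeasurable_open)

lemma fin: "finite_measure M" by (rule finite_measure_lebesgue_on[OF Sm])

lemma measure_space_eq: "measure M S = measure lebesgue S"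
  using Sm by (simp add: measure_restrict_space)

lemma measure_pos: "measure lebesgue S > 0"
proof -
  obtain x r where r: "r > 0" "ball x r \<subseteq> S" using op ne open_contains_ball[of S] by blast
  have "0 < measure lebesgue (ball x r)" using content_ball_pos[OF r(1)] by simp
  also have "\<dots> \<le> measure lebesgue S" using r Sm by (intro measure_mono_fmeasurable) auto
  finally show ?thesis .
qed

lemma sq_continuous: "continuous_on UNIV (g :: 'n \<Rightarrow> 'b::euclidean_space) \<Longrightarrow> sq_integrable M g"
  by (rule continuous_bounded_open_sq_integrable[OF bd op])

lemma sq_bounded:
  fixes f :: "'n \<Rightarrow> real"
  assumes "f \<in> borel_measurable M" "AE x in M. l \<le> f x \<and> f x \<le> u"
  shows "sq_integrable M f"
proof (rule sq_integrable_bounded[OF fin assms(1)])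
  show "AE x in M. norm (f x) \<le> \<bar>l\<bar> + \<bar>u\<bar>"
    using assms(2) by (rule eventually_mono) auto
qed

text \<open>The bounds hold at every point of \<open>S\<close>, so that they survive the passage to
  the boundary by continuity; convergence almost everywhere is included for the sake of nonlinear
  compositions.\<close>

definition approximates ::
  "real \<Rightarrow> real \<Rightarrow> (nat \<Rightarrow> 'n \<Rightarrow> real) \<Rightarrow> ('n \<Rightarrow> real) \<Rightarrow> ('n \<Rightarrow> 'n) \<Rightarrow> bool" where
  "approximates l u F f g \<longleftrightarrow> (\<forall>n. smooth (F n)) \<and> (\<forall>n. \<forall>x\<in>S. l \<le> F n x \<and> F n x \<le> u) \<and>
     l2_tendsto M F f \<and> l2_tendsto M (\<lambda>n. grad (F n)) g \<and> (AE x in M. (\<lambda>n. F n x) \<longlonglongrightarrow> f x)"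

lemma approximation_exists:
  assumes f: "sq_integrable M f" and g: "has_weak_gradient S f g" and b: "AE x in M. l \<le> f x \<and> f x \<le> u"
  obtains F where "approximates l u F f g"
proof -
  obtain F where F: "\<forall>n. smooth (F n)" "l2_tendsto M F f" "l2_tendsto M (\<lambda>n. grad (F n)) g"
    "\<forall>n. \<forall>x\<in>S. l \<le> F n x \<and> F n x \<le> u"
    by (rule H1_smooth_approximation[OF op cv bd ne f g b])
  obtain r where r: "strict_mono r" "AE x in M. (\<lambda>n. F (r n) x) \<longlonglongrightarrow> f x" by (rule l2_tendsto_AE_subseq[OF F(2)])
  have "\<forall>n. \<forall>x\<in>S. l \<le> F (r n) x \<and> F (r n) x \<le> u" "\<forall>n. smooth (F (r n))" using F(1,4) by blast+
  then have "approximates l u (\<lambda>n. F (r n)) f g"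
    unfolding approximates_def
    by (intro conjI l2_tendsto_subseq[OF F(2) r(1)] l2_tendsto_subseq[OF F(3) r(1)] r(2))
  then show thesis by (rule that)
qed

lemma approximates_bounds:
  assumes "approximates l u F f g"
  shows "AE x in M. l \<le> f x \<and> f x \<le> u"
proof -
  have "AE x in M. x \<in> S" by (intro AE_I2) auto
  moreover have "AE x in M. (\<lambda>n. F n x) \<longlonglongrightarrow> f x" using assms by (simp add: approximates_def)
  ultimately show ?thesis
  proof eventually_elim
    case (elim x)
    have "\<forall>n. l \<le> F n x \<and> F n x \<le> u" using assms elim(1) by (simp add: approximates_def)
    then show ?case using elim(2) by (auto intro: LIMSEQ_le_const LIMSEQ_le_const2)
  qed
qed

lemma compose_continuous_bound:
  fixes \<phi> :: "real \<Rightarrow> real"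
  assumes "continuous_on UNIV \<phi>"
  obtains K where "K \<ge> 0" "\<And>s. l \<le> s \<Longrightarrow> s \<le> u \<Longrightarrow> \<bar>\<phi> s\<bar> \<le> K"
proof -
  have "bounded (\<phi> ` {l..u})"
    by (intro compact_imp_bounded compact_continuous_image continuous_on_subset[OF assms]) auto
  then obtain K where "\<forall>s\<in>{l..u}. \<bar>\<phi> s\<bar> \<le> K" by (auto simp: bounded_iff)
  then show thesis by (intro that[of "max K 0"]) force+
qed

text \<open>\<open>\<phi>'\<close> need not be bounded on the line. Only values between
  \<open>l\<close> and \<open>u\<close> occur, and compactness of that interval supplies the bound.
  Besides the chain rule, this yields C1 approximations of the composition.\<close>

lemma chain_approximation:
  fixes \<phi> :: "real \<Rightarrow> real"
  assumes A: "approximates l u F f g" and \<phi>: "\<And>s. (\<phi> has_real_derivative \<phi>' s) (at s)" "continuous_on UNIV \<phi>'"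
  shows "C1_fun (\<lambda>x. \<phi> (F n x)) (\<lambda>x. \<phi>' (F n x) *\<^sub>R grad (F n) x)"
    and "l2_tendsto M (\<lambda>n x. \<phi> (F n x)) (\<lambda>x. \<phi> (f x))"
    and "l2_tendsto M (\<lambda>n x. \<phi>' (F n x) *\<^sub>R grad (F n) x) (\<lambda>x. \<phi>' (f x) *\<^sub>R g x)"
    and "has_weak_gradient S (\<lambda>x. \<phi> (f x)) (\<lambda>x. \<phi>' (f x) *\<^sub>R g x)"
    and "sq_integrable M (\<lambda>x. \<phi> (f x))"
proof -
  have Fs: "\<And>n. smooth (F n)" and Fb: "\<And>n x. x \<in> S \<Longrightarrow> l \<le> F n x \<and> F n x \<le> u"
    and L: "l2_tendsto M F f" "l2_tendsto M (\<lambda>n. grad (F n)) g" and ae: "AE x in M. (\<lambda>n. F n x) \<longlonglongrightarrow> f x"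
    using A by (auto simp: approximates_def)
  have \<phi>c: "continuous_on UNIV \<phi>" using \<phi>(1) by (meson DERIV_continuous_on has_field_derivative_at_within)
  have \<phi>m: "\<phi> \<in> borel_measurable borel" "\<phi>' \<in> borel_measurable borel"
    using \<phi>c \<phi>(2) by (auto intro: borel_measurable_continuous_onI)
  show C1: "C1_fun (\<lambda>x. \<phi> (F n x)) (\<lambda>x. \<phi>' (F n x) *\<^sub>R grad (F n) x)" for n
    by (rule C1_fun_compose[OF C1_fun_smooth[OF Fs] \<phi>])
  obtain K where K: "K \<ge> 0" "\<And>s. l \<le> s \<Longrightarrow> s \<le> u \<Longrightarrow> \<bar>\<phi> s\<bar> \<le> K" using compose_continuous_bound[OF \<phi>c] by metis
  obtain K' where K': "K' \<ge> 0" "\<And>s. l \<le> s \<Longrightarrow> s \<le> u \<Longrightarrow> \<bar>\<phi>' s\<bar> \<le> K'" using compose_continuous_bound[OF \<phi>(2)] by metis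
  have Fm: "F n \<in> borel_measurable M" "f \<in> borel_measurable M" for n
    using l2_tendstoD(1,2)[OF L(1)] by (auto intro: sq_integrableD(1))
  have m: "(\<lambda>x. \<phi> (F n x)) \<in> borel_measurable M" "(\<lambda>x. \<phi> (f x)) \<in> borel_measurable M"
    "(\<lambda>x. \<phi>' (F n x)) \<in> borel_measurable M" "(\<lambda>x. \<phi>' (f x)) \<in> borel_measurable M" for n
    using measurable_compose[OF Fm(1) \<phi>m(1)] measurable_compose[OF Fm(2) \<phi>m(1)]
      measurable_compose[OF Fm(1) \<phi>m(2)] measurable_compose[OF Fm(2) \<phi>m(2)] by auto
  have lim: "AE x in M. (\<lambda>n. \<psi> (F n x)) \<longlonglongrightarrow> \<psi> (f x)" if "continuous_on UNIV \<psi>" for \<psi> :: "real \<Rightarrow> real"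
    using ae
  proof (rule eventually_mono)
    fix x assume "(\<lambda>n. F n x) \<longlonglongrightarrow> f x"
    then show "(\<lambda>n. \<psi> (F n x)) \<longlonglongrightarrow> \<psi> (f x)"
      using that by (intro isCont_tendsto_compose[of "f x" \<psi>]) (simp_all add: continuous_on_eq_continuous_at)
  qed
  have sK: "sq_integrable M (\<lambda>x. K)" by (intro sq_continuous continuous_intros)
  show v: "l2_tendsto M (\<lambda>n x. \<phi> (F n x)) (\<lambda>x. \<phi> (f x))"
  proof (rule l2_tendsto_dominated[OF m(1,2) sK _ lim[OF \<phi>c]])
    show "AE x in M. norm (\<phi> (F n x)) \<le> norm K" for n using K Fb by (intro AE_I2) auto
  qed
  show gr: "l2_tendsto M (\<lambda>n x. \<phi>' (F n x) *\<^sub>R grad (F n) x) (\<lambda>x. \<phi>' (f x) *\<^sub>R g x)"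
  proof (rule l2_tendsto_scaleR_bounded[OF L(2) m(3,4) _ lim[OF \<phi>(2)]])
    show "AE x in M. \<bar>\<phi>' (F n x)\<bar> \<le> K'" for n using K' Fb by (intro AE_I2) auto
  qed
  show "has_weak_gradient S (\<lambda>x. \<phi> (f x)) (\<lambda>x. \<phi>' (f x) *\<^sub>R g x)"
    by (rule has_weak_gradient_limit[OF op bd v gr C1_has_weak_gradient[OF op bd C1]])
  show "sq_integrable M (\<lambda>x. \<phi> (f x))" by (rule l2_tendstoD(2)[OF v])
qed

lemma l2_tendsto_integral:
  assumes "l2_tendsto M F (f :: 'n \<Rightarrow> real)"
  shows "(\<lambda>n. LINT x|M. F n x) \<longlonglongrightarrow> (LINT x|M. f x)"
proof -
  have "sq_integrable M (\<lambda>x. 1::real)" by (intro sq_continuous continuous_intros)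
  from l2_tendsto_inner[OF assms l2_tendsto_const[OF this]] show ?thesis by simp
qed

text \<open>Stated for limits of C1 pairs because it is applied to powers of the solution, for which
  \<open>chain_approximation\<close> provides approximations of class C1.\<close>

lemma poincare:
  obtains K where "K \<ge> 0" "\<And>F G f g. (\<And>n. C1_fun (F n) (G n)) \<Longrightarrow> l2_tendsto M F f \<Longrightarrow> l2_tendsto M G g \<Longrightarrow>
    (LINT x|M. (f x - (LINT x|M. f x) / measure lebesgue S)\<^sup>2) \<le> K * (LINT x|M. (norm (g x))\<^sup>2)"
proof -
  let ?m = "measure lebesgue S"
  obtain K where K: "K \<ge> 0" "\<And>f G. C1_fun f G \<Longrightarrow>
    ?m * (LINT x|M. (f x)\<^sup>2) - (LINT x|M. f x)\<^sup>2 \<le> K * (LINT x|M. (norm (G x))\<^sup>2)"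
    using poincare_C1[OF op cv bd] by metis
  show thesis
  proof (rule that[of "K / ?m"])
    show "K / ?m \<ge> 0" using K measure_pos by simp
    fix F G and f :: "'n \<Rightarrow> real" and g :: "'n \<Rightarrow> 'n"
    assume C1: "\<And>n. C1_fun (F n) (G n)" and F: "l2_tendsto M F f" and G: "l2_tendsto M G g"
    have 1: "(\<lambda>n. ?m * (LINT x|M. (F n x)\<^sup>2) - (LINT x|M. F n x)\<^sup>2) \<longlonglongrightarrow> ?m * (LINT x|M. (f x)\<^sup>2) - (LINT x|M. f x)\<^sup>2"
    proof (intro tendsto_diff tendsto_mult tendsto_const tendsto_power l2_tendsto_integral[OF F])
      show "(\<lambda>n. LINT x|M. (F n x)\<^sup>2) \<longlonglongrightarrow> (LINT x|M. (f x)\<^sup>2)" using l2_tendsto_norm_sq[OF F] by simp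
    qed
    have 2: "(\<lambda>n. K * (LINT x|M. (norm (G n x))\<^sup>2)) \<longlonglongrightarrow> K * (LINT x|M. (norm (g x))\<^sup>2)"
      by (intro tendsto_intros l2_tendsto_norm_sq G)
    have 3: "?m * (LINT x|M. (f x)\<^sup>2) - (LINT x|M. f x)\<^sup>2 \<le> K * (LINT x|M. (norm (g x))\<^sup>2)"
      by (rule LIMSEQ_le[OF 1 2]) (use K(2)[OF C1] in auto)
    define a where "a = (LINT x|M. f x)"
    have sf: "sq_integrable M f" by (rule l2_tendstoD(2)[OF F])
    have i: "integrable M f" "integrable M (\<lambda>x. (f x)\<^sup>2)"
      using integrable_sq[OF fin sf] sq_integrable_realD[OF sf] by auto
    have "(LINT x|M. (f x - a / ?m)\<^sup>2) = (LINT x|M. (f x)\<^sup>2 - 2 * (a / ?m) * f x + (a / ?m)\<^sup>2)"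
      by (simp add: power2_diff algebra_simps)
    also have "\<dots> = (LINT x|M. (f x)\<^sup>2) - 2 * (a / ?m) * a + (a / ?m)\<^sup>2 * ?m"
      using i fin by (simp add: a_def finite_measure.integrable_const measure_space_eq mult.commute)
    also have "\<dots> = (?m * (LINT x|M. (f x)\<^sup>2) - a\<^sup>2) / ?m"
      using measure_pos by (simp add: field_simps power2_eq_square)
    also have "\<dots> \<le> (K * (LINT x|M. (norm (g x))\<^sup>2)) / ?m"
      using 3 measure_pos unfolding a_def by (intro divide_right_mono) auto
    finally show "(LINT x|M. (f x - (LINT x|M. f x) / ?m)\<^sup>2) \<le> K / ?m * (LINT x|M. (norm (g x))\<^sup>2)"
      by (simp add: a_def)
  qed
qed

lemma integral_abs_le_sqrt:
  assumes "sq_integrable M (h :: 'n \<Rightarrow> real)"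
  shows "(LINT x|M. \<bar>h x\<bar>) \<le> sqrt (measure lebesgue S) * sqrt (LINT x|M. (h x)\<^sup>2)"
proof -
  have "sq_integrable M (\<lambda>x. 1::real)" by (intro sq_continuous continuous_intros)
  from integral_norm_mult_le[OF this assms] show ?thesis by (simp add: measure_space_eq)
qed

end

locale cylinder =
  fixes \<omega> :: "'a::euclidean_space set" and L :: real
  assumes \<omega>: "open \<omega>" "convex \<omega>" "bounded \<omega>" "\<omega> \<noteq> {}" and L: "L > 0"
begin

definition \<Omega> where "\<Omega> = \<omega> \<times> {0<..<L}"

sublocale R: bounded_convex \<omega> by unfold_locales (use \<omega> in auto)

sublocale B: bounded_convex \<Omega>
  by unfold_locales (use \<omega> L in \<open>auto simp: \<Omega>_def open_Times convex_Times bounded_Times\<close>)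

definition tr_const :: real where "tr_const = 2 / L + 2 * L"

lemma tr_const_pos: "tr_const > 0" using L by (simp add: tr_const_def add_pos_pos)

lemma trace_sq: "C1_fun f G \<Longrightarrow> sq_integrable R.M (\<lambda>x. f (x, 0))"
  by (intro R.sq_continuous continuous_on_compose2[OF C1_fun_continuous[of f G UNIV]] continuous_intros) auto

lemma C1_fun_diff: "C1_fun f F \<Longrightarrow> C1_fun g G \<Longrightarrow> C1_fun (\<lambda>x. f x - g x) (\<lambda>x. F x - G x)"
  unfolding C1_fun_def inner_diff_left by (intro conjI allI has_derivative_diff continuous_on_diff) auto

lemma trace_inequality:
  "C1_fun f G \<Longrightarrow> (LINT x|R.M. (f (x, 0))\<^sup>2) \<le> tr_const * ((LINT z|B.M. (f z)\<^sup>2) + (LINT z|B.M. (norm (G z))\<^sup>2))"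
  unfolding tr_const_def \<Omega>_def by (rule trace_inequality_C1[OF \<omega>(1,3) L])

text \<open>By the trace inequality for the difference, boundary values in the limit depend only on
  the limits of function and gradient. Existence and uniqueness of the trace both rest on
  this.\<close>

lemma trace_difference_tendsto:
  assumes F: "\<And>n. C1_fun (F n) (G n)" "l2_tendsto B.M F f" "l2_tendsto B.M G g"
    and F': "\<And>n. C1_fun (F' n) (G' n)" "l2_tendsto B.M F' f" "l2_tendsto B.M G' g"
  shows "(\<lambda>n. LINT x|R.M. (norm (F n (x, 0) - F' n (x, 0)))\<^sup>2) \<longlonglongrightarrow> 0"
proof -
  note s = l2_tendstoD(1,2)[OF F(2)] l2_tendstoD(1,2)[OF F(3)] l2_tendstoD(1,2)[OF F'(2)] l2_tendstoD(1,2)[OF F'(3)]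
  define b where "b n = tr_const * (2 * (LINT z|B.M. (norm (F n z - f z))\<^sup>2) + 2 * (LINT z|B.M. (norm (F' n z - f z))\<^sup>2)
      + (2 * (LINT z|B.M. (norm (G n z - g z))\<^sup>2) + 2 * (LINT z|B.M. (norm (G' n z - g z))\<^sup>2)))" for n
  have "b \<longlonglongrightarrow> tr_const * (2 * 0 + 2 * 0 + (2 * 0 + 2 * 0))"
    unfolding b_def by (intro tendsto_intros l2_tendstoD(3)[OF F(2)] l2_tendstoD(3)[OF F'(2)] l2_tendstoD(3)[OF F(3)] l2_tendstoD(3)[OF F'(3)])
  then have b0: "b \<longlonglongrightarrow> 0" by simp
  show ?thesis
  proof (rule Lim_null_comparison[OF always_eventually b0], rule allI)
    fix n
    have "(LINT x|R.M. (F n (x, 0) - F' n (x, 0))\<^sup>2)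
      \<le> tr_const * ((LINT z|B.M. (F n z - F' n z)\<^sup>2) + (LINT z|B.M. (norm (G n z - G' n z))\<^sup>2))"
      by (rule trace_inequality[OF C1_fun_diff[OF F(1) F'(1)]])
    also have "\<dots> \<le> b n"
      unfolding b_def
    proof (intro mult_left_mono add_mono)
      show "(LINT z|B.M. (F n z - F' n z)\<^sup>2) \<le> 2 * (LINT z|B.M. (norm (F n z - f z))\<^sup>2) + 2 * (LINT z|B.M. (norm (F' n z - f z))\<^sup>2)"
        using integral_norm_sq_triangle[of B.M "F n" f "F' n"] s by (simp add: power2_commute)
      show "(LINT z|B.M. (norm (G n z - G' n z))\<^sup>2) \<le> 2 * (LINT z|B.M. (norm (G n z - g z))\<^sup>2) + 2 * (LINT z|B.M. (norm (G' n z - g z))\<^sup>2)"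
        using integral_norm_sq_triangle[of B.M "G n" g "G' n"] s by (simp add: norm_minus_commute)
    qed (use tr_const_pos in auto)
    finally show "norm (LINT x|R.M. (norm (F n (x, 0) - F' n (x, 0)))\<^sup>2) \<le> b n" by simp
  qed
qed

text \<open>The trace is defined through smooth functions; comparison with such a sequence allows it
  to be computed from any C1 approximation, as compositions require.\<close>

lemma trace_l2_tendsto:
  assumes tr: "has_trace \<omega> L f h" and g: "has_weak_gradient \<Omega> f g"
    and F: "\<And>n. C1_fun (F n) (G n)" "l2_tendsto B.M F f" "l2_tendsto B.M G g"
  shows "l2_tendsto R.M (\<lambda>n x. F n (x, 0)) h"
proof -
  obtain p :: "nat \<Rightarrow> 'a \<times> real \<Rightarrow> real" where p: "\<And>n. smooth (p n)" "(\<lambda>n. H1_norm \<Omega> (p n - f)) \<longlonglongrightarrow> 0"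
    "(\<lambda>n. Lp_norm \<omega> 2 (\<lambda>x. p n (x, 0) - h x)) \<longlonglongrightarrow> 0" and h: "sq_integrable R.M h" and fH: "f \<in> H1_space \<Omega>"
    using tr unfolding has_trace_def \<Omega>_def Lp_space_2_iff by blast
  have fs: "sq_integrable B.M f" by (rule H1_spaceD[OF fH])
  have ps: "sq_integrable B.M (p n)" "sq_integrable B.M (grad (p n))" for n
    using p(1) by (auto intro!: B.sq_continuous smooth_continuous smooth_continuous_grad)
  have gs: "sq_integrable B.M g" by (rule has_weak_gradientD(1)[OF g])
  have eq: "(H1_norm \<Omega> (p n - f))\<^sup>2 = (LINT z|B.M. (norm (p n z - f z))\<^sup>2) + (LINT z|B.M. (norm (grad (p n) z - g z))\<^sup>2)" for n
  proof -
    have "has_weak_gradient \<Omega> (\<lambda>z. 1 * p n z + (-1) * f z) (\<lambda>z. 1 *\<^sub>R grad (p n) z + (-1) *\<^sub>R g z)"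
      by (rule has_weak_gradient_lincomb[OF B.op B.bd ps(1) fs C1_has_weak_gradient[OF B.op B.bd C1_fun_smooth[OF p(1)]] g])
    then have w: "has_weak_gradient \<Omega> (p n - f) (\<lambda>z. grad (p n) z - g z)" by (simp add: fun_diff_def)
    have "sq_integrable B.M (p n - f)" using sq_integrable_diff[OF ps(1) fs] by (simp add: fun_diff_def)
    from H1_norm_sq[OF B.op B.cv B.bd this w] show ?thesis by simp
  qed
  have H0: "(\<lambda>n. (H1_norm \<Omega> (p n - f))\<^sup>2) \<longlonglongrightarrow> 0" using tendsto_power[OF p(2), of 2] by simp
  have c1: "(\<lambda>n. LINT z|B.M. (norm (p n z - f z))\<^sup>2) \<longlonglongrightarrow> 0"
    by (rule Lim_null_comparison[OF always_eventually H0]) (simp add: eq)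
  have c2: "(\<lambda>n. LINT z|B.M. (norm (grad (p n) z - g z))\<^sup>2) \<longlonglongrightarrow> 0"
    by (rule Lim_null_comparison[OF always_eventually H0]) (simp add: eq)
  have p1: "l2_tendsto B.M p f" using ps fs c1 by (simp add: l2_tendsto_def)
  have p2: "l2_tendsto B.M (\<lambda>n. grad (p n)) g" using ps gs c2 by (simp add: l2_tendsto_def)
  have C1p: "C1_fun (p n) (grad (p n))" for n by (rule C1_fun_smooth[OF p(1)])
  have "(\<lambda>n. (Lp_norm \<omega> 2 (\<lambda>x. p n (x, 0) - h x))\<^sup>2) \<longlonglongrightarrow> 0" using tendsto_power[OF p(3), of 2] by simp
  then have "(\<lambda>n. LINT x|R.M. (norm (p n (x, 0) - h x))\<^sup>2) \<longlonglongrightarrow> 0" by (simp add: Lp_norm_2)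
  then have "l2_tendsto R.M (\<lambda>n x. p n (x, 0)) h" using h trace_sq[OF C1p] by (simp add: l2_tendsto_def)
  then show ?thesis
    by (rule l2_tendsto_close[OF _ trace_sq[OF F(1)]]) (rule trace_difference_tendsto[OF F C1p p1 p2])
qed

text \<open>The face \<open>y = 0\<close> does not belong to \<open>\<Omega>\<close>; bounds are
  carried there by continuity along the points \<open>(x, L / (real n + 2))\<close>, which lie
  inside.\<close>

lemma boundary_values:
  assumes F: "continuous_on UNIV F" "\<And>z. z \<in> \<Omega> \<Longrightarrow> l \<le> F z \<and> F z \<le> u" and x: "x \<in> \<omega>"
  shows "l \<le> F (x, 0) \<and> F (x, 0) \<le> (u::real)"
proof -
  have "(\<lambda>n. L / (real n + 2)) \<longlonglongrightarrow> 0"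
    using LIMSEQ_ignore_initial_segment[OF lim_const_over_n[of L], of 2] by (simp add: add.commute)
  then have "(\<lambda>n. (x, L / (real n + 2))) \<longlonglongrightarrow> (x, 0)" by (intro tendsto_intros)
  moreover have "isCont F (x, 0)" using F(1) by (simp add: continuous_on_eq_continuous_at)
  ultimately have lim: "(\<lambda>n. F (x, L / (real n + 2))) \<longlonglongrightarrow> F (x, 0)" by (rule isCont_tendsto_compose[rotated])
  have "(x, L / (real n + 2)) \<in> \<Omega>" for n
  proof -
    have "L * 1 < L * (real n + 2)" using L by (intro mult_strict_left_mono) auto
    then have "L / (real n + 2) < L" by (simp add: divide_less_eq)
    then show ?thesis using x L by (simp add: \<Omega>_def)
  qed
  then have "\<forall>n. l \<le> F (x, L / (real n + 2)) \<and> F (x, L / (real n + 2)) \<le> u" using F(2) by blast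
  then show ?thesis using lim by (auto intro: LIMSEQ_le_const LIMSEQ_le_const2)
qed

lemma trace_bounds:
  assumes tr: "has_trace \<omega> L f h" and A: "B.approximates l u F f g" and g: "has_weak_gradient \<Omega> f g"
  shows "AE x in R.M. l \<le> h x \<and> h x \<le> u"
proof -
  have F: "\<And>n. smooth (F n)" "\<And>n z. z \<in> \<Omega> \<Longrightarrow> l \<le> F n z \<and> F n z \<le> u"
    "l2_tendsto B.M F f" "l2_tendsto B.M (\<lambda>n. grad (F n)) g"
    using A by (auto simp: B.approximates_def)
  have "l2_tendsto R.M (\<lambda>n x. F n (x, 0)) h"
    by (rule trace_l2_tendsto[OF tr g C1_fun_smooth[OF F(1)] F(3,4)])
  from l2_tendsto_AE_subseq[OF this] obtain r where r: "AE x in R.M. (\<lambda>n. F (r n) (x, 0)) \<longlonglongrightarrow> h x" by metis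
  have "AE x in R.M. x \<in> \<omega>" by (intro AE_I2) auto
  with r show ?thesis
  proof eventually_elim
    case (elim x)
    have "\<forall>n. l \<le> F (r n) (x, 0) \<and> F (r n) (x, 0) \<le> u"
      using boundary_values[OF smooth_continuous[OF F(1)] F(2) elim(2)] by blast
    then show ?case using elim(1) by (auto intro: LIMSEQ_le_const LIMSEQ_le_const2)
  qed
qed

text \<open>The boundary values of the approximations are Cauchy in L1 by the trace inequality, so a
  subsequence converges almost everywhere. Their uniform bounds then give the L2 convergence that
  \<open>has_trace\<close> demands.\<close>

lemma trace_exists:
  assumes A: "B.approximates l u F f g" and g: "has_weak_gradient \<Omega> f g" and fs: "sq_integrable B.M f"
  shows "\<exists>h. has_trace \<omega> L f h"
proof -
  have F: "\<And>n. smooth (F n)" "\<And>n z. z \<in> \<Omega> \<Longrightarrow> l \<le> F n z \<and> F n z \<le> u"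
    "l2_tendsto B.M F f" "l2_tendsto B.M (\<lambda>n. grad (F n)) g"
    using A by (auto simp: B.approximates_def)
  define T where "T n x = F n (x, 0)" for n x
  have Ts: "sq_integrable R.M (T n)" for n unfolding T_def by (rule trace_sq[OF C1_fun_smooth[OF F(1)]])
  have Ti: "integrable R.M (T n)" for n by (rule integrable_sq[OF R.fin Ts])
  have Tb: "l \<le> T n x \<and> T n x \<le> u" if "x \<in> \<omega>" for n x
    unfolding T_def using boundary_values[OF smooth_continuous[OF F(1)] F(2) that] by blast
  \<comment> \<open>If this failed, two sequences of indices tending to infinity would give
    approximations of the same function whose boundary values stay apart, against
    \<open>trace_difference_tendsto\<close>.\<close>
  have cauchy: "\<exists>N. \<forall>i\<ge>N. \<forall>j\<ge>N. (LINT x|R.M. norm (T i x - T j x)) < e" if e: "e > 0" for e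
  proof (rule ccontr)
    assume "\<nexists>N. \<forall>i\<ge>N. \<forall>j\<ge>N. (LINT x|R.M. norm (T i x - T j x)) < e"
    then have "\<forall>N. \<exists>i j. i \<ge> N \<and> j \<ge> N \<and> (LINT x|R.M. norm (T i x - T j x)) \<ge> e" by (meson not_less)
    then obtain i j where ij: "\<And>N. i N \<ge> N" "\<And>N. j N \<ge> N" "\<And>N. (LINT x|R.M. norm (T (i N) x - T (j N) x)) \<ge> e" by metis
    have fl: "filterlim i sequentially sequentially" "filterlim j sequentially sequentially"
      using ij(1,2) by (auto intro!: filterlim_at_top_mono[OF filterlim_ident] always_eventually simp: filterlim_ident)
    have sub: "l2_tendsto N (\<lambda>n. H (k n)) h" if "l2_tendsto N H h" "filterlim k sequentially sequentially"
      for N and H :: "nat \<Rightarrow> 'c \<Rightarrow> 'd::{real_normed_vector, second_countable_topology}" and h k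
      using that filterlim_compose[OF l2_tendstoD(3)[OF that(1)] that(2)] by (auto simp: l2_tendsto_def)
    have "(\<lambda>n. LINT x|R.M. (norm (F (i n) (x, 0) - F (j n) (x, 0)))\<^sup>2) \<longlonglongrightarrow> 0"
      by (rule trace_difference_tendsto[OF C1_fun_smooth[OF F(1)] sub[OF F(3) fl(1)] sub[OF F(4) fl(1)]
          C1_fun_smooth[OF F(1)] sub[OF F(3) fl(2)] sub[OF F(4) fl(2)]])
    then have "(\<lambda>n. sqrt (measure lebesgue \<omega>) * sqrt (LINT x|R.M. (norm (F (i n) (x, 0) - F (j n) (x, 0)))\<^sup>2)) \<longlonglongrightarrow> sqrt (measure lebesgue \<omega>) * sqrt 0"
      by (intro tendsto_intros)
    then have "(\<lambda>n. sqrt (measure lebesgue \<omega>) * sqrt (LINT x|R.M. (norm (F (i n) (x, 0) - F (j n) (x, 0)))\<^sup>2)) \<longlonglongrightarrow> 0" by simp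
    from order_tendstoD(2)[OF this e] obtain n where
      n: "sqrt (measure lebesgue \<omega>) * sqrt (LINT x|R.M. (norm (F (i n) (x, 0) - F (j n) (x, 0)))\<^sup>2) < e"
      by (auto simp: eventually_sequentially)
    have "(LINT x|R.M. norm (T (i n) x - T (j n) x)) < e"
      using R.integral_abs_le_sqrt[OF sq_integrable_diff[OF Ts[of "i n"] Ts[of "j n"]]] n by (simp add: T_def)
    then show False using ij(3)[of n] by simp
  qed
  obtain r where r: "strict_mono r" "AE x in R.M. Cauchy (\<lambda>n. T (r n) x)"
    using cauchy_L1_AE_cauchy_subseq[OF Ti cauchy] by metis
  define h where "h x = lim (\<lambda>n. T (r n) x)" for x
  have lim: "AE x in R.M. (\<lambda>n. T (r n) x) \<longlonglongrightarrow> h x"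
    using r(2) by (rule eventually_mono) (simp add: h_def Cauchy_convergent convergent_LIMSEQ_iff[symmetric])
  have hm: "h \<in> borel_measurable R.M"
    unfolding h_def using Ts by (intro borel_measurable_lim_metric) (auto intro: sq_integrableD(1))
  have sK: "sq_integrable R.M (\<lambda>x. \<bar>l\<bar> + \<bar>u\<bar>)" by (intro R.sq_continuous continuous_intros)
  have l2: "l2_tendsto R.M (\<lambda>n. T (r n)) h"
  proof (rule l2_tendsto_dominated[OF sq_integrableD(1)[OF Ts] hm sK _ lim])
    show "AE x in R.M. norm (T (r n) x) \<le> norm (\<bar>l\<bar> + \<bar>u\<bar>)" for n
      using Tb[of _ "r n"] by (intro AE_I2) force
  qed
  have "has_trace \<omega> L f h"
    unfolding has_trace_def Lp_space_2_iff \<Omega>_def[symmetric]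
  proof (intro conjI exI[of _ "\<lambda>n. F (r n)"] allI)
    show "f \<in> H1_space \<Omega>" by (rule H1_spaceI[OF fs g])
    show "sq_integrable R.M h" by (rule l2_tendstoD(2)[OF l2])
    show "smooth (F (r n))" for n by (rule F(1))
    have "(\<lambda>n. sqrt (LINT x|R.M. (norm (T (r n) x - h x))\<^sup>2)) \<longlonglongrightarrow> sqrt 0"
      by (intro tendsto_intros l2_tendstoD(3)[OF l2])
    then show "(\<lambda>n. Lp_norm \<omega> 2 (\<lambda>x. F (r n) (x, 0) - h x)) \<longlonglongrightarrow> 0" by (simp add: Lp_norm_2 T_def)
    have eq: "H1_norm \<Omega> (F n - f) = sqrt ((LINT z|B.M. (norm (F n z - f z))\<^sup>2) + (LINT z|B.M. (norm (grad (F n) z - g z))\<^sup>2))" for n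
    proof -
      have "has_weak_gradient \<Omega> (\<lambda>z. 1 * F n z + (-1) * f z) (\<lambda>z. 1 *\<^sub>R grad (F n) z + (-1) *\<^sub>R g z)"
        by (rule has_weak_gradient_lincomb[OF B.op B.bd l2_tendstoD(1)[OF F(3)] fs C1_has_weak_gradient[OF B.op B.bd C1_fun_smooth[OF F(1)]] g])
      then have w: "has_weak_gradient \<Omega> (F n - f) (\<lambda>z. grad (F n) z - g z)" by (simp add: fun_diff_def)
      have "sq_integrable B.M (F n - f)" using sq_integrable_diff[OF l2_tendstoD(1)[OF F(3)] fs] by (simp add: fun_diff_def)
      from H1_norm_sq[OF B.op B.cv B.bd this w] show ?thesis
        using H1_norm_nonneg[of \<Omega> "F n - f"] by (simp add: real_sqrt_unique)
    qed
    have "(\<lambda>n. sqrt ((LINT z|B.M. (norm (F n z - f z))\<^sup>2) + (LINT z|B.M. (norm (grad (F n) z - g z))\<^sup>2))) \<longlonglongrightarrow> sqrt (0 + 0)"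
      by (intro tendsto_intros l2_tendstoD(3)[OF F(3)] l2_tendstoD(3)[OF F(4)])
    then have "(\<lambda>n. H1_norm \<Omega> (F n - f)) \<longlonglongrightarrow> 0" by (simp add: eq)
    from LIMSEQ_subseq_LIMSEQ[OF this r(1)] show "(\<lambda>n. H1_norm \<Omega> (F (r n) - f)) \<longlonglongrightarrow> 0" by (simp add: o_def)
  qed
  then show ?thesis by blast
qed

lemma has_trace_trace0:
  assumes A: "B.approximates l u F f g" and g: "has_weak_gradient \<Omega> f g" and fs: "sq_integrable B.M f"
  shows "has_trace \<omega> L f (trace0 \<omega> L f)"
  using someI_ex[OF trace_exists[OF assms]] by (simp add: trace0_def)

lemma trace0_unique:
  assumes b: "AE z in B.M. l \<le> f z \<and> f z \<le> u" and g: "has_weak_gradient \<Omega> f g" and fs: "sq_integrable B.M f"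
    and F: "\<And>n. C1_fun (F n) (G n)" "l2_tendsto B.M F f" "l2_tendsto B.M G g"
  shows "l2_tendsto R.M (\<lambda>n x. F n (x, 0)) (trace0 \<omega> L f)"
proof -
  obtain F' where "B.approximates l u F' f g" using B.approximation_exists[OF fs g b] by metis
  from trace_l2_tendsto[OF has_trace_trace0[OF this g fs] g F] show ?thesis .
qed

text \<open>Along a subsequence \<open>\<phi> (F n (x, 0))\<close> converges both to the trace of
  the composition and to \<open>\<phi>\<close> of the trace. In the last claim the constant
  \<open>a\<close> is free because it does not change the gradient.\<close>

lemma trace_compose:
  fixes \<phi> :: "real \<Rightarrow> real"
  assumes A: "B.approximates l u F f g" and g: "has_weak_gradient \<Omega> f g" and fs: "sq_integrable B.M f"
    and \<phi>: "\<And>s. (\<phi> has_real_derivative \<phi>' s) (at s)" "continuous_on UNIV \<phi>'"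
  defines "h \<equiv> trace0 \<omega> L f"
  shows "AE x in R.M. trace0 \<omega> L (\<lambda>z. \<phi> (f z)) x = \<phi> (h x)"
    and "AE x in R.M. l \<le> h x \<and> h x \<le> u" and "h \<in> borel_measurable R.M"
    and "(LINT x|R.M. (\<phi> (h x) - a)\<^sup>2) \<le> tr_const * ((LINT z|B.M. (\<phi> (f z) - a)\<^sup>2) + (LINT z|B.M. (norm (\<phi>' (f z) *\<^sub>R g z))\<^sup>2))"
proof -
  note C = B.chain_approximation[where \<phi> = \<phi> and \<phi>' = \<phi>', OF A \<phi>]
  have F: "\<And>n. smooth (F n)" "\<And>n z. z \<in> \<Omega> \<Longrightarrow> l \<le> F n z \<and> F n z \<le> u"
    "l2_tendsto B.M F f" "l2_tendsto B.M (\<lambda>n. grad (F n)) g"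
    using A by (auto simp: B.approximates_def)
  have ht: "has_trace \<omega> L f h" unfolding h_def by (rule has_trace_trace0[OF A g fs])
  have \<phi>c: "continuous_on UNIV \<phi>" using \<phi>(1) by (meson DERIV_continuous_on has_field_derivative_at_within)
  have \<phi>m: "\<phi> \<in> borel_measurable borel" using \<phi>c by (rule borel_measurable_continuous_onI)
  have hl: "l2_tendsto R.M (\<lambda>n x. F n (x, 0)) h"
    by (rule trace_l2_tendsto[OF ht g C1_fun_smooth[OF F(1)] F(3,4)])
  show hm: "h \<in> borel_measurable R.M" by (rule sq_integrableD(1)[OF l2_tendstoD(2)[OF hl]])
  show hb: "AE x in R.M. l \<le> h x \<and> h x \<le> u" by (rule trace_bounds[OF ht A g])
  obtain K where K: "K \<ge> 0" "\<And>s. l \<le> s \<Longrightarrow> s \<le> u \<Longrightarrow> \<bar>\<phi> s\<bar> \<le> K" using B.compose_continuous_bound[OF \<phi>c] by metis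
  have fb: "AE z in B.M. - K \<le> \<phi> (f z) \<and> \<phi> (f z) \<le> K"
    using B.approximates_bounds[OF A]
  proof (rule eventually_mono)
    fix z assume "l \<le> f z \<and> f z \<le> u"
    then show "- K \<le> \<phi> (f z) \<and> \<phi> (f z) \<le> K" using K(2)[of "f z"] by auto
  qed
  have t1: "l2_tendsto R.M (\<lambda>n x. \<phi> (F n (x, 0))) (trace0 \<omega> L (\<lambda>z. \<phi> (f z)))"
    by (rule trace0_unique[OF fb C(4,5,1,2,3)])
  obtain r where r: "strict_mono r" "AE x in R.M. (\<lambda>n. F (r n) (x, 0)) \<longlonglongrightarrow> h x" by (rule l2_tendsto_AE_subseq[OF hl])
  have sK: "sq_integrable R.M (\<lambda>x. K)" by (intro R.sq_continuous continuous_intros)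
  have t2: "l2_tendsto R.M (\<lambda>n x. \<phi> (F (r n) (x, 0))) (\<lambda>x. \<phi> (h x))"
  proof (rule l2_tendsto_dominated[OF _ _ sK])
    show "(\<lambda>x. \<phi> (F (r n) (x, 0))) \<in> borel_measurable R.M" for n by (rule sq_integrableD(1)[OF l2_tendstoD(1)[OF t1]])
    show "(\<lambda>x. \<phi> (h x)) \<in> borel_measurable R.M" using measurable_compose[OF hm \<phi>m] by simp
    show "AE x in R.M. norm (\<phi> (F (r n) (x, 0))) \<le> norm K" for n
      using K boundary_values[OF smooth_continuous[OF F(1)] F(2)] by (intro AE_I2) auto
    show "AE x in R.M. (\<lambda>n. \<phi> (F (r n) (x, 0))) \<longlonglongrightarrow> \<phi> (h x)"
      using r(2)
    proof (rule eventually_mono)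
      fix x assume "(\<lambda>n. F (r n) (x, 0)) \<longlonglongrightarrow> h x"
      then show "(\<lambda>n. \<phi> (F (r n) (x, 0))) \<longlonglongrightarrow> \<phi> (h x)"
        using \<phi>c by (intro isCont_tendsto_compose[of "h x" \<phi>]) (simp_all add: continuous_on_eq_continuous_at)
    qed
  qed
  show "AE x in R.M. trace0 \<omega> L (\<lambda>z. \<phi> (f z)) x = \<phi> (h x)"
    by (rule l2_tendsto_unique[OF l2_tendsto_subseq[OF t1 r(1)] t2])
  have sc: "sq_integrable R.M (\<lambda>x. - a)" "sq_integrable B.M (\<lambda>x. - a)"
    by (intro R.sq_continuous B.sq_continuous continuous_intros)+
  have l1: "l2_tendsto R.M (\<lambda>n x. \<phi> (F (r n) (x, 0)) + - a) (\<lambda>x. \<phi> (h x) + - a)"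
    by (rule l2_tendsto_add[OF t2 l2_tendsto_const[OF sc(1)]])
  have l2: "l2_tendsto B.M (\<lambda>n z. \<phi> (F (r n) z) + - a) (\<lambda>z. \<phi> (f z) + - a)"
    by (rule l2_tendsto_add[OF l2_tendsto_subseq[OF C(2) r(1)] l2_tendsto_const[OF sc(2)]])
  have l3: "l2_tendsto B.M (\<lambda>n x. \<phi>' (F (r n) x) *\<^sub>R grad (F (r n)) x) (\<lambda>x. \<phi>' (f x) *\<^sub>R g x)"
    by (rule l2_tendsto_subseq[OF C(3) r(1)])
  have C1a: "C1_fun (\<lambda>z. \<phi> (F n z) - a) (\<lambda>x. \<phi>' (F n x) *\<^sub>R grad (F n) x)" for n
    using C1_fun_diff[OF C(1)[of n], of "\<lambda>z. a" "\<lambda>z. 0"] by (simp add: C1_fun_def)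
  have e1: "(\<lambda>n. LINT x|R.M. (\<phi> (F (r n) (x, 0)) - a)\<^sup>2) \<longlonglongrightarrow> (LINT x|R.M. (\<phi> (h x) - a)\<^sup>2)"
    using l2_tendsto_norm_sq[OF l1] by simp
  have "(\<lambda>n. LINT z|B.M. (\<phi> (F (r n) z) - a)\<^sup>2) \<longlonglongrightarrow> (LINT z|B.M. (\<phi> (f z) - a)\<^sup>2)"
    using l2_tendsto_norm_sq[OF l2] by simp
  then have e2: "(\<lambda>n. tr_const * ((LINT z|B.M. (\<phi> (F (r n) z) - a)\<^sup>2) + (LINT z|B.M. (norm (\<phi>' (F (r n) z) *\<^sub>R grad (F (r n)) z))\<^sup>2)))
    \<longlonglongrightarrow> tr_const * ((LINT z|B.M. (\<phi> (f z) - a)\<^sup>2) + (LINT z|B.M. (norm (\<phi>' (f z) *\<^sub>R g z))\<^sup>2))"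
    by (intro tendsto_intros l2_tendsto_norm_sq[OF l3])
  show "(LINT x|R.M. (\<phi> (h x) - a)\<^sup>2) \<le> tr_const * ((LINT z|B.M. (\<phi> (f z) - a)\<^sup>2) + (LINT z|B.M. (norm (\<phi>' (f z) *\<^sub>R g z))\<^sup>2))"
    by (rule LIMSEQ_le[OF e1 e2]) (use trace_inequality[OF C1a] in auto)
qed

end

section \<open>The entropy function and the entropy-entropy dissipation inequality\<close>

text \<open>The cut-off at \<open>0\<close> makes powers with exponent \<open>p > 1\<close> continuously differentiable on the whole line, so that
  the chain rule needs no sign condition.\<close>

definition pospow :: "real \<Rightarrow> real \<Rightarrow> real" where "pospow p x = (max 0 x) powr p"

lemma pospow_mono: "0 \<le> p \<Longrightarrow> x \<le> y \<Longrightarrow> pospow p x \<le> pospow p y"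
  by (auto simp: pospow_def intro!: powr_mono2)

lemma pospow_split: "p > 0 \<Longrightarrow> pospow (p + 1) x = pospow p x * x"
  by (auto simp: pospow_def max_def powr_add)

lemma pospow_continuous: "p > 0 \<Longrightarrow> continuous_on A (pospow p)"
  unfolding pospow_def[abs_def] by (intro continuous_on_powr' continuous_intros) auto

lemma pospow_DERIV:
  assumes p: "p > 1"
  shows "(pospow p has_real_derivative (p * pospow (p - 1) x)) (at x)"
proof -
  consider "x > 0" | "x < 0" | "x = 0" by linarith
  then show ?thesis
  proof cases
    case 1
    have "((\<lambda>x. x powr p) has_real_derivative (p * pospow (p - 1) x)) (at x)"
      using has_real_derivative_powr[OF 1, of p] 1 by (simp add: pospow_def)
    from has_field_derivative_transform_within_open[OF this open_greaterThan] show ?thesis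
      using 1 by (auto simp: pospow_def)
  next
    case 2
    have "((\<lambda>x. 0) has_real_derivative (p * pospow (p - 1) x)) (at x)"
      using 2 by (simp add: pospow_def)
    from has_field_derivative_transform_within_open[OF this open_lessThan] show ?thesis
      using 2 by (auto simp: pospow_def)
  next
    case 3
    \<comment> \<open>At 0 the difference quotient of \<open>pospow p\<close> is
      \<open>pospow (p - 1)\<close>, which is continuous with value 0 there.\<close>
    have c: "(pospow (p - 1) \<longlongrightarrow> pospow (p - 1) 0) (at 0)"
      using pospow_continuous[of "p - 1" UNIV] p by (simp add: continuous_on_eq_continuous_at isCont_def)
    have "((\<lambda>h. pospow p h / h) \<longlongrightarrow> 0) (at 0)"
    proof (rule Lim_transform_eventually)
      show "(pospow (p - 1) \<longlongrightarrow> 0) (at 0)" using c by (simp add: pospow_def)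
      show "\<forall>\<^sub>F h in at 0. pospow (p - 1) h = pospow p h / h"
        using pospow_split[of "p - 1"] p by (auto simp: eventually_at_filter)
    qed
    then show ?thesis using 3 p by (simp add: DERIV_def pospow_def)
  qed
qed

section \<open>Convexity inequalities for powers\<close>

lemma pospow_tangent:
  assumes p: "p > 1"
  shows "p * pospow (p - 1) a * (s - a) \<le> pospow p s - pospow p a"
proof -
  have D: "\<And>x. (pospow p has_real_derivative (p * pospow (p - 1) x)) (at x)" by (rule pospow_DERIV[OF p])
  have m: "p * pospow (p - 1) x \<le> p * pospow (p - 1) y" if "x \<le> y" for x y
    using that p by (intro mult_left_mono pospow_mono) auto
  consider "a < s" | "s < a" | "s = a" by linarith
  then show ?thesis
  proof cases
    case 1
    then obtain z where z: "a < z" "z < s" "pospow p s - pospow p a = (s - a) * (p * pospow (p - 1) z)"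
      using MVT2[OF 1, of "pospow p" "\<lambda>x. p * pospow (p - 1) x"] D by blast
    then show ?thesis using m[of a z] 1 by (simp add: mult.commute mult_left_mono)
  next
    case 2
    then obtain z where z: "s < z" "z < a" "pospow p a - pospow p s = (a - s) * (p * pospow (p - 1) z)"
      using MVT2[OF 2, of "pospow p" "\<lambda>x. p * pospow (p - 1) x"] D by blast
    have "(a - s) * (p * pospow (p - 1) z) \<le> (a - s) * (p * pospow (p - 1) a)"
      by (rule mult_left_mono[OF m]) (use z 2 in auto)
    then show ?thesis using z(3) by (simp add: algebra_simps)
  qed simp
qed

lemma powr_tangent:
  assumes "(p::real) > 1" "0 \<le> a" "0 \<le> s"
  shows "p * a powr (p - 1) * (s - a) \<le> s powr p - a powr p"
  using pospow_tangent[OF assms(1), of a s] assms by (simp add: pospow_def)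

lemma powr_pred_mult: "0 \<le> s \<Longrightarrow> (s::real) powr p = s powr (p - 1) * s"
proof -
  assume s: "0 \<le> s"
  show ?thesis
  proof (cases "s = 0")
    case False
    then show ?thesis using s powr_add[of s "p - 1" 1] by simp
  qed simp
qed

lemma powr_diff_lower_aux:
  assumes "p \<ge> 1" "0 \<le> t" "t \<le> (s::real)"
  shows "s powr (p - 1) * (s - t) \<le> s powr p - t powr p"
proof -
  have "t powr (p - 1) * t \<le> s powr (p - 1) * t" using assms by (intro mult_right_mono powr_mono2) auto
  then show ?thesis using powr_pred_mult[of s p] powr_pred_mult[of t p] assms by (simp add: algebra_simps)
qed

lemma powr_diff_lower:
  assumes "p \<ge> 1" "0 \<le> s" "0 \<le> (t::real)"
  shows "(max s t) powr (p - 1) * \<bar>s - t\<bar> \<le> \<bar>s powr p - t powr p\<bar>"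
proof (cases "t \<le> s")
  case True
  then show ?thesis using powr_diff_lower_aux[OF assms(1,3) True] powr_mono2[OF _ assms(3) True, of p] assms by (simp add: max_def)
next
  case False
  then have "s \<le> t" by simp
  then show ?thesis using powr_diff_lower_aux[OF assms(1,2), of t] powr_mono2[OF _ assms(2), of p t] assms by (simp add: max_def)
qed

text \<open>A quantitative inverse of the power map: as soon as one of the two points is at least
  \<open>c\<close>, closeness of the powers gives closeness of the points. Away from 0 this needs no
  upper bound on them.\<close>

lemma powr_diff_lower':
  assumes "p \<ge> 1" "0 \<le> s" "0 \<le> (t::real)" "0 \<le> c" "c \<le> max s t"
  shows "c powr (p - 1) * \<bar>s - t\<bar> \<le> \<bar>s powr p - t powr p\<bar>"
proof -
  have "c powr (p - 1) * \<bar>s - t\<bar> \<le> (max s t) powr (p - 1) * \<bar>s - t\<bar>"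
    using assms by (intro mult_right_mono powr_mono2) auto
  then show ?thesis using powr_diff_lower[OF assms(1-3)] by linarith
qed

section \<open>Two-sided bounds for the entropy function\<close>

lemma alpha_Phi: "\<alpha> > 1 \<Longrightarrow> \<alpha> * Phi \<alpha> s = s powr (\<alpha> + 1) - (\<alpha> + 1) * s + \<alpha>"
  by (simp add: Phi_def distrib_left)

text \<open>With \<open>\<alpha> + 1 = 2 * p\<close>, \<open>\<alpha> * Phi \<alpha> s\<close>
  equals \<open>(s powr p - 1)\<^sup>2 + 2 * ((s powr p - 1) - p * (s - 1))\<close>. The tangent
  inequality bounds the second bracket by \<open>p * ((s - 1) * (s powr (p - 1) - 1))\<close>, and
  both factors are at most \<open>\<bar>s powr p - 1\<bar>\<close>. The constant is
  \<open>1 + 2 * p\<close>.\<close>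

lemma Phi_upper:
  assumes \<alpha>: "\<alpha> > 1" and s: "0 \<le> s"
  shows "\<alpha> * Phi \<alpha> s \<le> (\<alpha> + 2) * (s powr ((\<alpha> + 1) / 2) - 1)\<^sup>2"
proof -
  define p where "p = (\<alpha> + 1) / 2"
  have p: "p > 1" "\<alpha> = 2 * p - 1" using \<alpha> by (simp_all add: p_def field_simps)
  have s2p: "s powr (\<alpha> + 1) = (s powr p)\<^sup>2"
    using s by (simp add: p(2) power2_eq_square flip: powr_add)
  have t: "s powr p - 1 \<le> p * s powr (p - 1) * (s - 1)"
    using powr_tangent[OF p(1) s, of 1] by (simp add: algebra_simps)
  have "(s powr p - 1) - p * (s - 1) \<le> p * ((s - 1) * (s powr (p - 1) - 1))"
    using t by (simp add: algebra_simps)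
  also have "\<dots> \<le> p * (\<bar>s powr p - 1\<bar> * \<bar>s powr p - 1\<bar>)"
  proof (intro mult_left_mono)
    have a: "\<bar>s - 1\<bar> \<le> \<bar>s powr p - 1\<bar>" using powr_diff_lower'[of p s 1 1] p s by simp
    have b: "\<bar>s powr (p - 1) - 1\<bar> \<le> \<bar>s powr p - 1\<bar>"
    proof (cases "s \<ge> 1")
      case True
      then have "1 \<le> s powr (p - 1)" "s powr (p - 1) \<le> s powr p" using p by (auto intro: ge_one_powr_ge_zero powr_mono)
      then show ?thesis by simp
    next
      case False
      then have "s powr (p - 1) \<le> 1" "s powr p \<le> s powr (p - 1)" using p s by (auto intro: powr_le1 powr_mono')
      then show ?thesis by simp
    qed
    have "(s - 1) * (s powr (p - 1) - 1) \<le> \<bar>s - 1\<bar> * \<bar>s powr (p - 1) - 1\<bar>" by (simp flip: abs_mult)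
    also have "\<dots> \<le> \<bar>s powr p - 1\<bar> * \<bar>s powr p - 1\<bar>" using a b by (intro mult_mono) auto
    finally show "(s - 1) * (s powr (p - 1) - 1) \<le> \<bar>s powr p - 1\<bar> * \<bar>s powr p - 1\<bar>" .
  qed (use p in auto)
  finally have key: "(s powr p - 1) - p * (s - 1) \<le> p * (s powr p - 1)\<^sup>2" by (simp add: power2_eq_square)
  have "\<alpha> * Phi \<alpha> s = s powr (\<alpha> + 1) - (\<alpha> + 1) * s + \<alpha>" by (rule alpha_Phi[OF \<alpha>])
  also have "\<dots> = (s powr p - 1)\<^sup>2 + 2 * ((s powr p - 1) - p * (s - 1))"
    unfolding s2p by (simp add: p(2) power2_diff algebra_simps)
  also have "\<dots> \<le> (\<alpha> + 2) * (s powr p - 1)\<^sup>2" using key by (simp add: p(2) algebra_simps)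
  finally show ?thesis by (simp add: p_def)
qed

lemma powr_superadditive:
  assumes "(q::real) \<ge> 1" "0 \<le> x" "0 \<le> (y::real)"
  shows "x powr q + y powr q \<le> (x + y) powr q"
proof -
  have "x powr q = x powr (q - 1) * x" "y powr q = y powr (q - 1) * y"
    by (rule powr_pred_mult[OF assms(2)], rule powr_pred_mult[OF assms(3)])
  moreover have "x powr (q - 1) * x \<le> (x + y) powr (q - 1) * x" "y powr (q - 1) * y \<le> (x + y) powr (q - 1) * y"
    using assms by (auto intro!: mult_right_mono powr_mono2)
  moreover have "(x + y) powr q = (x + y) powr (q - 1) * (x + y)" using assms by (intro powr_pred_mult) auto
  ultimately show ?thesis by (simp add: distrib_left)
qed

text \<open>The difference of the two sides vanishes at 0 and has derivative \<open>(\<alpha> + 1) *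
  ((1 + y) powr \<alpha> - 1 - y powr \<alpha>)\<close>, nonnegative by superadditivity of the
  power.\<close>

lemma Phi_lower_above:
  assumes \<alpha>: "\<alpha> > 1" and x: "0 \<le> x"
  shows "x powr (\<alpha> + 1) \<le> \<alpha> * Phi \<alpha> (1 + x)"
proof -
  define F where "F x = pospow (\<alpha> + 1) (1 + x) - 1 - (\<alpha> + 1) * x - pospow (\<alpha> + 1) x" for x
  have "F 0 \<le> F x"
  proof (rule DERIV_nonneg_imp_nondecreasing[OF x])
    fix y :: real assume y: "0 \<le> y" "y \<le> x"
    have d: "(pospow (\<alpha> + 1) has_real_derivative (\<alpha> + 1) * pospow \<alpha> (1 + y)) (at (1 + y))"
      using pospow_DERIV[of "\<alpha> + 1" "1 + y"] \<alpha> by simp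
    have e: "((\<lambda>x. 1 + x) has_real_derivative 1) (at y)" by (auto intro!: derivative_eq_intros)
    have "((\<lambda>x. pospow (\<alpha> + 1) (1 + x)) has_real_derivative (\<alpha> + 1) * pospow \<alpha> (1 + y) * 1) (at y)"
      by (rule DERIV_chain2[OF d e])
    then have "(F has_real_derivative ((\<alpha> + 1) * pospow \<alpha> (1 + y) * 1 - 0 - (\<alpha> + 1) * 1 - (\<alpha> + 1) * pospow \<alpha> y)) (at y)"
      unfolding F_def using pospow_DERIV[of "\<alpha> + 1" y] \<alpha>
      by (intro DERIV_diff DERIV_const DERIV_cmult DERIV_ident) auto
    moreover have "pospow \<alpha> 1 + pospow \<alpha> y \<le> pospow \<alpha> (1 + y)"
      using powr_superadditive[of \<alpha> 1 y] \<alpha> y by (simp add: pospow_def)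
    then have "0 \<le> (\<alpha> + 1) * (pospow \<alpha> (1 + y) - 1 - pospow \<alpha> y)"
      using \<alpha> by (intro mult_nonneg_nonneg) (auto simp: pospow_def)
    ultimately show "\<exists>z. (F has_real_derivative z) (at y) \<and> 0 \<le> z"
      by (intro exI[of _ "(\<alpha> + 1) * pospow \<alpha> (1 + y) * 1 - 0 - (\<alpha> + 1) * 1 - (\<alpha> + 1) * pospow \<alpha> y"]) (auto simp: algebra_simps)
  qed
  then have "x powr (\<alpha> + 1) \<le> (1 + x) powr (\<alpha> + 1) - 1 - (\<alpha> + 1) * x" using x by (simp add: F_def pospow_def)
  also have "\<dots> = \<alpha> * Phi \<alpha> (1 + x)" unfolding alpha_Phi[OF \<alpha>] by (simp add: algebra_simps)
  finally show ?thesis .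
qed

text \<open>The same monotonicity argument, with superadditivity for the decomposition of 1 into
  \<open>1 - y\<close> and \<open>y\<close>.\<close>

lemma Phi_lower_below:
  assumes \<alpha>: "\<alpha> > 1" and x: "0 \<le> x" "x \<le> 1"
  shows "x powr (\<alpha> + 1) \<le> \<alpha> * Phi \<alpha> (1 - x)"
proof -
  define F where "F x = pospow (\<alpha> + 1) (1 - x) - 1 + (\<alpha> + 1) * x - pospow (\<alpha> + 1) x" for x
  have "F 0 \<le> F x"
  proof (rule DERIV_nonneg_imp_nondecreasing[OF x(1)])
    fix y :: real assume y: "0 \<le> y" "y \<le> x"
    have d: "(pospow (\<alpha> + 1) has_real_derivative (\<alpha> + 1) * pospow \<alpha> (1 - y)) (at (1 - y))"
      using pospow_DERIV[of "\<alpha> + 1" "1 - y"] \<alpha> by simp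
    have e: "((\<lambda>x. 1 - x) has_real_derivative -1) (at y)" by (auto intro!: derivative_eq_intros)
    have "((\<lambda>x. pospow (\<alpha> + 1) (1 - x)) has_real_derivative (\<alpha> + 1) * pospow \<alpha> (1 - y) * (-1)) (at y)"
      by (rule DERIV_chain2[OF d e])
    then have "(F has_real_derivative ((\<alpha> + 1) * pospow \<alpha> (1 - y) * (-1) - 0 + (\<alpha> + 1) * 1 - (\<alpha> + 1) * pospow \<alpha> y)) (at y)"
      unfolding F_def using pospow_DERIV[of "\<alpha> + 1" y] \<alpha>
      by (intro DERIV_diff DERIV_add DERIV_const DERIV_cmult DERIV_ident) auto
    moreover have "pospow \<alpha> (1 - y) + pospow \<alpha> y \<le> 1"
      using powr_superadditive[of \<alpha> "1 - y" y] \<alpha> y x by (simp add: pospow_def)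
    then have "0 \<le> (\<alpha> + 1) * (1 - pospow \<alpha> (1 - y) - pospow \<alpha> y)"
      using \<alpha> by (intro mult_nonneg_nonneg) (auto simp: pospow_def)
    ultimately show "\<exists>z. (F has_real_derivative z) (at y) \<and> 0 \<le> z"
      by (intro exI[of _ "(\<alpha> + 1) * pospow \<alpha> (1 - y) * (-1) - 0 + (\<alpha> + 1) * 1 - (\<alpha> + 1) * pospow \<alpha> y"]) (auto simp: algebra_simps)
  qed
  then have "x powr (\<alpha> + 1) \<le> (1 - x) powr (\<alpha> + 1) - 1 + (\<alpha> + 1) * x" using x by (simp add: F_def pospow_def)
  also have "\<dots> = \<alpha> * Phi \<alpha> (1 - x)" unfolding alpha_Phi[OF \<alpha>] by (simp add: algebra_simps)
  finally show ?thesis .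
qed

lemma Phi_lower:
  assumes "\<alpha> > 1" "0 \<le> s"
  shows "\<bar>s - 1\<bar> powr (\<alpha> + 1) \<le> \<alpha> * Phi \<alpha> s"
  using Phi_lower_above[OF assms(1), of "s - 1"] Phi_lower_below[OF assms(1), of "1 - s"] assms(2)
  by (cases "s \<ge> 1") auto

lemma Phi_nonneg: "\<alpha> > 1 \<Longrightarrow> 0 \<le> s \<Longrightarrow> 0 \<le> Phi \<alpha> s"
  using Phi_lower[of \<alpha> s] powr_ge_zero[of "\<bar>s - 1\<bar>" "\<alpha> + 1"] by (smt (verit) mult_nonneg_nonpos2 zero_less_mult_pos mult_neg_pos mult_less_0_iff)

text \<open>Poincare compares \<open>V powr p\<close> with its own mean \<open>wb\<close>, whereas
  conservation of mass speaks of the mean \<open>a\<close> of \<open>V\<close>. This lemma passes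
  from one to the other. In the factor 4, one 2 comes from squaring a sum and the other from the
  mean deviation \<open>E\<close>, which Cauchy-Schwarz bounds by the variance.\<close>

lemma mean_power_deviation:
  fixes V :: "'x \<Rightarrow> real"
  assumes M: "finite_measure M" and m: "measure M (space M) > 0" and p: "p > 1"
    and V: "V \<in> borel_measurable M" "AE x in M. 0 \<le> V x \<and> V x \<le> C"
  defines "m \<equiv> measure M (space M)"
  defines "a \<equiv> (LINT x|M. V x) / m" and "wb \<equiv> (LINT x|M. V x powr p) / m"
  shows "(LINT x|M. (V x powr p - a powr p)\<^sup>2) \<le> 4 * p\<^sup>2 * (LINT x|M. (V x powr p - wb)\<^sup>2)"
proof -
  interpret finite_measure M by (rule M)
  note [measurable] = V(1)
  have m0: "m > 0" using m by (simp add: m_def)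
  have C: "C \<ge> 0"
  proof (rule ccontr)
    assume "\<not> C \<ge> 0"
    with V(2) have "AE x in M. False" by (elim eventually_mono) linarith
    then have "emeasure M (space M) = 0" by (subst (asm) AE_iff_measurable[of "space M"]) auto
    then show False using m by (simp add: measure_def)
  qed
  define w where "w x = V x powr p" for x
  have [measurable]: "w \<in> borel_measurable M" unfolding w_def by measurable
  have wb_bd: "AE x in M. norm (w x) \<le> C powr p"
    using V(2) by (rule eventually_mono) (use p in \<open>auto simp: w_def intro!: powr_mono2\<close>)
  have ws: "sq_integrable M w" by (rule sq_integrable_bounded[OF M _ wb_bd]) measurable
  have Vs: "sq_integrable M V"
    by (rule sq_integrable_bounded[OF M V(1), of C]) (use V(2) in \<open>rule eventually_mono, auto\<close>)
  have wi: "integrable M w" and Vi: "integrable M V" by (auto intro: integrable_sq[OF M] ws Vs)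
  have a0: "0 \<le> a" unfolding a_def using V(2) m0
    by (intro divide_nonneg_nonneg integral_nonneg_AE) (auto elim!: eventually_mono)
  have mV: "(LINT x|M. V x) = a * m" using m0 by (simp add: a_def)
  define E where "E = (LINT x|M. \<bar>w x - wb\<bar>) / m"
  have wm: "(LINT x|M. w x) = wb * m" using m0 by (simp add: wb_def w_def)
  \<comment> \<open>Above the mean, the tangent at \<open>s\<close> gives
    \<open>p * s powr (p - 1) * (s - a)\<close>; here \<open>s - a\<close> is the mean of
    \<open>s - V\<close>, and \<open>s powr (p - 1) * (s - V)\<close> is at most the difference of
    the powers. Below the mean, Jensen's inequality for \<open>a powr p\<close> suffices.\<close>
  have pt: "\<bar>s powr p - a powr p\<bar> \<le> p / m * (LINT y|M. \<bar>s powr p - w y\<bar>)" if s: "0 \<le> s" for s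
  proof (cases "a \<le> s")
    case True
    have "s powr p - a powr p \<le> p * s powr (p - 1) * (s - a)"
      using powr_tangent[OF p s a0] by (simp add: algebra_simps)
    also have "\<dots> = p / m * (s powr (p - 1) * (LINT y|M. s - V y))"
      using m0 Vi by (simp add: mV m_def[symmetric] field_simps)
    also have "s powr (p - 1) * (LINT y|M. s - V y) = (LINT y|M. s powr (p - 1) * (s - V y))" by simp
    also have "(LINT y|M. s powr (p - 1) * (s - V y)) \<le> (LINT y|M. \<bar>s powr p - w y\<bar>)"
    proof (rule integral_mono_AE)
      show "AE y in M. s powr (p - 1) * (s - V y) \<le> \<bar>s powr p - w y\<bar>"
        using V(2)
      proof (rule eventually_mono)
        fix y assume y: "0 \<le> V y \<and> V y \<le> C"
        have "s powr (p - 1) * (s - V y) \<le> s powr (p - 1) * \<bar>s - V y\<bar>" by (intro mult_left_mono) auto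
        also have "\<dots> \<le> \<bar>s powr p - w y\<bar>" unfolding w_def
          using powr_diff_lower'[of p s "V y" s] p s y by simp
        finally show "s powr (p - 1) * (s - V y) \<le> \<bar>s powr p - w y\<bar>" .
      qed
    qed (use Vi wi in auto)
    finally have "s powr p - a powr p \<le> p / m * (LINT y|M. \<bar>s powr p - w y\<bar>)" using p m0 by (simp add: divide_right_mono mult_left_mono)
    moreover have "a powr p \<le> s powr p" using True a0 p by (intro powr_mono2) auto
    ultimately show ?thesis by simp
  next
    case False
    have "a powr p * m \<le> (LINT y|M. w y)"
    proof -
      have "a powr p * m = (LINT y|M. a powr p + p * a powr (p - 1) * (V y - a))"
        using Vi by (simp add: mV m_def[symmetric])
      also have "\<dots> \<le> (LINT y|M. w y)"
      proof (rule integral_mono_AE)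
        show "AE y in M. a powr p + p * a powr (p - 1) * (V y - a) \<le> w y"
          using V(2)
        proof (rule eventually_mono)
          fix y assume y: "0 \<le> V y \<and> V y \<le> C"
          then show "a powr p + p * a powr (p - 1) * (V y - a) \<le> w y" unfolding w_def
            using powr_tangent[OF p a0, of "V y"] by simp
        qed
      qed (use Vi wi in auto)
      finally show ?thesis .
    qed
    then have "(a powr p - s powr p) * m \<le> (LINT y|M. w y - s powr p)"
      using wi by (simp add: m_def[symmetric] algebra_simps)
    also have "\<dots> \<le> (LINT y|M. \<bar>s powr p - w y\<bar>)" using wi by (intro integral_mono) auto
    finally have "a powr p - s powr p \<le> (LINT y|M. \<bar>s powr p - w y\<bar>) / m" using m0 by (simp add: field_simps)
    also have "\<dots> \<le> p / m * (LINT y|M. \<bar>s powr p - w y\<bar>)"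
      using p m0 mult_right_mono[of 1 p "LINT y|M. \<bar>s powr p - w y\<bar>"] by (simp add: divide_right_mono)
    finally have "a powr p - s powr p \<le> p / m * (LINT y|M. \<bar>s powr p - w y\<bar>)" .
    moreover have "s powr p \<le> a powr p" using False s p by (intro powr_mono2) auto
    ultimately show ?thesis by simp
  qed
  have pt2: "(s powr p - a powr p)\<^sup>2 \<le> 2 * p\<^sup>2 * ((s powr p - wb)\<^sup>2 + E\<^sup>2)" if s: "0 \<le> s" for s
  proof -
    have "(LINT y|M. \<bar>s powr p - w y\<bar>) \<le> (LINT y|M. \<bar>s powr p - wb\<bar> + \<bar>w y - wb\<bar>)"
      using wi by (intro integral_mono) auto
    also have "\<dots> = m * (\<bar>s powr p - wb\<bar> + E)" using wi m0 by (simp add: E_def m_def[symmetric] distrib_left)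
    finally have "p / m * (LINT y|M. \<bar>s powr p - w y\<bar>) \<le> p / m * (m * (\<bar>s powr p - wb\<bar> + E))"
      using p m0 by (intro mult_left_mono) auto
    then have "\<bar>s powr p - a powr p\<bar> \<le> p * (\<bar>s powr p - wb\<bar> + E)" using pt[OF s] m0 by simp
    then have "\<bar>s powr p - a powr p\<bar>\<^sup>2 \<le> (p * (\<bar>s powr p - wb\<bar> + E))\<^sup>2" by (intro power_mono) auto
    also have "\<dots> = p\<^sup>2 * (\<bar>s powr p - wb\<bar> + E)\<^sup>2" by (simp add: power_mult_distrib)
    also have "\<dots> \<le> p\<^sup>2 * (2 * (s powr p - wb)\<^sup>2 + 2 * E\<^sup>2)"
      using norm_add_sq_le[of "\<bar>s powr p - wb\<bar>" E] by (intro mult_left_mono) auto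
    finally show ?thesis by (simp add: algebra_simps)
  qed
  have ds: "sq_integrable M (\<lambda>x. w x - wb)" and das: "sq_integrable M (\<lambda>x. w x - a powr p)"
    by (auto intro!: sq_integrable_diff ws simp: sq_integrable_def[of M "\<lambda>x. c" for c])
  have E2: "m * E\<^sup>2 \<le> (LINT x|M. (w x - wb)\<^sup>2)"
  proof -
    have s1: "sq_integrable M (\<lambda>x. 1::real)" by (simp add: sq_integrable_def)
    have "(LINT x|M. \<bar>w x - wb\<bar> * 1)\<^sup>2 \<le> (LINT x|M. \<bar>w x - wb\<bar>\<^sup>2) * (LINT x|M. 1\<^sup>2)"
      by (rule Cauchy_Schwarz_integral) (use sq_integrable_norm[OF ds] s1 in auto)
    then have "(LINT x|M. \<bar>w x - wb\<bar>)\<^sup>2 \<le> (LINT x|M. (w x - wb)\<^sup>2) * m" by (simp add: m_def)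
    then show ?thesis using m0 by (simp add: E_def power_divide power2_eq_square field_simps)
  qed
  have "(LINT x|M. (w x - a powr p)\<^sup>2) \<le> (LINT x|M. 2 * p\<^sup>2 * ((w x - wb)\<^sup>2 + E\<^sup>2))"
  proof (rule integral_mono_AE)
    show "AE x in M. (w x - a powr p)\<^sup>2 \<le> 2 * p\<^sup>2 * ((w x - wb)\<^sup>2 + E\<^sup>2)"
      using V(2) by (rule eventually_mono) (use pt2 in \<open>auto simp: w_def\<close>)
  qed (use sq_integrable_realD[OF ds] sq_integrable_realD[OF das] in auto)
  also have "\<dots> = 2 * p\<^sup>2 * ((LINT x|M. (w x - wb)\<^sup>2) + m * E\<^sup>2)"
    using sq_integrable_realD[OF ds] by (simp add: m_def)
  also have "\<dots> \<le> 2 * p\<^sup>2 * ((LINT x|M. (w x - wb)\<^sup>2) + (LINT x|M. (w x - wb)\<^sup>2))"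
    using E2 by (intro mult_left_mono) auto
  finally show ?thesis by (simp add: w_def)
qed

text \<open>\<open>A\<close> and \<open>B\<close> are the \<open>p\<close>-th powers of the two means, and \<open>w\<close>, \<open>z\<close> those of the trace and of the road density at one point.
  Conservation of mass forces \<open>max A B \<ge> 1\<close>; this excludes the degenerate region near \<open>0\<close>, where the \<open>q\<close>-th power has zero slope.\<close>

lemma equilibrium_gap_pointwise:
  assumes q: "q \<ge> 1" "q \<le> 2" and nn: "0 \<le> A" "0 \<le> B" "A \<le> K" "B \<le> K" "1 \<le> max A B" "0 \<le> w" "0 \<le> (z::real)"
  shows "\<bar>A - B\<bar> \<le> (3 + 2 * K) * (\<bar>w - A\<bar> + \<bar>z - B\<bar> + \<bar>w powr q - z powr q\<bar>)"
proof (cases "1/2 \<le> max w z")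
  case True
  have "(1/2) powr (q - 1) * \<bar>w - z\<bar> \<le> \<bar>w powr q - z powr q\<bar>"
    using powr_diff_lower'[of q w z "1/2"] q nn True by simp
  moreover have "(1/2) powr 1 \<le> (1/2::real) powr (q - 1)" using q by (intro powr_mono') auto
  then have "(1/2) * \<bar>w - z\<bar> \<le> (1/2) powr (q - 1) * \<bar>w - z\<bar>" by (intro mult_right_mono) auto
  ultimately have "(1/2) * \<bar>w - z\<bar> \<le> \<bar>w powr q - z powr q\<bar>" by (rule order_trans[rotated])
  moreover have "\<bar>A - B\<bar> \<le> \<bar>w - A\<bar> + \<bar>w - z\<bar> + \<bar>z - B\<bar>" by linarith
  moreover have "0 \<le> \<bar>w - A\<bar>" "0 \<le> \<bar>z - B\<bar>" "0 \<le> \<bar>w powr q - z powr q\<bar>" by simp_all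
  ultimately have "\<bar>A - B\<bar> \<le> 3 * (\<bar>w - A\<bar> + \<bar>z - B\<bar> + \<bar>w powr q - z powr q\<bar>)" by argo
  also have "\<dots> \<le> (3 + 2 * K) * (\<bar>w - A\<bar> + \<bar>z - B\<bar> + \<bar>w powr q - z powr q\<bar>)"
    using nn by (intro mult_right_mono) auto
  finally show ?thesis .
next
  case False
  then have "1/2 \<le> \<bar>w - A\<bar> + \<bar>z - B\<bar> + \<bar>w powr q - z powr q\<bar>" using nn by linarith
  then have "(3 + 2 * K) * (1/2) \<le> (3 + 2 * K) * (\<bar>w - A\<bar> + \<bar>z - B\<bar> + \<bar>w powr q - z powr q\<bar>)"
    using nn by (intro mult_left_mono) auto
  moreover have "\<bar>A - B\<bar> \<le> K" using nn(1-4) by linarith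
  then have "\<bar>A - B\<bar> \<le> (3 + 2 * K) * (1/2)" by simp
  ultimately show ?thesis by linarith
qed

section \<open>From dissipation to entropy\<close>

locale entropy_exponents =
  fixes \<alpha> vinf uinf :: real
  assumes \<alpha>: "\<alpha> > 1" and vinf: "vinf > 0" and uinf: "uinf > 0"
begin

definition p where "p = (\<alpha> + 1) / 2"

lemma p: "p > 1" using \<alpha> by (simp add: p_def)

lemma integral_Phi_le:
  fixes V :: "'x \<Rightarrow> real"
  assumes M: "finite_measure M" and V: "V \<in> borel_measurable M" "AE x in M. 0 \<le> V x \<and> V x \<le> C"
  shows "integrable M (\<lambda>x. Phi \<alpha> (V x))"
    and "\<alpha> * (LINT x|M. Phi \<alpha> (V x)) \<le> 2 * (\<alpha> + 2) * ((LINT x|M. (V x powr p - A)\<^sup>2) + measure M (space M) * (A - 1)\<^sup>2)"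
proof -
  interpret finite_measure M by (rule M)
  note [measurable] = V(1)
  have b: "AE x in M. norm (V x powr q) \<le> C powr q" if "q > 0" for q
    using V(2) by (rule eventually_mono) (use that in \<open>auto intro!: powr_mono2\<close>)
  have ws: "sq_integrable M (\<lambda>x. V x powr p)" "sq_integrable M (\<lambda>x. V x powr (\<alpha> + 1))"
    using p \<alpha> by (auto intro!: sq_integrable_bounded[OF M _ b])
  have Vs: "sq_integrable M V"
    by (rule sq_integrable_bounded[OF M V(1), of C]) (use V(2) in \<open>rule eventually_mono, auto\<close>)
  show i: "integrable M (\<lambda>x. Phi \<alpha> (V x))"
    unfolding Phi_def using integrable_sq[OF M ws(2)] integrable_sq[OF M Vs] by auto
  have s: "sq_integrable M (\<lambda>x. V x powr p - A)"
    by (intro sq_integrable_diff ws) (simp add: sq_integrable_def)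
  have "\<alpha> * (LINT x|M. Phi \<alpha> (V x)) = (LINT x|M. \<alpha> * Phi \<alpha> (V x))" by simp
  also have "\<dots> \<le> (LINT x|M. 2 * (\<alpha> + 2) * ((V x powr p - A)\<^sup>2 + (A - 1)\<^sup>2))"
  proof (rule integral_mono_AE)
    show "AE x in M. \<alpha> * Phi \<alpha> (V x) \<le> 2 * (\<alpha> + 2) * ((V x powr p - A)\<^sup>2 + (A - 1)\<^sup>2)"
      using V(2)
    proof (rule eventually_mono)
      fix x assume x: "0 \<le> V x \<and> V x \<le> C"
      have "\<alpha> * Phi \<alpha> (V x) \<le> (\<alpha> + 2) * (V x powr p - 1)\<^sup>2" unfolding p_def by (rule Phi_upper[OF \<alpha>]) (use x in auto)
      also have "\<dots> \<le> (\<alpha> + 2) * (2 * (V x powr p - A)\<^sup>2 + 2 * (A - 1)\<^sup>2)"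
        using \<alpha> norm_add_sq_le[of "V x powr p - A" "A - 1"] by (intro mult_left_mono) auto
      finally show "\<alpha> * Phi \<alpha> (V x) \<le> 2 * (\<alpha> + 2) * ((V x powr p - A)\<^sup>2 + (A - 1)\<^sup>2)" by (simp add: algebra_simps)
    qed
  qed (use i sq_integrable_realD[OF s] in auto)
  also have "\<dots> = 2 * (\<alpha> + 2) * ((LINT x|M. (V x powr p - A)\<^sup>2) + measure M (space M) * (A - 1)\<^sup>2)"
    using sq_integrable_realD[OF s] by simp
  finally show "\<alpha> * (LINT x|M. Phi \<alpha> (V x)) \<le> 2 * (\<alpha> + 2) * ((LINT x|M. (V x powr p - A)\<^sup>2) + measure M (space M) * (A - 1)\<^sup>2)" .
qed

text \<open>The mass relation puts \<open>a\<close> and \<open>b\<close> on opposite sides of 1, so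
  both distances to 1 are at most \<open>\<bar>a - b\<bar>\<close>. As the larger of the two is at
  least 1, that gap is controlled by the gap of the p-th powers. Neither mean exceeds
  \<open>k\<close> because the other one is nonnegative.\<close>

lemma mass_equilibrium_gap:
  assumes c: "c1 > 0" "c2 > 0" and ab: "0 \<le> a" "0 \<le> b" "c1 * (a - 1) + c2 * (b - 1) = 0"
  defines "k \<equiv> 2 + c1 / c2 + c2 / c1"
  shows "a powr p \<le> k powr p" "b powr p \<le> k powr p" "1 \<le> max (a powr p) (b powr p)"
    "(a powr p - 1)\<^sup>2 \<le> (p * k powr (p - 1))\<^sup>2 * (a powr p - b powr p)\<^sup>2"
    "(b powr p - 1)\<^sup>2 \<le> (p * k powr (p - 1))\<^sup>2 * (a powr p - b powr p)\<^sup>2"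
proof -
  have eq: "c1 * (a - 1) = c2 * (1 - b)" using ab(3) by (simp add: algebra_simps)
  have q0: "0 < c1 / c2" "0 < c2 / c1" using c by auto
  have k: "k > 1" using q0 by (simp add: k_def)
  have ale: "a \<le> k"
  proof -
    have "c1 * (a - 1) \<le> c2" unfolding eq using c ab mult_left_mono[of "1 - b" 1 c2] by simp
    then have "a - 1 \<le> c2 / c1" using c by (simp add: pos_le_divide_eq mult.commute)
    then show ?thesis using q0 by (simp add: k_def)
  qed
  have ble: "b \<le> k"
  proof -
    have "c2 * (b - 1) = c1 * (1 - a)" using eq by (simp add: algebra_simps)
    also have "\<dots> \<le> c1" using c ab mult_left_mono[of "1 - a" 1 c1] by simp
    finally have "b - 1 \<le> c1 / c2" using c by (simp add: pos_le_divide_eq mult.commute)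
    then show ?thesis using q0 by (simp add: k_def)
  qed
  have cases: "(a \<ge> 1 \<and> b \<le> 1) \<or> (a \<le> 1 \<and> b \<ge> 1)"
  proof (cases "a \<ge> 1")
    case True
    then have "0 \<le> c2 * (1 - b)" unfolding eq[symmetric] using c by (intro mult_nonneg_nonneg) auto
    then show ?thesis using True c by (simp add: zero_le_mult_iff)
  next
    case False
    then have "c2 * (1 - b) \<le> 0" unfolding eq[symmetric] using c by (intro mult_nonneg_nonpos) auto
    then show ?thesis using False c by (simp add: mult_le_0_iff)
  qed
  show "a powr p \<le> k powr p" "b powr p \<le> k powr p" using ale ble ab p by (auto intro!: powr_mono2)
  show "1 \<le> max (a powr p) (b powr p)"
    using cases p by (auto simp: le_max_iff_disj intro!: ge_one_powr_ge_zero)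
  have m1: "1 \<le> max a b" using cases by auto
  have gap: "\<bar>a - b\<bar> \<le> \<bar>a powr p - b powr p\<bar>"
    using powr_diff_lower'[of p a b 1] p ab m1 by simp
  have up: "\<bar>s powr p - 1\<bar> \<le> p * k powr (p - 1) * \<bar>s - 1\<bar>" if s: "0 \<le> s" "s \<le> k" for s
  proof (cases "s \<ge> 1")
    case True
    have "s powr p - 1 \<le> p * s powr (p - 1) * (s - 1)" using powr_tangent[OF p s(1), of 1] by (simp add: algebra_simps)
    also have "\<dots> \<le> p * k powr (p - 1) * (s - 1)"
      using True s p by (intro mult_right_mono mult_left_mono powr_mono2) auto
    finally show ?thesis using True p ge_one_powr_ge_zero[of s p] by simp
  next
    case False
    have "1 - s powr p \<le> p * (1 - s)" using powr_tangent[OF p, of 1 s] s by (simp add: algebra_simps)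
    also have "\<dots> \<le> p * k powr (p - 1) * (1 - s)"
      using False p k ge_one_powr_ge_zero[of k "p - 1"] by (intro mult_right_mono) auto
    finally show ?thesis using False s p powr_le1[of p s] by simp
  qed
  have fin: "(s powr p - 1)\<^sup>2 \<le> (p * k powr (p - 1))\<^sup>2 * (a powr p - b powr p)\<^sup>2"
    if s: "0 \<le> s" "s \<le> k" "\<bar>s - 1\<bar> \<le> \<bar>a - b\<bar>" for s
  proof -
    have "\<bar>s powr p - 1\<bar> \<le> p * k powr (p - 1) * \<bar>s - 1\<bar>" by (rule up[OF s(1,2)])
    also have "\<dots> \<le> p * k powr (p - 1) * \<bar>a powr p - b powr p\<bar>"
      using s(3) gap p by (intro mult_left_mono) auto
    finally have "\<bar>s powr p - 1\<bar>\<^sup>2 \<le> (p * k powr (p - 1) * \<bar>a powr p - b powr p\<bar>)\<^sup>2" by (intro power_mono) auto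
    then show ?thesis by (simp add: power_mult_distrib)
  qed
  have "\<bar>a - 1\<bar> \<le> \<bar>a - b\<bar>" "\<bar>b - 1\<bar> \<le> \<bar>a - b\<bar>" using cases by auto
  then show "(a powr p - 1)\<^sup>2 \<le> (p * k powr (p - 1))\<^sup>2 * (a powr p - b powr p)\<^sup>2"
    "(b powr p - 1)\<^sup>2 \<le> (p * k powr (p - 1))\<^sup>2 * (a powr p - b powr p)\<^sup>2"
    using fin ale ble ab by auto
qed

text \<open>\<open>C\<close> is chosen before the functions and before their bound \<open>B\<close>,
  so the later rate does not depend on the size of the solution. \<open>P\<close> and
  \<open>Q\<close> stand for the squared gradient norms, and the three integral hypotheses for the
  Poincare inequalities and the trace inequality; this keeps Sobolev spaces out of the
  argument.\<close>

lemma entropy_entropy_dissipation: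
  assumes K: "0 \<le> K1" "0 \<le> K2" "0 \<le> kt" and m: "m1 > 0" "m2 > 0"
  shows "\<exists>C>0. \<forall>(M::'x measure) (N::'y measure) V U W B P Q.
    finite_measure M \<longrightarrow> finite_measure N \<longrightarrow> measure M (space M) = m1 \<longrightarrow> measure N (space N) = m2 \<longrightarrow>
    V \<in> borel_measurable M \<longrightarrow> U \<in> borel_measurable N \<longrightarrow> W \<in> borel_measurable N \<longrightarrow>
    (AE x in M. 0 \<le> V x \<and> V x \<le> B) \<longrightarrow> (AE x in N. 0 \<le> U x \<and> U x \<le> B) \<longrightarrow> (AE x in N. 0 \<le> W x \<and> W x \<le> B) \<longrightarrow>
    vinf * (LINT x|M. V x) + uinf * (LINT x|N. U x) = vinf * m1 + uinf * m2 \<longrightarrow>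
    (LINT x|M. (V x powr p - (LINT x|M. V x powr p) / m1)\<^sup>2) \<le> K1 * P \<longrightarrow>
    (LINT x|N. (U x powr p - (LINT x|N. U x powr p) / m2)\<^sup>2) \<le> K2 * Q \<longrightarrow>
    (\<forall>a. (LINT x|N. (W x powr p - a)\<^sup>2) \<le> kt * ((LINT x|M. (V x powr p - a)\<^sup>2) + P)) \<longrightarrow>
    0 \<le> P \<longrightarrow> 0 \<le> Q \<longrightarrow>
    vinf * (LINT x|M. Phi \<alpha> (V x)) + uinf * (LINT x|N. Phi \<alpha> (U x))
      \<le> C * (P + Q + (LINT x|N. (W x powr \<alpha> - U x powr \<alpha>)\<^sup>2))"
proof -
  define c1 where "c1 = vinf * m1"
  define c2 where "c2 = uinf * m2"
  have c: "c1 > 0" "c2 > 0" using m vinf uinf by (auto simp: c1_def c2_def)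
  define k where "k = 2 + c1 / c2 + c2 / c1"
  \<comment> \<open>Relative to the dissipation \<open>Y\<close>: \<open>k1\<close> and
    \<open>k2\<close> bound the squared deviations of the two powers from the powers
    \<open>A\<close> and \<open>D\<close> of the means, \<open>k3\<close> that of the trace from
    \<open>A\<close>, \<open>k4\<close> the squared gap of \<open>A\<close> and \<open>D\<close>,
    and \<open>k5\<close> their squared distances to 1.\<close>
  define k1 where "k1 = 4 * p\<^sup>2 * K1"
  define k2 where "k2 = 4 * p\<^sup>2 * K2"
  define k3 where "k3 = kt * (k1 + 1)"
  define k4 where "k4 = 3 * (3 + 2 * k powr p)\<^sup>2 * (k3 + k2 + 1) / m2"
  define k5 where "k5 = (p * k powr (p - 1))\<^sup>2 * k4"
  define C where "C = (vinf * (2 * (\<alpha> + 2) * (k1 + m1 * k5)) + uinf * (2 * (\<alpha> + 2) * (k2 + m2 * k5))) / \<alpha> + 1"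
  have pos: "0 \<le> k1" "0 \<le> k2" "0 \<le> k3" "0 \<le> k4" "0 \<le> k5"
    using K m by (auto simp: k1_def k2_def k3_def k4_def k5_def intro!: mult_nonneg_nonneg divide_nonneg_pos add_nonneg_nonneg)
  have Cpos: "C > 0" unfolding C_def using pos m vinf uinf \<alpha>
    by (intro add_nonneg_pos divide_nonneg_pos add_nonneg_nonneg mult_nonneg_nonneg) auto
  show ?thesis
  proof (intro exI[of _ C] conjI Cpos allI impI)
    fix M :: "'x measure" and N :: "'y measure" and V U W B P Q
    assume fin: "finite_measure M" "finite_measure N" and ms: "measure M (space M) = m1" "measure N (space N) = m2"
      and meas: "V \<in> borel_measurable M" "U \<in> borel_measurable N" "W \<in> borel_measurable N"
      and bV: "AE x in M. 0 \<le> V x \<and> V x \<le> B" and bU: "AE x in N. 0 \<le> U x \<and> U x \<le> B" and bW: "AE x in N. 0 \<le> W x \<and> W x \<le> B"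
      and mass: "vinf * (LINT x|M. V x) + uinf * (LINT x|N. U x) = vinf * m1 + uinf * m2"
      and PV: "(LINT x|M. (V x powr p - (LINT x|M. V x powr p) / m1)\<^sup>2) \<le> K1 * P"
      and PU: "(LINT x|N. (U x powr p - (LINT x|N. U x powr p) / m2)\<^sup>2) \<le> K2 * Q"
      and T: "\<forall>a. (LINT x|N. (W x powr p - a)\<^sup>2) \<le> kt * ((LINT x|M. (V x powr p - a)\<^sup>2) + P)"
      and PQ0: "0 \<le> P" "0 \<le> Q"
    interpret N: finite_measure N by (rule fin)
    note [measurable] = meas
    define R where "R = (LINT x|N. (W x powr \<alpha> - U x powr \<alpha>)\<^sup>2)"
    define Y where "Y = P + Q + R"
    have R0: "0 \<le> R" by (simp add: R_def)
    have Y: "0 \<le> Y" "P \<le> Y" "Q \<le> Y" "R \<le> Y" using PQ0 R0 by (auto simp: Y_def)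
    define a where "a = (LINT x|M. V x) / m1"
    define b where "b = (LINT x|N. U x) / m2"
    have ab0: "0 \<le> a" "0 \<le> b" unfolding a_def b_def using m bV bU
      by (auto intro!: divide_nonneg_nonneg integral_nonneg_AE elim!: eventually_mono)
    have ab: "c1 * (a - 1) + c2 * (b - 1) = 0"
    proof -
      have "c1 * a = vinf * (LINT x|M. V x)" "c2 * b = uinf * (LINT x|N. U x)"
        using m by (simp_all add: a_def b_def c1_def c2_def)
      moreover have "c1 * (a - 1) + c2 * (b - 1) = c1 * a + c2 * b - (vinf * m1 + uinf * m2)"
        by (simp add: right_diff_distrib c1_def c2_def)
      ultimately show ?thesis using mass by linarith
    qed
    note gap = mass_equilibrium_gap[OF c ab0 ab, folded k_def]
    define A where "A = a powr p"
    define D where "D = b powr p"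
    have X1: "(LINT x|M. (V x powr p - A)\<^sup>2) \<le> k1 * Y"
    proof -
      have "(LINT x|M. (V x powr p - A)\<^sup>2) \<le> 4 * p\<^sup>2 * (LINT x|M. (V x powr p - (LINT x|M. V x powr p) / m1)\<^sup>2)"
        using mean_power_deviation[OF fin(1) _ p meas(1) bV] m by (simp add: ms a_def A_def)
      also have "\<dots> \<le> 4 * p\<^sup>2 * (K1 * P)" using PV by (intro mult_left_mono) auto
      also have "\<dots> \<le> 4 * p\<^sup>2 * (K1 * Y)" using Y K by (intro mult_left_mono) auto
      finally show ?thesis by (simp add: k1_def)
    qed
    have X2: "(LINT x|N. (U x powr p - D)\<^sup>2) \<le> k2 * Y"
    proof -
      have "(LINT x|N. (U x powr p - D)\<^sup>2) \<le> 4 * p\<^sup>2 * (LINT x|N. (U x powr p - (LINT x|N. U x powr p) / m2)\<^sup>2)"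
        using mean_power_deviation[OF fin(2) _ p meas(2) bU] m by (simp add: ms b_def D_def)
      also have "\<dots> \<le> 4 * p\<^sup>2 * (K2 * Q)" using PU by (intro mult_left_mono) auto
      also have "\<dots> \<le> 4 * p\<^sup>2 * (K2 * Y)" using Y K by (intro mult_left_mono) auto
      finally show ?thesis by (simp add: k2_def)
    qed
    have X3: "(LINT x|N. (W x powr p - A)\<^sup>2) \<le> k3 * Y"
    proof -
      have "(LINT x|N. (W x powr p - A)\<^sup>2) \<le> kt * ((LINT x|M. (V x powr p - A)\<^sup>2) + P)" using T by blast
      also have "\<dots> \<le> kt * (k1 * Y + Y)" using X1 Y K by (intro mult_left_mono add_mono) auto
      finally show ?thesis by (simp add: k3_def algebra_simps)
    qed
    define G where "G = (3 + 2 * k powr p)"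
    have bnd: "AE x in N. norm (Z x powr q) \<le> B powr q" if "q > 0" "AE x in N. 0 \<le> Z x \<and> Z x \<le> B" for q Z
      using that(2) by (rule eventually_mono) (use that(1) in \<open>auto intro!: powr_mono2\<close>)
    have cst: "sq_integrable N (\<lambda>x. c::real)" for c by (simp add: sq_integrable_def)
    have s: "sq_integrable N (\<lambda>x. W x powr p - A)" "sq_integrable N (\<lambda>x. U x powr p - D)" "sq_integrable N (\<lambda>x. W x powr \<alpha> - U x powr \<alpha>)"
      using p \<alpha> bU bW by (auto intro!: sq_integrable_diff cst sq_integrable_bounded[OF fin(2) _ bnd])
    have i: "integrable N (\<lambda>x. (W x powr p - A)\<^sup>2)" "integrable N (\<lambda>x. (U x powr p - D)\<^sup>2)" "integrable N (\<lambda>x. (W x powr \<alpha> - U x powr \<alpha>)\<^sup>2)"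
      using s[THEN sq_integrable_realD] by auto
    have "m2 * (A - D)\<^sup>2 = (LINT x|N. (A - D)\<^sup>2)" by (simp add: ms)
    also have "\<dots> \<le> (LINT x|N. 3 * G\<^sup>2 * ((W x powr p - A)\<^sup>2 + (U x powr p - D)\<^sup>2 + (W x powr \<alpha> - U x powr \<alpha>)\<^sup>2))"
    proof (rule integral_mono_AE)
      show "AE x in N. (A - D)\<^sup>2 \<le> 3 * G\<^sup>2 * ((W x powr p - A)\<^sup>2 + (U x powr p - D)\<^sup>2 + (W x powr \<alpha> - U x powr \<alpha>)\<^sup>2)"
        using bU bW
      proof eventually_elim
        case (elim x)
        \<comment> \<open>The exponent that turns p-th powers into \<alpha>-th powers; it is
          \<open>2 * \<alpha> / (\<alpha> + 1)\<close>, hence between 1 and 2.\<close>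
        define q where "q = \<alpha> / p"
        have q: "1 \<le> q" "q \<le> 2" "p * q = \<alpha>" using \<alpha> p by (auto simp: q_def p_def field_simps)
        have "(W x powr p) powr q = W x powr \<alpha>" "(U x powr p) powr q = U x powr \<alpha>"
          unfolding powr_powr q(3) by simp_all
        then have "\<bar>A - D\<bar> \<le> G * (\<bar>W x powr p - A\<bar> + \<bar>U x powr p - D\<bar> + \<bar>W x powr \<alpha> - U x powr \<alpha>\<bar>)"
          using equilibrium_gap_pointwise[OF q(1,2), of A D "k powr p" "W x powr p" "U x powr p"] gap(1-3)
          by (simp add: A_def D_def G_def)
        then have "\<bar>A - D\<bar>\<^sup>2 \<le> (G * (\<bar>W x powr p - A\<bar> + \<bar>U x powr p - D\<bar> + \<bar>W x powr \<alpha> - U x powr \<alpha>\<bar>))\<^sup>2"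
          by (intro power_mono) auto
        also have "\<dots> = G\<^sup>2 * (\<bar>W x powr p - A\<bar> + \<bar>U x powr p - D\<bar> + \<bar>W x powr \<alpha> - U x powr \<alpha>\<bar>)\<^sup>2"
          by (simp add: power_mult_distrib)
        also have "\<dots> \<le> G\<^sup>2 * (3 * (\<bar>W x powr p - A\<bar>\<^sup>2 + \<bar>U x powr p - D\<bar>\<^sup>2 + \<bar>W x powr \<alpha> - U x powr \<alpha>\<bar>\<^sup>2))"
        proof (intro mult_left_mono)
          have "(x + y + z)\<^sup>2 \<le> 3 * (x\<^sup>2 + y\<^sup>2 + z\<^sup>2)" for x y z :: real
            using sum_squares_bound[of x y] sum_squares_bound[of y z] sum_squares_bound[of x z]
            by (simp add: power2_eq_square algebra_simps)
          then show "(\<bar>W x powr p - A\<bar> + \<bar>U x powr p - D\<bar> + \<bar>W x powr \<alpha> - U x powr \<alpha>\<bar>)\<^sup>2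
            \<le> 3 * (\<bar>W x powr p - A\<bar>\<^sup>2 + \<bar>U x powr p - D\<bar>\<^sup>2 + \<bar>W x powr \<alpha> - U x powr \<alpha>\<bar>\<^sup>2)" .
        qed auto
        finally show ?case by (simp add: algebra_simps)
      qed
    qed (use i in auto)
    also have "\<dots> = 3 * G\<^sup>2 * ((LINT x|N. (W x powr p - A)\<^sup>2) + (LINT x|N. (U x powr p - D)\<^sup>2) + R)"
      using i by (simp add: R_def)
    also have "\<dots> \<le> 3 * G\<^sup>2 * (k3 * Y + k2 * Y + Y)"
      using X2 X3 Y by (intro mult_left_mono add_mono) auto
    finally have AD: "(A - D)\<^sup>2 \<le> k4 * Y"
      using m by (simp add: k4_def G_def field_simps)
    have A1: "(A - 1)\<^sup>2 \<le> k5 * Y" and D1: "(D - 1)\<^sup>2 \<le> k5 * Y"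
      using gap(4,5) mult_left_mono[OF AD, of "(p * k powr (p - 1))\<^sup>2"]
      by (auto simp: k5_def A_def D_def mult.assoc)
    have "\<alpha> * (LINT x|M. Phi \<alpha> (V x)) \<le> 2 * (\<alpha> + 2) * ((LINT x|M. (V x powr p - A)\<^sup>2) + m1 * (A - 1)\<^sup>2)"
      using integral_Phi_le(2)[OF fin(1) meas(1) bV, of A] by (simp add: ms)
    also have "\<dots> \<le> 2 * (\<alpha> + 2) * (k1 * Y + m1 * (k5 * Y))"
      using X1 A1 m \<alpha> by (intro mult_left_mono add_mono) auto
    finally have HV: "\<alpha> * (LINT x|M. Phi \<alpha> (V x)) \<le> 2 * (\<alpha> + 2) * (k1 + m1 * k5) * Y" by (simp add: algebra_simps)
    have "\<alpha> * (LINT x|N. Phi \<alpha> (U x)) \<le> 2 * (\<alpha> + 2) * ((LINT x|N. (U x powr p - D)\<^sup>2) + m2 * (D - 1)\<^sup>2)"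
      using integral_Phi_le(2)[OF fin(2) meas(2) bU, of D] by (simp add: ms)
    also have "\<dots> \<le> 2 * (\<alpha> + 2) * (k2 * Y + m2 * (k5 * Y))"
      using X2 D1 m \<alpha> by (intro mult_left_mono add_mono) auto
    finally have HU: "\<alpha> * (LINT x|N. Phi \<alpha> (U x)) \<le> 2 * (\<alpha> + 2) * (k2 + m2 * k5) * Y" by (simp add: algebra_simps)
    have "\<alpha> * (vinf * (LINT x|M. Phi \<alpha> (V x)) + uinf * (LINT x|N. Phi \<alpha> (U x)))
      = vinf * (\<alpha> * (LINT x|M. Phi \<alpha> (V x))) + uinf * (\<alpha> * (LINT x|N. Phi \<alpha> (U x)))" by (simp add: algebra_simps)
    also have "\<dots> \<le> vinf * (2 * (\<alpha> + 2) * (k1 + m1 * k5) * Y) + uinf * (2 * (\<alpha> + 2) * (k2 + m2 * k5) * Y)"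
      using HV HU vinf uinf by (intro add_mono mult_left_mono) auto
    also have "\<dots> = \<alpha> * ((C - 1) * Y)" using \<alpha> by (simp add: C_def field_simps)
    finally have "vinf * (LINT x|M. Phi \<alpha> (V x)) + uinf * (LINT x|N. Phi \<alpha> (U x)) \<le> (C - 1) * Y" using \<alpha> by simp
    also have "\<dots> \<le> C * Y" using Y by (intro mult_right_mono) auto
    finally show "vinf * (LINT x|M. Phi \<alpha> (V x)) + uinf * (LINT x|N. Phi \<alpha> (U x))
      \<le> C * (P + Q + (LINT x|N. (W x powr \<alpha> - U x powr \<alpha>)\<^sup>2))" by (simp add: Y_def R_def)
  qed
qed

end

section \<open>Weak derivatives in time\<close>

text \<open>The primitive of a mollifier. Differences of its rescaled translates will approximate
  indicators of intervals, with approximate identities as derivatives.\<close>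

lemma smooth_step_exists:
  obtains R \<rho> :: "real \<Rightarrow> real" and K where "smooth R" "\<And>x. (R has_real_derivative \<rho> x) (at x)"
    "\<And>x. x \<le> -1 \<Longrightarrow> R x = 0" "\<And>x. x \<ge> 1 \<Longrightarrow> R x = 1" "\<And>x. \<bar>R x\<bar> \<le> K"
    "continuous_on UNIV \<rho>" "\<And>x. \<bar>x\<bar> \<ge> 1 \<Longrightarrow> \<rho> x = 0" "integrable lborel \<rho>" "(LINT x|lborel. \<rho> x) = 1"
proof -
  obtain \<rho> :: "real \<Rightarrow> real" where \<rho>: "smooth \<rho>" "\<And>x. 0 \<le> \<rho> x" "\<And>x. norm x \<ge> 1 \<Longrightarrow> \<rho> x = 0"
    "integrable lborel \<rho>" "(LINT x|lborel. \<rho> x) = 1" using mollifier_exists by metis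
  have \<rho>c: "continuous_on A \<rho>" for A by (rule smooth_continuous[OF \<rho>(1)])
  define R where "R x = integral {-2..x} \<rho>" for x
  have R0: "R x = 0" if "x \<le> -1" for x
  proof -
    have "integral {-2..x} \<rho> = integral {-2..x} (\<lambda>x. 0)"
      by (rule integral_cong) (use that \<rho>(3) in auto)
    then show ?thesis by (simp add: R_def)
  qed
  have D: "(R has_real_derivative \<rho> x) (at x)" for x
  proof (cases "x < -1")
    case True
    have "((\<lambda>x. 0) has_real_derivative \<rho> x) (at x)" using True \<rho>(3)[of x] by simp
    from has_field_derivative_transform_within_open[OF this open_lessThan, of "-1" R] show ?thesis
      using True R0 by auto
  next
    case False
    have "((\<lambda>u. integral {-2..u} \<rho>) has_real_derivative \<rho> x) (at x within {-2..x+1})"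
      using False by (intro integral_has_real_derivative \<rho>c) auto
    then have "(R has_real_derivative \<rho> x) (at x within {-2..x+1})" by (simp add: R_def[abs_def])
    moreover have "at x within {-2..x+1} = at x" using False by (intro at_within_interior) auto
    ultimately show ?thesis by simp
  qed
  have sm: "smooth R"
  proof (rule smooth_coinduct[of _ "insert R (Collect smooth)"])
    fix g :: "real \<Rightarrow> real" assume "g \<in> insert R (Collect smooth)"
    then consider "g = R" | "smooth g" by blast
    then show "\<exists>g'. (\<forall>x. (g has_derivative g' x) (at x)) \<and> (\<forall>b\<in>Basis. (\<lambda>x. g' x b) \<in> insert R (Collect smooth))"
    proof cases
      case 1 then show ?thesis
        using D \<rho>(1) by (intro exI[of _ "\<lambda>x h. \<rho> x * h"]) (auto simp: has_field_derivative_def)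
    next
      case 2 then show ?thesis
        by (intro exI[of _ "\<lambda>x h. grad g x \<bullet> h"] conjI allI ballI insertI2 CollectI
            smooth_has_derivative[OF 2] smooth_partial[OF 2])
    qed
  qed auto
  have R1: "R x = 1" if x: "x \<ge> 1" for x
  proof -
    have "(LINT y|lborel. \<rho> y) = (LINT y:{-2..x}|lborel. \<rho> y)"
      unfolding set_lebesgue_integral_def
    proof (intro Bochner_Integration.integral_cong refl)
      fix y
      have "\<rho> y = 0" if y: "y \<notin> {-2..x}" by (rule \<rho>(3)) (use x y in auto)
      then show "\<rho> y = indicator {-2..x} y *\<^sub>R \<rho> y" by (auto simp: indicator_def)
    qed
    also have "\<dots> = integral {-2..x} \<rho>"
      by (rule set_borel_integral_eq_integral) (unfold set_integrable_def, intro borel_integrable_compact \<rho>c, auto)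
    finally show ?thesis using \<rho>(5) by (simp add: R_def)
  qed
  have "bounded (R ` {-1..1})"
    by (intro compact_imp_bounded compact_continuous_image smooth_continuous sm) auto
  then obtain K where K: "\<forall>x\<in>{-1..1}. \<bar>R x\<bar> \<le> K" by (auto simp: bounded_iff)
  have "\<bar>R x\<bar> \<le> max K 1" for x
    using K[rule_format, of x] R0[of x] R1[of x] by (cases "x \<le> -1"; cases "x \<ge> 1") auto
  then show thesis using that[OF sm D R0 R1 _ \<rho>c] \<rho> by auto
qed

lemma approximate_identity_tendsto:
  fixes \<rho> m :: "real \<Rightarrow> real"
  assumes \<rho>: "continuous_on UNIV \<rho>" "\<And>x. \<bar>x\<bar> \<ge> 1 \<Longrightarrow> \<rho> x = 0" "integrable lborel \<rho>" "(LINT x|lborel. \<rho> x) = 1"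
    and m: "continuous_on {0..T} m" and r: "0 < r" "r < T" and e: "\<And>n. 0 < e n" "\<And>n. e n \<le> r" "\<And>n. e n \<le> T - r" "e \<longlonglongrightarrow> 0"
  shows "(\<lambda>n. LINT \<tau>|lebesgue_on {0<..<T}. (1 / e n) * \<rho> ((\<tau> - r) / e n) * m \<tau>) \<longlonglongrightarrow> m r"
proof -
  \<comment> \<open>Extension of \<open>m\<close> by its end values, so that after rescaling the
    integral can run over the whole line.\<close>
  define m' where "m' x = m (max 0 (min T x))" for x
  have m'c: "continuous_on UNIV m'" unfolding m'_def
    by (intro continuous_on_compose2[OF m] continuous_intros) (use r in auto)
  have "bounded (m ` {0..T})" by (intro compact_imp_bounded compact_continuous_image m) auto
  then obtain K where K: "\<forall>x\<in>{0..T}. \<bar>m x\<bar> \<le> K" by (auto simp: bounded_iff)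
  have m'K: "\<bar>m' x\<bar> \<le> K" for x unfolding m'_def using K r by auto
  have [measurable]: "m' \<in> borel_measurable borel" "\<rho> \<in> borel_measurable borel"
    using m'c \<rho>(1) by (auto intro: borel_measurable_continuous_onI)
  have mm: "m' \<tau> = m \<tau>" if "\<tau> \<in> {0..T}" for \<tau> using that by (auto simp: m'_def)
  have eq: "(LINT \<tau>|lebesgue_on {0<..<T}. (1 / e n) * \<rho> ((\<tau> - r) / e n) * m \<tau>) = (LINT z|lborel. \<rho> z * m' (r + e n * z))" for n
  proof -
    have "(LINT \<tau>|lebesgue_on {0<..<T}. (1 / e n) * \<rho> ((\<tau> - r) / e n) * m \<tau>)
      = (LINT \<tau>|lebesgue_on {0<..<T}. (1 / e n) * \<rho> ((\<tau> - r) / e n) * m' \<tau>)"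
      using mm by (intro Bochner_Integration.integral_cong) auto
    also have "\<dots> = (LINT \<tau>|lborel. indicator {0<..<T} \<tau> * ((1 / e n) * \<rho> ((\<tau> - r) / e n) * m' \<tau>))"
      by (intro lebesgue_on_integral_borel) measurable
    also have "\<dots> = (LINT \<tau>|lborel. (1 / e n) * \<rho> ((\<tau> - r) / e n) * m' \<tau>)"
    proof (intro Bochner_Integration.integral_cong refl)
      fix \<tau>
      show "indicator {0<..<T} \<tau> * ((1 / e n) * \<rho> ((\<tau> - r) / e n) * m' \<tau>) = (1 / e n) * \<rho> ((\<tau> - r) / e n) * m' \<tau>"
      proof (cases "\<tau> \<in> {0<..<T}")
        case False
        then have "e n \<le> \<bar>\<tau> - r\<bar>" using e(2,3)[of n] by auto
        then have "1 \<le> \<bar>(\<tau> - r) / e n\<bar>" using e(1)[of n] by (simp add: le_divide_eq)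
        then show ?thesis using \<rho>(2) by simp
      qed simp
    qed
    also have "\<dots> = \<bar>e n\<bar> ^ DIM(real) * (LINT z|lborel. (1 / e n) * \<rho> ((r + e n *\<^sub>R z - r) / e n) * m' (r + e n *\<^sub>R z))"
      using e(1)[of n] by (intro lborel_integral_affine) auto
    also have "\<dots> = (LINT z|lborel. e n * ((1 / e n) * \<rho> z * m' (r + e n * z)))"
      using e(1)[of n] by simp
    also have "\<dots> = (LINT z|lborel. \<rho> z * m' (r + e n * z))" using e(1)[of n] by (intro Bochner_Integration.integral_cong) auto
    finally show ?thesis .
  qed
  have "(\<lambda>n. LINT z|lborel. \<rho> z * m' (r + e n * z)) \<longlonglongrightarrow> (LINT z|lborel. \<rho> z * m' r)"
  proof (rule integral_dominated_convergence[where w = "\<lambda>z. K * norm (\<rho> z)"])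
    show "AE z in lborel. (\<lambda>n. \<rho> z * m' (r + e n * z)) \<longlonglongrightarrow> \<rho> z * m' r"
    proof (intro always_eventually allI)
      fix z
      have "(\<lambda>n. r + e n * z) \<longlonglongrightarrow> r + 0 * z" by (intro tendsto_intros e)
      then have "(\<lambda>n. m' (r + e n * z)) \<longlonglongrightarrow> m' r"
        using m'c by (intro isCont_tendsto_compose[of r m']) (simp_all add: continuous_on_eq_continuous_at)
      then show "(\<lambda>n. \<rho> z * m' (r + e n * z)) \<longlonglongrightarrow> \<rho> z * m' r" by (intro tendsto_intros)
    qed
    show "AE z in lborel. norm (\<rho> z * m' (r + e n * z)) \<le> K * norm (\<rho> z)" for n
    proof (intro always_eventually allI)
      fix z
      have "norm (\<rho> z * m' (r + e n * z)) = \<bar>m' (r + e n * z)\<bar> * \<bar>\<rho> z\<bar>" by (simp add: abs_mult)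
      also have "\<dots> \<le> K * \<bar>\<rho> z\<bar>" by (intro mult_right_mono m'K) auto
      finally show "norm (\<rho> z * m' (r + e n * z)) \<le> K * norm (\<rho> z)" by simp
    qed
  qed (use \<rho>(3) in auto)
  then show ?thesis unfolding eq using \<rho>(4) r by (simp add: m'_def)
qed

text \<open>Differences of two smooth steps are test functions that tend to the indicator of
  \<open>{r<..<t}\<close>, and their derivatives concentrate at \<open>r\<close> and
  \<open>t\<close>. Continuity of \<open>m\<close> gives the identity for all \<open>r < t\<close>
  and not merely for almost all.\<close>

lemma weak_derivative_integral:
  fixes m k :: "real \<Rightarrow> real"
  assumes m: "continuous_on {0..T} m" and k: "integrable (lebesgue_on {0<..<T}) k"
    and w: "\<And>\<theta>. \<theta> \<in> test_functions {0<..<T} \<Longrightarrow>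
      (LINT t|lebesgue_on {0<..<T}. deriv \<theta> t * m t) = - (LINT t|lebesgue_on {0<..<T}. \<theta> t * k t)"
    and r: "0 < r" "r < t" "t < T"
  shows "m t - m r = (LINT s|lebesgue_on {0<..<T}. indicator {r<..<t} s * k s)"
proof -
  let ?J = "lebesgue_on {0<..<T}"
  obtain R \<rho> :: "real \<Rightarrow> real" and K where R: "smooth R" "\<And>x. (R has_real_derivative \<rho> x) (at x)"
    "\<And>x. x \<le> -1 \<Longrightarrow> R x = 0" "\<And>x. x \<ge> 1 \<Longrightarrow> R x = 1" "\<And>x. \<bar>R x\<bar> \<le> K"
    and \<rho>: "continuous_on UNIV \<rho>" "\<And>x. \<bar>x\<bar> \<ge> 1 \<Longrightarrow> \<rho> x = 0" "integrable lborel \<rho>" "(LINT x|lborel. \<rho> x) = 1"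
    using smooth_step_exists by metis
  \<comment> \<open>Half the distance to the nearer end of the interval, so that the transition
    zones of half-width \<open>e n\<close> stay inside \<open>{0<..<T}\<close>.\<close>
  define e0 where "e0 = min r (T - t) / 2"
  have e0: "e0 > 0" "2 * e0 \<le> r" "2 * e0 \<le> T - t" using r by (auto simp: e0_def)
  define e where "e n = e0 / real (Suc n)" for n
  have e: "0 < e n" "e n \<le> e0" for n
    using e0(1) by (auto simp: e_def divide_le_eq mult_le_cancel_left1)
  have elim: "e \<longlonglongrightarrow> 0" unfolding e_def
    using LIMSEQ_Suc[OF lim_const_over_n[of e0]] by simp
  define \<theta> where "\<theta> n \<tau> = R ((\<tau> - r) / e n) - R ((\<tau> - t) / e n)" for n \<tau>
  have th: "\<theta> n = (\<lambda>\<tau>. R ((1 / e n) *\<^sub>R \<tau> + (- r / e n)) + (-1) * R ((1 / e n) *\<^sub>R \<tau> + (- t / e n)))" for n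
    by (auto simp: \<theta>_def diff_divide_distrib fun_eq_iff)
  have test: "\<theta> n \<in> test_functions {0<..<T}" for n
  proof -
    have "smooth (\<theta> n)" unfolding th by (intro smooth_add smooth_cmult smooth_affine R)
    moreover have "\<theta> n \<tau> = 0" if outside: "\<tau> \<notin> {r - e n .. t + e n}" for \<tau>
    proof -
      consider "\<tau> < r - e n" | "\<tau> > t + e n" using outside by force
      then show ?thesis
      proof cases
        case 1
        then have "(\<tau> - r) / e n \<le> -1" "(\<tau> - t) / e n \<le> -1" using e(1)[of n] r by (auto simp: divide_le_eq)
        then show ?thesis using R(3) by (simp add: \<theta>_def)
      next
        case 2
        then have "(\<tau> - r) / e n \<ge> 1" "(\<tau> - t) / e n \<ge> 1" using e(1)[of n] r by (auto simp: le_divide_eq)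
        then show ?thesis using R(4) by (simp add: \<theta>_def)
      qed
    qed
    moreover have "{r - e n .. t + e n} \<subseteq> {0<..<T}" using e(2)[of n] e0 by auto
    ultimately show ?thesis unfolding test_functions_def by (intro CollectI conjI exI[of _ "{r - e n .. t + e n}"]) auto
  qed
  have der: "deriv (\<theta> n) \<tau> = (1 / e n) * \<rho> ((\<tau> - r) / e n) - (1 / e n) * \<rho> ((\<tau> - t) / e n)" for n \<tau>
  proof -
    have d: "((\<lambda>\<tau>. R ((\<tau> - c) / e n)) has_real_derivative (\<rho> ((\<tau> - c) / e n) * (1 / e n))) (at \<tau>)" for c
      by (rule DERIV_chain2[OF R(2)]) (use e(1)[of n] in \<open>auto intro!: derivative_eq_intros\<close>)
    have "(\<theta> n has_real_derivative (\<rho> ((\<tau> - r) / e n) * (1 / e n) - \<rho> ((\<tau> - t) / e n) * (1 / e n))) (at \<tau>)"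
      unfolding \<theta>_def by (intro DERIV_diff d)
    then show ?thesis by (simp add: DERIV_imp_deriv mult.commute)
  qed
  have [measurable]: "\<rho> \<in> borel_measurable borel" using \<rho>(1) by (rule borel_measurable_continuous_onI)
  have im: "integrable ?J (\<lambda>\<tau>. (1 / e n) * \<rho> ((\<tau> - c) / e n) * m \<tau>)" for n c
  proof -
    have c1: "continuous_on {0..T} (\<lambda>\<tau>. (1 / e n) * \<rho> ((\<tau> - c) / e n) * m \<tau>)"
      by (intro continuous_intros m continuous_on_compose2[OF \<rho>(1)]) (use e(1)[of n] in auto)
    then have "(\<lambda>\<tau>. (1 / e n) * \<rho> ((\<tau> - c) / e n) * m \<tau>) absolutely_integrable_on {0..T}"
      by (rule absolutely_integrable_continuous_real)
    then have "(\<lambda>\<tau>. (1 / e n) * \<rho> ((\<tau> - c) / e n) * m \<tau>) absolutely_integrable_on {0<..<T}"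
      by (rule set_integrable_subset) auto
    then show ?thesis by (intro absolutely_integrable_imp_integrable) auto
  qed
  have "(\<lambda>n. LINT \<tau>|?J. deriv (\<theta> n) \<tau> * m \<tau>) \<longlonglongrightarrow> m r - m t"
  proof -
    have "(LINT \<tau>|?J. deriv (\<theta> n) \<tau> * m \<tau>) = (LINT \<tau>|?J. (1 / e n) * \<rho> ((\<tau> - r) / e n) * m \<tau>) - (LINT \<tau>|?J. (1 / e n) * \<rho> ((\<tau> - t) / e n) * m \<tau>)" for n
      unfolding der by (subst Bochner_Integration.integral_diff[OF im im, symmetric]) (simp add: algebra_simps)
    moreover have "e n \<le> r" "e n \<le> t" "e n \<le> T - r" "e n \<le> T - t" for n using e(2)[of n] e0 r by auto
    then have "(\<lambda>n. (LINT \<tau>|?J. (1 / e n) * \<rho> ((\<tau> - r) / e n) * m \<tau>) - (LINT \<tau>|?J. (1 / e n) * \<rho> ((\<tau> - t) / e n) * m \<tau>)) \<longlonglongrightarrow> m r - m t"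
      using r e(1) elim by (intro tendsto_diff approximate_identity_tendsto[OF \<rho> m]) auto
    ultimately show ?thesis by simp
  qed
  moreover have "(\<lambda>n. - (LINT \<tau>|?J. \<theta> n \<tau> * k \<tau>)) \<longlonglongrightarrow> - (LINT \<tau>|?J. indicator {r<..<t} \<tau> * k \<tau>)"
  proof (intro tendsto_minus integral_dominated_convergence[where w = "\<lambda>\<tau>. 2 * K * norm (k \<tau>)"])
    have [measurable]: "R \<in> borel_measurable borel" by (intro borel_measurable_continuous_onI smooth_continuous R)
    have "\<theta> n \<in> borel_measurable lebesgue" for n unfolding \<theta>_def by (intro measurable_completion) measurable
    then have [measurable]: "\<theta> n \<in> borel_measurable ?J" for n by (rule measurable_restrict_space1)
    have [measurable]: "indicator {r<..<t} \<in> borel_measurable ?J"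
      by (intro measurable_restrict_space1 measurable_completion) measurable
    note [measurable] = borel_measurable_integrable[OF k]
    show "(\<lambda>\<tau>. indicator {r<..<t} \<tau> * k \<tau>) \<in> borel_measurable ?J" "(\<lambda>\<tau>. \<theta> n \<tau> * k \<tau>) \<in> borel_measurable ?J" for n
      by measurable
    show "integrable ?J (\<lambda>\<tau>. 2 * K * norm (k \<tau>))" using k by auto
    show "AE \<tau> in ?J. norm (\<theta> n \<tau> * k \<tau>) \<le> 2 * K * norm (k \<tau>)" for n
    proof (intro always_eventually allI)
      fix \<tau>
      have "\<bar>\<theta> n \<tau>\<bar> \<le> 2 * K" using R(5)[of "(\<tau> - r) / e n"] R(5)[of "(\<tau> - t) / e n"] unfolding \<theta>_def by linarith
      then show "norm (\<theta> n \<tau> * k \<tau>) \<le> 2 * K * norm (k \<tau>)" by (simp add: abs_mult mult_right_mono)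
    qed
    have ne: "AE \<tau> in ?J. \<tau> \<noteq> c" for c :: real
      using AE_completion[OF AE_lborel_singleton[of c]] by (subst AE_restrict_space_iff) (auto elim: eventually_mono)
    show "AE \<tau> in ?J. (\<lambda>n. \<theta> n \<tau> * k \<tau>) \<longlonglongrightarrow> indicator {r<..<t} \<tau> * k \<tau>"
      using ne[of r] ne[of t]
    proof eventually_elim
      case (elim \<tau>)
      have up: "\<forall>\<^sub>F n in sequentially. R ((\<tau> - c) / e n) = (if c < \<tau> then 1 else 0)" if "\<tau> \<noteq> c" for c
      proof -
        have "\<forall>\<^sub>F n in sequentially. e n < \<bar>\<tau> - c\<bar>" using order_tendstoD(2)[OF \<open>e \<longlonglongrightarrow> 0\<close>, of "\<bar>\<tau> - c\<bar>"] that by auto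
        then show ?thesis
        proof eventually_elim
          case (elim n)
          show ?case
          proof (cases "c < \<tau>")
            case True
            then have "1 \<le> (\<tau> - c) / e n" using elim e(1)[of n] by (simp add: le_divide_eq)
            then show ?thesis using R(4) True by simp
          next
            case False
            then have "(\<tau> - c) / e n \<le> -1" using elim e(1)[of n] by (simp add: divide_le_eq)
            then show ?thesis using R(3) False by simp
          qed
        qed
      qed
      have "\<forall>\<^sub>F n in sequentially. \<theta> n \<tau> * k \<tau> = indicator {r<..<t} \<tau> * k \<tau>"
        using up[OF elim(1)] up[OF elim(2)]
        by eventually_elim (use elim r in \<open>auto simp: \<theta>_def indicator_def\<close>)
      then show ?case by (rule tendsto_eventually)
    qed
  qed
  moreover have "(LINT \<tau>|?J. deriv (\<theta> n) \<tau> * m \<tau>) = - (LINT \<tau>|?J. \<theta> n \<tau> * k \<tau>)" for n by (rule w[OF test])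
  ultimately have "m r - m t = - (LINT \<tau>|?J. indicator {r<..<t} \<tau> * k \<tau>)" by (simp add: LIMSEQ_unique)
  then show ?thesis by simp
qed

section \<open>The dual norm of H1\<close>

context bounded_convex
begin

lemma H1_lincomb:
  assumes "f \<in> H1_space S" "g \<in> H1_space S"
  shows "(\<lambda>x. a * f x + b * g x) \<in> H1_space S"
  by (rule H1_spaceI[OF sq_integrable_add[OF sq_integrable_mult sq_integrable_mult]
      has_weak_gradient_lincomb[OF op bd _ _ has_weak_gradient_weak_grad has_weak_gradient_weak_grad]])
     (use assms H1_spaceD in auto)

lemma zero_H1: "(\<lambda>x. 0) \<in> H1_space S" and H1_norm_zero: "H1_norm S (\<lambda>x. 0) = 0"
proof -
  have s: "sq_integrable M (\<lambda>x. 0::real)" by (intro sq_continuous continuous_intros)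
  have w: "has_weak_gradient S (\<lambda>x. 0) (\<lambda>x. 0)" by (intro C1_has_weak_gradient op bd) (simp add: C1_fun_def)
  show "(\<lambda>x. 0) \<in> H1_space S" by (rule H1_spaceI[OF s w])
  show "H1_norm S (\<lambda>x. 0) = 0" using H1_norm_sq[OF op cv bd s w] by simp
qed

text \<open>The summand \<open>0 * f x\<close> gives the function the shape of the linear
  combinations in \<open>H1_dual\<close>, so that linearity of functionals applies to it
  literally.\<close>

lemma H1_norm_scale:
  assumes f: "f \<in> H1_space S"
  shows "H1_norm S (\<lambda>x. a * f x + 0 * f x) = \<bar>a\<bar> * H1_norm S f"
proof -
  note s = H1_spaceD[OF f] and w = has_weak_gradient_weak_grad[OF f]
  have w': "has_weak_gradient S (\<lambda>x. a * f x + 0 * f x) (\<lambda>x. a *\<^sub>R weak_grad S f x + 0 *\<^sub>R weak_grad S f x)"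
    by (rule has_weak_gradient_lincomb[OF op bd s s w w])
  have "(H1_norm S (\<lambda>x. a * f x + 0 * f x))\<^sup>2 = (\<bar>a\<bar> * H1_norm S f)\<^sup>2"
    using H1_norm_sq[OF op cv bd H1_spaceD[OF H1_lincomb[OF f f]] w'] H1_norm_sq[OF op cv bd s w]
    by (simp add: power_mult_distrib distrib_left)
  then show ?thesis by (rule power2_eq_imp_eq) (auto simp: H1_norm_nonneg)
qed

lemma H1_dual_bdd: "F \<in> H1_dual S \<Longrightarrow> bdd_above {\<bar>F f\<bar> | f. f \<in> H1_space S \<and> H1_norm S f \<le> 1}"
proof -
  assume "F \<in> H1_dual S"
  then obtain C where C: "\<And>f. f \<in> H1_space S \<Longrightarrow> \<bar>F f\<bar> \<le> C * H1_norm S f" unfolding H1_dual_def by blast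
  show ?thesis
  proof (rule bdd_aboveI[of _ "\<bar>C\<bar>"])
    fix x assume "x \<in> {\<bar>F f\<bar> | f. f \<in> H1_space S \<and> H1_norm S f \<le> 1}"
    then obtain f where f: "x = \<bar>F f\<bar>" "f \<in> H1_space S" "H1_norm S f \<le> 1" by blast
    have "C * H1_norm S f \<le> \<bar>C\<bar> * H1_norm S f" using H1_norm_nonneg by (intro mult_right_mono) auto
    also have "\<dots> \<le> \<bar>C\<bar> * 1" using f by (intro mult_left_mono) auto
    finally show "x \<le> \<bar>C\<bar>" using C[OF f(2)] f(1) by simp
  qed
qed

lemma H1_dual_norm_upper:
  assumes F: "F \<in> H1_dual S" and f: "f \<in> H1_space S"
  shows "\<bar>F f\<bar> \<le> H1_dual_norm S F * H1_norm S f"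
proof (cases "H1_norm S f = 0")
  case True
  then show ?thesis using F f by (auto simp: H1_dual_def)
next
  case False
  then have h: "H1_norm S f > 0" using H1_norm_nonneg[of S f] by simp
  let ?a = "1 / H1_norm S f"
  let ?g = "\<lambda>x. ?a * f x + 0 * f x"
  have "H1_norm S ?g = 1" using H1_norm_scale[OF f, of ?a] h by simp
  then have "\<bar>F ?g\<bar> \<le> H1_dual_norm S F"
    unfolding H1_dual_norm_def
    by (intro cSup_upper H1_dual_bdd[OF F] CollectI exI[of _ ?g] conjI refl H1_lincomb f) simp
  moreover have "F ?g = ?a * F f + 0 * F f" using F f unfolding H1_dual_def by blast
  ultimately have "\<bar>F f\<bar> / H1_norm S f \<le> H1_dual_norm S F" using h by (simp add: abs_mult)
  then show ?thesis using h by (simp add: divide_le_eq)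
qed

lemma H1_dual_norm_least:
  assumes "\<And>f. f \<in> H1_space S \<Longrightarrow> H1_norm S f \<le> 1 \<Longrightarrow> \<bar>F f\<bar> \<le> c"
  shows "H1_dual_norm S F \<le> c"
  unfolding H1_dual_norm_def
proof (rule cSup_least)
  show "{\<bar>F f\<bar> | f. f \<in> H1_space S \<and> H1_norm S f \<le> 1} \<noteq> {}"
    using zero_H1 H1_norm_zero by auto
qed (use assms in auto)

lemma H1_dual_norm_nonneg: "F \<in> H1_dual S \<Longrightarrow> 0 \<le> H1_dual_norm S F"
proof -
  assume F: "F \<in> H1_dual S"
  have "\<bar>F (\<lambda>x. 0)\<bar> \<le> H1_dual_norm S F"
    unfolding H1_dual_norm_def using zero_H1 H1_norm_zero by (intro cSup_upper H1_dual_bdd[OF F]) auto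
  then show ?thesis by simp
qed

lemma H1_dual_lincomb:
  assumes "F \<in> H1_dual S" "G \<in> H1_dual S"
  shows "F - G \<in> H1_dual S" "(\<lambda>f. 0) \<in> H1_dual S"
proof -
  obtain C C' where C: "\<And>f. f \<in> H1_space S \<Longrightarrow> \<bar>F f\<bar> \<le> C * H1_norm S f" "\<And>f. f \<in> H1_space S \<Longrightarrow> \<bar>G f\<bar> \<le> C' * H1_norm S f"
    using assms unfolding H1_dual_def by blast
  have "\<bar>(F - G) f\<bar> \<le> (C + C') * H1_norm S f" if "f \<in> H1_space S" for f
    using C[OF that] by (simp add: distrib_right)
  moreover have "(F - G) (\<lambda>x. a * f x + b * g x) = a * (F - G) f + b * (F - G) g" if "f \<in> H1_space S" "g \<in> H1_space S" for f g a b
  proof -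
    have "F (\<lambda>x. a * f x + b * g x) = a * F f + b * F g" "G (\<lambda>x. a * f x + b * g x) = a * G f + b * G g"
      using assms that unfolding H1_dual_def by blast+
    then show ?thesis by (simp add: algebra_simps)
  qed
  ultimately show "F - G \<in> H1_dual S" unfolding H1_dual_def by blast
  show "(\<lambda>f. 0) \<in> H1_dual S" unfolding H1_dual_def by (auto intro!: exI[of _ 0])
qed

lemma H1_dual_norm_triangle:
  assumes "F \<in> H1_dual S" "G \<in> H1_dual S" "E \<in> H1_dual S"
  shows "H1_dual_norm S (F - E) \<le> H1_dual_norm S (F - G) + H1_dual_norm S (G - E)"
proof (rule H1_dual_norm_least)
  fix f assume f: "f \<in> H1_space S" "H1_norm S f \<le> 1"
  have "\<bar>(F - G) f\<bar> \<le> H1_dual_norm S (F - G)" "\<bar>(G - E) f\<bar> \<le> H1_dual_norm S (G - E)"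
    unfolding H1_dual_norm_def
    by (intro cSup_upper H1_dual_bdd H1_dual_lincomb(1) assms CollectI exI[of _ f] conjI refl f)+
  then show "\<bar>(F - E) f\<bar> \<le> H1_dual_norm S (F - G) + H1_dual_norm S (G - E)" by simp
qed

lemma H1_dual_norm_commute: "H1_dual_norm S (F - G) = H1_dual_norm S (G - F)"
  by (simp add: H1_dual_norm_def abs_minus_commute)

end

text \<open>The value space carries no sigma-algebra. With finitely many values on measurable level
  sets, every real function of the value is measurable.\<close>

lemma finite_range_measurable:
  fixes \<phi> :: "'f \<Rightarrow> real"
  assumes J: "J \<in> sets lebesgue" and s: "finite (s ` J)" "\<And>f. {t \<in> J. s t = f} \<in> sets lebesgue"
  shows "(\<lambda>t. \<phi> (s t)) \<in> borel_measurable (lebesgue_on J)"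
proof -
  have "(\<lambda>t. \<Sum>f\<in>s ` J. \<phi> f * indicator {t \<in> J. s t = f} t) \<in> borel_measurable (lebesgue_on J)"
    using s by (intro borel_measurable_sum borel_measurable_times borel_measurable_const measurable_restrict_space1 borel_measurable_indicator)
  moreover have "(\<Sum>f\<in>s ` J. \<phi> f * indicator {t \<in> J. s t = f} t) = \<phi> (s t)" if "t \<in> J" for t
    using s(1) that by (subst sum.remove[of _ "s t"]) (auto simp: indicator_def intro!: sum.neutral)
  ultimately show ?thesis using J by (subst measurable_cong) (auto simp: eq_commute)
qed

text \<open>\<open>H1_dual_norm\<close> is a seminorm only on \<open>H1_dual\<close>, which is a set of functions and not a vector space type. Hence
  the axioms mention differences only.\<close>

locale seminormed_set =
  fixes V :: "'f::minus set" and N :: "'f \<Rightarrow> real" and z :: 'f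
  assumes z: "z \<in> V" and diff: "x - z = x"
    and nonneg: "x \<in> V \<Longrightarrow> y \<in> V \<Longrightarrow> 0 \<le> N (x - y)"
    and commute: "N (x - y) = N (y - x)"
    and triangle: "x \<in> V \<Longrightarrow> y \<in> V \<Longrightarrow> w \<in> V \<Longrightarrow> N (x - w) \<le> N (x - y) + N (y - w)"
    and self: "N (x - x) = 0"
begin

lemma N_nonneg: "x \<in> V \<Longrightarrow> 0 \<le> N x"
  using nonneg[OF _ z] diff by metis

lemma N_diff_le: "x \<in> V \<Longrightarrow> y \<in> V \<Longrightarrow> N (x - y) \<le> N x + N y"
  using triangle[OF _ z, of x y] commute[of z y] diff by metis

lemma N_triangle': "x \<in> V \<Longrightarrow> y \<in> V \<Longrightarrow> N x \<le> N y + N (y - x)"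
  using triangle[OF _ _ z, of x y] commute[of x y] diff by (metis add.commute)

text \<open>Strong measurability gives convergence almost everywhere without domination. Replacing a
  value whose seminorm exceeds \<open>2 * nw t + 1\<close> by \<open>z\<close> keeps the error below
  \<open>3 * nw t + 1\<close>, and the truncation is eventually inactive; dominated convergence then
  applies.\<close>

lemma simple_L2_approximation:
  assumes J: "J \<in> lmeasurable" and w: "w \<in> L2_Bochner J V N" and \<eta>: "\<eta> > 0"
  obtains s e where "finite (s ` J)" "s ` J \<subseteq> V" "\<And>\<phi> :: 'f \<Rightarrow> real. (\<lambda>t. \<phi> (s t)) \<in> borel_measurable (lebesgue_on J)"
    "sq_integrable (lebesgue_on J) e" "AE t in lebesgue_on J. w t \<in> V \<and> N (s t - w t) = e t"
    "(LINT t|lebesgue_on J. (e t)\<^sup>2) < \<eta>"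
proof -
  let ?M = "lebesgue_on J"
  have JL: "J \<in> sets lebesgue" using J by auto
  have fin: "finite_measure ?M" by (rule finite_measure_lebesgue_on[OF J])
  interpret finite_measure ?M by (rule fin)
  obtain s where s: "\<And>n. finite (s n ` J)" "\<And>n. s n ` J \<subseteq> V" "\<And>n f. {t \<in> J. s n t = f} \<in> sets lebesgue"
    and ae: "AE t in ?M. w t \<in> V \<and> (\<lambda>n. N (s n t - w t)) \<longlonglongrightarrow> 0"
    using w unfolding L2_Bochner_def strongly_measurable_def by blast
  have iw: "integrable ?M (\<lambda>t. (N (w t))\<^sup>2)" using w by (simp add: L2_Bochner_def)
  define nw where "nw t = sqrt ((N (w t))\<^sup>2)" for t
  have nwm[measurable]: "nw \<in> borel_measurable ?M"
    unfolding nw_def using borel_measurable_integrable[OF iw] by measurable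
  have nw: "nw t = N (w t)" if "w t \<in> V" for t using N_nonneg[OF that] by (simp add: nw_def)
  have nw0: "0 \<le> nw t" for t by (simp add: nw_def)
  have nws: "sq_integrable ?M nw" using iw nwm by (simp add: sq_integrable_def nw_def)
  have aeJ: "AE t in ?M. t \<in> J" using JL by (intro AE_I2) auto
  have fm: "(\<lambda>t. \<phi> (s n t)) \<in> borel_measurable ?M" for n and \<phi> :: "'f \<Rightarrow> real"
    by (rule finite_range_measurable[OF JL s(1,3)])
  have fm2: "(\<lambda>t. N (s n t - s m t)) \<in> borel_measurable ?M" for n m
  proof -
    have "(\<lambda>t. case_prod (\<lambda>x y. N (x - y)) (s n t, s m t)) \<in> borel_measurable ?M"
    proof (rule finite_range_measurable[OF JL, where \<phi> = "case_prod (\<lambda>x y. N (x - y))" and s = "\<lambda>t. (s n t, s m t)"])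
      have "(\<lambda>t. (s n t, s m t)) ` J \<subseteq> s n ` J \<times> s m ` J" by auto
      then show "finite ((\<lambda>t. (s n t, s m t)) ` J)" using s(1) by (meson finite_SigmaI finite_subset)
      fix f :: "'f \<times> 'f"
      have eq: "{t \<in> J. (s n t, s m t) = f} = {t \<in> J. s n t = fst f} \<inter> {t \<in> J. s m t = snd f}" by auto
      show "{t \<in> J. (s n t, s m t) = f} \<in> sets lebesgue" unfolding eq by (intro sets.Int s(3))
    qed
    then show ?thesis by simp
  qed
  \<comment> \<open>Measurability in \<open>t\<close> of \<open>N (s n t - w t)\<close> is obtained
    by writing it as a limit of distances between simple functions.\<close>
  define err where "err n t = lim (\<lambda>m. N (s n t - s m t))" for n t
  have [measurable]: "err n \<in> borel_measurable ?M" for n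
    unfolding err_def by (intro borel_measurable_lim_metric fm2)
  have err: "err n t = N (s n t - w t)" if t: "t \<in> J" "w t \<in> V" "(\<lambda>n. N (s n t - w t)) \<longlonglongrightarrow> 0" for n t
  proof -
    have sV: "s m t \<in> V" for m using s(2) t(1) by blast
    have "(\<lambda>m. N (s n t - s m t) - N (s n t - w t)) \<longlonglongrightarrow> 0"
    proof (rule Lim_null_comparison[OF always_eventually t(3)], rule allI)
      fix m
      have "N (s n t - s m t) \<le> N (s n t - w t) + N (w t - s m t)" "N (s n t - w t) \<le> N (s n t - s m t) + N (s m t - w t)"
        using triangle sV t(2) by auto
      then show "norm (N (s n t - s m t) - N (s n t - w t)) \<le> N (s m t - w t)"
        using commute[of "w t" "s m t"] by (auto simp: abs_le_iff)
    qed
    then have "(\<lambda>m. N (s n t - s m t)) \<longlonglongrightarrow> N (s n t - w t)" by (simp add: LIM_zero_iff)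
    then show ?thesis unfolding err_def by (rule limI)
  qed
  define good where "good n t \<longleftrightarrow> N (s n t) \<le> 2 * nw t + 1" for n t
  have goodm[measurable]: "Measurable.pred ?M (good n)" for n
  proof -
    note [measurable] = fm[of N n]
    show ?thesis unfolding good_def by measurable
  qed
  define st where "st n t = (if good n t then s n t else z)" for n t
  define e where "e n t = (if good n t then err n t else nw t)" for n t
  have em: "e n \<in> borel_measurable ?M" for n unfolding e_def by measurable
  have eN: "N (st n t - w t) = e n t \<and> 0 \<le> e n t \<and> e n t \<le> 3 * nw t + 1"
    if t: "t \<in> J" "w t \<in> V" "(\<lambda>n. N (s n t - w t)) \<longlonglongrightarrow> 0" for n t
  proof -
    have sV: "s n t \<in> V" using s(2) t(1) by blast
    have zw: "N (z - w t) = nw t" using commute[of z "w t"] diff nw[OF t(2)] by simp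
    show ?thesis
      using err[OF t, of n] zw N_diff_le[OF sV t(2)] nonneg[OF sV t(2)] nw[OF t(2)] nw0[of t]
      by (auto simp: st_def e_def good_def)
  qed
  have ae2: "AE t in ?M. t \<in> J \<and> w t \<in> V \<and> (\<lambda>n. N (s n t - w t)) \<longlonglongrightarrow> 0"
    using ae aeJ by eventually_elim auto
  have dom: "sq_integrable ?M (\<lambda>t. 3 * nw t + 1)"
    by (intro sq_integrable_add sq_integrable_mult nws) (simp add: sq_integrable_def)
  have l2: "l2_tendsto ?M e (\<lambda>t. 0)"
  proof (rule l2_tendsto_dominated[OF em _ dom])
    show "AE t in ?M. norm (e n t) \<le> norm (3 * nw t + 1)" for n
      using ae2 by (rule eventually_mono) (use eN nw0 in \<open>auto simp: abs_of_nonneg\<close>)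
    show "AE t in ?M. (\<lambda>n. e n t) \<longlonglongrightarrow> 0"
      using ae2
    proof (rule eventually_mono)
      fix t assume t: "t \<in> J \<and> w t \<in> V \<and> (\<lambda>n. N (s n t - w t)) \<longlonglongrightarrow> 0"
      have "\<forall>\<^sub>F n in sequentially. N (s n t - w t) < 1" using t order_tendstoD(2)[of "\<lambda>n. N (s n t - w t)" 0 sequentially 1] by simp
      then have "\<forall>\<^sub>F n in sequentially. N (s n t - w t) = e n t"
      proof eventually_elim
        case (elim n)
        have sV: "s n t \<in> V" using s(2) t by blast
        have "N (s n t) \<le> N (w t) + N (w t - s n t)" using N_triangle'[OF sV, of "w t"] t by blast
        then have "good n t" using elim commute[of "w t" "s n t"] nw[of t] nw0[of t] t by (simp add: good_def)
        then show ?case using err[of t n] t by (simp add: e_def)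
      qed
      then show "(\<lambda>n. e n t) \<longlonglongrightarrow> 0" using t by (blast intro: Lim_transform_eventually)
    qed
  qed simp
  from order_tendstoD(2)[OF l2_tendstoD(3)[OF l2] \<eta>] obtain n where n: "(LINT t|?M. (e n t)\<^sup>2) < \<eta>"
    by (auto simp: eventually_sequentially)
  show thesis
  proof (rule that[of "st n" "e n"])
    have sub: "st n ` J \<subseteq> insert z (s n ` J)" by (auto simp: st_def)
    then show "finite (st n ` J)" using s(1) by (meson finite_insert finite_subset)
    show "st n ` J \<subseteq> V" using sub s(2)[of n] z by blast
    fix \<phi> :: "'f \<Rightarrow> real"
    have eq: "(\<lambda>t. \<phi> (st n t)) = (\<lambda>t. if good n t then \<phi> (s n t) else \<phi> z)"
      by (auto simp: st_def)
    note [measurable] = fm[of \<phi> n]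
    show "(\<lambda>t. \<phi> (st n t)) \<in> borel_measurable ?M" unfolding eq by measurable
  next
    show "sq_integrable ?M (e n)" by (rule l2_tendstoD(1)[OF l2])
    show "AE t in ?M. w t \<in> V \<and> N (st n t - w t) = e n t"
      using ae2 by (rule eventually_mono) (use eN in auto)
  qed (rule n)
qed

text \<open>This replaces the strong convergence of time averages at Lebesgue points. A simple approximant is encoded by
  the index of its value, a real function for which density of continuous functions applies; distinct indices differ by at least \<open>1\<close>.\<close>

lemma L2_translation_bound:
  assumes w: "w \<in> L2_Bochner {0<..<T} V N" and \<eta>: "\<eta> > 0"
  obtains \<psi> h P where "integrable (lebesgue_on {0<..<T}) \<psi>" "\<And>t. 0 \<le> \<psi> t" "(LINT t|lebesgue_on {0<..<T}. \<psi> t) < \<eta>" "h > 0"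
    "AE t in lebesgue_on {0<..<T}. P t" "\<And>s t. P s \<Longrightarrow> P t \<Longrightarrow> \<bar>s - t\<bar> < h \<Longrightarrow> (N (w s - w t))\<^sup>2 \<le> \<psi> s + \<psi> t + \<eta>"
proof -
  let ?J = "{0<..<T}" and ?M = "lebesgue_on {0<..<T}"
  have J: "?J \<in> lmeasurable" by (simp add: lmeasurable_open)
  have fin: "finite_measure ?M" by (rule finite_measure_lebesgue_on[OF J])
  obtain q e where q: "finite (q ` ?J)" "q ` ?J \<subseteq> V" "\<And>\<phi> :: 'f \<Rightarrow> real. (\<lambda>t. \<phi> (q t)) \<in> borel_measurable ?M"
    "sq_integrable ?M e" "AE t in ?M. w t \<in> V \<and> N (q t - w t) = e t" "(LINT t|?M. (e t)\<^sup>2) < \<eta> / 12"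
    using simple_L2_approximation[OF J w, of "\<eta> / 12"] \<eta> by auto
  obtain \<iota> :: "'f \<Rightarrow> nat" where \<iota>: "inj_on \<iota> (q ` ?J)" using finite_imp_inj_to_nat_seg[OF q(1)] by blast
  define j where "j t = real (\<iota> (q t))" for t
  have jm: "j \<in> borel_measurable ?M" unfolding j_def by (rule q(3))
  have "finite (j ` ?J)" unfolding j_def using finite_imageI[OF q(1), of "\<lambda>x. real (\<iota> x)"] by (simp add: image_image)
  then have "bounded (j ` ?J)" by (rule finite_imp_bounded)
  then obtain Kj where Kj: "\<forall>t\<in>?J. \<bar>j t\<bar> \<le> Kj" by (auto simp: bounded_iff)
  have js: "sq_integrable ?M j"
    by (rule sq_integrable_bounded[OF fin jm, of Kj]) (use Kj in \<open>auto intro!: AE_I2\<close>)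
  have "finite ((\<lambda>(x, y). \<bar>N (x - y)\<bar>) ` (q ` ?J \<times> q ` ?J))" using q(1) by auto
  then have "bounded ((\<lambda>(x, y). \<bar>N (x - y)\<bar>) ` (q ` ?J \<times> q ` ?J))" by (rule finite_imp_bounded)
  then obtain K0 where K0: "\<forall>x\<in>(\<lambda>(x, y). \<bar>N (x - y)\<bar>) ` (q ` ?J \<times> q ` ?J). norm x \<le> K0" unfolding bounded_iff by blast
  define K where "K = max K0 1"
  have K1: "K \<ge> 1" by (simp add: K_def)
  have K: "\<bar>N (q s - q t)\<bar> \<le> K" if "s \<in> ?J" "t \<in> ?J" for s t using K0 that by (force simp: K_def)
  \<comment> \<open>Budget for \<open>\<eta>\<close>: the approximation error \<open>e\<close>
    contributes less than \<open>3 * (\<eta> / 12)\<close> and the index function less than or equal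
    to \<open>9 * K\<^sup>2 * \<kappa> = \<eta> / 4\<close>; the same value
    \<open>\<eta> / 4\<close> also pays for the oscillation of \<open>g\<close>.\<close>
  define \<kappa> where "\<kappa> = \<eta> / (36 * K\<^sup>2)"
  have \<kappa>: "\<kappa> > 0" "9 * K\<^sup>2 * \<kappa> = \<eta> / 4" using \<eta> K1 by (auto simp: \<kappa>_def field_simps)
  obtain g Kg where g: "continuous_on UNIV g" "sq_integrable ?M g" "(LINT t|?M. (j t - g t)\<^sup>2) < \<kappa>"
    using sq_dense_continuous[OF J js \<kappa>(1)] by metis
  have "uniformly_continuous_on {0..T} g" by (intro compact_uniformly_continuous continuous_on_subset[OF g(1)]) auto
  then obtain h where h: "h > 0" "\<And>s t. s \<in> {0..T} \<Longrightarrow> t \<in> {0..T} \<Longrightarrow> dist s t < h \<Longrightarrow> dist (g s) (g t) < sqrt \<kappa>"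
    using \<kappa> unfolding uniformly_continuous_on_def by (metis real_sqrt_gt_0_iff)
  define P where "P t \<longleftrightarrow> t \<in> ?J \<and> w t \<in> V \<and> N (q t - w t) = e t" for t
  define \<psi> where "\<psi> t = 3 * (e t)\<^sup>2 + 9 * K\<^sup>2 * (j t - g t)\<^sup>2" for t
  have dg: "sq_integrable ?M (\<lambda>t. j t - g t)" by (rule sq_integrable_diff[OF js g(2)])
  have ie: "integrable ?M (\<lambda>t. (e t)\<^sup>2)" "integrable ?M (\<lambda>t. (j t - g t)\<^sup>2)"
    using sq_integrable_realD[OF q(4)] sq_integrable_realD[OF dg] by auto
  show thesis
  proof (rule that[of \<psi> h P])
    show "integrable ?M \<psi>" unfolding \<psi>_def using ie by auto
    show "0 \<le> \<psi> t" for t by (simp add: \<psi>_def)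
    have "(LINT t|?M. \<psi> t) = 3 * (LINT t|?M. (e t)\<^sup>2) + 9 * K\<^sup>2 * (LINT t|?M. (j t - g t)\<^sup>2)"
      unfolding \<psi>_def using ie by simp
    also have "\<dots> \<le> 3 * (LINT t|?M. (e t)\<^sup>2) + 9 * K\<^sup>2 * \<kappa>" using g(3) by (intro add_left_mono mult_left_mono) auto
    also have "\<dots> < \<eta>" using q(6) \<kappa>(2) \<eta> by simp
    finally show "(LINT t|?M. \<psi> t) < \<eta>" .
    show "h > 0" by (rule h(1))
    have "AE t in ?M. t \<in> ?J" by (intro AE_I2) auto
    with q(5) show "AE t in ?M. P t" by eventually_elim (auto simp: P_def)
    fix s t assume P: "P s" "P t" and st: "\<bar>s - t\<bar> < h"
    have V: "w s \<in> V" "w t \<in> V" "q s \<in> V" "q t \<in> V" using P q(2) by (auto simp: P_def)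
    have sJ: "s \<in> ?J" "t \<in> ?J" using P by (auto simp: P_def)
    have "N (w s - w t) \<le> N (w s - q s) + N (q s - w t)" "N (q s - w t) \<le> N (q s - q t) + N (q t - w t)"
      using triangle V by auto
    then have "N (w s - w t) \<le> e s + N (q s - q t) + e t" using P commute[of "w s" "q s"] by (simp add: P_def)
    then have "(N (w s - w t))\<^sup>2 \<le> (e s + N (q s - q t) + e t)\<^sup>2" using nonneg[OF V(1,2)] by (intro power_mono) auto
    also have sq3: "(x + y + z)\<^sup>2 \<le> 3 * (x\<^sup>2 + y\<^sup>2 + z\<^sup>2)" for x y z :: real
      using sum_squares_bound[of x y] sum_squares_bound[of y z] sum_squares_bound[of x z]
      by (simp add: power2_eq_square algebra_simps)
    then have "(e s + N (q s - q t) + e t)\<^sup>2 \<le> 3 * ((e s)\<^sup>2 + (N (q s - q t))\<^sup>2 + (e t)\<^sup>2)" .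
    finally have 1: "(N (w s - w t))\<^sup>2 \<le> 3 * ((e s)\<^sup>2 + (N (q s - q t))\<^sup>2 + (e t)\<^sup>2)" .
    have 2: "(N (q s - q t))\<^sup>2 \<le> K\<^sup>2 * (j s - j t)\<^sup>2"
    proof (cases "q s = q t")
      case True then show ?thesis using self by simp
    next
      case False
      then have "\<iota> (q s) \<noteq> \<iota> (q t)" using \<iota> sJ by (auto dest: inj_onD)
      then have "1 \<le> \<bar>j s - j t\<bar>" by (simp add: j_def)
      then have "1 \<le> (j s - j t)\<^sup>2" using power_mono[of 1 "\<bar>j s - j t\<bar>" 2] by simp
      moreover have "(N (q s - q t))\<^sup>2 \<le> K\<^sup>2" using K[OF sJ] power_mono[of "\<bar>N (q s - q t)\<bar>" K 2] by simp
      ultimately show ?thesis using mult_left_mono[of 1 "(j s - j t)\<^sup>2" "K\<^sup>2"] by simp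
    qed
    have "\<bar>g s - g t\<bar> \<le> sqrt \<kappa>" using h(2)[of s t] sJ st by (simp add: dist_real_def)
    then have "\<bar>g s - g t\<bar>\<^sup>2 \<le> (sqrt \<kappa>)\<^sup>2" by (intro power_mono) auto
    then have 3: "(g s - g t)\<^sup>2 \<le> \<kappa>" using \<kappa> by simp
    have "(j s - j t)\<^sup>2 = ((j s - g s) + (g s - g t) + (g t - j t))\<^sup>2" by simp
    also have "\<dots> \<le> 3 * ((j s - g s)\<^sup>2 + (g s - g t)\<^sup>2 + (g t - j t)\<^sup>2)" by (rule sq3)
    also have "\<dots> \<le> 3 * ((j s - g s)\<^sup>2 + \<kappa> + (j t - g t)\<^sup>2)" using 3 by (simp add: power2_commute)
    finally have "K\<^sup>2 * (j s - j t)\<^sup>2 \<le> K\<^sup>2 * (3 * ((j s - g s)\<^sup>2 + \<kappa> + (j t - g t)\<^sup>2))" by (intro mult_left_mono) auto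
    then have "3 * (N (q s - q t))\<^sup>2 \<le> 9 * K\<^sup>2 * (j s - g s)\<^sup>2 + 9 * K\<^sup>2 * \<kappa> + 9 * K\<^sup>2 * (j t - g t)\<^sup>2"
      using 2 by (simp add: algebra_simps)
    then show "(N (w s - w t))\<^sup>2 \<le> \<psi> s + \<psi> t + \<eta>"
      using 1 \<kappa>(2) \<eta> unfolding \<psi>_def by simp
  qed
qed

end

lemma (in bounded_convex) H1_dual_seminormed: "seminormed_set (H1_dual S) (H1_dual_norm S) (\<lambda>f. 0)"
proof
  show "(\<lambda>f. 0) \<in> H1_dual S" using H1_dual_lincomb(2)[of "\<lambda>f. 0" "\<lambda>f. 0"] by (auto simp: H1_dual_def intro!: exI[of _ 0])
  show "F - (\<lambda>f. 0) = F" for F :: "('n \<Rightarrow> real) \<Rightarrow> real" by (simp add: fun_eq_iff)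
  show "0 \<le> H1_dual_norm S (F - G)" if "F \<in> H1_dual S" "G \<in> H1_dual S" for F G
    by (intro H1_dual_norm_nonneg H1_dual_lincomb that)
  show "H1_dual_norm S (F - G) = H1_dual_norm S (G - F)" for F G by (rule H1_dual_norm_commute)
  show "H1_dual_norm S (F - E) \<le> H1_dual_norm S (F - G) + H1_dual_norm S (G - E)"
    if "F \<in> H1_dual S" "G \<in> H1_dual S" "E \<in> H1_dual S" for F G E by (rule H1_dual_norm_triangle[OF that])
  show "H1_dual_norm S (F - F) = 0" for F
  proof (rule antisym)
    show "H1_dual_norm S (F - F) \<le> 0" by (rule H1_dual_norm_least) simp
    have "{\<bar>(F - F) f\<bar> | f. f \<in> H1_space S \<and> H1_norm S f \<le> 1} = {0}" using zero_H1 H1_norm_zero by auto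
    then show "0 \<le> H1_dual_norm S (F - F)" by (simp add: H1_dual_norm_def)
  qed
qed

section \<open>Differential inequalities with small errors\<close>

text \<open>Lebesgue measure is complete, so measurability passes along equality almost
  everywhere.\<close>

lemma borel_measurable_lebesgue_on_AE:
  fixes f g :: "'n::euclidean_space \<Rightarrow> real"
  assumes S: "S \<in> sets lebesgue" and f: "f \<in> borel_measurable (lebesgue_on S)" and ae: "AE x in lebesgue_on S. f x = g x"
  shows "g \<in> borel_measurable (lebesgue_on S)"
proof -
  have "(\<lambda>x. if x \<in> S then f x else 0) \<in> borel_measurable lebesgue"
    using borel_measurable_if[OF S] f by blast
  moreover have "AE x in lebesgue. (if x \<in> S then f x else 0) = (if x \<in> S then g x else 0)"
    using ae S by (subst (asm) AE_restrict_space_iff) (auto elim: eventually_mono)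
  ultimately have "(\<lambda>x. if x \<in> S then g x else 0) \<in> borel_measurable lebesgue" by (rule borel_measurable_AE)
  then show ?thesis using borel_measurable_if[OF S] by blast
qed

lemma integrable_lebesgue_on_mono:
  fixes f :: "real \<Rightarrow> real"
  assumes "integrable (lebesgue_on A) f" "B \<subseteq> A" "A \<in> sets lebesgue" "B \<in> sets lebesgue"
  shows "integrable (lebesgue_on B) f"
proof -
  have "set_integrable lebesgue A f" using assms unfolding set_integrable_def by (simp add: integrable_restrict_space)
  then have "set_integrable lebesgue B f" by (rule set_integrable_subset) (use assms in auto)
  then show ?thesis using assms unfolding set_integrable_def by (simp add: integrable_restrict_space)
qed

lemma divide_Suc_le: "0 \<le> c \<Longrightarrow> c / real (Suc n) \<le> (c::real)"
  using mult_left_mono[of 1 "real (Suc n)" c] by (simp add: divide_le_eq)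

text \<open>The hypothesis bounds backward increments, and only those that end at a good time
  \<open>t\<close>. Integrating \<open>Y t - Y (t - k)\<close> over \<open>{a..b}\<close> ignores
  the exceptional times and telescopes in the primitive \<open>Z\<close>. Division by
  \<open>k\<close> and \<open>k\<close> to 0 recover \<open>Y b - Y a\<close>, as \<open>Y\<close>
  is continuous.\<close>

lemma differential_inequality_average:
  fixes Y c :: "real \<Rightarrow> real"
  assumes Y: "continuous_on {0..T} Y" and c: "integrable (lebesgue_on {a..b}) c" and ab: "0 < a" "a < b" "b < T" and h: "h > 0"
    and ae: "AE t in lebesgue_on {a..b}. P t"
    and le: "\<And>r t. P t \<Longrightarrow> t \<in> {a..b} \<Longrightarrow> 0 < r \<Longrightarrow> r < t \<Longrightarrow> t - r < h \<Longrightarrow> Y t - Y r \<le> (t - r) * c t"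
  shows "Y b - Y a \<le> (LINT t|lebesgue_on {a..b}. c t)"
proof -
  define Z where "Z t = integral {0..t} Y" for t
  have Zd: "(Z has_real_derivative Y t) (at t)" if t: "0 < t" "t < T" for t
  proof -
    have "(Z has_real_derivative Y t) (at t within {0..T})"
      unfolding Z_def using t by (intro integral_has_real_derivative Y) auto
    moreover have "at t within {0..T} = at t" using t by (intro at_within_interior) auto
    ultimately show ?thesis by simp
  qed
  define C where "C = (LINT t|lebesgue_on {a..b}. c t)"
  have bound: "Z b - Z (b - k) - (Z a - Z (a - k)) \<le> k * C" if k: "0 < k" "k < h" "k < a" for k
  proof -
    have "((\<lambda>t. Y t - Y (t - k)) has_integral ((Z b - Z (b - k)) - (Z a - Z (a - k)))) {a..b}"
    proof (rule fundamental_theorem_of_calculus)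
      fix t assume t: "t \<in> {a..b}"
      have "((\<lambda>t. Z (t - k)) has_real_derivative Y (t - k) * 1) (at t)"
        by (rule DERIV_chain2[OF Zd]) (use t k ab in \<open>auto intro!: derivative_eq_intros\<close>)
      then have "((\<lambda>t. Z t - Z (t - k)) has_real_derivative (Y t - Y (t - k))) (at t)"
        using Zd[of t] t ab by (auto intro!: DERIV_diff)
      then show "((\<lambda>t. Z t - Z (t - k)) has_vector_derivative (Y t - Y (t - k))) (at t within {a..b})"
        by (simp add: has_real_derivative_iff_has_vector_derivative has_vector_derivative_at_within)
    qed (use ab in auto)
    moreover have i: "integrable (lebesgue_on {a..b}) (\<lambda>t. Y t - Y (t - k))"
    proof -
      have "continuous_on {a..b} (\<lambda>t. Y t - Y (t - k))"
        by (intro continuous_intros continuous_on_subset[OF Y] continuous_on_compose2[OF Y]) (use k ab in auto)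
      then show ?thesis by (intro absolutely_integrable_imp_integrable absolutely_integrable_continuous_real) auto
    qed
    ultimately have "Z b - Z (b - k) - (Z a - Z (a - k)) = (LINT t|lebesgue_on {a..b}. Y t - Y (t - k))"
      using lebesgue_integral_eq_integral[OF i] by (simp add: integral_unique)
    also have "\<dots> \<le> (LINT t|lebesgue_on {a..b}. k * c t)"
    proof (rule integral_mono_AE)
      have "AE t in lebesgue_on {a..b}. t \<in> {a..b}" by (intro AE_I2) auto
      with ae show "AE t in lebesgue_on {a..b}. Y t - Y (t - k) \<le> k * c t"
      proof eventually_elim
        case (elim t)
        show ?case using le[OF elim, of "t - k"] k elim(2) by auto
      qed
    qed (use i c in auto)
    finally show ?thesis by (simp add: C_def)
  qed
  define e where "e n = min h a / 2 / real (Suc n)" for n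
  have e: "0 < e n" "e n < h" "e n < a" for n
  proof -
    have "e n \<le> min h a / 2" unfolding e_def using h ab by (intro divide_Suc_le) auto
    moreover have "min h a / 2 < h" "min h a / 2 < a" using h ab by auto
    ultimately show "e n < h" "e n < a" by linarith+
    show "0 < e n" using h ab by (auto simp: e_def)
  qed
  have e0: "e \<longlonglongrightarrow> 0" unfolding e_def using LIMSEQ_Suc[OF lim_const_over_n[of "min h a / 2"]] by simp
  have F: "filterlim (\<lambda>n. - e n) (at 0) sequentially"
    using tendsto_minus[OF e0] e(1) by (intro filterlim_atI) (auto simp: less_imp_neq[symmetric] order_less_imp_not_eq2)
  have lim: "(\<lambda>n. (Z t - Z (t - e n)) / e n) \<longlonglongrightarrow> Y t" if t: "0 < t" "t < T" for t
  proof -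
    have "((\<lambda>k. (Z (t + k) - Z t) / k) \<longlongrightarrow> Y t) (at 0)" using Zd[OF t] by (simp add: DERIV_def)
    from filterlim_compose[OF this F] have "(\<lambda>n. (Z (t - e n) - Z t) / - e n) \<longlonglongrightarrow> Y t" by simp
    then show ?thesis by (simp add: minus_divide_right[symmetric] minus_divide_left)
  qed
  have "(\<lambda>n. (Z b - Z (b - e n)) / e n - (Z a - Z (a - e n)) / e n) \<longlonglongrightarrow> Y b - Y a"
    using ab by (intro tendsto_diff lim) auto
  moreover have "(Z b - Z (b - e n)) / e n - (Z a - Z (a - e n)) / e n \<le> C" for n
    using bound[of "e n"] e[of n] by (simp add: diff_divide_distrib[symmetric] divide_le_eq mult.commute)
  ultimately show ?thesis unfolding C_def[symmetric] by (intro LIMSEQ_le_const2) auto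
qed

text \<open>Of the two errors, \<open>(t - r) * \<xi> t\<close> already has the shape that can be
  averaged, and the integral of \<open>\<xi>\<close> over \<open>{r<..<t}\<close> is absorbed by
  subtracting the primitive \<open>X\<close>. Together they cost at most twice the integral of
  \<open>\<xi>\<close>, whence \<open>\<epsilon> / 2\<close>.\<close>

lemma entropy_decay_step:
  fixes G :: "real \<Rightarrow> real"
  assumes G: "continuous_on {0..T} G" and ab: "0 < a" "a < b" "b < T"
    and hyp: "\<And>\<epsilon>. \<epsilon> > 0 \<Longrightarrow> \<exists>\<xi> h P. integrable (lebesgue_on {0<..<T}) \<xi> \<and> (\<forall>t. 0 \<le> \<xi> t) \<and> (LINT t|lebesgue_on {0<..<T}. \<xi> t) < \<epsilon> \<and> h > 0 \<and>
      (AE t in lebesgue_on {0<..<T}. P t) \<and>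
      (\<forall>r t. P t \<longrightarrow> 0 < r \<longrightarrow> r < t \<longrightarrow> t < T \<longrightarrow> t - r < h \<longrightarrow>
         G t - G r \<le> (t - r) * (- l * G t + \<xi> t) + (LINT s|lebesgue_on {0<..<T}. indicator {r<..<t} s * \<xi> s))"
  shows "G b - G a \<le> - l * integral {a..b} G"
proof (rule field_le_epsilon)
  fix \<epsilon> :: real assume "\<epsilon> > 0"
  then have e2: "\<epsilon> / 2 > 0" by simp
  obtain \<xi> h P where chi: "integrable (lebesgue_on {0<..<T}) \<xi>" "\<And>t. 0 \<le> \<xi> t" "(LINT t|lebesgue_on {0<..<T}. \<xi> t) < \<epsilon> / 2" "h > 0"
    "AE t in lebesgue_on {0<..<T}. P t"
    and step: "\<And>r t. P t \<Longrightarrow> 0 < r \<Longrightarrow> r < t \<Longrightarrow> t < T \<Longrightarrow> t - r < h \<Longrightarrow>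
         G t - G r \<le> (t - r) * (- l * G t + \<xi> t) + (LINT s|lebesgue_on {0<..<T}. indicator {r<..<t} s * \<xi> s)"
    using hyp[OF e2] by blast
  let ?J = "{0<..<T}"
  have iHK: "\<xi> integrable_on ?J" by (rule integrable_on_lebesgue_on[OF chi(1)]) auto
  then have i0T: "\<xi> integrable_on {0..T}" by (simp add: integrable_on_open_interval_real)
  define X where "X t = integral {0..t} \<xi>" for t
  have Xc: "continuous_on {0..T} X" unfolding X_def by (rule indefinite_integral_continuous_1[OF i0T])
  have sub: "\<xi> integrable_on {r..t}" if "0 \<le> r" "t \<le> T" for r t
    by (rule integrable_on_subinterval[OF i0T]) (use that in auto)
  have Xd: "X t - X r = integral {r..t} \<xi>" if "0 \<le> r" "r \<le> t" "t \<le> T" for r t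
    using Henstock_Kurzweil_Integration.integral_combine[of 0 r t \<xi>] sub[of 0 t] that by (simp add: X_def)
  have conv: "(LINT s|lebesgue_on ?J. indicator {r<..<t} s * \<xi> s) = X t - X r" if rt: "0 < r" "r < t" "t < T" for r t
  proof -
    have sJ: "{r<..<t} \<subseteq> ?J" using rt by auto
    have i1: "integrable (lebesgue_on {r<..<t}) \<xi>" by (rule integrable_lebesgue_on_mono[OF chi(1) sJ]) auto
    have "(LINT s|lebesgue_on ?J. indicator {r<..<t} s * \<xi> s) = (LINT s|lebesgue_on ?J. (if s \<in> {r<..<t} then \<xi> s else 0))"
      by (intro Bochner_Integration.integral_cong) (auto simp: indicator_def)
    also have "\<dots> = (LINT s|lebesgue_on ({r<..<t} \<inter> ?J). \<xi> s)" by (rule Lebesgue_Measure.integral_restrict_Int) auto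
    also have "{r<..<t} \<inter> ?J = {r<..<t}" using sJ by blast
    also have "(LINT s|lebesgue_on {r<..<t}. \<xi> s) = integral {r<..<t} \<xi>" using lebesgue_integral_eq_integral[OF i1] by simp
    also have "\<dots> = integral {r..t} \<xi>" by (rule integral_open_interval_real[symmetric])
    finally show ?thesis using Xd[of r t] rt by simp
  qed
  have sI: "{a..b} \<subseteq> ?J" using ab by auto
  have chiab: "integrable (lebesgue_on {a..b}) \<xi>" by (rule integrable_lebesgue_on_mono[OF chi(1) sI]) auto
  have Gab: "integrable (lebesgue_on {a..b}) G"
    by (intro absolutely_integrable_imp_integrable absolutely_integrable_continuous_real continuous_on_subset[OF G]) (use ab in auto)
  have iab: "(LINT t|lebesgue_on {a..b}. \<xi> t) \<le> (LINT t|lebesgue_on ?J. \<xi> t)"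
  proof -
    have "(LINT t|lebesgue_on {a..b}. \<xi> t) = integral {a..b} \<xi>" using lebesgue_integral_eq_integral[OF chiab] by simp
    also have "\<dots> \<le> integral {0..T} \<xi>"
      using ab chi(2) by (intro integral_subset_le sub i0T) auto
    also have "\<dots> = integral ?J \<xi>" by (rule integral_open_interval_real)
    also have "\<dots> = (LINT t|lebesgue_on ?J. \<xi> t)" using lebesgue_integral_eq_integral[OF chi(1)] by simp
    finally show ?thesis .
  qed
  have "(G b - X b) - (G a - X a) \<le> (LINT t|lebesgue_on {a..b}. - l * G t + \<xi> t)"
  proof (rule differential_inequality_average[where Y = "\<lambda>t. G t - X t" and P = P, OF _ _ ab chi(4)])
    show "continuous_on {0..T} (\<lambda>t. G t - X t)" by (intro continuous_intros G Xc)
    show "integrable (lebesgue_on {a..b}) (\<lambda>t. - l * G t + \<xi> t)" using chiab Gab by auto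
    have "AE t in lebesgue. t \<in> ?J \<longrightarrow> P t" using chi(5) by (subst (asm) AE_restrict_space_iff) auto
    then have "AE t in lebesgue. t \<in> {a..b} \<longrightarrow> P t" by (rule eventually_mono) (use sI in blast)
    then show "AE t in lebesgue_on {a..b}. P t" by (subst AE_restrict_space_iff) auto
    show "(G t - X t) - (G r - X r) \<le> (t - r) * (- l * G t + \<xi> t)"
      if "P t" "t \<in> {a..b}" "0 < r" "r < t" "t - r < h" for r t
      using step[of t r] conv[of r t] that ab by simp
  qed
  also have "\<dots> = - l * integral {a..b} G + (LINT t|lebesgue_on {a..b}. \<xi> t)"
    using chiab Gab lebesgue_integral_eq_integral[OF Gab] by simp
  finally have "G b - G a \<le> - l * integral {a..b} G + (LINT t|lebesgue_on {a..b}. \<xi> t) + (X b - X a)" by simp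
  also have "X b - X a = (LINT t|lebesgue_on {a..b}. \<xi> t)"
    using Xd[of a b] ab lebesgue_integral_eq_integral[OF chiab] by simp
  finally show "G b - G a \<le> - l * integral {a..b} G + \<epsilon>" using iab chi(3) by simp
qed

text \<open>\<open>G\<close> is nonincreasing, so its integral is at least
  \<open>(b - a) * G b\<close>, and a step reads \<open>G b * (1 + l * (b - a)) \<le> G a\<close>,
  as in the implicit Euler scheme. Taking \<open>n\<close> steps of length \<open>t / n\<close> and
  letting \<open>n\<close> grow produces the exponential.\<close>

lemma exponential_decay:
  fixes G :: "real \<Rightarrow> real"
  assumes G: "\<And>T. continuous_on {0..T} G" "\<And>t. t \<ge> 0 \<Longrightarrow> 0 \<le> G t" and l: "l > 0"
    and step: "\<And>a b. 0 < a \<Longrightarrow> a < b \<Longrightarrow> G b - G a \<le> - l * integral {a..b} G" and t: "t > 0"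
  shows "G t \<le> G 0 * exp (- l * t)"
proof -
  have Gi: "G integrable_on {a..b}" if "0 \<le> a" for a b
    by (rule integrable_continuous_interval) (use continuous_on_subset[OF G(1)[of b]] that in auto)
  have mono: "G b \<le> G a" if "0 < a" "a < b" for a b
  proof -
    have "0 \<le> integral {a..b} G" using that by (intro Henstock_Kurzweil_Integration.integral_nonneg Gi G) auto
    then have "- l * integral {a..b} G \<le> 0" using l by (simp add: mult_nonneg_nonneg)
    then show ?thesis using step[OF that] by linarith
  qed
  have dec: "G b * (1 + l * (b - a)) \<le> G a" if ab: "0 < a" "a < b" for a b
  proof -
    have "integral {a..b} (\<lambda>s. G b) \<le> integral {a..b} G"
    proof (rule integral_le)
      fix s assume "s \<in> {a..b}"
      then show "G b \<le> G s" using mono[of s b] ab by (cases "s = b") auto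
    qed (use Gi ab in auto)
    then have "l * (G b * (b - a)) \<le> l * integral {a..b} G" using ab l by (intro mult_left_mono) (auto simp: mult.commute)
    then show ?thesis using step[OF ab] by (simp add: algebra_simps)
  qed
  \<comment> \<open>The hypothesis speaks of steps that start at a positive time; continuity at 0
    supplies the first step.\<close>
  have dec0: "G b * (1 + l * b) \<le> G 0" if b: "0 < b" for b
  proof -
    have c0: "(G \<longlongrightarrow> G 0) (at 0 within {0..b})" using G(1)[of b] b by (simp add: continuous_on_def)
    define e where "e n = b / 2 / real (Suc n)" for n
    have e: "0 < e n" "e n < b" for n
    proof -
      have "e n \<le> b / 2" unfolding e_def using b by (intro divide_Suc_le) auto
      then show "e n < b" using b by linarith
      show "0 < e n" using b by (auto simp: e_def)
    qed
    have e0: "e \<longlonglongrightarrow> 0" unfolding e_def using LIMSEQ_Suc[OF lim_const_over_n[of "b / 2"]] by simp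
    have "filterlim e (at 0 within {0..b}) sequentially"
      using e0 e by (auto simp: filterlim_at less_imp_le order_less_imp_not_eq2 intro!: always_eventually)
    from filterlim_compose[OF c0 this] have 1: "(\<lambda>n. G (e n)) \<longlonglongrightarrow> G 0" .
    have "(\<lambda>n. G b * (1 + l * (b - e n))) \<longlonglongrightarrow> G b * (1 + l * (b - 0))" by (intro tendsto_intros e0)
    then have 2: "(\<lambda>n. G b * (1 + l * (b - e n))) \<longlonglongrightarrow> G b * (1 + l * b)" by simp
    show ?thesis by (rule LIMSEQ_le[OF 2 1]) (use dec e in auto)
  qed
  have pow: "G t * (1 + l * t / real n) ^ n \<le> G 0" if n: "n > 0" for n
  proof -
    define d where "d = t / real n"
    have d: "d > 0" using t n by (simp add: d_def)
    have ld: "0 \<le> 1 + l * d" using l d by simp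
    have "G (real k * d) * (1 + l * d) ^ k \<le> G 0" for k
    proof (induction k)
      case (Suc k)
      have "G (real (Suc k) * d) * (1 + l * d) \<le> G (real k * d)"
      proof (cases "k = 0")
        case True then show ?thesis using dec0[OF d] by simp
      next
        case False
        then have "G (real (Suc k) * d) * (1 + l * (real (Suc k) * d - real k * d)) \<le> G (real k * d)"
          using d by (intro dec) auto
        then show ?thesis by (simp add: algebra_simps)
      qed
      then have "(G (real (Suc k) * d) * (1 + l * d)) * (1 + l * d) ^ k \<le> G (real k * d) * (1 + l * d) ^ k"
        using ld by (intro mult_right_mono) auto
      then show ?case using Suc by (simp add: mult.assoc)
    qed simp
    from this[of n] show ?thesis using n by (simp add: d_def)
  qed
  have "(\<lambda>n. G t * (1 + l * t / real n) ^ n) \<longlonglongrightarrow> G t * exp (l * t)"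
    by (intro tendsto_intros tendsto_exp_limit_sequentially)
  then have "G t * exp (l * t) \<le> G 0"
    by (rule LIMSEQ_le_const2) (use pow in \<open>auto intro!: exI[of _ 1]\<close>)
  then have "G t * exp (l * t) * exp (- l * t) \<le> G 0 * exp (- l * t)" by (intro mult_right_mono) auto
  then show ?thesis by (simp add: mult.assoc flip: exp_add)
qed

section \<open>Pairings of the solution with fixed functions\<close>

context bounded_convex
begin

lemma parabolic_classD:
  assumes "parabolic_class S w w'" "T > 0"
  shows "w \<in> L2_Bochner {0<..<T} (H1_space S) (H1_norm S)" "w \<in> C_L2 T S"
    "w' \<in> L2_Bochner {0<..<T} (H1_dual S) (H1_dual_norm S)" "has_weak_time_deriv T S w w'"
  using assms by (auto simp: parabolic_class_def)

lemma C_L2_sq: "w \<in> C_L2 T S \<Longrightarrow> t \<in> {0..T} \<Longrightarrow> sq_integrable M (w t)"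
  by (auto simp: C_L2_def Lp_space_2_iff)

lemma pairing_continuous:
  assumes w: "w \<in> C_L2 T S" and \<phi>: "sq_integrable M \<phi>"
  shows "continuous_on {0..T} (\<lambda>t. LINT x|M. w t x * \<phi> x)"
  unfolding continuous_on_def
proof
  fix t assume t: "t \<in> {0..T}"
  have 0: "((\<lambda>s. Lp_norm S 2 (w s - w t)) \<longlongrightarrow> 0) (at t within {0..T})" using w t by (auto simp: C_L2_def)
  have "((\<lambda>s. Lp_norm S 2 (w s - w t) * sqrt (LINT x|M. (norm (\<phi> x))\<^sup>2)) \<longlongrightarrow> 0 * sqrt (LINT x|M. (norm (\<phi> x))\<^sup>2)) (at t within {0..T})"
    by (intro tendsto_intros 0)
  then have L: "((\<lambda>s. Lp_norm S 2 (w s - w t) * sqrt (LINT x|M. (norm (\<phi> x))\<^sup>2)) \<longlongrightarrow> 0) (at t within {0..T})" by simp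
  have "((\<lambda>s. (LINT x|M. w s x * \<phi> x) - (LINT x|M. w t x * \<phi> x)) \<longlongrightarrow> 0) (at t within {0..T})"
  proof (rule Lim_null_comparison[OF _ L])
    have "\<forall>\<^sub>F s in at t within {0..T}. s \<in> {0..T}" by (simp add: eventually_at_filter)
    then show "\<forall>\<^sub>F s in at t within {0..T}. norm ((LINT x|M. w s x * \<phi> x) - (LINT x|M. w t x * \<phi> x))
      \<le> Lp_norm S 2 (w s - w t) * sqrt (LINT x|M. (norm (\<phi> x))\<^sup>2)"
    proof (rule eventually_mono)
      fix s assume s: "s \<in> {0..T}"
      note sw = C_L2_sq[OF w s] C_L2_sq[OF w t]
      have d: "sq_integrable M (\<lambda>x. w s x - w t x)" by (rule sq_integrable_diff[OF sw])
      have "(LINT x|M. w s x * \<phi> x) - (LINT x|M. w t x * \<phi> x) = (LINT x|M. (w s x - w t x) * \<phi> x)"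
        using integrable_mult_sq[OF sw(1) \<phi>] integrable_mult_sq[OF sw(2) \<phi>] by (simp add: left_diff_distrib)
      also have "\<bar>\<dots>\<bar> \<le> (LINT x|M. \<bar>(w s x - w t x) * \<phi> x\<bar>)" by (rule integral_abs_bound)
      also have "\<dots> = (LINT x|M. norm (w s x - w t x) * norm (\<phi> x))" by (simp add: abs_mult)
      also have "\<dots> \<le> sqrt (LINT x|M. (norm (w s x - w t x))\<^sup>2) * sqrt (LINT x|M. (norm (\<phi> x))\<^sup>2)"
        by (rule integral_norm_mult_le[OF d \<phi>])
      finally show "norm ((LINT x|M. w s x * \<phi> x) - (LINT x|M. w t x * \<phi> x)) \<le> Lp_norm S 2 (w s - w t) * sqrt (LINT x|M. (norm (\<phi> x))\<^sup>2)"
        by (simp add: Lp_norm_2)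
    qed
  qed
  then show "((\<lambda>t. LINT x|M. w t x * \<phi> x) \<longlongrightarrow> (LINT x|M. w t x * \<phi> x)) (at t within {0..T})" by (simp add: LIM_zero_iff)
qed

lemma L2_Bochner_AE_mem: "w \<in> L2_Bochner J V N \<Longrightarrow> AE t in lebesgue_on J. w t \<in> V"
  unfolding L2_Bochner_def strongly_measurable_def by (auto elim: eventually_mono)

text \<open>Measurability comes from the values \<open>s n t \<phi>\<close> of the simple
  approximants, integrability from the square integrable dual norm on a bounded interval.\<close>

lemma functional_integrable:
  assumes w: "w' \<in> L2_Bochner {0<..<T} (H1_dual S) (H1_dual_norm S)" and \<phi>: "\<phi> \<in> H1_space S"
  shows "integrable (lebesgue_on {0<..<T}) (\<lambda>t. w' t \<phi>)"
proof -
  let ?J = "{0<..<T}" and ?L = "lebesgue_on {0<..<T}"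
  interpret D: seminormed_set "H1_dual S" "H1_dual_norm S" "\<lambda>f. 0" by (rule H1_dual_seminormed)
  have J: "?J \<in> lmeasurable" by (simp add: lmeasurable_open)
  have fin: "finite_measure ?L" by (rule finite_measure_lebesgue_on[OF J])
  obtain s where s: "\<And>n. finite (s n ` ?J)" "\<And>n. s n ` ?J \<subseteq> H1_dual S" "\<And>n f. {t \<in> ?J. s n t = f} \<in> sets lebesgue"
    and ae: "AE t in ?L. w' t \<in> H1_dual S \<and> (\<lambda>n. H1_dual_norm S (s n t - w' t)) \<longlonglongrightarrow> 0"
    using w unfolding L2_Bochner_def strongly_measurable_def by blast
  have iw: "integrable ?L (\<lambda>t. (H1_dual_norm S (w' t))\<^sup>2)" using w by (simp add: L2_Bochner_def)
  have fm: "(\<lambda>t. s n t \<phi>) \<in> borel_measurable ?L" for n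
    using finite_range_measurable[where \<phi> = "\<lambda>F. F \<phi>", OF _ s(1,3)] by auto
  have lm: "(\<lambda>t. lim (\<lambda>n. s n t \<phi>)) \<in> borel_measurable ?L" by (intro borel_measurable_lim_metric fm)
  have aeJ: "AE t in ?L. t \<in> ?J" by (intro AE_I2) auto
  have eq: "AE t in ?L. lim (\<lambda>n. s n t \<phi>) = w' t \<phi>"
    using ae aeJ
  proof eventually_elim
    case (elim t)
    have "(\<lambda>n. H1_dual_norm S (s n t - w' t) * H1_norm S \<phi>) \<longlonglongrightarrow> 0 * H1_norm S \<phi>" using elim by (intro tendsto_intros) auto
    then have L: "(\<lambda>n. H1_dual_norm S (s n t - w' t) * H1_norm S \<phi>) \<longlonglongrightarrow> 0" by simp
    have "(\<lambda>n. s n t \<phi> - w' t \<phi>) \<longlonglongrightarrow> 0"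
    proof (rule Lim_null_comparison[OF always_eventually L], rule allI)
      fix n
      have "s n t - w' t \<in> H1_dual S" using s(2)[of n] elim by (intro H1_dual_lincomb(1)) auto
      from H1_dual_norm_upper[OF this \<phi>] show "norm (s n t \<phi> - w' t \<phi>) \<le> H1_dual_norm S (s n t - w' t) * H1_norm S \<phi>" by simp
    qed
    then show ?case by (intro limI) (simp add: LIM_zero_iff)
  qed
  have wm: "(\<lambda>t. w' t \<phi>) \<in> borel_measurable ?L"
    by (rule borel_measurable_lebesgue_on_AE[OF _ lm eq]) auto
  have nsq: "sq_integrable ?L (\<lambda>t. sqrt ((H1_dual_norm S (w' t))\<^sup>2))"
  proof -
    have "(\<lambda>t. sqrt ((H1_dual_norm S (w' t))\<^sup>2)) \<in> borel_measurable ?L"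
      using borel_measurable_integrable[OF iw] by measurable
    then show ?thesis using iw unfolding sq_integrable_def by (intro conjI) simp_all
  qed
  have "sq_integrable ?L (\<lambda>t. w' t \<phi>)"
  proof (rule sq_integrable_dominated[OF nsq wm, where C = "H1_norm S \<phi>"])
    show "AE t in ?L. norm (w' t \<phi>) \<le> H1_norm S \<phi> * norm (sqrt ((H1_dual_norm S (w' t))\<^sup>2))"
      using ae
    proof (rule eventually_mono)
      fix t assume t: "w' t \<in> H1_dual S \<and> (\<lambda>n. H1_dual_norm S (s n t - w' t)) \<longlonglongrightarrow> 0"
      then show "norm (w' t \<phi>) \<le> H1_norm S \<phi> * norm (sqrt ((H1_dual_norm S (w' t))\<^sup>2))"
        using H1_dual_norm_upper[of "w' t" \<phi>] \<phi> H1_dual_norm_nonneg[of "w' t"] by (simp add: mult.commute)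
    qed
  qed
  then show ?thesis by (rule integrable_sq[OF fin])
qed

lemma pairing_increment:
  assumes p: "parabolic_class S w w'" and \<phi>: "\<phi> \<in> H1_space S" and r: "0 < r" "r < t" "t < T"
  shows "(LINT x|M. w t x * \<phi> x) - (LINT x|M. w r x * \<phi> x) = (LINT s|lebesgue_on {0<..<T}. indicator {r<..<t} s * w' s \<phi>)"
proof -
  have T: "T > 0" using r by simp
  note P = parabolic_classD[OF p T]
  show ?thesis
  proof (rule weak_derivative_integral[OF pairing_continuous[OF P(2) H1_spaceD[OF \<phi>]] functional_integrable[OF P(3) \<phi>] _ r])
    fix \<theta> assume "\<theta> \<in> test_functions {0<..<T}"
    then show "(LINT t|lebesgue_on {0<..<T}. deriv \<theta> t * (LINT x|M. w t x * \<phi> x)) = - (LINT t|lebesgue_on {0<..<T}. \<theta> t * w' t \<phi>)"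
      using P(4) \<phi> unfolding has_weak_time_deriv_def by blast
  qed
qed

end

section \<open>Entropy increments and dissipation\<close>

text \<open>Derivative of \<open>c * Phi \<alpha> (s / c)\<close> with respect to \<open>s\<close>
  for \<open>s \<ge> 0\<close>, continued by a constant to negative \<open>s\<close>.\<close>

definition dPhi :: "real \<Rightarrow> real \<Rightarrow> real \<Rightarrow> real" where
  "dPhi \<alpha> c s = (\<alpha> + 1) / \<alpha> * (pospow \<alpha> (s / c) - 1)"

definition ddPhi :: "real \<Rightarrow> real \<Rightarrow> real \<Rightarrow> real" where
  "ddPhi \<alpha> c s = (\<alpha> + 1) / c * pospow (\<alpha> - 1) (s / c)"

lemma pospow_scaled_DERIV:
  assumes "q > 1" "c > 0"
  shows "((\<lambda>s. pospow q (s / c)) has_real_derivative (q / c * pospow (q - 1) (s / c))) (at s)"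
proof -
  have "((\<lambda>s. s / c) has_real_derivative 1 / c) (at s)" using assms by (auto intro!: derivative_eq_intros)
  from DERIV_chain2[OF pospow_DERIV[OF assms(1)] this] show ?thesis by simp
qed

lemma pospow_scaled_continuous:
  assumes "q > 0" "c > 0"
  shows "continuous_on A (\<lambda>s. pospow q (s / c))"
  by (intro continuous_on_compose2[OF pospow_continuous[OF assms(1), of UNIV]] continuous_intros) (use assms in auto)

lemma dPhi_DERIV:
  assumes "\<alpha> > 1" "c > 0"
  shows "(dPhi \<alpha> c has_real_derivative ddPhi \<alpha> c s) (at s)"
proof -
  have "((\<lambda>s. (\<alpha> + 1) / \<alpha> * (pospow \<alpha> (s / c) - 1)) has_real_derivative (\<alpha> + 1) / \<alpha> * (\<alpha> / c * pospow (\<alpha> - 1) (s / c) - 0)) (at s)"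
    by (intro DERIV_cmult DERIV_diff pospow_scaled_DERIV assms DERIV_const)
  then show ?thesis using assms by (simp add: dPhi_def[abs_def] ddPhi_def)
qed

lemma ddPhi_continuous: "\<alpha> > 1 \<Longrightarrow> c > 0 \<Longrightarrow> continuous_on A (ddPhi \<alpha> c)"
  unfolding ddPhi_def[abs_def] by (intro continuous_intros pospow_scaled_continuous) auto

lemma dPhi_continuous: "\<alpha> > 1 \<Longrightarrow> c > 0 \<Longrightarrow> continuous_on A (dPhi \<alpha> c)"
  unfolding dPhi_def[abs_def] by (intro continuous_intros pospow_scaled_continuous) auto

lemma Phi_convexity:
  assumes \<alpha>: "\<alpha> > 1" and c: "c > 0" and sr: "0 \<le> s" "0 \<le> r"
  shows "c * Phi \<alpha> (s / c) - c * Phi \<alpha> (r / c) \<le> dPhi \<alpha> c s * (s - r)"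
proof -
  have "(\<alpha> + 1) * (s / c) powr \<alpha> * (r / c - s / c) \<le> (r / c) powr (\<alpha> + 1) - (s / c) powr (\<alpha> + 1)"
    using powr_tangent[of "\<alpha> + 1" "s / c" "r / c"] assms by simp
  then have "\<alpha> * (Phi \<alpha> (s / c) - Phi \<alpha> (r / c)) \<le> (\<alpha> + 1) * ((s / c) powr \<alpha> - 1) * (s / c - r / c)"
    unfolding right_diff_distrib alpha_Phi[OF \<alpha>] by (simp add: algebra_simps)
  also have "\<dots> = \<alpha> * (dPhi \<alpha> c s * (s / c - r / c))" using assms by (simp add: dPhi_def pospow_def)
  finally have "Phi \<alpha> (s / c) - Phi \<alpha> (r / c) \<le> dPhi \<alpha> c s * (s / c - r / c)" using \<alpha> by simp
  then have "c * (Phi \<alpha> (s / c) - Phi \<alpha> (r / c)) \<le> c * (dPhi \<alpha> c s * (s / c - r / c))" using c by (intro mult_left_mono) auto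
  also have "\<dots> = dPhi \<alpha> c s * (s - r)" using c by (simp add: field_simps)
  finally show ?thesis by (simp add: right_diff_distrib)
qed

text \<open>Convexity, applied with the two points in either order, bounds the difference by the
  derivative on the compact interval.\<close>

lemma Phi_Lipschitz:
  assumes \<alpha>: "\<alpha> > 1" and c: "c > 0"
  obtains K where "K \<ge> 0" "\<And>s r. 0 \<le> s \<Longrightarrow> s \<le> C \<Longrightarrow> 0 \<le> r \<Longrightarrow> r \<le> C \<Longrightarrow> \<bar>c * Phi \<alpha> (s / c) - c * Phi \<alpha> (r / c)\<bar> \<le> K * \<bar>s - r\<bar>"
proof -
  have "bounded (dPhi \<alpha> c ` {0..C})"
    by (intro compact_imp_bounded compact_continuous_image dPhi_continuous assms) auto
  then obtain K where K: "\<forall>s\<in>{0..C}. \<bar>dPhi \<alpha> c s\<bar> \<le> K" by (auto simp: bounded_iff)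
  have one: "c * Phi \<alpha> (s / c) - c * Phi \<alpha> (r / c) \<le> max K 0 * \<bar>s - r\<bar>" if "0 \<le> s" "s \<le> C" "0 \<le> r" for s r
  proof -
    have "dPhi \<alpha> c s * (s - r) \<le> \<bar>dPhi \<alpha> c s\<bar> * \<bar>s - r\<bar>" by (simp flip: abs_mult)
    also have "\<dots> \<le> max K 0 * \<bar>s - r\<bar>" using K[rule_format, of s] that by (intro mult_right_mono) auto
    finally show ?thesis using Phi_convexity[OF \<alpha> c that(1,3)] by linarith
  qed
  show thesis
  proof (rule that[of "max K 0"])
    fix s r assume "0 \<le> s" "s \<le> C" "0 \<le> r" "r \<le> C"
    then show "\<bar>c * Phi \<alpha> (s / c) - c * Phi \<alpha> (r / c)\<bar> \<le> max K 0 * \<bar>s - r\<bar>"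
      using one[of s r] one[of r s] by (simp add: abs_minus_commute abs_le_iff)
  qed auto
qed

lemma pospow_square: "pospow q x * pospow q x = pospow (2 * q) x"
  unfolding pospow_def by (simp flip: powr_add)

context bounded_convex
begin

lemma Phi_integrable:
  assumes \<alpha>: "\<alpha> > 1" and c: "c > 0" and w: "w \<in> borel_measurable M" "AE x in M. 0 \<le> w x \<and> w x \<le> C"
  shows "integrable M (\<lambda>x. Phi \<alpha> (w x / c))"
proof -
  interpret E: entropy_exponents \<alpha> c c by unfold_locales (use \<alpha> c in auto)
  have m: "(\<lambda>x. w x / c) \<in> borel_measurable M" using w(1) by measurable
  have b: "AE x in M. 0 \<le> w x / c \<and> w x / c \<le> C / c"
    using w(2) by (rule eventually_mono) (use c in \<open>auto intro: divide_right_mono\<close>)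
  show ?thesis by (rule E.integral_Phi_le(1)[OF fin m b])
qed

lemma Phi_integral_continuous:
  assumes \<alpha>: "\<alpha> > 1" and c: "c > 0" and w: "w \<in> C_L2 T S" and b: "\<And>t. t \<in> {0..T} \<Longrightarrow> AE x in M. 0 \<le> w t x \<and> w t x \<le> C"
  shows "continuous_on {0..T} (\<lambda>t. LINT x|M. c * Phi \<alpha> (w t x / c))"
  unfolding continuous_on_def
proof
  fix t assume t: "t \<in> {0..T}"
  obtain K where K: "K \<ge> 0" "\<And>s r. 0 \<le> s \<Longrightarrow> s \<le> C \<Longrightarrow> 0 \<le> r \<Longrightarrow> r \<le> C \<Longrightarrow> \<bar>c * Phi \<alpha> (s / c) - c * Phi \<alpha> (r / c)\<bar> \<le> K * \<bar>s - r\<bar>"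
    using Phi_Lipschitz[OF \<alpha> c, of C] by metis
  have 0: "((\<lambda>s. Lp_norm S 2 (w s - w t)) \<longlongrightarrow> 0) (at t within {0..T})" using w t by (auto simp: C_L2_def)
  have "((\<lambda>s. K * (sqrt (measure lebesgue S) * Lp_norm S 2 (w s - w t))) \<longlongrightarrow> K * (sqrt (measure lebesgue S) * 0)) (at t within {0..T})"
    by (intro tendsto_intros 0)
  then have L: "((\<lambda>s. K * (sqrt (measure lebesgue S) * Lp_norm S 2 (w s - w t))) \<longlongrightarrow> 0) (at t within {0..T})" by simp
  have "((\<lambda>s. (LINT x|M. c * Phi \<alpha> (w s x / c)) - (LINT x|M. c * Phi \<alpha> (w t x / c))) \<longlongrightarrow> 0) (at t within {0..T})"
  proof (rule Lim_null_comparison[OF _ L])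
    have "\<forall>\<^sub>F s in at t within {0..T}. s \<in> {0..T}" by (simp add: eventually_at_filter)
    then show "\<forall>\<^sub>F s in at t within {0..T}. norm ((LINT x|M. c * Phi \<alpha> (w s x / c)) - (LINT x|M. c * Phi \<alpha> (w t x / c)))
      \<le> K * (sqrt (measure lebesgue S) * Lp_norm S 2 (w s - w t))"
    proof (rule eventually_mono)
      fix s assume s: "s \<in> {0..T}"
      note sw = C_L2_sq[OF w s] C_L2_sq[OF w t]
      have d: "sq_integrable M (\<lambda>x. w s x - w t x)" by (rule sq_integrable_diff[OF sw])
      have i: "integrable M (\<lambda>x. c * Phi \<alpha> (w s x / c))" "integrable M (\<lambda>x. c * Phi \<alpha> (w t x / c))"
        using Phi_integrable[OF \<alpha> c sq_integrableD(1)[OF sw(1)] b[OF s]] Phi_integrable[OF \<alpha> c sq_integrableD(1)[OF sw(2)] b[OF t]] by auto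
      have "(LINT x|M. c * Phi \<alpha> (w s x / c)) - (LINT x|M. c * Phi \<alpha> (w t x / c)) = (LINT x|M. c * Phi \<alpha> (w s x / c) - c * Phi \<alpha> (w t x / c))"
        using i by simp
      also have "\<bar>\<dots>\<bar> \<le> (LINT x|M. \<bar>c * Phi \<alpha> (w s x / c) - c * Phi \<alpha> (w t x / c)\<bar>)" by (rule integral_abs_bound)
      also have "\<dots> \<le> (LINT x|M. K * \<bar>w s x - w t x\<bar>)"
      proof (rule integral_mono_AE)
        show "AE x in M. \<bar>c * Phi \<alpha> (w s x / c) - c * Phi \<alpha> (w t x / c)\<bar> \<le> K * \<bar>w s x - w t x\<bar>"
          using b[OF s] b[OF t] by eventually_elim (use K(2) in auto)
      qed (use i integrable_sq[OF fin d] in auto)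
      also have "\<dots> = K * (LINT x|M. \<bar>w s x - w t x\<bar>)" by simp
      also have "\<dots> \<le> K * (sqrt (measure lebesgue S) * Lp_norm S 2 (w s - w t))"
        using integral_abs_le_sqrt[OF d] K(1) by (intro mult_left_mono) (auto simp: Lp_norm_2)
      finally show "norm ((LINT x|M. c * Phi \<alpha> (w s x / c)) - (LINT x|M. c * Phi \<alpha> (w t x / c)))
        \<le> K * (sqrt (measure lebesgue S) * Lp_norm S 2 (w s - w t))" by simp
    qed
  qed
  then show "((\<lambda>t. LINT x|M. c * Phi \<alpha> (w t x / c)) \<longlongrightarrow> (LINT x|M. c * Phi \<alpha> (w t x / c))) (at t within {0..T})" by (simp add: LIM_zero_iff)
qed

text \<open>A bound affine in \<open>(H1_norm S f)\<^sup>2\<close> is what is wanted, because along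
  the solution that quantity is integrable in time.\<close>

lemma dPhi_H1:
  assumes \<alpha>: "\<alpha> > 1" and c: "c > 0"
  obtains A B where "A \<ge> 0" "B \<ge> 0" "\<forall>f. f \<in> H1_space S \<longrightarrow> (AE x in M. 0 \<le> f x \<and> f x \<le> C) \<longrightarrow>
    (\<lambda>x. dPhi \<alpha> c (f x)) \<in> H1_space S \<and> (H1_norm S (\<lambda>x. dPhi \<alpha> c (f x)))\<^sup>2 \<le> A + B * (H1_norm S f)\<^sup>2"
proof -
  obtain K where K: "K \<ge> 0" "\<And>s. 0 \<le> s \<Longrightarrow> s \<le> C \<Longrightarrow> \<bar>dPhi \<alpha> c s\<bar> \<le> K"
    using compose_continuous_bound[OF dPhi_continuous[OF \<alpha> c], of 0 C] by metis
  obtain K' where K': "K' \<ge> 0" "\<And>s. 0 \<le> s \<Longrightarrow> s \<le> C \<Longrightarrow> \<bar>ddPhi \<alpha> c s\<bar> \<le> K'"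
    using compose_continuous_bound[OF ddPhi_continuous[OF \<alpha> c], of 0 C] by metis
  show thesis
  proof (rule that[of "K\<^sup>2 * measure lebesgue S" "K'\<^sup>2"])
    show "\<forall>f. f \<in> H1_space S \<longrightarrow> (AE x in M. 0 \<le> f x \<and> f x \<le> C) \<longrightarrow> (\<lambda>x. dPhi \<alpha> c (f x)) \<in> H1_space S \<and>
      (H1_norm S (\<lambda>x. dPhi \<alpha> c (f x)))\<^sup>2 \<le> K\<^sup>2 * measure lebesgue S + K'\<^sup>2 * (H1_norm S f)\<^sup>2"
    proof (intro allI impI)
    fix f assume f: "f \<in> H1_space S" and b: "AE x in M. 0 \<le> f x \<and> f x \<le> C"
    define g where "g = weak_grad S f"
    note fs = H1_spaceD[OF f]
    have g: "has_weak_gradient S f g" unfolding g_def by (rule has_weak_gradient_weak_grad[OF f])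
    have gs: "sq_integrable M g" by (rule has_weak_gradientD(1)[OF g])
    obtain F where A: "approximates 0 C F f g" using approximation_exists[OF fs g b] by metis
    note ch = chain_approximation[where \<phi> = "dPhi \<alpha> c" and \<phi>' = "ddPhi \<alpha> c", OF A dPhi_DERIV[OF \<alpha> c] ddPhi_continuous[OF \<alpha> c]]
    have ds: "sq_integrable M (\<lambda>x. ddPhi \<alpha> c (f x) *\<^sub>R g x)" by (rule has_weak_gradientD(1)[OF ch(4)])
    have h: "(H1_norm S (\<lambda>x. dPhi \<alpha> c (f x)))\<^sup>2 = (LINT x|M. (dPhi \<alpha> c (f x))\<^sup>2) + (LINT x|M. (norm (ddPhi \<alpha> c (f x) *\<^sub>R g x))\<^sup>2)"
      by (rule H1_norm_sq[OF op cv bd ch(5,4)])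
    have "(LINT x|M. (dPhi \<alpha> c (f x))\<^sup>2) \<le> (LINT x|M. K\<^sup>2)"
    proof (rule integral_mono_AE)
      show "AE x in M. (dPhi \<alpha> c (f x))\<^sup>2 \<le> K\<^sup>2"
        using b by (rule eventually_mono) (use K in \<open>auto simp: abs_le_square_iff[symmetric]\<close>)
    qed (use sq_integrable_realD[OF ch(5)] fin in \<open>auto simp: finite_measure.integrable_const\<close>)
    moreover have "(LINT x|M. (norm (ddPhi \<alpha> c (f x) *\<^sub>R g x))\<^sup>2) \<le> (LINT x|M. K'\<^sup>2 * (norm (g x))\<^sup>2)"
    proof (rule integral_mono_AE)
      show "AE x in M. (norm (ddPhi \<alpha> c (f x) *\<^sub>R g x))\<^sup>2 \<le> K'\<^sup>2 * (norm (g x))\<^sup>2"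
        using b
      proof (rule eventually_mono)
        fix x assume "0 \<le> f x \<and> f x \<le> C"
        then have "\<bar>ddPhi \<alpha> c (f x)\<bar> \<le> K'" using K' by blast
        then have "(norm (ddPhi \<alpha> c (f x) *\<^sub>R g x))\<^sup>2 \<le> (K' * norm (g x))\<^sup>2" by (intro power_mono) (auto intro: mult_right_mono)
        then show "(norm (ddPhi \<alpha> c (f x) *\<^sub>R g x))\<^sup>2 \<le> K'\<^sup>2 * (norm (g x))\<^sup>2" by (simp add: power_mult_distrib)
      qed
    qed (use sq_integrableD(2)[OF ds] sq_integrableD(2)[OF gs] in auto)
    moreover have "(LINT x|M. (norm (g x))\<^sup>2) \<le> (H1_norm S f)\<^sup>2" using H1_norm_sq[OF op cv bd fs g] by simp
    then have "K'\<^sup>2 * (LINT x|M. (norm (g x))\<^sup>2) \<le> K'\<^sup>2 * (H1_norm S f)\<^sup>2" by (intro mult_left_mono) auto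
    ultimately have "(H1_norm S (\<lambda>x. dPhi \<alpha> c (f x)))\<^sup>2 \<le> K\<^sup>2 * measure lebesgue S + K'\<^sup>2 * (H1_norm S f)\<^sup>2"
      unfolding h by (simp add: measure_space_eq mult.commute)
    then show "(\<lambda>x. dPhi \<alpha> c (f x)) \<in> H1_space S \<and> (H1_norm S (\<lambda>x. dPhi \<alpha> c (f x)))\<^sup>2 \<le> K\<^sup>2 * measure lebesgue S + K'\<^sup>2 * (H1_norm S f)\<^sup>2"
      using H1_spaceI[OF ch(5,4)] by blast
    qed
  qed auto
qed

text \<open>Convexity bounds the increment by the pairing of \<open>w t - w r\<close> with the derivative of the entropy at the later time \<open>t\<close> only.
  Thus no time regularity of \<open>dPhi \<alpha> c (w t)\<close>, and no chain rule for the entropy, is needed.\<close>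

lemma component_entropy_increment:
  assumes \<alpha>: "\<alpha> > 1" and c: "c > 0" and par: "parabolic_class S w w'" and b: "\<And>t. t > 0 \<Longrightarrow> AE x in M. 0 \<le> w t x \<and> w t x \<le> C"
    and T: "T > 0" and \<epsilon>: "\<epsilon> > 0"
  obtains \<xi> h P where "integrable (lebesgue_on {0<..<T}) \<xi>" "\<And>t. 0 \<le> \<xi> t" "(LINT t|lebesgue_on {0<..<T}. \<xi> t) < \<epsilon>" "h > 0"
    "AE t in lebesgue_on {0<..<T}. P t" "\<And>t. P t \<Longrightarrow> w t \<in> H1_space S"
    "\<And>r t. P t \<Longrightarrow> 0 < r \<Longrightarrow> r < t \<Longrightarrow> t < T \<Longrightarrow> t - r < h \<Longrightarrow>
      (LINT x|M. c * Phi \<alpha> (w t x / c)) - (LINT x|M. c * Phi \<alpha> (w r x / c))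
        \<le> (t - r) * (w' t (\<lambda>x. dPhi \<alpha> c (w t x)) + \<xi> t) + (LINT s|lebesgue_on {0<..<T}. indicator {r<..<t} s * \<xi> s)"
proof -
  let ?J = "{0<..<T}" and ?L = "lebesgue_on {0<..<T}"
  note P = parabolic_classD[OF par T]
  interpret D: seminormed_set "H1_dual S" "H1_dual_norm S" "\<lambda>f. 0" by (rule H1_dual_seminormed)
  have J: "?J \<in> lmeasurable" by (simp add: lmeasurable_open)
  have finL: "finite_measure ?L" by (rule finite_measure_lebesgue_on[OF J])
  have mL: "measure ?L ?J = T" using T by (simp add: measure_restrict_space)
  obtain A B where AB: "A \<ge> 0" "B \<ge> 0" "\<forall>f. f \<in> H1_space S \<longrightarrow> (AE x in M. 0 \<le> f x \<and> f x \<le> C) \<longrightarrow>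
    (\<lambda>x. dPhi \<alpha> c (f x)) \<in> H1_space S \<and> (H1_norm S (\<lambda>x. dPhi \<alpha> c (f x)))\<^sup>2 \<le> A + B * (H1_norm S f)\<^sup>2"
    using dPhi_H1[OF \<alpha> c, of C] by blast
  define a where "a t = A + B * (H1_norm S (w t))\<^sup>2" for t
  have a0: "0 \<le> a t" for t using AB by (simp add: a_def)
  have "integrable ?L (\<lambda>t. (H1_norm S (w t))\<^sup>2)" using P(1) by (simp add: L2_Bochner_def)
  then have ai: "integrable ?L a" unfolding a_def using finL by (auto simp: finite_measure.integrable_const)
  define I where "I = (LINT t|?L. a t)"
  have I0: "I \<ge> 0" unfolding I_def using a0 by simp
  \<comment> \<open>Weight in Young's inequality: the part with \<open>a\<close> costs at most
    \<open>\<epsilon> / 2\<close>. Afterwards \<open>\<eta>\<close> is taken so small that the part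
    amplified by \<open>1 / (2 * \<delta>)\<close> costs at most
    \<open>\<epsilon> / 4\<close>.\<close>
  define \<delta> where "\<delta> = \<epsilon> / (I + 1)"
  have \<delta>: "\<delta> > 0" "\<delta> / 2 * I \<le> \<epsilon> / 2"
  proof -
    show "\<delta> > 0" using \<epsilon> I0 by (simp add: \<delta>_def)
    have "\<epsilon> * I \<le> \<epsilon> * (I + 1)" using \<epsilon> by (intro mult_left_mono) auto
    then have "\<delta> * I \<le> \<epsilon>" using I0 by (simp add: \<delta>_def divide_le_eq)
    then show "\<delta> / 2 * I \<le> \<epsilon> / 2" by simp
  qed
  define \<eta> where "\<eta> = \<epsilon> * \<delta> / (2 * (1 + T))"
  have \<eta>: "\<eta> > 0" "1 / (2 * \<delta>) * (\<eta> + \<eta> * T) \<le> \<epsilon> / 4"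
  proof -
    show "\<eta> > 0" using \<epsilon> \<delta> T by (simp add: \<eta>_def)
    have "\<eta> + \<eta> * T = \<eta> * (1 + T)" by (simp add: distrib_left)
    also have "\<dots> = \<epsilon> * \<delta> / 2" unfolding \<eta>_def using T by (simp add: divide_simps)
    finally have e: "\<eta> + \<eta> * T = \<epsilon> * \<delta> / 2" .
    show "1 / (2 * \<delta>) * (\<eta> + \<eta> * T) \<le> \<epsilon> / 4" unfolding e using \<delta>(1) by simp
  qed
  obtain \<psi> h Q where \<psi>: "integrable ?L \<psi>" "\<And>t. 0 \<le> \<psi> t" "(LINT t|?L. \<psi> t) < \<eta>" "h > 0"
    "AE t in ?L. Q t" "\<And>s t. Q s \<Longrightarrow> Q t \<Longrightarrow> \<bar>s - t\<bar> < h \<Longrightarrow> (H1_dual_norm S (w' s - w' t))\<^sup>2 \<le> \<psi> s + \<psi> t + \<eta>"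
    using D.L2_translation_bound[OF P(3) \<eta>(1)] by metis
  define \<xi> where "\<xi> t = 1 / (2 * \<delta>) * (\<psi> t + \<eta>) + \<delta> / 2 * a t" for t
  have \<xi>i: "integrable ?L \<xi>" unfolding \<xi>_def using \<psi>(1) ai finL by (auto simp: finite_measure.integrable_const)
  have \<xi>0: "0 \<le> \<xi> t" for t unfolding \<xi>_def using \<psi>(2) a0 \<delta> \<eta> by (intro add_nonneg_nonneg mult_nonneg_nonneg) auto
  define Pt where "Pt t \<longleftrightarrow> t \<in> ?J \<and> w t \<in> H1_space S \<and> w' t \<in> H1_dual S \<and> Q t" for t
  have aeP: "AE t in ?L. Pt t"
  proof -
    have "AE t in ?L. t \<in> ?J" by (intro AE_I2) auto
    with L2_Bochner_AE_mem[OF P(1)] L2_Bochner_AE_mem[OF P(3)] \<psi>(5) show ?thesis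
      by eventually_elim (auto simp: Pt_def)
  qed
  show thesis
  proof (rule that[OF \<xi>i \<xi>0 _ \<psi>(4) aeP])
    have "(LINT t|?L. \<xi> t) = 1 / (2 * \<delta>) * ((LINT t|?L. \<psi> t) + \<eta> * T) + \<delta> / 2 * I"
      unfolding \<xi>_def using \<psi>(1) ai finL by (simp add: finite_measure.integrable_const I_def mL distrib_left mult.commute add_divide_distrib)
    also have "\<dots> \<le> 1 / (2 * \<delta>) * (\<eta> + \<eta> * T) + \<delta> / 2 * I"
    proof -
      have "(LINT t|?L. \<psi> t) + \<eta> * T \<le> \<eta> + \<eta> * T" using \<psi>(3) by simp
      from mult_left_mono[OF this, of "1 / (2 * \<delta>)"] show ?thesis using \<delta>(1) by simp
    qed
    also have "\<dots> < \<epsilon>" using \<eta>(2) \<delta>(2) \<epsilon> by linarith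
    finally show "(LINT t|?L. \<xi> t) < \<epsilon>" .
    show "w t \<in> H1_space S" if "Pt t" for t using that by (simp add: Pt_def)
    fix r t assume t: "Pt t" and r: "0 < r" "r < t" "t < T" "t - r < h"
    define \<phi> where "\<phi> x = dPhi \<alpha> c (w t x)" for x
    have \<phi>H: "\<phi> \<in> H1_space S" "(H1_norm S \<phi>)\<^sup>2 \<le> a t"
      using AB(3)[rule_format, of "w t"] t b[of t] r unfolding \<phi>_def a_def Pt_def by auto
    have sq: "sq_integrable M (w t)" "sq_integrable M (w r)" "sq_integrable M \<phi>"
      using C_L2_sq[OF P(2)] r H1_spaceD[OF \<phi>H(1)] by auto
    have iP: "integrable M (\<lambda>x. c * Phi \<alpha> (w t x / c))" "integrable M (\<lambda>x. c * Phi \<alpha> (w r x / c))"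
      using Phi_integrable[OF \<alpha> c sq_integrableD(1)[OF sq(1)] b] Phi_integrable[OF \<alpha> c sq_integrableD(1)[OF sq(2)] b] r by auto
    have ip: "integrable M (\<lambda>x. w t x * \<phi> x)" "integrable M (\<lambda>x. w r x * \<phi> x)"
      by (intro integrable_mult_sq sq)+
    have "(LINT x|M. c * Phi \<alpha> (w t x / c)) - (LINT x|M. c * Phi \<alpha> (w r x / c)) = (LINT x|M. c * Phi \<alpha> (w t x / c) - c * Phi \<alpha> (w r x / c))"
      using iP by simp
    also have "\<dots> \<le> (LINT x|M. w t x * \<phi> x - w r x * \<phi> x)"
    proof (rule integral_mono_AE)
      have "AE x in M. 0 \<le> w t x \<and> w t x \<le> C" "AE x in M. 0 \<le> w r x \<and> w r x \<le> C" using b r by auto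
      then show "AE x in M. c * Phi \<alpha> (w t x / c) - c * Phi \<alpha> (w r x / c) \<le> w t x * \<phi> x - w r x * \<phi> x"
      proof eventually_elim
        case (elim x)
        have "c * Phi \<alpha> (w t x / c) - c * Phi \<alpha> (w r x / c) \<le> \<phi> x * (w t x - w r x)"
          unfolding \<phi>_def by (rule Phi_convexity[OF \<alpha> c]) (use elim in auto)
        then show ?case by (simp add: algebra_simps)
      qed
    qed (use iP ip in auto)
    also have "\<dots> = (LINT x|M. w t x * \<phi> x) - (LINT x|M. w r x * \<phi> x)" using ip by simp
    also have "\<dots> = (LINT s|?L. indicator {r<..<t} s * w' s \<phi>)" by (rule pairing_increment[OF par \<phi>H(1) r(1-3)])
    \<comment> \<open>The derivative at time \<open>s\<close> is replaced by the one at
      \<open>t\<close>. The dual norm of the difference times the H1 norm of \<open>\<phi>\<close>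
      is split by Young's inequality and distributed over \<open>\<xi> t\<close> and
      \<open>\<xi> s\<close>.\<close>
    also have "\<dots> \<le> (LINT s|?L. indicator {r<..<t} s * (w' t \<phi> + \<xi> t) + indicator {r<..<t} s * \<xi> s)"
    proof (rule integral_mono_AE)
      have ind: "integrable ?L (\<lambda>s. indicator {r<..<t} s * f s)" if "integrable ?L f" for f :: "real \<Rightarrow> real"
      proof -
        have "{r<..<t} \<in> sets ?L" using r by (auto simp: sets_restrict_space_iff)
        from integrable_mult_indicator[OF this that] show ?thesis by simp
      qed
      show "integrable ?L (\<lambda>s. indicator {r<..<t} s * w' s \<phi>)"
        by (rule ind[OF functional_integrable[OF P(3) \<phi>H(1)]])
      show "integrable ?L (\<lambda>s. indicator {r<..<t} s * (w' t \<phi> + \<xi> t) + indicator {r<..<t} s * \<xi> s)"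
        by (intro Bochner_Integration.integrable_add[OF ind[OF finite_measure.integrable_const[OF finL]] ind[OF \<xi>i]])
      show "AE s in ?L. indicator {r<..<t} s * w' s \<phi> \<le> indicator {r<..<t} s * (w' t \<phi> + \<xi> t) + indicator {r<..<t} s * \<xi> s"
        using aeP
      proof (rule eventually_mono)
        fix s assume s: "Pt s"
        show "indicator {r<..<t} s * w' s \<phi> \<le> indicator {r<..<t} s * (w' t \<phi> + \<xi> t) + indicator {r<..<t} s * \<xi> s"
        proof (cases "s \<in> {r<..<t}")
          case True
          let ?n = "H1_dual_norm S (w' s - w' t)"
          have "w' s - w' t \<in> H1_dual S" using s t by (intro H1_dual_lincomb(1)) (auto simp: Pt_def)
          from H1_dual_norm_upper[OF this \<phi>H(1)] have 1: "w' s \<phi> \<le> w' t \<phi> + ?n * H1_norm S \<phi>" by simp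
          have "\<bar>s - t\<bar> < h" using True r by auto
          then have 2: "?n\<^sup>2 \<le> \<psi> s + \<psi> t + \<eta>" using \<psi>(6) s t by (simp add: Pt_def)
          have "0 \<le> (?n - \<delta> * H1_norm S \<phi>)\<^sup>2" by simp
          then have "2 * \<delta> * (?n * H1_norm S \<phi>) \<le> ?n\<^sup>2 + \<delta>\<^sup>2 * (H1_norm S \<phi>)\<^sup>2"
            by (simp add: power2_diff power_mult_distrib algebra_simps)
          also have "\<dots> \<le> (\<psi> s + \<psi> t + \<eta>) + \<delta>\<^sup>2 * a t" using 2 \<phi>H(2) by (intro add_mono mult_left_mono) auto
          finally have "?n * H1_norm S \<phi> \<le> ((\<psi> s + \<psi> t + \<eta>) + \<delta>\<^sup>2 * a t) / (2 * \<delta>)" using \<delta>(1) by (simp add: le_divide_eq mult.commute)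
          also have "\<dots> = 1 / (2 * \<delta>) * (\<psi> s + \<psi> t + \<eta>) + \<delta> / 2 * a t" using \<delta>(1) by (simp add: field_simps power2_eq_square)
          also have "\<dots> \<le> \<xi> t + \<xi> s"
          proof -
            have "0 \<le> 1 / (2 * \<delta>) * \<eta>" "0 \<le> \<delta> / 2 * a s" using \<delta> \<eta> a0 by auto
            then show ?thesis unfolding \<xi>_def distrib_left by linarith
          qed
          finally show ?thesis using 1 True by simp
        qed simp
      qed
    qed
    also have "\<dots> = (t - r) * (w' t \<phi> + \<xi> t) + (LINT s|?L. indicator {r<..<t} s * \<xi> s)"
    proof -
      have rt: "{r<..<t} \<in> sets ?L" "{r<..<t} \<subseteq> ?J" using r by (auto simp: sets_restrict_space_iff)
      have i1: "integrable ?L (\<lambda>s. indicator {r<..<t} s * (w' t \<phi> + \<xi> t))" "integrable ?L (\<lambda>s. indicator {r<..<t} s * \<xi> s)"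
        using integrable_mult_indicator[OF rt(1) \<xi>i] integrable_mult_indicator[OF rt(1), of "\<lambda>s. w' t \<phi> + \<xi> t"] finL
        by (auto simp: finite_measure.integrable_const)
      have "measure ?L {r<..<t} = t - r" using rt r by (simp add: measure_restrict_space)
      then have "(LINT s|?L. indicator {r<..<t} s * (w' t \<phi> + \<xi> t)) = (t - r) * (w' t \<phi> + \<xi> t)"
      proof -
        have "max r 0 = r" "min t T = t" using r by auto
        then show ?thesis using \<open>measure ?L {r<..<t} = t - r\<close> by simp
      qed
      then show ?thesis using i1 by simp
    qed
    finally show "(LINT x|M. c * Phi \<alpha> (w t x / c)) - (LINT x|M. c * Phi \<alpha> (w r x / c))
        \<le> (t - r) * (w' t (\<lambda>x. dPhi \<alpha> c (w t x)) + \<xi> t) + (LINT s|?L. indicator {r<..<t} s * \<xi> s)"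
      unfolding \<phi>_def .
  qed
qed

end

section \<open>Dissipation for the coupled system\<close>

locale field_road = cylinder \<omega> L + entropy_exponents \<alpha> vinf uinf
  for \<omega> :: "'a::euclidean_space set" and L \<alpha> vinf uinf :: real +
  fixes d D \<mu> \<nu> :: real
  assumes dD: "d > 0" "D > 0" and mn: "\<mu> > 0" "\<nu> > 0" and balance: "\<nu> * vinf powr \<alpha> = \<mu> * uinf powr \<alpha>"
begin

definition equilibrium_flux :: real where "equilibrium_flux = \<nu> * vinf powr \<alpha>"

lemma equilibrium_flux: "equilibrium_flux > 0" "equilibrium_flux = \<mu> * uinf powr \<alpha>"
  using mn vinf by (simp_all add: equilibrium_flux_def flip: balance)

text \<open>At equilibrium both exchange rates have the same value, so in equilibrium units they
  share one constant factor. This is what lets the two boundary terms combine.\<close>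

lemma flux_scaling:
  assumes "0 \<le> s" "0 \<le> r"
  shows "\<nu> * s powr \<alpha> = equilibrium_flux * pospow \<alpha> (s / vinf)" "\<mu> * r powr \<alpha> = equilibrium_flux * pospow \<alpha> (r / uinf)"
proof -
  have "s powr \<alpha> = vinf powr \<alpha> * pospow \<alpha> (s / vinf)" "r powr \<alpha> = uinf powr \<alpha> * pospow \<alpha> (r / uinf)"
    using assms vinf uinf by (simp_all add: pospow_def powr_divide)
  then show "\<nu> * s powr \<alpha> = equilibrium_flux * pospow \<alpha> (s / vinf)" "\<mu> * r powr \<alpha> = equilibrium_flux * pospow \<alpha> (r / uinf)"
    by (simp_all add: equilibrium_flux(2), simp add: balance[symmetric])
qed

definition pospow_slope :: "real \<Rightarrow> real \<Rightarrow> real" where "pospow_slope c s = p / c * pospow (p - 1) (s / c)"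

lemma pospow_slope_DERIV: "c > 0 \<Longrightarrow> ((\<lambda>s. pospow p (s / c)) has_real_derivative pospow_slope c s) (at s)"
  unfolding pospow_slope_def by (rule pospow_scaled_DERIV[OF p])

lemma pospow_slope_continuous: "c > 0 \<Longrightarrow> continuous_on A (pospow_slope c)"
  unfolding pospow_slope_def[abs_def] using p by (intro continuous_intros pospow_scaled_continuous) auto

text \<open>Since \<open>2 * (p - 1) = \<alpha> - 1\<close>, the second derivative of the entropy is
  a multiple of the square of the derivative of the p-th power; gradient dissipation thus becomes
  the squared gradient of a power.\<close>

lemma ddPhi_pospow_slope: "c > 0 \<Longrightarrow> ddPhi \<alpha> c s = (\<alpha> + 1) * c / p\<^sup>2 * (pospow_slope c s)\<^sup>2"
proof -
  assume c: "c > 0"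
  have "2 * (p - 1) = \<alpha> - 1" by (simp add: p_def field_simps)
  then have "(pospow (p - 1) (s / c))\<^sup>2 = pospow (\<alpha> - 1) (s / c)"
    using pospow_square[of "p - 1" "s / c"] by (simp add: power2_eq_square)
  then have "(pospow_slope c s)\<^sup>2 = p\<^sup>2 / c\<^sup>2 * pospow (\<alpha> - 1) (s / c)" by (simp add: pospow_slope_def power_mult_distrib power_divide)
  then show ?thesis using c p by (simp add: ddPhi_def power2_eq_square)
qed

lemma component_dissipation:
  fixes S :: "'c::euclidean_space set"
  assumes BC: "bounded_convex S" and c: "c > 0" and A: "bounded_convex.approximates S 0 C F f g"
    and g: "has_weak_gradient S f g"
  shows "(LINT x|lebesgue_on S. g x \<bullet> weak_grad S (\<lambda>x. dPhi \<alpha> c (f x)) x)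
    = (\<alpha> + 1) * c / p\<^sup>2 * (LINT x|lebesgue_on S. (norm (pospow_slope c (f x) *\<^sub>R g x))\<^sup>2)"
proof -
  interpret X: bounded_convex S by (rule BC)
  note ch = X.chain_approximation[where \<phi> = "dPhi \<alpha> c" and \<phi>' = "ddPhi \<alpha> c", OF A dPhi_DERIV[OF \<alpha> c] ddPhi_continuous[OF \<alpha> c]]
  note cp = X.chain_approximation[where \<phi> = "\<lambda>s. pospow p (s / c)" and \<phi>' = "pospow_slope c", OF A pospow_slope_DERIV[OF c] pospow_slope_continuous[OF c]]
  have w: "has_weak_gradient S (\<lambda>x. dPhi \<alpha> c (f x)) (weak_grad S (\<lambda>x. dPhi \<alpha> c (f x)))"
    by (rule has_weak_gradient_weak_grad[OF H1_spaceI[OF ch(5,4)]])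
  have "AE x in X.M. weak_grad S (\<lambda>x. dPhi \<alpha> c (f x)) x = ddPhi \<alpha> c (f x) *\<^sub>R g x"
    by (rule has_weak_gradient_unique[OF X.op X.cv X.bd w ch(4)])
  then have ae: "AE x in X.M. g x \<bullet> weak_grad S (\<lambda>x. dPhi \<alpha> c (f x)) x = (\<alpha> + 1) * c / p\<^sup>2 * (norm (pospow_slope c (f x) *\<^sub>R g x))\<^sup>2"
  proof (rule eventually_mono)
    fix x assume "weak_grad S (\<lambda>x. dPhi \<alpha> c (f x)) x = ddPhi \<alpha> c (f x) *\<^sub>R g x"
    then have "g x \<bullet> weak_grad S (\<lambda>x. dPhi \<alpha> c (f x)) x = ddPhi \<alpha> c (f x) * (norm (g x))\<^sup>2"
      by (simp add: power2_norm_eq_inner)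
    then show "g x \<bullet> weak_grad S (\<lambda>x. dPhi \<alpha> c (f x)) x = (\<alpha> + 1) * c / p\<^sup>2 * (norm (pospow_slope c (f x) *\<^sub>R g x))\<^sup>2"
      unfolding ddPhi_pospow_slope[OF c] by (simp add: power_mult_distrib)
  qed
  have "(LINT x|X.M. g x \<bullet> weak_grad S (\<lambda>x. dPhi \<alpha> c (f x)) x) = (LINT x|X.M. (\<alpha> + 1) * c / p\<^sup>2 * (norm (pospow_slope c (f x) *\<^sub>R g x))\<^sup>2)"
  proof (rule integral_cong_AE[OF _ _ ae])
    show "(\<lambda>x. g x \<bullet> weak_grad S (\<lambda>x. dPhi \<alpha> c (f x)) x) \<in> borel_measurable X.M"
      using has_weak_gradientD(1)[OF g] has_weak_gradientD(1)[OF w] by (intro borel_measurable_inner sq_integrableD(1))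
    have "(\<lambda>x. pospow_slope c (f x) *\<^sub>R g x) \<in> borel_measurable X.M" by (rule sq_integrableD(1)[OF has_weak_gradientD(1)[OF cp(4)]])
    then show "(\<lambda>x. (\<alpha> + 1) * c / p\<^sup>2 * (norm (pospow_slope c (f x) *\<^sub>R g x))\<^sup>2) \<in> borel_measurable X.M" by measurable
  qed
  then show ?thesis by simp
qed

text \<open>Tested with the derivatives of the entropy, the gradient terms become multiples of
  \<open>P\<close> and \<open>Q\<close>. In the exchange terms the constants cancel, because
  \<open>X * (W powr \<alpha> - 1) - X * (U powr \<alpha> - 1)\<close> is \<open>X\<^sup>2\<close>.
  What remains is the right side of \<open>entropy_entropy_dissipation\<close>, up to
  coefficients.\<close>

lemma dissipation_inequality:
  obtains l where "l > 0" "\<And>v u C. v \<in> H1_space \<Omega> \<Longrightarrow> u \<in> H1_space \<omega> \<Longrightarrow>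
    AE z in B.M. 0 \<le> v z \<and> v z \<le> C \<Longrightarrow> AE x in R.M. 0 \<le> u x \<and> u x \<le> C \<Longrightarrow>
    (LINT z|B.M. v z) + (LINT x|R.M. u x) = measure lebesgue \<Omega> * vinf + measure lebesgue \<omega> * uinf \<Longrightarrow>
    (- d * (LINT z|B.M. weak_grad \<Omega> v z \<bullet> weak_grad \<Omega> (\<lambda>z. dPhi \<alpha> vinf (v z)) z)
       + (LINT x|R.M. (\<mu> * u x powr \<alpha> - \<nu> * trace0 \<omega> L v x powr \<alpha>) * trace0 \<omega> L (\<lambda>z. dPhi \<alpha> vinf (v z)) x))
    + (- D * (LINT x|R.M. weak_grad \<omega> u x \<bullet> weak_grad \<omega> (\<lambda>x. dPhi \<alpha> uinf (u x)) x)
       + (LINT x|R.M. (\<nu> * trace0 \<omega> L v x powr \<alpha> - \<mu> * u x powr \<alpha>) * dPhi \<alpha> uinf (u x)))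
    \<le> - l * ((LINT z|B.M. vinf * Phi \<alpha> (v z / vinf)) + (LINT x|R.M. uinf * Phi \<alpha> (u x / uinf)))"
proof -
  let ?m1 = "measure lebesgue \<Omega>" and ?m2 = "measure lebesgue \<omega>"
  obtain K1 where K1: "K1 \<ge> 0" "\<forall>F G f g. (\<forall>n. C1_fun (F n) (G n)) \<longrightarrow> l2_tendsto B.M F f \<longrightarrow> l2_tendsto B.M G g \<longrightarrow>
    (LINT x|B.M. (f x - (LINT x|B.M. f x) / ?m1)\<^sup>2) \<le> K1 * (LINT x|B.M. (norm (g x))\<^sup>2)"
  proof (rule B.poincare, goal_cases)
    case (1 K)
    show ?case by (rule 1(1)[of K]) (use 1(2,3) in blast)+
  qed
  obtain K2 where K2: "K2 \<ge> 0" "\<forall>F G f g. (\<forall>n. C1_fun (F n) (G n)) \<longrightarrow> l2_tendsto R.M F f \<longrightarrow> l2_tendsto R.M G g \<longrightarrow>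
    (LINT x|R.M. (f x - (LINT x|R.M. f x) / ?m2)\<^sup>2) \<le> K2 * (LINT x|R.M. (norm (g x))\<^sup>2)"
  proof (rule R.poincare, goal_cases)
    case (1 K)
    show ?case by (rule 1(1)[of K]) (use 1(2,3) in blast)+
  qed
  obtain Ce where Ce: "Ce > 0" "\<forall>(M::('a \<times> real) measure) (N::'a measure) V U W B P Q.
    finite_measure M \<longrightarrow> finite_measure N \<longrightarrow> measure M (space M) = ?m1 \<longrightarrow> measure N (space N) = ?m2 \<longrightarrow>
    V \<in> borel_measurable M \<longrightarrow> U \<in> borel_measurable N \<longrightarrow> W \<in> borel_measurable N \<longrightarrow>
    (AE x in M. 0 \<le> V x \<and> V x \<le> B) \<longrightarrow> (AE x in N. 0 \<le> U x \<and> U x \<le> B) \<longrightarrow> (AE x in N. 0 \<le> W x \<and> W x \<le> B) \<longrightarrow>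
    vinf * (LINT x|M. V x) + uinf * (LINT x|N. U x) = vinf * ?m1 + uinf * ?m2 \<longrightarrow>
    (LINT x|M. (V x powr p - (LINT x|M. V x powr p) / ?m1)\<^sup>2) \<le> K1 * P \<longrightarrow>
    (LINT x|N. (U x powr p - (LINT x|N. U x powr p) / ?m2)\<^sup>2) \<le> K2 * Q \<longrightarrow>
    (\<forall>a. (LINT x|N. (W x powr p - a)\<^sup>2) \<le> tr_const * ((LINT x|M. (V x powr p - a)\<^sup>2) + P)) \<longrightarrow>
    0 \<le> P \<longrightarrow> 0 \<le> Q \<longrightarrow>
    vinf * (LINT x|M. Phi \<alpha> (V x)) + uinf * (LINT x|N. Phi \<alpha> (U x))
      \<le> Ce * (P + Q + (LINT x|N. (W x powr \<alpha> - U x powr \<alpha>)\<^sup>2))"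
    using entropy_entropy_dissipation[OF K1(1) K2(1) less_imp_le[OF tr_const_pos] B.measure_pos R.measure_pos] by blast
  define cv where "cv = d * ((\<alpha> + 1) * vinf / p\<^sup>2)"
  define cu where "cu = D * ((\<alpha> + 1) * uinf / p\<^sup>2)"
  define ck where "ck = equilibrium_flux * ((\<alpha> + 1) / \<alpha>)"
  \<comment> \<open>Smallest of the three dissipation coefficients: field diffusion, road diffusion
    and exchange.\<close>
  define c0 where "c0 = min cv (min cu ck)"
  have cpos: "cv > 0" "cu > 0" "ck > 0" using dD \<alpha> vinf uinf p equilibrium_flux by (auto simp: cv_def cu_def ck_def)
  then have c0: "c0 > 0" "c0 \<le> cv" "c0 \<le> cu" "c0 \<le> ck" by (auto simp: c0_def)
  show thesis
  proof (rule that[of "c0 / Ce"])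
    show "c0 / Ce > 0" using c0 Ce by simp
    fix v u C
    assume v: "v \<in> H1_space \<Omega>" and u: "u \<in> H1_space \<omega>"
      and bv: "AE z in B.M. 0 \<le> v z \<and> v z \<le> C" and bu: "AE x in R.M. 0 \<le> u x \<and> u x \<le> C"
      and mass: "(LINT z|B.M. v z) + (LINT x|R.M. u x) = ?m1 * vinf + ?m2 * uinf"
    define g where "g = weak_grad \<Omega> v"
    define gu where "gu = weak_grad \<omega> u"
    define h where "h = trace0 \<omega> L v"
    have g: "has_weak_gradient \<Omega> v g" unfolding g_def by (rule has_weak_gradient_weak_grad[OF v])
    have gu: "has_weak_gradient \<omega> u gu" unfolding gu_def by (rule has_weak_gradient_weak_grad[OF u])
    note vs = H1_spaceD[OF v] and us = H1_spaceD[OF u]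
    obtain F where A: "B.approximates 0 C F v g" using B.approximation_exists[OF vs g bv] by metis
    obtain Fu where Au: "R.approximates 0 C Fu u gu" using R.approximation_exists[OF us gu bu] by metis
    note cv' = B.chain_approximation[where \<phi> = "\<lambda>s. pospow p (s / vinf)" and \<phi>' = "pospow_slope vinf", OF A pospow_slope_DERIV[OF vinf] pospow_slope_continuous[OF vinf]]
    note cu' = R.chain_approximation[where \<phi> = "\<lambda>s. pospow p (s / uinf)" and \<phi>' = "pospow_slope uinf", OF Au pospow_slope_DERIV[OF uinf] pospow_slope_continuous[OF uinf]]
    note tp = trace_compose[where \<phi> = "\<lambda>s. pospow p (s / vinf)" and \<phi>' = "pospow_slope vinf", OF A g vs pospow_slope_DERIV[OF vinf] pospow_slope_continuous[OF vinf], folded h_def]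
    note td = trace_compose[where \<phi> = "dPhi \<alpha> vinf" and \<phi>' = "ddPhi \<alpha> vinf", OF A g vs dPhi_DERIV[OF \<alpha> vinf] ddPhi_continuous[OF \<alpha> vinf], folded h_def]
    note cd = B.chain_approximation[where \<phi> = "dPhi \<alpha> vinf" and \<phi>' = "ddPhi \<alpha> vinf", OF A dPhi_DERIV[OF \<alpha> vinf] ddPhi_continuous[OF \<alpha> vinf]]
    note cdu = R.chain_approximation[where \<phi> = "dPhi \<alpha> uinf" and \<phi>' = "ddPhi \<alpha> uinf", OF Au dPhi_DERIV[OF \<alpha> uinf] ddPhi_continuous[OF \<alpha> uinf]]
    define P where "P = (LINT z|B.M. (norm (pospow_slope vinf (v z) *\<^sub>R g z))\<^sup>2)"
    define Q where "Q = (LINT x|R.M. (norm (pospow_slope uinf (u x) *\<^sub>R gu x))\<^sup>2)"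
    have PQ: "0 \<le> P" "0 \<le> Q" by (auto simp: P_def Q_def)
    \<comment> \<open>Cutting off at 0 changes the functions only on null sets and makes
      \<open>pospow\<close> of the rescaled densities equal to \<open>powr\<close>
      everywhere.\<close>
    define V where "V z = max 0 (v z / vinf)" for z
    define U where "U x = max 0 (u x / uinf)" for x
    define W where "W x = max 0 (h x / vinf)" for x
    note [measurable] = sq_integrableD(1)[OF vs] sq_integrableD(1)[OF us] td(3)
    have m: "V \<in> borel_measurable B.M" "U \<in> borel_measurable R.M" "W \<in> borel_measurable R.M"
      unfolding V_def U_def W_def by measurable
    define Bd where "Bd = \<bar>C\<bar> / vinf + \<bar>C\<bar> / uinf"
    have Bd: "\<bar>C\<bar> / vinf \<le> Bd" "\<bar>C\<bar> / uinf \<le> Bd" "0 \<le> Bd" using vinf uinf by (auto simp: Bd_def)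
    have sc: "0 \<le> max 0 (s / c) \<and> max 0 (s / c) \<le> Bd" if "0 \<le> s \<and> s \<le> C" "c > 0" "\<bar>C\<bar> / c \<le> Bd" for s c
    proof -
      have "s / c \<le> \<bar>C\<bar> / c" using that by (intro divide_right_mono) auto
      then show ?thesis using that(3) Bd(3) by auto
    qed
    have bV: "AE z in B.M. 0 \<le> V z \<and> V z \<le> Bd" using bv by (rule eventually_mono) (use sc vinf Bd in \<open>simp add: V_def\<close>)
    have bU: "AE x in R.M. 0 \<le> U x \<and> U x \<le> Bd" using bu by (rule eventually_mono) (use sc uinf Bd in \<open>simp add: U_def\<close>)
    have bW: "AE x in R.M. 0 \<le> W x \<and> W x \<le> Bd" using td(2) by (rule eventually_mono) (use sc vinf Bd in \<open>simp add: W_def\<close>)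
    have aeV: "AE z in B.M. V z = v z / vinf" using bv by (rule eventually_mono) (use vinf in \<open>simp add: V_def\<close>)
    have aeU: "AE x in R.M. U x = u x / uinf" using bu by (rule eventually_mono) (use uinf in \<open>simp add: U_def\<close>)
    have massV: "vinf * (LINT z|B.M. V z) = (LINT z|B.M. v z)"
    proof -
      have "(LINT z|B.M. V z) = (LINT z|B.M. v z / vinf)" using aeV m by (intro integral_cong_AE) auto
      then show ?thesis using vinf by simp
    qed
    have massU: "uinf * (LINT x|R.M. U x) = (LINT x|R.M. u x)"
    proof -
      have "(LINT x|R.M. U x) = (LINT x|R.M. u x / uinf)" using aeU m by (intro integral_cong_AE) auto
      then show ?thesis using uinf by simp
    qed
    have PhiV: "vinf * (LINT z|B.M. Phi \<alpha> (V z)) = (LINT z|B.M. vinf * Phi \<alpha> (v z / vinf))"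
    proof -
      have "(LINT z|B.M. Phi \<alpha> (V z)) = (LINT z|B.M. Phi \<alpha> (v z / vinf))"
      proof (rule integral_cong_AE)
        show "AE z in B.M. Phi \<alpha> (V z) = Phi \<alpha> (v z / vinf)" using aeV by (rule eventually_mono) simp
        show "(\<lambda>z. Phi \<alpha> (V z)) \<in> borel_measurable B.M" unfolding Phi_def using m by measurable
        show "(\<lambda>z. Phi \<alpha> (v z / vinf)) \<in> borel_measurable B.M" unfolding Phi_def by measurable
      qed
      then show ?thesis by simp
    qed
    have PhiU: "uinf * (LINT x|R.M. Phi \<alpha> (U x)) = (LINT x|R.M. uinf * Phi \<alpha> (u x / uinf))"
    proof -
      have "(LINT x|R.M. Phi \<alpha> (U x)) = (LINT x|R.M. Phi \<alpha> (u x / uinf))"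
      proof (rule integral_cong_AE)
        show "AE x in R.M. Phi \<alpha> (U x) = Phi \<alpha> (u x / uinf)" using aeU by (rule eventually_mono) simp
        show "(\<lambda>x. Phi \<alpha> (U x)) \<in> borel_measurable R.M" unfolding Phi_def using m by measurable
        show "(\<lambda>x. Phi \<alpha> (u x / uinf)) \<in> borel_measurable R.M" unfolding Phi_def by measurable
      qed
      then show ?thesis by simp
    qed
    have Vp: "pospow q (v z / vinf) = V z powr q" "pospow q (u x / uinf) = U x powr q" "pospow q (h x / vinf) = W x powr q" for q z x
      by (simp_all add: V_def U_def W_def pospow_def)
    define X where "X x = W x powr \<alpha> - U x powr \<alpha>" for x
    have "vinf * (LINT z|B.M. Phi \<alpha> (V z)) + uinf * (LINT x|R.M. Phi \<alpha> (U x))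
      \<le> Ce * (P + Q + (LINT x|R.M. (W x powr \<alpha> - U x powr \<alpha>)\<^sup>2))"
    proof (rule Ce(2)[rule_format, OF B.fin R.fin _ _ m bV bU bW])
      show "measure B.M (space B.M) = ?m1" "measure R.M (space R.M) = ?m2"
        using B.measure_space_eq R.measure_space_eq by simp_all
      show "vinf * (LINT z|B.M. V z) + uinf * (LINT x|R.M. U x) = vinf * ?m1 + uinf * ?m2"
        using mass massV massU by (simp add: mult.commute)
      show "(LINT z|B.M. (V z powr p - (LINT z|B.M. V z powr p) / ?m1)\<^sup>2) \<le> K1 * P"
        using K1(2)[rule_format, OF cv'(1,2,3)] by (simp only: Vp P_def)
      show "(LINT x|R.M. (U x powr p - (LINT x|R.M. U x powr p) / ?m2)\<^sup>2) \<le> K2 * Q"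
        using K2(2)[rule_format, OF cu'(1,2,3)] by (simp only: Vp Q_def)
      show "(LINT x|R.M. (W x powr p - a)\<^sup>2) \<le> tr_const * ((LINT z|B.M. (V z powr p - a)\<^sup>2) + P)" for a
        using tp(4)[of a] by (simp only: Vp P_def)
    qed (rule PQ)+
    then have H: "(LINT z|B.M. vinf * Phi \<alpha> (v z / vinf)) + (LINT x|R.M. uinf * Phi \<alpha> (u x / uinf)) \<le> Ce * (P + Q + (LINT x|R.M. (X x)\<^sup>2))"
      unfolding PhiV PhiU X_def .
    have dv: "(LINT z|B.M. weak_grad \<Omega> v z \<bullet> weak_grad \<Omega> (\<lambda>z. dPhi \<alpha> vinf (v z)) z) = (\<alpha> + 1) * vinf / p\<^sup>2 * P"
      unfolding P_def g_def[symmetric] by (rule component_dissipation[OF B.bounded_convex_axioms vinf A g])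
    have du: "(LINT x|R.M. weak_grad \<omega> u x \<bullet> weak_grad \<omega> (\<lambda>x. dPhi \<alpha> uinf (u x)) x) = (\<alpha> + 1) * uinf / p\<^sup>2 * Q"
      unfolding Q_def gu_def[symmetric] by (rule component_dissipation[OF R.bounded_convex_axioms uinf Au gu])
    have powsq: "sq_integrable R.M (\<lambda>x. Y x powr \<alpha>)" if "Y \<in> borel_measurable R.M" "AE x in R.M. 0 \<le> Y x \<and> Y x \<le> Bd" for Y
    proof (rule R.sq_bounded[where l = 0 and u = "Bd powr \<alpha>"])
      show "(\<lambda>x. Y x powr \<alpha>) \<in> borel_measurable R.M" using that(1) by measurable
      show "AE x in R.M. 0 \<le> Y x powr \<alpha> \<and> Y x powr \<alpha> \<le> Bd powr \<alpha>"
        using that(2) by (rule eventually_mono) (use \<alpha> in \<open>auto intro: powr_mono2\<close>)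
    qed
    have s1: "sq_integrable R.M (\<lambda>x. 1::real)" by (intro R.sq_continuous continuous_intros)
    note sWU = powsq[OF m(3) bW] powsq[OF m(2) bU]
    have sX: "sq_integrable R.M X" unfolding X_def by (rule sq_integrable_diff[OF sWU])
    note iX = integrable_mult_sq[OF sX sq_integrable_diff[OF sWU(1) s1]] integrable_mult_sq[OF sX sq_integrable_diff[OF sWU(2) s1]]
    let ?k = "(\<alpha> + 1) / \<alpha>"
    have trm: "trace0 \<omega> L (\<lambda>z. dPhi \<alpha> vinf (v z)) \<in> borel_measurable R.M"
    proof -
      obtain Kb where "Kb \<ge> 0" "\<And>s. 0 \<le> s \<Longrightarrow> s \<le> C \<Longrightarrow> \<bar>dPhi \<alpha> vinf s\<bar> \<le> Kb"
        using B.compose_continuous_bound[OF dPhi_continuous[OF \<alpha> vinf], of 0 C] by metis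
      then have "AE z in B.M. - Kb \<le> dPhi \<alpha> vinf (v z) \<and> dPhi \<alpha> vinf (v z) \<le> Kb"
        using bv by (elim eventually_mono) (force simp: abs_le_iff)
      from trace0_unique[OF this cd(4,5,1,2,3)] show ?thesis by (intro sq_integrableD(1)[OF l2_tendstoD(2)])
    qed
    have ae: "AE x in R.M. 0 \<le> h x \<and> h x \<le> C" "AE x in R.M. trace0 \<omega> L (\<lambda>z. dPhi \<alpha> vinf (v z)) x = dPhi \<alpha> vinf (h x)" by (rule td)+
    have b1: "(LINT x|R.M. (\<mu> * u x powr \<alpha> - \<nu> * h x powr \<alpha>) * trace0 \<omega> L (\<lambda>z. dPhi \<alpha> vinf (v z)) x)
      = - (equilibrium_flux * ?k) * (LINT x|R.M. X x * (W x powr \<alpha> - 1))"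
    proof -
      have "(LINT x|R.M. (\<mu> * u x powr \<alpha> - \<nu> * h x powr \<alpha>) * trace0 \<omega> L (\<lambda>z. dPhi \<alpha> vinf (v z)) x)
        = (LINT x|R.M. - (equilibrium_flux * ?k) * (X x * (W x powr \<alpha> - 1)))"
      proof (rule integral_cong_AE)
        show "AE x in R.M. (\<mu> * u x powr \<alpha> - \<nu> * h x powr \<alpha>) * trace0 \<omega> L (\<lambda>z. dPhi \<alpha> vinf (v z)) x = - (equilibrium_flux * ?k) * (X x * (W x powr \<alpha> - 1))"
          using ae bu
        proof eventually_elim
          case (elim x)
          have "\<nu> * h x powr \<alpha> = equilibrium_flux * W x powr \<alpha>" "\<mu> * u x powr \<alpha> = equilibrium_flux * U x powr \<alpha>"
            using flux_scaling[of "h x" "u x"] elim by (auto simp: Vp)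
          then show ?case unfolding elim(2) by (simp add: dPhi_def Vp X_def algebra_simps)
        qed
        show "(\<lambda>x. (\<mu> * u x powr \<alpha> - \<nu> * h x powr \<alpha>) * trace0 \<omega> L (\<lambda>z. dPhi \<alpha> vinf (v z)) x) \<in> borel_measurable R.M"
          using trm by measurable
        show "(\<lambda>x. - (equilibrium_flux * ?k) * (X x * (W x powr \<alpha> - 1))) \<in> borel_measurable R.M" unfolding X_def using m by measurable
      qed
      then show ?thesis by simp
    qed
    have b2: "(LINT x|R.M. (\<nu> * h x powr \<alpha> - \<mu> * u x powr \<alpha>) * dPhi \<alpha> uinf (u x)) = (equilibrium_flux * ?k) * (LINT x|R.M. X x * (U x powr \<alpha> - 1))"
    proof -
      have "(LINT x|R.M. (\<nu> * h x powr \<alpha> - \<mu> * u x powr \<alpha>) * dPhi \<alpha> uinf (u x)) = (LINT x|R.M. (equilibrium_flux * ?k) * (X x * (U x powr \<alpha> - 1)))"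
      proof (rule integral_cong_AE)
        show "AE x in R.M. (\<nu> * h x powr \<alpha> - \<mu> * u x powr \<alpha>) * dPhi \<alpha> uinf (u x) = (equilibrium_flux * ?k) * (X x * (U x powr \<alpha> - 1))"
          using ae(1) bu
        proof eventually_elim
          case (elim x)
          have "\<nu> * h x powr \<alpha> = equilibrium_flux * W x powr \<alpha>" "\<mu> * u x powr \<alpha> = equilibrium_flux * U x powr \<alpha>"
            using flux_scaling[of "h x" "u x"] elim by (auto simp: Vp)
          then show ?case by (simp add: dPhi_def Vp X_def algebra_simps)
        qed
        show "(\<lambda>x. (\<nu> * h x powr \<alpha> - \<mu> * u x powr \<alpha>) * dPhi \<alpha> uinf (u x)) \<in> borel_measurable R.M"
          using sq_integrableD(1)[OF cdu(5)] by measurable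
        show "(\<lambda>x. (equilibrium_flux * ?k) * (X x * (U x powr \<alpha> - 1))) \<in> borel_measurable R.M" unfolding X_def using m by measurable
      qed
      then show ?thesis by simp
    qed
    have XX: "(LINT x|R.M. X x * (W x powr \<alpha> - 1)) - (LINT x|R.M. X x * (U x powr \<alpha> - 1)) = (LINT x|R.M. (X x)\<^sup>2)"
    proof -
      have "(LINT x|R.M. X x * (W x powr \<alpha> - 1)) - (LINT x|R.M. X x * (U x powr \<alpha> - 1))
        = (LINT x|R.M. X x * (W x powr \<alpha> - 1) - X x * (U x powr \<alpha> - 1))" using iX by simp
      also have "\<dots> = (LINT x|R.M. (X x)\<^sup>2)"
        by (intro Bochner_Integration.integral_cong refl) (simp add: X_def power2_eq_square algebra_simps)
      finally show ?thesis .
    qed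
    define E where "E = (LINT z|B.M. vinf * Phi \<alpha> (v z / vinf)) + (LINT x|R.M. uinf * Phi \<alpha> (u x / uinf))"
    define XI where "XI = (LINT x|R.M. (X x)\<^sup>2)"
    have XI0: "0 \<le> XI" by (simp add: XI_def)
    have "(c0 / Ce) * E \<le> (c0 / Ce) * (Ce * (P + Q + XI))" using H c0 Ce unfolding E_def XI_def by (intro mult_left_mono) auto
    also have "\<dots> = c0 * P + c0 * Q + c0 * XI" using Ce by (simp add: distrib_left)
    also have "\<dots> \<le> cv * P + cu * Q + ck * XI" using c0 PQ XI0 by (intro add_mono mult_right_mono) auto
    finally have fin: "(c0 / Ce) * E \<le> cv * P + cu * Q + ck * XI" .
    define Y1 where "Y1 = (LINT x|R.M. X x * (W x powr \<alpha> - 1))"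
    define Y2 where "Y2 = (LINT x|R.M. X x * (U x powr \<alpha> - 1))"
    have "ck * XI = equilibrium_flux * ?k * Y1 - equilibrium_flux * ?k * Y2"
      unfolding XI_def XX[symmetric] ck_def Y1_def Y2_def by (simp add: right_diff_distrib)
    then show "(- d * (LINT z|B.M. weak_grad \<Omega> v z \<bullet> weak_grad \<Omega> (\<lambda>z. dPhi \<alpha> vinf (v z)) z)
       + (LINT x|R.M. (\<mu> * u x powr \<alpha> - \<nu> * trace0 \<omega> L v x powr \<alpha>) * trace0 \<omega> L (\<lambda>z. dPhi \<alpha> vinf (v z)) x))
      + (- D * (LINT x|R.M. weak_grad \<omega> u x \<bullet> weak_grad \<omega> (\<lambda>x. dPhi \<alpha> uinf (u x)) x)
       + (LINT x|R.M. (\<nu> * trace0 \<omega> L v x powr \<alpha> - \<mu> * u x powr \<alpha>) * dPhi \<alpha> uinf (u x)))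
      \<le> - (c0 / Ce) * ((LINT z|B.M. vinf * Phi \<alpha> (v z / vinf)) + (LINT x|R.M. uinf * Phi \<alpha> (u x / uinf)))"
    proof -
      have "- d * ((\<alpha> + 1) * vinf / p\<^sup>2 * P) = - (cv * P)" "- D * ((\<alpha> + 1) * uinf / p\<^sup>2 * Q) = - (cu * Q)"
        "- (c0 / Ce) * E = - ((c0 / Ce) * E)" "- (equilibrium_flux * ?k) * Y1 = - (equilibrium_flux * ?k * Y1)"
        by (simp_all add: cv_def cu_def)
      then show ?thesis
        using fin \<open>ck * XI = equilibrium_flux * ?k * Y1 - equilibrium_flux * ?k * Y2\<close>
        unfolding h_def[symmetric] dv du b1 b2 E_def[symmetric] Y1_def[symmetric] Y2_def[symmetric] by linarith
    qed
  qed
qed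

end

section \<open>Decay of the entropy\<close>

text \<open>If one of the functions is not measurable then, by completeness, neither is the other,
  and both integrals are 0. This suits integrands with traces, where measurability is not at
  hand.\<close>

lemma integral_lebesgue_on_cong_AE:
  fixes f g :: "'n::euclidean_space \<Rightarrow> real"
  assumes S: "S \<in> sets lebesgue" and ae: "AE x in lebesgue_on S. f x = g x"
  shows "(LINT x|lebesgue_on S. f x) = (LINT x|lebesgue_on S. g x)"
proof (cases "f \<in> borel_measurable (lebesgue_on S)")
  case True
  show ?thesis by (rule integral_cong_AE[OF True borel_measurable_lebesgue_on_AE[OF S True ae] ae])
next
  case False
  have "AE x in lebesgue_on S. g x = f x" using ae by (rule eventually_mono) simp
  then have "g \<notin> borel_measurable (lebesgue_on S)" using False borel_measurable_lebesgue_on_AE[OF S] by blast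
  then have "\<not> integrable (lebesgue_on S) f" "\<not> integrable (lebesgue_on S) g" using False by auto
  then show ?thesis by (simp add: not_integrable_integral_eq)
qed

lemma integrable_indicator_mult:
  fixes f :: "real \<Rightarrow> real"
  assumes "integrable (lebesgue_on A) f" "B \<subseteq> A" "A \<in> sets lebesgue" "B \<in> sets lebesgue"
  shows "integrable (lebesgue_on A) (\<lambda>s. indicator B s * f s)"
proof -
  have "B \<in> sets (lebesgue_on A)" using assms by (simp add: sets_restrict_space_iff)
  from integrable_mult_indicator[OF this assms(1)] show ?thesis by simp
qed

context bounded_convex
begin

lemma const_has_weak_gradient: "has_weak_gradient S (\<lambda>x. c) (\<lambda>x. 0)"
  by (rule C1_has_weak_gradient[OF op bd]) (simp add: C1_fun_def)

lemma const_H1: "(\<lambda>x. c) \<in> H1_space S"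
  by (rule H1_spaceI[OF sq_continuous const_has_weak_gradient]) simp

lemma weak_grad_const: "AE x in M. weak_grad S (\<lambda>x. c) x = 0"
  by (rule has_weak_gradient_unique[OF op cv bd has_weak_gradient_weak_grad[OF const_H1] const_has_weak_gradient])

lemma integral_inner_weak_grad_const: "(LINT x|M. g x \<bullet> weak_grad S (\<lambda>x. c) x) = 0"
  by (rule integral_eq_zero_AE, rule eventually_mono[OF weak_grad_const[of c]]) simp

lemma Phi_integral_nonneg:
  assumes \<alpha>: "\<alpha> > 1" and c: "c > 0" and w: "AE x in M. 0 \<le> w x \<and> w x \<le> C"
  shows "0 \<le> (LINT x|M. c * Phi \<alpha> (w x / c))"
proof (rule integral_nonneg_AE)
  show "AE x in M. 0 \<le> c * Phi \<alpha> (w x / c)"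
    using w by (rule eventually_mono) (use \<alpha> c in \<open>auto intro!: mult_nonneg_nonneg Phi_nonneg\<close>)
qed

text \<open>Rescaled integral form of \<open>Phi_lower\<close>: of the factor
  \<open>c powr (\<alpha> + 1)\<close>, one power of \<open>c\<close> is the weight in the entropy
  and the rest is the constant.\<close>

lemma Lp_norm_le_Phi:
  assumes \<alpha>: "\<alpha> > 1" and c: "c > 0" and w: "w \<in> borel_measurable M" "AE x in M. 0 \<le> w x \<and> w x \<le> C"
  shows "Lp_norm S (\<alpha> + 1) (\<lambda>x. w x - c) powr (\<alpha> + 1) \<le> \<alpha> * c powr \<alpha> * (LINT x|M. c * Phi \<alpha> (w x / c))"
proof -
  define I where "I = (LINT x|M. norm (w x - c) powr (\<alpha> + 1))"
  have "I \<ge> 0" unfolding I_def by simp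
  then have "Lp_norm S (\<alpha> + 1) (\<lambda>x. w x - c) powr (\<alpha> + 1) = I"
    unfolding Lp_norm_def I_def[symmetric] using \<alpha> by (simp add: powr_powr)
  also have "I \<le> (LINT x|M. (\<alpha> * c powr \<alpha>) * (c * Phi \<alpha> (w x / c)))"
    unfolding I_def
  proof (rule integral_mono_AE')
    show "integrable M (\<lambda>x. (\<alpha> * c powr \<alpha>) * (c * Phi \<alpha> (w x / c)))"
      using Phi_integrable[OF \<alpha> c w] by simp
    show "AE x in M. norm (w x - c) powr (\<alpha> + 1) \<le> (\<alpha> * c powr \<alpha>) * (c * Phi \<alpha> (w x / c))"
      using w(2)
    proof (rule eventually_mono)
      fix x assume x: "0 \<le> w x \<and> w x \<le> C"
      have "norm (w x - c) = c * \<bar>w x / c - 1\<bar>" using c by (simp add: abs_if field_simps)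
      then have "norm (w x - c) powr (\<alpha> + 1) = c powr (\<alpha> + 1) * \<bar>w x / c - 1\<bar> powr (\<alpha> + 1)"
        using c by (simp add: powr_mult)
      also have "\<dots> \<le> c powr (\<alpha> + 1) * (\<alpha> * Phi \<alpha> (w x / c))"
        using x c by (intro mult_left_mono Phi_lower[OF \<alpha>]) auto
      also have "\<dots> = (\<alpha> * c powr \<alpha>) * (c * Phi \<alpha> (w x / c))" using c by (simp add: powr_add)
      finally show "norm (w x - c) powr (\<alpha> + 1) \<le> (\<alpha> * c powr \<alpha>) * (c * Phi \<alpha> (w x / c))" .
    qed
    show "AE x in M. 0 \<le> (\<alpha> * c powr \<alpha>) * (c * Phi \<alpha> (w x / c))"
      using w(2) by (rule eventually_mono) (use \<alpha> c in \<open>auto intro!: mult_nonneg_nonneg Phi_nonneg\<close>)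
  qed
  finally show ?thesis by simp
qed

end

section \<open>Consequences of the weak equations at a fixed time\<close>

context field_road
begin

lemma trace0_one: "AE x in R.M. trace0 \<omega> L (\<lambda>z. 1) x = 1"
proof -
  have "AE z in B.M. 1 \<le> (1::real) \<and> 1 \<le> (1::real)" by simp
  from trace0_unique[where F = "\<lambda>n z. 1" and G = "\<lambda>n z. 0", OF this B.const_has_weak_gradient B.sq_continuous]
  have "l2_tendsto R.M (\<lambda>n x. 1) (trace0 \<omega> L (\<lambda>z. 1))"
    by (simp add: C1_fun_def l2_tendsto_const B.sq_continuous)
  moreover have "l2_tendsto R.M (\<lambda>n x. 1::real) (\<lambda>x. 1)" by (rule l2_tendsto_const[OF R.sq_continuous]) simp
  ultimately show ?thesis by (rule l2_tendsto_unique)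
qed

text \<open>\<open>F\<close> and \<open>K\<close> take the place of the two time derivatives at one
  instant.\<close>

definition weak_identity where
  "weak_identity v u F K \<longleftrightarrow> (\<forall>\<phi>\<in>H1_space \<Omega>. \<forall>\<psi>\<in>H1_space \<omega>.
    F \<phi> = - d * (LINT z|B.M. weak_grad \<Omega> v z \<bullet> weak_grad \<Omega> \<phi> z)
      + (LINT x|R.M. (\<mu> * u x powr \<alpha> - \<nu> * trace0 \<omega> L v x powr \<alpha>) * trace0 \<omega> L \<phi> x) \<and>
    K \<psi> = - D * (LINT x|R.M. weak_grad \<omega> u x \<bullet> weak_grad \<omega> \<psi> x)
      + (LINT x|R.M. (\<nu> * trace0 \<omega> L v x powr \<alpha> - \<mu> * u x powr \<alpha>) * \<psi> x))"

text \<open>Constants have no gradient part, and the exchange terms of field and road cancel. This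
  is conservation of mass in infinitesimal form.\<close>

lemma weak_identity_one:
  assumes "weak_identity v u F K"
  shows "F (\<lambda>z. 1) + K (\<lambda>x. 1) = 0"
proof -
  have "F (\<lambda>z. 1) = - d * (LINT z|B.M. weak_grad \<Omega> v z \<bullet> weak_grad \<Omega> (\<lambda>z. 1) z)
      + (LINT x|R.M. (\<mu> * u x powr \<alpha> - \<nu> * trace0 \<omega> L v x powr \<alpha>) * trace0 \<omega> L (\<lambda>z. 1) x)"
    "K (\<lambda>x. 1) = - D * (LINT x|R.M. weak_grad \<omega> u x \<bullet> weak_grad \<omega> (\<lambda>x. 1) x)
      + (LINT x|R.M. (\<nu> * trace0 \<omega> L v x powr \<alpha> - \<mu> * u x powr \<alpha>) * 1)"
    using assms B.const_H1[of 1] R.const_H1[of 1] unfolding weak_identity_def by blast+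
  moreover have "(LINT x|R.M. (\<mu> * u x powr \<alpha> - \<nu> * trace0 \<omega> L v x powr \<alpha>) * trace0 \<omega> L (\<lambda>z. 1) x)
    = (LINT x|R.M. - ((\<nu> * trace0 \<omega> L v x powr \<alpha> - \<mu> * u x powr \<alpha>) * 1))"
    using trace0_one R.Sm by (intro integral_lebesgue_on_cong_AE) (auto elim!: eventually_mono)
  moreover have "\<dots> = - (LINT x|R.M. (\<nu> * trace0 \<omega> L v x powr \<alpha> - \<mu> * u x powr \<alpha>) * 1)" by (rule integral_minus)
  ultimately show ?thesis
    unfolding B.integral_inner_weak_grad_const R.integral_inner_weak_grad_const by linarith
qed

definition total_entropy where
  "total_entropy v u = (LINT z|B.M. vinf * Phi \<alpha> (v z / vinf)) + (LINT x|R.M. uinf * Phi \<alpha> (u x / uinf))"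

text \<open>\<open>C\<close> is quantified inside, so one rate serves bounded densities of any
  size.\<close>

definition dissipation_rate :: "real \<Rightarrow> bool" where
  "dissipation_rate l \<longleftrightarrow> (\<forall>v u C F K. v \<in> H1_space \<Omega> \<longrightarrow> u \<in> H1_space \<omega> \<longrightarrow>
    (AE z in B.M. 0 \<le> v z \<and> v z \<le> C) \<longrightarrow> (AE x in R.M. 0 \<le> u x \<and> u x \<le> C) \<longrightarrow>
    (LINT z|B.M. v z) + (LINT x|R.M. u x) = measure lebesgue \<Omega> * vinf + measure lebesgue \<omega> * uinf \<longrightarrow>
    weak_identity v u F K \<longrightarrow>
    F (\<lambda>z. dPhi \<alpha> vinf (v z)) + K (\<lambda>x. dPhi \<alpha> uinf (u x)) \<le> - l * total_entropy v u)"

lemma dissipation_rate_exists: "\<exists>l>0. dissipation_rate l"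
proof (rule dissipation_inequality, goal_cases)
  case (1 l)
  have "dissipation_rate l" unfolding dissipation_rate_def
  proof (intro allI impI)
    fix v u C F K
    assume v: "v \<in> H1_space \<Omega>" and u: "u \<in> H1_space \<omega>"
      and bv: "AE z in B.M. 0 \<le> v z \<and> v z \<le> C" and bu: "AE x in R.M. 0 \<le> u x \<and> u x \<le> C"
      and m: "(LINT z|B.M. v z) + (LINT x|R.M. u x) = measure lebesgue \<Omega> * vinf + measure lebesgue \<omega> * uinf"
      and w: "weak_identity v u F K"
    obtain A1 B1 where "\<forall>f. f \<in> H1_space \<Omega> \<longrightarrow> (AE x in B.M. 0 \<le> f x \<and> f x \<le> C) \<longrightarrow>
      (\<lambda>x. dPhi \<alpha> vinf (f x)) \<in> H1_space \<Omega> \<and> (H1_norm \<Omega> (\<lambda>x. dPhi \<alpha> vinf (f x)))\<^sup>2 \<le> A1 + B1 * (H1_norm \<Omega> f)\<^sup>2"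
      using B.dPhi_H1[OF \<alpha> vinf, of C] by blast
    then have 2: "(\<lambda>z. dPhi \<alpha> vinf (v z)) \<in> H1_space \<Omega>" using v bv by blast
    obtain A2 B2 where "\<forall>f. f \<in> H1_space \<omega> \<longrightarrow> (AE x in R.M. 0 \<le> f x \<and> f x \<le> C) \<longrightarrow>
      (\<lambda>x. dPhi \<alpha> uinf (f x)) \<in> H1_space \<omega> \<and> (H1_norm \<omega> (\<lambda>x. dPhi \<alpha> uinf (f x)))\<^sup>2 \<le> A2 + B2 * (H1_norm \<omega> f)\<^sup>2"
      using R.dPhi_H1[OF \<alpha> uinf, of C] by blast
    then have 3: "(\<lambda>x. dPhi \<alpha> uinf (u x)) \<in> H1_space \<omega>" using u bu by blast
    note w' = w[unfolded weak_identity_def, rule_format, OF 2 3]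
    show "F (\<lambda>z. dPhi \<alpha> vinf (v z)) + K (\<lambda>x. dPhi \<alpha> uinf (u x)) \<le> - l * total_entropy v u"
      unfolding w'[THEN conjunct1] w'[THEN conjunct2] total_entropy_def by (rule 1(2)[OF v u bv bu m])
  qed
  then show ?case using 1(1) by blast
qed

end

text \<open>The bounds include \<open>t = 0\<close>: continuity of the entropy up to 0, and with it
  the comparison with the initial entropy, relies on them.\<close>

locale field_road_evolution = field_road \<omega> L \<alpha> vinf uinf d D \<mu> \<nu>
  for \<omega> :: "'a::euclidean_space set" and L \<alpha> vinf uinf d D \<mu> \<nu> :: real +
  fixes v v' u u' and C :: real
  assumes bv: "\<And>t. 0 \<le> t \<Longrightarrow> AE z in B.M. 0 \<le> v t z \<and> v t z \<le> C"
    and bu: "\<And>t. 0 \<le> t \<Longrightarrow> AE x in R.M. 0 \<le> u t x \<and> u t x \<le> C"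
    and pv: "parabolic_class \<Omega> v v'" and pu: "parabolic_class \<omega> u u'"
    and weak: "AE t in lebesgue_on {0<..}. weak_identity (v t) (u t) (v' t) (u' t)"
    and initial_mass: "(LINT z|B.M. v 0 z) + (LINT x|R.M. u 0 x) = measure lebesgue \<Omega> * vinf + measure lebesgue \<omega> * uinf"
begin

lemma sq: "0 \<le> t \<Longrightarrow> sq_integrable B.M (v t)" "0 \<le> t \<Longrightarrow> sq_integrable R.M (u t)"
  using B.C_L2_sq[OF B.parabolic_classD(2)[OF pv, of "t + 1"]] R.C_L2_sq[OF R.parabolic_classD(2)[OF pu, of "t + 1"]] by auto

lemma weak_on: "AE t in lebesgue_on {0<..<T}. weak_identity (v t) (u t) (v' t) (u' t)"
proof -
  have "AE t in lebesgue. t \<in> {0<..} \<longrightarrow> weak_identity (v t) (u t) (v' t) (u' t)"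
    using weak by (subst (asm) AE_restrict_space_iff) auto
  then have "AE t in lebesgue. t \<in> {0<..<T} \<longrightarrow> weak_identity (v t) (u t) (v' t) (u' t)"
    by (rule eventually_mono) auto
  then show ?thesis by (subst AE_restrict_space_iff) auto
qed

text \<open>The weak equations tested with 1 give zero increments between positive times; continuity
  in L2 extends the constancy to \<open>t = 0\<close>.\<close>

lemma mass:
  assumes t: "0 \<le> t"
  shows "(LINT z|B.M. v t z) + (LINT x|R.M. u t x) = measure lebesgue \<Omega> * vinf + measure lebesgue \<omega> * uinf"
proof -
  define T where "T = t + 1"
  have T: "T > 0" "t \<in> {0..T}" using t by (auto simp: T_def)
  define m where "m t = (LINT z|B.M. v t z * 1) + (LINT x|R.M. u t x * 1)" for t
  have cont: "continuous_on {0..T} m"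
    unfolding m_def by (intro continuous_on_add B.pairing_continuous R.pairing_continuous B.parabolic_classD(2)[OF pv T(1)] R.parabolic_classD(2)[OF pu T(1)] B.sq_continuous R.sq_continuous continuous_intros)
  have const: "m s = m r" if rs: "0 < r" "r < s" "s < T" for r s
  proof -
    let ?L = "lebesgue_on {0<..<T}"
    have i: "integrable ?L (\<lambda>q. indicator {r<..<s} q * v' q (\<lambda>z. 1))" "integrable ?L (\<lambda>q. indicator {r<..<s} q * u' q (\<lambda>x. 1))"
      by (intro integrable_indicator_mult B.functional_integrable[OF B.parabolic_classD(3)[OF pv T(1)] B.const_H1]
          R.functional_integrable[OF R.parabolic_classD(3)[OF pu T(1)] R.const_H1]; use rs in auto)+
    have "m s - m r = (LINT q|?L. indicator {r<..<s} q * v' q (\<lambda>z. 1)) + (LINT q|?L. indicator {r<..<s} q * u' q (\<lambda>x. 1))"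
      using B.pairing_increment[OF pv B.const_H1[of 1] rs] R.pairing_increment[OF pu R.const_H1[of 1] rs] by (simp add: m_def)
    also have "\<dots> = (LINT q|?L. indicator {r<..<s} q * v' q (\<lambda>z. 1) + indicator {r<..<s} q * u' q (\<lambda>x. 1))" using i by simp
    also have "\<dots> = 0"
    proof (rule integral_eq_zero_AE, rule eventually_mono[OF weak_on[of T]])
      fix q assume "weak_identity (v q) (u q) (v' q) (u' q)"
      from weak_identity_one[OF this] show "indicator {r<..<s} q * v' q (\<lambda>z. 1) + indicator {r<..<s} q * u' q (\<lambda>x. 1) = 0"
        by (simp add: distrib_left[symmetric])
    qed
    finally show ?thesis by simp
  qed
  have half: "m s = m (T / 2)" if "s \<in> {0<..<T}" for s
    using const[of s "T / 2"] const[of "T / 2" s] that T by (cases s "T / 2" rule: linorder_cases) auto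
  have "m s = m (T / 2)" if "s \<in> {0..T}" for s
  proof (rule continuous_constant_on_closure[where S = "{0<..<T}" and f = m])
    have cl: "closure {0<..<T} = {0..T}" using T by simp
    show "continuous_on (closure {0<..<T}) m" unfolding cl by (rule cont)
    show "s \<in> closure {0<..<T}" unfolding cl by (rule that)
  qed (rule half)
  from this[of t] this[of 0] have "m t = m 0" using T by simp
  then show ?thesis using initial_mass by (simp add: m_def)
qed

lemma total_entropy_continuous: "continuous_on {0..T} (\<lambda>t. total_entropy (v t) (u t))"
proof (rule continuous_on_subset)
  let ?T = "max T 1"
  have T: "?T > 0" by simp
  show "continuous_on {0..?T} (\<lambda>t. total_entropy (v t) (u t))"
    unfolding total_entropy_def
    by (intro continuous_on_add B.Phi_integral_continuous[OF \<alpha> vinf B.parabolic_classD(2)[OF pv T] bv]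
        R.Phi_integral_continuous[OF \<alpha> uinf R.parabolic_classD(2)[OF pu T] bu]) auto
qed auto

lemma total_entropy_nonneg: "0 \<le> t \<Longrightarrow> 0 \<le> total_entropy (v t) (u t)"
  unfolding total_entropy_def
  by (intro add_nonneg_nonneg B.Phi_integral_nonneg[OF \<alpha> vinf bv] R.Phi_integral_nonneg[OF \<alpha> uinf bu])

text \<open>Each component contributes an error of at most half of \<open>\<epsilon>\<close>. The
  pairings of the two time derivatives have no sign separately; only their sum is controlled, by the
  dissipation rate at the later time.\<close>

lemma total_entropy_increment:
  assumes l: "dissipation_rate l" and T: "T > 0" and \<epsilon>: "\<epsilon> > 0"
  shows "\<exists>\<xi> h P. integrable (lebesgue_on {0<..<T}) \<xi> \<and> (\<forall>t. 0 \<le> \<xi> t) \<and> (LINT t|lebesgue_on {0<..<T}. \<xi> t) < \<epsilon> \<and> h > 0 \<and>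
      (AE t in lebesgue_on {0<..<T}. P t) \<and>
      (\<forall>r t. P t \<longrightarrow> 0 < r \<longrightarrow> r < t \<longrightarrow> t < T \<longrightarrow> t - r < h \<longrightarrow>
         total_entropy (v t) (u t) - total_entropy (v r) (u r) \<le> (t - r) * (- l * total_entropy (v t) (u t) + \<xi> t)
           + (LINT s|lebesgue_on {0<..<T}. indicator {r<..<t} s * \<xi> s))"
proof -
  let ?L = "lebesgue_on {0<..<T}"
  have e: "\<epsilon> / 2 > 0" using \<epsilon> by simp
  show ?thesis
  proof (rule B.component_entropy_increment[OF \<alpha> vinf pv bv[OF less_imp_le] T e], assumption, goal_cases)
    case (1 \<xi>1 h1 P1)
    note a = 1
    show ?case
    proof (rule R.component_entropy_increment[OF \<alpha> uinf pu bu[OF less_imp_le] T e], assumption, goal_cases)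
      case (1 \<xi>2 h2 P2)
      note b = 1
      define \<xi> where "\<xi> t = \<xi>1 t + \<xi>2 t" for t
      define P where "P t \<longleftrightarrow> P1 t \<and> P2 t \<and> weak_identity (v t) (u t) (v' t) (u' t)" for t
      have "integrable ?L \<xi>" "\<forall>t. 0 \<le> \<xi> t" "min h1 h2 > 0" unfolding \<xi>_def[abs_def] using a(1,2,4) b(1,2,4) by auto
      moreover have "(LINT t|?L. \<xi> t) < \<epsilon>" unfolding \<xi>_def using a(1,3) b(1,3) by simp
      moreover have "AE t in ?L. P t"
        using a(5) b(5) weak_on by eventually_elim (simp add: P_def)
      moreover have "total_entropy (v t) (u t) - total_entropy (v r) (u r) \<le> (t - r) * (- l * total_entropy (v t) (u t) + \<xi> t)
           + (LINT s|?L. indicator {r<..<t} s * \<xi> s)"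
        if t: "P t" "0 < r" "r < t" "t < T" "t - r < min h1 h2" for r t
      proof -
        have P: "P1 t" "P2 t" "weak_identity (v t) (u t) (v' t) (u' t)" using t(1) by (auto simp: P_def)
        have t0: "0 \<le> t" using t by simp
        define F where "F = v' t (\<lambda>z. dPhi \<alpha> vinf (v t z))"
        define K where "K = u' t (\<lambda>x. dPhi \<alpha> uinf (u t x))"
        have "F + K \<le> - l * total_entropy (v t) (u t)"
          unfolding F_def K_def
          by (rule l[unfolded dissipation_rate_def, rule_format, OF a(6)[OF P(1)] b(6)[OF P(2)] bv[OF t0] bu[OF t0] mass[OF t0] P(3)])
        then have 1: "(t - r) * (F + K) \<le> (t - r) * (- l * total_entropy (v t) (u t))" using t by (intro mult_left_mono) auto
        have h: "t - r < h1" "t - r < h2" using t by auto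
        have i: "integrable ?L (\<lambda>s. indicator {r<..<t} s * \<xi>1 s)" "integrable ?L (\<lambda>s. indicator {r<..<t} s * \<xi>2 s)"
          using a(1) b(1) t by (auto intro!: integrable_indicator_mult)
        have 2: "(LINT s|?L. indicator {r<..<t} s * \<xi> s) = (LINT s|?L. indicator {r<..<t} s * \<xi>1 s) + (LINT s|?L. indicator {r<..<t} s * \<xi>2 s)"
          unfolding \<xi>_def distrib_left using i by simp
        have 3: "(t - r) * (F + \<xi>1 t) + (t - r) * (K + \<xi>2 t) = (t - r) * (F + K) + (t - r) * \<xi> t"
          by (simp add: \<xi>_def algebra_simps)
        show ?thesis
          using a(7)[OF P(1) t(2-4) h(1)] b(7)[OF P(2) t(2-4) h(2)] 1 3
          unfolding total_entropy_def[of "v t"] total_entropy_def[of "v r"] F_def[symmetric] K_def[symmetric] 2 distrib_left[of "t - r" "- l * _"]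
          by linarith
      qed
      ultimately show ?case by blast
    qed
  qed
qed

lemma total_entropy_decay:
  assumes l: "l > 0" "dissipation_rate l" and t: "t > 0"
  shows "total_entropy (v t) (u t) \<le> total_entropy (v 0) (u 0) * exp (- l * t)"
proof (rule exponential_decay[where G = "\<lambda>t. total_entropy (v t) (u t)", OF total_entropy_continuous total_entropy_nonneg l(1) _ t])
  fix a b :: real assume ab: "0 < a" "a < b"
  show "total_entropy (v b) (u b) - total_entropy (v a) (u a) \<le> - l * integral {a..b} (\<lambda>t. total_entropy (v t) (u t))"
    by (rule entropy_decay_step[where G = "\<lambda>t. total_entropy (v t) (u t)" and T = "b + 1",
          OF total_entropy_continuous ab _ total_entropy_increment[OF l(2)]]) (use ab in auto)
qed

lemma Lp_norms_le_total_entropy: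
  assumes t: "0 \<le> t"
  shows "Lp_norm \<Omega> (\<alpha> + 1) (\<lambda>z. v t z - vinf) powr (\<alpha> + 1) + Lp_norm \<omega> (\<alpha> + 1) (\<lambda>x. u t x - uinf) powr (\<alpha> + 1)
    \<le> \<alpha> * max (vinf powr \<alpha>) (uinf powr \<alpha>) * total_entropy (v t) (u t)"
proof -
  have nn: "0 \<le> (LINT z|B.M. vinf * Phi \<alpha> (v t z / vinf))" "0 \<le> (LINT x|R.M. uinf * Phi \<alpha> (u t x / uinf))"
    by (rule B.Phi_integral_nonneg[OF \<alpha> vinf bv[OF t]], rule R.Phi_integral_nonneg[OF \<alpha> uinf bu[OF t]])
  have "\<alpha> * vinf powr \<alpha> \<le> \<alpha> * max (vinf powr \<alpha>) (uinf powr \<alpha>)" "\<alpha> * uinf powr \<alpha> \<le> \<alpha> * max (vinf powr \<alpha>) (uinf powr \<alpha>)"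
    using \<alpha> by (auto intro: mult_left_mono)
  from mult_right_mono[OF this(1) nn(1)] mult_right_mono[OF this(2) nn(2)]
    B.Lp_norm_le_Phi[OF \<alpha> vinf sq_integrableD(1)[OF sq(1)[OF t]] bv[OF t]] R.Lp_norm_le_Phi[OF \<alpha> uinf sq_integrableD(1)[OF sq(2)[OF t]] bu[OF t]]
  show ?thesis unfolding total_entropy_def distrib_left by linarith
qed

end

theorem theorem2p1:
  fixes \<omega> :: "'a::euclidean_space set"
    and \<Omega> :: "('a \<times> real) set"
    and L d D \<mu>0 \<nu>0 \<alpha> \<mu> \<nu> M0 vinf uinf :: real
    and v0 :: "'a \<times> real \<Rightarrow> real"
    and u0 :: "'a \<Rightarrow> real"
  assumes "bounded \<omega>" and "convex \<omega>" and "open \<omega>"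
    and "L > 0" and "\<Omega> = \<omega> \<times> {0<..<L}"
    and "d > 0" and "D > 0" and "\<mu>0 > 0" and "\<nu>0 > 0"
    and "\<alpha> > 1" and "\<mu> = \<alpha> * \<mu>0" and "\<nu> = \<alpha> * \<nu>0"
    and "v0 \<in> Linf_space \<Omega>" and "u0 \<in> Linf_space \<omega>"
    and "AE z in lebesgue_on \<Omega>. 0 \<le> v0 z"
    and "AE x in lebesgue_on \<omega>. 0 \<le> u0 x"
    and "\<not> ((AE z in lebesgue_on \<Omega>. v0 z = 0) \<and> (AE x in lebesgue_on \<omega>. u0 x = 0))"
    and "M0 = (LINT z|lebesgue_on \<Omega>. v0 z) + (LINT x|lebesgue_on \<omega>. u0 x)"
    and "vinf > 0" and "uinf > 0"
    and "\<nu> * vinf powr \<alpha> = \<mu> * uinf powr \<alpha>"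
    and "measure lebesgue \<Omega> * vinf + measure lebesgue \<omega> * uinf = M0"
  shows "\<exists>lam>0. \<exists>M>0. \<forall>v u.
    field_road_solution \<omega> L d D \<mu> \<nu> \<alpha> v0 u0 v u \<longrightarrow>
      (\<forall>t>0. 0 \<le> entropy \<omega> L \<alpha> vinf uinf v u t \<and>
        entropy \<omega> L \<alpha> vinf uinf v u t \<le> entropy \<omega> L \<alpha> vinf uinf v u 0 * exp (- lam * t)) \<and>
      (\<forall>t>0. Lp_norm \<Omega> (\<alpha> + 1) (\<lambda>z. v t z - vinf) powr (\<alpha> + 1)
        + Lp_norm \<omega> (\<alpha> + 1) (\<lambda>x. u t x - uinf) powr (\<alpha> + 1) \<le> M * exp (- lam * t))"
proof -
  \<comment> \<open>Over an empty base both initial data would vanish almost everywhere.\<close>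
  have ne: "\<omega> \<noteq> {}"
  proof
    assume "\<omega> = {}"
    then have "(AE z in lebesgue_on \<Omega>. v0 z = 0) \<and> (AE x in lebesgue_on \<omega>. u0 x = 0)"
      using assms(5) by (auto intro!: AE_I2)
    then show False using assms(17) by blast
  qed
  have mn: "\<mu> > 0" "\<nu> > 0" using assms by auto
  interpret R: field_road \<omega> L \<alpha> vinf uinf d D \<mu> \<nu>
    by unfold_locales (use assms(1-4,6,7,10,19-21) ne mn in auto)
  have \<Omega>: "R.\<Omega> = \<Omega>" by (simp add: R.\<Omega>_def assms(5))
  \<comment> \<open>The rate is fixed here, from geometry, coefficients, exponent and equilibrium,
    before any solution is introduced.\<close>
  obtain l where l: "l > 0" "R.dissipation_rate l" using R.dissipation_rate_exists by blast
  define k where "k = \<alpha> * max (vinf powr \<alpha>) (uinf powr \<alpha>)"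
  have k: "k > 0" using assms(10,19) by (simp add: k_def less_max_iff_disj)
  define E0 where "E0 = R.total_entropy v0 u0"
  have ent: "entropy \<omega> L \<alpha> vinf uinf v u t = R.total_entropy (v t) (u t)" for v u t
    by (simp add: entropy_def R.total_entropy_def R.\<Omega>_def)
  obtain Cv Cu where Cv: "AE z in lebesgue_on \<Omega>. \<bar>v0 z\<bar> \<le> Cv" and Cu: "AE x in lebesgue_on \<omega>. \<bar>u0 x\<bar> \<le> Cu"
    using assms(13,14) unfolding Linf_space_def by blast
  show ?thesis
  \<comment> \<open>\<open>E0\<close> is the entropy of the initial data, so \<open>M\<close> is the
    same for every solution; the summand 1 keeps \<open>M\<close> positive even if \<open>E0\<close>
    is 0.\<close>
  proof (rule exI[of _ l], intro conjI l(1) exI[of _ "k * \<bar>E0\<bar> + 1"])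
    show "0 < k * \<bar>E0\<bar> + 1" using k by (simp add: add_nonneg_pos)
    show "\<forall>v u. field_road_solution \<omega> L d D \<mu> \<nu> \<alpha> v0 u0 v u \<longrightarrow>
      (\<forall>t>0. 0 \<le> entropy \<omega> L \<alpha> vinf uinf v u t \<and>
        entropy \<omega> L \<alpha> vinf uinf v u t \<le> entropy \<omega> L \<alpha> vinf uinf v u 0 * exp (- l * t)) \<and>
      (\<forall>t>0. Lp_norm \<Omega> (\<alpha> + 1) (\<lambda>z. v t z - vinf) powr (\<alpha> + 1)
        + Lp_norm \<omega> (\<alpha> + 1) (\<lambda>x. u t x - uinf) powr (\<alpha> + 1) \<le> (k * \<bar>E0\<bar> + 1) * exp (- l * t))"
    proof (intro allI impI)
      fix v u assume sol: "field_road_solution \<omega> L d D \<mu> \<nu> \<alpha> v0 u0 v u"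
      note sol' = sol[unfolded field_road_solution_def Let_def, folded assms(5)]
      obtain C where C: "\<forall>t>0. (AE z in lebesgue_on \<Omega>. 0 \<le> v t z \<and> v t z \<le> C) \<and> (AE x in lebesgue_on \<omega>. 0 \<le> u t x \<and> u t x \<le> C)"
        using sol' by blast
      have i0: "AE z in lebesgue_on \<Omega>. v 0 z = v0 z" "AE x in lebesgue_on \<omega>. u 0 x = u0 x" using sol' by blast+
      obtain v' u' where par: "parabolic_class \<Omega> v v'" "parabolic_class \<omega> u u'"
        and weak: "AE t in lebesgue_on {0<..}. R.weak_identity (v t) (u t) (v' t) (u' t)"
        using sol' unfolding R.weak_identity_def \<Omega> by blast
      have S: "\<Omega> \<in> sets lebesgue" "\<omega> \<in> sets lebesgue" using R.B.Sm R.R.Sm \<Omega> by auto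
      \<comment> \<open>The solution concept bounds the solution for \<open>t > 0\<close>; at
        \<open>t = 0\<close> the bounds of the initial data take over.\<close>
      have bv: "AE z in lebesgue_on \<Omega>. 0 \<le> v t z \<and> v t z \<le> max C (max Cv Cu)" if "0 \<le> t" for t
      proof (cases "t = 0")
        case True
        show ?thesis unfolding True using i0(1) Cv assms(15) by eventually_elim auto
      next
        case False
        then have "AE z in lebesgue_on \<Omega>. 0 \<le> v t z \<and> v t z \<le> C" using C that by simp
        then show ?thesis by (rule eventually_mono) auto
      qed
      have bu: "AE x in lebesgue_on \<omega>. 0 \<le> u t x \<and> u t x \<le> max C (max Cv Cu)" if "0 \<le> t" for t
      proof (cases "t = 0")
        case True
        show ?thesis unfolding True using i0(2) Cu assms(16) by eventually_elim auto
      next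
        case False
        then have "AE x in lebesgue_on \<omega>. 0 \<le> u t x \<and> u t x \<le> C" using C that by simp
        then show ?thesis by (rule eventually_mono) auto
      qed
      have m0: "(LINT z|lebesgue_on \<Omega>. v 0 z) + (LINT x|lebesgue_on \<omega>. u 0 x) = measure lebesgue \<Omega> * vinf + measure lebesgue \<omega> * uinf"
        using integral_lebesgue_on_cong_AE[OF S(1) i0(1)] integral_lebesgue_on_cong_AE[OF S(2) i0(2)] assms(18,22) by simp
      interpret E: field_road_evolution \<omega> L \<alpha> vinf uinf d D \<mu> \<nu> v v' u u' "max C (max Cv Cu)"
        by unfold_locales (unfold \<Omega>, use bv bu par weak m0 in auto)
      have E0: "R.total_entropy (v 0) (u 0) = E0"
        unfolding E0_def R.total_entropy_def \<Omega>
        by (intro arg_cong2[where f = "(+)"] integral_lebesgue_on_cong_AE S eventually_mono[OF i0(1)] eventually_mono[OF i0(2)]) simp_all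
      note decay = E.total_entropy_decay[OF l]
      show "(\<forall>t>0. 0 \<le> entropy \<omega> L \<alpha> vinf uinf v u t \<and>
        entropy \<omega> L \<alpha> vinf uinf v u t \<le> entropy \<omega> L \<alpha> vinf uinf v u 0 * exp (- l * t)) \<and>
      (\<forall>t>0. Lp_norm \<Omega> (\<alpha> + 1) (\<lambda>z. v t z - vinf) powr (\<alpha> + 1)
        + Lp_norm \<omega> (\<alpha> + 1) (\<lambda>x. u t x - uinf) powr (\<alpha> + 1) \<le> (k * \<bar>E0\<bar> + 1) * exp (- l * t))"
      proof (intro conjI allI impI)
        fix t :: real assume t: "t > 0"
        show "0 \<le> entropy \<omega> L \<alpha> vinf uinf v u t" unfolding ent using t by (intro E.total_entropy_nonneg) simp
        show "entropy \<omega> L \<alpha> vinf uinf v u t \<le> entropy \<omega> L \<alpha> vinf uinf v u 0 * exp (- l * t)" unfolding ent by (rule decay[OF t])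
        have "Lp_norm \<Omega> (\<alpha> + 1) (\<lambda>z. v t z - vinf) powr (\<alpha> + 1) + Lp_norm \<omega> (\<alpha> + 1) (\<lambda>x. u t x - uinf) powr (\<alpha> + 1)
          \<le> k * R.total_entropy (v t) (u t)"
          unfolding k_def using E.Lp_norms_le_total_entropy[of t] t by (simp add: \<Omega>)
        also have "\<dots> \<le> k * (E0 * exp (- l * t))" using decay[OF t] k by (intro mult_left_mono) (auto simp: E0)
        also have "\<dots> \<le> (k * \<bar>E0\<bar> + 1) * exp (- l * t)"
        proof -
          have "k * E0 \<le> k * \<bar>E0\<bar> + 1" using mult_left_mono[of E0 "\<bar>E0\<bar>" k] k by linarith
          from mult_right_mono[OF this, of "exp (- l * t)"] show ?thesis by (simp add: mult.assoc)
        qed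
        finally show "Lp_norm \<Omega> (\<alpha> + 1) (\<lambda>z. v t z - vinf) powr (\<alpha> + 1) + Lp_norm \<omega> (\<alpha> + 1) (\<lambda>x. u t x - uinf) powr (\<alpha> + 1)
          \<le> (k * \<bar>E0\<bar> + 1) * exp (- l * t)" .
      qed
    qed
  qed
qed

end
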